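(* Let $q$ be a prime or a prime power with $q\equiv 1\pmod 6$ and $q\neq 13$. Then there exists a regular Hesse Kaleidoscope of order $q$ (a regular HK$(q)$).
   Context: A Hesse plane is a 2-$(9,3,1)$ design (the affine plane AG$(2,3)$), which has twelve lines. A Hesse Kaleidoscope of order $v$, HK$(v)$, is a set $\mathcal H$ of Hesse planes whose points lie in a $v$-set $\mathcal V$, the twelve lines of each plane colored with twelve distinct colors $c_0,\dots,c_{11}$, such that for any two distinct points $x,y\in\mathcal V$ and any color $c_i$ there is exactly one plane of $\mathcal H$ whose $c_i$-colored line contains $x$ and $y$. It is regular if there is a group $G$ of order $v$ acting sharply transitively on $\mathcal V$ (so $\mathcal V$ is identified with $G$) such that the collection of colored planes is invariant under translations by $G$.
   Formalization: The case q = 7 is also excluded: a Hesse plane has 9 points and cannot lie in a 7-set, so no Hesse Kaleidoscope of order 7 exists and the statement as written fails there. *)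

theory Defs
  imports
    "HOL-Algebra.Group_Action"
    "HOL-Number_Theory.Number_Theory"
    "HOL-Library.Numeral_Type"
begin

text \<open>For \<open>\<lambda> = 1\<close> a set of blocks is enough: a repeated block would cover its pairs twice.\<close>

definition two_design :: "nat \<Rightarrow> nat \<Rightarrow> 'a set \<Rightarrow> 'a set set \<Rightarrow> bool" where
  "two_design v k P \<B> \<longleftrightarrow>
     finite P \<and> card P = v \<and>
     (\<forall>B\<in>\<B>. B \<subseteq> P \<and> card B = k) \<and>
     (\<forall>x\<in>P. \<forall>y\<in>P. x \<noteq> y \<longrightarrow> (\<exists>!B. B \<in> \<B> \<and> x \<in> B \<and> y \<in> B))"

definition hesse_plane :: "'a set \<Rightarrow> 'a set set \<Rightarrow> bool" where
  "hesse_plane P \<L> \<longleftrightarrow> two_design 9 3 P \<L>"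

text \<open>
  The twelve colors are the elements of the type \<open>12\<close>, used only as labels. A colored Hesse plane
  is given by the map sending each color to the line of that color; its line set is the range of
  this map and its point set is the union of the lines.
\<close>

type_synonym 'a colored_plane = "12 \<Rightarrow> 'a set"

definition colored_hesse_plane :: "'a colored_plane \<Rightarrow> bool" where
  "colored_hesse_plane \<pi> \<longleftrightarrow> inj \<pi> \<and> hesse_plane (\<Union>(range \<pi>)) (range \<pi>)"

definition hesse_kaleidoscope :: "nat \<Rightarrow> 'a set \<Rightarrow> 'a colored_plane set \<Rightarrow> bool" where
  "hesse_kaleidoscope v V H \<longleftrightarrow>
     finite V \<and> card V = v \<and>
     (\<forall>\<pi>\<in>H. colored_hesse_plane \<pi> \<and> \<Union>(range \<pi>) \<subseteq> V) \<and>
     (\<forall>x\<in>V. \<forall>y\<in>V. x \<noteq> y \<longrightarrow> (\<forall>c. \<exists>!\<pi>. \<pi> \<in> H \<and> x \<in> \<pi> c \<and> y \<in> \<pi> c))"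

definition sharply_transitive_action ::
    "('g, 'm) monoid_scheme \<Rightarrow> 'a set \<Rightarrow> ('g \<Rightarrow> 'a \<Rightarrow> 'a) \<Rightarrow> bool" where
  "sharply_transitive_action G V \<phi> \<longleftrightarrow>
     group_action G V \<phi> \<and>
     (\<forall>x\<in>V. \<forall>y\<in>V. \<exists>!g. g \<in> carrier G \<and> \<phi> g x = y)"

definition regular_hesse_kaleidoscope ::
    "nat \<Rightarrow> ('g, 'm) monoid_scheme \<Rightarrow> ('g \<Rightarrow> 'a \<Rightarrow> 'a) \<Rightarrow> 'a set \<Rightarrow> 'a colored_plane set \<Rightarrow> bool" where
  "regular_hesse_kaleidoscope v G \<phi> V H \<longleftrightarrow>
     hesse_kaleidoscope v V H \<and>
     group G \<and> order G = v \<and> sharply_transitive_action G V \<phi> \<and>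
     (\<forall>g\<in>carrier G. (\<lambda>\<pi> c. \<phi> g ` \<pi> c) ` H = H)"

text \<open>
  A Hesse plane needs nine points, so there is no Hesse Kaleidoscope of order 7, although
  7 is a prime congruent to 1 modulo 6.
\<close>

lemma hesse_kaleidoscope_order_ge_9:
  assumes "hesse_kaleidoscope v V H" and "v \<ge> 2"
  shows "v \<ge> 9"
proof -
  have fin: "finite V" and cV: "card V = v"
    using assms(1) by (auto simp: hesse_kaleidoscope_def)
  then obtain x y where xy: "x \<in> V" "y \<in> V" "x \<noteq> y"
    using assms(2) card_le_Suc0_iff_eq[OF fin] by fastforce
  then have "\<exists>!\<pi>. \<pi> \<in> H \<and> x \<in> \<pi> 0 \<and> y \<in> \<pi> 0"
    using assms(1) unfolding hesse_kaleidoscope_def by blast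
  then obtain \<pi> where "\<pi> \<in> H" by blast
  then have "card (\<Union>(range \<pi>)) = 9" "\<Union>(range \<pi>) \<subseteq> V"
    using assms(1)
    by (auto simp: hesse_kaleidoscope_def colored_hesse_plane_def hesse_plane_def two_design_def)
  then show ?thesis using card_mono[OF fin] cV by metis
qed

end

theory Submission
  imports Defs "HOL-Library.Function_Algebras" "HOL-Library.Product_Plus" "HOL-Computational_Algebra.Polynomial"
begin

text \<open>
  Let \<open>q = 3 n + 1\<close> with \<open>n\<close> even. If the three differences along every line of a labelling of the model
  plane by elements of the field with \<open>q\<close> elements lie in the three cosets of the cubes, then multiplying the
  labelling by representatives of the cubes modulo \<open>1, - 1\<close> covers each nonzero difference once in every colour.
  With \<open>w\<close> a primitive cube root of unity, the labelling \<open>w\<^sup>i + e w\<^sup>j\<close> works if \<open>w\<close> is not a cube. If \<open>w\<close> is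
  a cube, the labelling \<open>w\<^sup>i + t w\<^sup>j + t\<^sup>2 w\<^bsup>2(i+j)\<^esup>\<close> works after a recolouring; a suitable \<open>t\<close> exists for
  \<open>q \<ge> 181\<^sup>2\<close> by a Stepanov type count and is found explicitly for smaller \<open>q\<close>. Higher powers
  follow from vector spaces over these fields, and the odd powers of 7 and 13 from products of the fields of
  order \<open>p\<^sup>3\<close> and \<open>p\<^sup>2\<close>.
\<close>

text \<open>The obstacle is \<open>q\<close> congruent to 1 modulo 9. A step that multiplies labels
  by \<open>w\<close> produces differences \<open>d\<close>, \<open>d * w\<close>,
  \<open>d * w^2\<close>: three classes if \<open>w\<close> is no cube, a single class if it is. In
  the first case a relation among counts of pairs \<open>x\<close>, \<open>1 + x\<close> in
  prescribed classes supplies \<open>e\<close>, without any estimate. In the second case the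
  labelling in \<open>t\<close> confines such steps to three parallel lines; permuting their colours
  cyclically while multiplying by \<open>w\<close> repairs them together. The search for
  \<open>t\<close> depends on six classes, and upper bounds for the number of \<open>t\<close> with
  a given character value are enough: a weight that is at least 9 on every failing pattern would
  have mean 25/3 under equidistribution. This gap, set against the error terms, gives the constant
  181. Derivatives of every order below 181 are used, so the characteristic must be at least 181
  there. Fields appear as rings modulo a prime ideal with chosen representatives. So one development
  serves the integers and several orders of number fields, and the numerical checks are integer
  arithmetic.\<close>

section \<open>Residue fields: a ring modulo a prime ideal, with representatives\<close>

locale residue_field =
  fixes I :: "'a::comm_ring_1 set" and V :: "'a set" and p q :: nat
  assumes I_zero: "0 \<in> I"
    and I_add: "x \<in> I \<Longrightarrow> y \<in> I \<Longrightarrow> x + y \<in> I"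
    and I_mult: "x \<in> I \<Longrightarrow> a * x \<in> I"
    and one_notin_I: "1 \<notin> I"
    and I_prime: "x * y \<in> I \<Longrightarrow> x \<in> I \<or> y \<in> I"
    and finite_V: "finite V" and card_V: "card V = q"
    and V_ex: "\<exists>v\<in>V. x - v \<in> I"
    and V_unique: "u \<in> V \<Longrightarrow> v \<in> V \<Longrightarrow> u - v \<in> I \<Longrightarrow> u = v"
    and prime_p: "prime p" and p_in_I: "of_nat p \<in> I" and q_power: "\<exists>m>0. q = p ^ m"
begin

definition eqv :: "'a \<Rightarrow> 'a \<Rightarrow> bool" (infix "\<simeq>" 50) where "x \<simeq> y \<longleftrightarrow> x - y \<in> I"

lemma I_mult2: "x \<in> I \<Longrightarrow> x * a \<in> I"
  using I_mult[of x a] by (simp add: mult.commute)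

lemma I_neg: "x \<in> I \<Longrightarrow> - x \<in> I"
  using I_mult[of x "-1"] by simp

lemma I_neg_iff [simp]: "- x \<in> I \<longleftrightarrow> x \<in> I"
  using I_neg[of x] I_neg[of "- x"] by auto

lemma I_diff: "x \<in> I \<Longrightarrow> y \<in> I \<Longrightarrow> x - y \<in> I"
  using I_add[of x "- y"] by simp

lemma I_sum: "(\<And>i. i \<in> A \<Longrightarrow> f i \<in> I) \<Longrightarrow> sum f A \<in> I"
  by (induction A rule: infinite_finite_induct) (auto simp: I_zero I_add)

lemma I_mult_iff: "x * y \<in> I \<longleftrightarrow> x \<in> I \<or> y \<in> I"
  using I_prime I_mult I_mult2 by blast

lemma I_power_iff: "x ^ k \<in> I \<longleftrightarrow> k > 0 \<and> x \<in> I"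
  by (induction k) (auto simp: I_mult_iff one_notin_I)

lemma eqv_refl [simp, intro]: "x \<simeq> x"
  by (simp add: eqv_def I_zero)

lemma eqv_sym: "x \<simeq> y \<Longrightarrow> y \<simeq> x"
  unfolding eqv_def using I_neg by fastforce

lemma eqv_trans [trans]: "x \<simeq> y \<Longrightarrow> y \<simeq> z \<Longrightarrow> x \<simeq> z"
  unfolding eqv_def using I_add by fastforce

lemma eqv_eq_trans [trans]: "x \<simeq> y \<Longrightarrow> y = z \<Longrightarrow> x \<simeq> z" "x = y \<Longrightarrow> y \<simeq> z \<Longrightarrow> x \<simeq> z"
  by auto

lemma eqv_add: "x \<simeq> y \<Longrightarrow> x' \<simeq> y' \<Longrightarrow> x + x' \<simeq> y + y'"
  unfolding eqv_def using I_add by (metis add_diff_add)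

lemma eqv_minus: "x \<simeq> y \<Longrightarrow> - x \<simeq> - y"
  unfolding eqv_def using I_neg by fastforce

lemma eqv_diff: "x \<simeq> y \<Longrightarrow> x' \<simeq> y' \<Longrightarrow> x - x' \<simeq> y - y'"
  using eqv_add[of x y "- x'" "- y'"] eqv_minus by simp

lemma eqv_mult: "x \<simeq> y \<Longrightarrow> x' \<simeq> y' \<Longrightarrow> x * x' \<simeq> y * y'"
proof -
  assume "x \<simeq> y" "x' \<simeq> y'"
  moreover have "x * x' - y * y' = x' * (x - y) + y * (x' - y')" by (simp add: algebra_simps)
  ultimately show ?thesis unfolding eqv_def using I_add I_mult by metis
qed

lemma eqv_power: "x \<simeq> y \<Longrightarrow> x ^ k \<simeq> y ^ k"
  by (induction k) (auto intro: eqv_mult)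

lemma eqv_sum: "(\<And>i. i \<in> A \<Longrightarrow> f i \<simeq> g i) \<Longrightarrow> sum f A \<simeq> sum g A"
  by (induction A rule: infinite_finite_induct) (auto intro: eqv_add)

lemma eqv_prod: "(\<And>i. i \<in> A \<Longrightarrow> f i \<simeq> g i) \<Longrightarrow> prod f A \<simeq> prod g A"
  by (induction A rule: infinite_finite_induct) (auto intro: eqv_mult)

lemma eqv_I: "x \<simeq> y \<Longrightarrow> x \<in> I \<longleftrightarrow> y \<in> I"
  unfolding eqv_def using I_add[of "x - y" y] I_diff[of x "x - y"] by auto

lemma eqv_0_iff: "x \<simeq> 0 \<longleftrightarrow> x \<in> I"
  by (simp add: eqv_def)

lemma eqv_mult_cancel: "a \<notin> I \<Longrightarrow> a * x \<simeq> a * y \<longleftrightarrow> x \<simeq> y"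
  unfolding eqv_def by (simp add: right_diff_distrib [symmetric] I_mult_iff)

lemma eqv_mult_cancel2: "a \<notin> I \<Longrightarrow> x * a \<simeq> y * a \<longleftrightarrow> x \<simeq> y"
  using eqv_mult_cancel[of a x y] by (simp add: mult.commute)

lemma of_nat_in_I_iff: "of_nat k \<in> I \<longleftrightarrow> p dvd k"
proof
  assume "p dvd k"
  then obtain m where "k = p * m" ..
  then show "of_nat k \<in> I" using I_mult2[OF p_in_I] by simp
next
  assume k: "of_nat k \<in> I"
  show "p dvd k"
  proof (rule ccontr)
    assume "\<not> p dvd k"
    then have "coprime (int p) (int k)" using prime_p
      by (simp add: prime_imp_coprime_nat)
    then obtain u v where "u * int p + v * int k = 1"
      using bezout_int[of "int p" "int k"] by auto
    then have "of_int u * of_nat p + of_int v * of_nat k = (1::'a)"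
      by (metis of_int_1 of_int_add of_int_mult of_int_of_nat_eq)
    then show False using I_add[OF I_mult[OF p_in_I] I_mult[OF k]] one_notin_I by metis
  qed
qed

lemma q_gt_1: "q > 1"
  using q_power prime_gt_1_nat[OF prime_p] one_less_power by metis

lemma p_dvd_q: "p dvd q"
  using q_power by auto

lemma inj_on_rep: "x \<notin> I \<Longrightarrow> u \<in> V \<Longrightarrow> v \<in> V \<Longrightarrow> x * u \<simeq> x * v \<Longrightarrow> u = v"
  using V_unique eqv_mult_cancel by (auto simp: eqv_def)

definition rep :: "'a \<Rightarrow> 'a" where "rep x = (SOME v. v \<in> V \<and> x - v \<in> I)"

lemma rep_in_V [simp]: "rep x \<in> V" and rep_eqv: "x \<simeq> rep x"
proof -
  have "\<exists>v. v \<in> V \<and> x - v \<in> I" using V_ex by blast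
  then have "rep x \<in> V \<and> x - rep x \<in> I" unfolding rep_def by (rule someI_ex)
  then show "rep x \<in> V" "x \<simeq> rep x" by (auto simp: eqv_def)
qed

lemma rep_eq_iff: "rep x = rep y \<longleftrightarrow> x \<simeq> y"
  by (metis V_unique eqv_def eqv_sym eqv_trans rep_eqv rep_in_V)

lemma rep_in_I_iff [simp]: "rep x \<in> I \<longleftrightarrow> x \<in> I"
  using eqv_I[OF rep_eqv] by blast

lemma card_nonzero: "card (V - I) = q - 1"
proof -
  have "V \<inter> I = {rep 0}"
  proof (intro equalityI subsetI)
    fix v assume "v \<in> V \<inter> I"
    then have "v - rep 0 \<in> I" by (simp add: I_diff I_zero)
    then show "v \<in> {rep 0}" using V_unique \<open>v \<in> V \<inter> I\<close> by auto
  qed (auto simp: I_zero)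
  then show ?thesis using finite_V card_V
    by (metis card_Diff_subset_Int card_1_singleton_iff finite_Int is_singletonI is_singleton_altdef)
qed

lemma bij_mult: "x \<notin> I \<Longrightarrow> bij_betw (\<lambda>v. rep (x * v)) (V - I) (V - I)"
proof -
  assume x: "x \<notin> I"
  have "inj_on (\<lambda>v. rep (x * v)) (V - I)"
    by (auto intro!: inj_onI inj_on_rep[OF x] simp: rep_eq_iff)
  moreover have "(\<lambda>v. rep (x * v)) ` (V - I) \<subseteq> V - I"
    using x by (auto simp: I_mult_iff)
  ultimately show ?thesis
    by (simp add: bij_betw_def endo_inj_surj finite_V)
qed

lemma inverse_ex: "x \<notin> I \<Longrightarrow> \<exists>y. x * y \<simeq> 1"
proof -
  assume x: "x \<notin> I"
  have "rep 1 \<in> V - I" using one_notin_I by simp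
  then obtain y where "rep (x * y) = rep 1"
    using bij_mult[OF x] unfolding bij_betw_def by (metis imageE)
  then show ?thesis by (auto simp: rep_eq_iff)
qed

lemma divide_ex: "x \<notin> I \<Longrightarrow> \<exists>y. x * y \<simeq> z"
proof -
  assume "x \<notin> I"
  then obtain y where "x * y \<simeq> 1" using inverse_ex by blast
  then have "x * y * z \<simeq> 1 * z" by (intro eqv_mult) auto
  then show ?thesis by (auto simp: mult.assoc)
qed

text \<open>Multiplication by \<open>x\<close> permutes the nonzero representatives, so their
  product is unchanged by the factor \<open>x ^ (q - 1)\<close>.\<close>

lemma fermat: "x \<notin> I \<Longrightarrow> x ^ (q - 1) \<simeq> 1"
proof -
  assume x: "x \<notin> I"
  let ?P = "\<Prod>v\<in>V - I. v"
  have P: "?P \<notin> I"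
  proof -
    have "prod id A \<notin> I" if "finite A" "A \<subseteq> V - I" for A
      using that by (induction A rule: finite_induct) (auto simp: one_notin_I I_mult_iff)
    from this[of "V - I"] show ?thesis using finite_V by simp
  qed
  have "x ^ (q - 1) * ?P = (\<Prod>v\<in>V - I. x * v)"
    by (simp add: prod.distrib card_nonzero)
  also have "\<dots> \<simeq> (\<Prod>v\<in>V - I. rep (x * v))"
    by (intro eqv_prod rep_eqv)
  also have "\<dots> = ?P" using prod.reindex_bij_betw[OF bij_mult[OF x], of "\<lambda>v. v"] .
  finally have "x ^ (q - 1) * ?P \<simeq> 1 * ?P" by simp
  then show ?thesis using eqv_mult_cancel2[OF P] by blast
qed

lemma fermat_q: "x ^ q \<simeq> x"
proof (cases "x \<in> I")
  case True
  then show ?thesis using I_power_iff[of x q] q_gt_1 by (auto simp: eqv_def intro!: I_diff)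
next
  case False
  have "x ^ q = x ^ (q - 1) * x" using q_gt_1 by (metis Suc_diff_1 gr0I not_one_less_zero power_Suc2)
  also have "\<dots> \<simeq> 1 * x" by (intro eqv_mult fermat False) auto
  finally show ?thesis by simp
qed

end

section \<open>Polynomials modulo the ideal\<close>

lemma pderiv_power_mult: "pderiv (f ^ n) * f = of_nat n * pderiv f * f ^ n" for f :: "'a::idom poly"
  by (induction n) (simp_all add: pderiv_mult algebra_simps)

context residue_field
begin

definition Ip :: "'a poly set" where "Ip = {f. \<forall>n. coeff f n \<in> I}"

definition peqv :: "'a poly \<Rightarrow> 'a poly \<Rightarrow> bool" (infix "\<simeq>\<^sub>p" 50) where "f \<simeq>\<^sub>p g \<longleftrightarrow> f - g \<in> Ip"

lemma Ip_zero: "0 \<in> Ip"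
  by (simp add: Ip_def I_zero)

lemma Ip_add: "f \<in> Ip \<Longrightarrow> g \<in> Ip \<Longrightarrow> f + g \<in> Ip"
  by (simp add: Ip_def I_add)

lemma Ip_mult: "f \<in> Ip \<Longrightarrow> g * f \<in> Ip"
  by (auto simp: Ip_def coeff_mult intro!: I_sum I_mult)

lemma Ip_mult2: "f \<in> Ip \<Longrightarrow> f * g \<in> Ip"
  using Ip_mult[of f g] by (simp add: mult.commute)

lemma Ip_neg: "f \<in> Ip \<Longrightarrow> - f \<in> Ip"
  by (simp add: Ip_def)

lemma Ip_diff: "f \<in> Ip \<Longrightarrow> g \<in> Ip \<Longrightarrow> f - g \<in> Ip"
  by (simp add: Ip_def I_diff)

lemma Ip_sum: "(\<And>i. i \<in> A \<Longrightarrow> f i \<in> Ip) \<Longrightarrow> sum f A \<in> Ip"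
  by (induction A rule: infinite_finite_induct) (auto simp: Ip_zero Ip_add)

lemma Ip_one: "1 \<notin> Ip"
  using one_notin_I by (auto simp: Ip_def intro!: exI[of _ 0])

text \<open>Gauss's argument: the product of the lowest coefficients of \<open>f\<close> and
  \<open>g\<close> outside \<open>I\<close> is, modulo \<open>I\<close>, a coefficient of
  \<open>f * g\<close>.\<close>

lemma Ip_prime: "f * g \<in> Ip \<Longrightarrow> f \<in> Ip \<or> g \<in> Ip"
proof (rule ccontr)
  assume fg: "f * g \<in> Ip" and neg: "\<not> (f \<in> Ip \<or> g \<in> Ip)"
  define m where "m = (LEAST n. coeff f n \<notin> I)"
  define k where "k = (LEAST n. coeff g n \<notin> I)"
  have "\<exists>n. coeff f n \<notin> I" using neg by (auto simp: Ip_def)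
  then have m1: "coeff f m \<notin> I" unfolding m_def by (rule LeastI_ex)
  have m2: "coeff f i \<in> I" if "i < m" for i
    using not_less_Least[of i "\<lambda>n. coeff f n \<notin> I"] that by (auto simp: m_def)
  note m = m1 m2
  have "\<exists>n. coeff g n \<notin> I" using neg by (auto simp: Ip_def)
  then have k1: "coeff g k \<notin> I" unfolding k_def by (rule LeastI_ex)
  have k2: "coeff g i \<in> I" if "i < k" for i
    using not_less_Least[of i "\<lambda>n. coeff g n \<notin> I"] that by (auto simp: k_def)
  note k = k1 k2
  have "coeff (f * g) (m + k) = (\<Sum>i\<le>m + k. coeff f i * coeff g (m + k - i))"
    by (simp add: coeff_mult)
  also have "\<dots> = coeff f m * coeff g k + (\<Sum>i\<in>{..m + k} - {m}. coeff f i * coeff g (m + k - i))"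
    by (subst sum.remove[of _ m]) auto
  finally have eq: "coeff f m * coeff g k =
      coeff (f * g) (m + k) - (\<Sum>i\<in>{..m + k} - {m}. coeff f i * coeff g (m + k - i))"
    by simp
  have "coeff f i * coeff g (m + k - i) \<in> I" if "i \<in> {..m + k} - {m}" for i
  proof (cases "i < m")
    case True
    then show ?thesis using m(2) I_mult2 by blast
  next
    case False
    then have "m + k - i < k" using that by auto
    then show ?thesis using k(2) I_mult by blast
  qed
  then have "coeff f m * coeff g k \<in> I"
    unfolding eq using fg by (intro I_diff I_sum) (auto simp: Ip_def)
  then show False using m(1) k(1) I_prime by blast
qed

lemma Ip_mult_iff: "f * g \<in> Ip \<longleftrightarrow> f \<in> Ip \<or> g \<in> Ip"
  using Ip_prime Ip_mult Ip_mult2 by blast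

lemma Ip_power_iff: "f ^ k \<in> Ip \<longleftrightarrow> k > 0 \<and> f \<in> Ip"
  by (induction k) (auto simp: Ip_mult_iff Ip_one)

lemma monom_one_notin_Ip: "monom 1 k \<notin> Ip"
  using one_notin_I by (auto simp: Ip_def intro!: exI[of _ k])

lemma Ip_of_nat: "p dvd n \<Longrightarrow> of_nat n \<in> Ip"
  by (auto simp: Ip_def of_nat_in_I_iff of_nat_poly coeff_pCons I_zero split: nat.split)

lemma peqv_refl [simp]: "f \<simeq>\<^sub>p f" by (simp add: peqv_def Ip_zero)

lemma peqv_sym: "f \<simeq>\<^sub>p g \<Longrightarrow> g \<simeq>\<^sub>p f"
  unfolding peqv_def using Ip_neg by fastforce

lemma peqv_trans [trans]: "f \<simeq>\<^sub>p g \<Longrightarrow> g \<simeq>\<^sub>p h \<Longrightarrow> f \<simeq>\<^sub>p h"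
  unfolding peqv_def using Ip_add by fastforce

lemma peqv_eq_trans [trans]: "x \<simeq>\<^sub>p y \<Longrightarrow> y = z \<Longrightarrow> x \<simeq>\<^sub>p z" "x = y \<Longrightarrow> y \<simeq>\<^sub>p z \<Longrightarrow> x \<simeq>\<^sub>p z"
  by auto

lemma peqv_add: "f \<simeq>\<^sub>p g \<Longrightarrow> f' \<simeq>\<^sub>p g' \<Longrightarrow> f + f' \<simeq>\<^sub>p g + g'"
  unfolding peqv_def using Ip_add by (metis add_diff_add)

lemma peqv_diff: "f \<simeq>\<^sub>p g \<Longrightarrow> f' \<simeq>\<^sub>p g' \<Longrightarrow> f - f' \<simeq>\<^sub>p g - g'"
proof -
  assume "f \<simeq>\<^sub>p g" "f' \<simeq>\<^sub>p g'"
  moreover have "f - f' - (g - g') = (f - g) - (f' - g')" by simp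
  ultimately show ?thesis unfolding peqv_def using Ip_diff by metis
qed

lemma peqv_mult: "f \<simeq>\<^sub>p g \<Longrightarrow> f' \<simeq>\<^sub>p g' \<Longrightarrow> f * f' \<simeq>\<^sub>p g * g'"
proof -
  assume "f \<simeq>\<^sub>p g" "f' \<simeq>\<^sub>p g'"
  moreover have "f * f' - g * g' = f' * (f - g) + g * (f' - g')" by (simp add: algebra_simps)
  ultimately show ?thesis unfolding peqv_def using Ip_add Ip_mult by metis
qed

lemma peqv_power: "f \<simeq>\<^sub>p g \<Longrightarrow> f ^ k \<simeq>\<^sub>p g ^ k"
  by (induction k) (auto intro: peqv_mult)

lemma peqv_sum: "(\<And>i. i \<in> A \<Longrightarrow> f i \<simeq>\<^sub>p g i) \<Longrightarrow> sum f A \<simeq>\<^sub>p sum g A"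
  by (induction A rule: infinite_finite_induct) (auto intro: peqv_add)

lemma peqv_Ip: "f \<simeq>\<^sub>p g \<Longrightarrow> f \<in> Ip \<longleftrightarrow> g \<in> Ip"
  unfolding peqv_def using Ip_add[of "f - g" g] Ip_diff[of f "f - g"] by auto

lemma poly_in_I: "f \<in> Ip \<Longrightarrow> poly f a \<in> I"
  by (auto simp: poly_altdef Ip_def intro!: I_sum I_mult2)

lemma peqv_poly: "f \<simeq>\<^sub>p g \<Longrightarrow> poly f a \<simeq> poly g a"
  using poly_in_I[of "f - g" a] by (simp add: peqv_def eqv_def)

lemma poly_eqv: "a \<simeq> b \<Longrightarrow> poly f a \<simeq> poly f b"
  by (auto simp: poly_altdef intro!: eqv_sum eqv_mult eqv_power)

lemma synthetic_peqv: "poly f a \<in> I \<Longrightarrow> f \<simeq>\<^sub>p [:-a, 1:] * synthetic_div f a"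
proof -
  assume "poly f a \<in> I"
  then have "[:poly f a:] \<in> Ip" by (auto simp: Ip_def coeff_pCons I_zero split: nat.split)
  moreover have "f - [:-a, 1:] * synthetic_div f a = [:poly f a:]"
    using synthetic_div_correct'[of a f] by (metis add_diff_cancel_left')
  ultimately show ?thesis by (simp add: peqv_def)
qed

lemma const_in_Ip: "degree f = 0 \<Longrightarrow> poly f a \<in> I \<Longrightarrow> f \<in> Ip"
  by (auto simp: Ip_def coeff_pCons I_zero split: nat.split elim!: degree_eq_zeroE)

text \<open>The substitute for a finite subset of the residue field: no two elements are identified
  modulo \<open>I\<close>.\<close>

definition incong :: "'a set \<Rightarrow> bool" where
  "incong A \<longleftrightarrow> finite A \<and> (\<forall>a\<in>A. \<forall>b\<in>A. a \<noteq> b \<longrightarrow> a - b \<notin> I)"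

text \<open>Roots are split off one at a time; \<open>b - a\<close> is invertible modulo
  \<open>I\<close> for different members, so the other roots pass to the quotient. Degrees are those
  of the polynomials over the ring itself, and synthetic division lowers these as well.\<close>

lemma roots_factor:
  assumes "incong A" "\<And>a. a \<in> A \<Longrightarrow> poly h a \<in> I" "h \<notin> Ip"
  shows "\<exists>h'. h \<simeq>\<^sub>p (\<Prod>a\<in>A. [:-a, 1:]) * h' \<and> h' \<notin> Ip \<and> degree h' + card A \<le> degree h"
proof -
  have "finite A" using assms(1) by (simp add: incong_def)
  then show ?thesis using assms
  proof (induction A arbitrary: h rule: finite_induct)
    case empty
    then show ?case by (intro exI[of _ h]) auto
  next
    case (insert a A)
    let ?s = "synthetic_div h a"
    have h: "h \<simeq>\<^sub>p [:-a, 1:] * ?s" using insert.prems by (intro synthetic_peqv) auto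
    have s: "?s \<notin> Ip" using h insert.prems(3) peqv_Ip Ip_mult by blast
    have deg: "degree h \<noteq> 0" using const_in_Ip insert.prems(2,3) by blast
    have "poly ?s b \<in> I" if b: "b \<in> A" for b
    proof -
      have "poly h b \<simeq> (b - a) * poly ?s b" using peqv_poly[OF h, of b] by (simp add: algebra_simps)
      then have "(b - a) * poly ?s b \<in> I" using insert.prems(2) b eqv_I by blast
      moreover have "b - a \<notin> I" using insert.prems(1) insert.hyps b by (auto simp: incong_def)
      ultimately show ?thesis using I_prime by blast
    qed
    moreover have "incong A" using insert.prems(1) by (auto simp: incong_def)
    ultimately obtain h' where h': "?s \<simeq>\<^sub>p (\<Prod>a\<in>A. [:-a, 1:]) * h'" "h' \<notin> Ip"
      "degree h' + card A \<le> degree ?s"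
      using insert.IH[of ?s] s by blast
    have "h \<simeq>\<^sub>p [:-a, 1:] * ((\<Prod>a\<in>A. [:-a, 1:]) * h')"
      using h peqv_mult[OF peqv_refl h'(1)] peqv_trans by blast
    then have "h \<simeq>\<^sub>p (\<Prod>a\<in>insert a A. [:-a, 1:]) * h'"
      by (simp only: prod.insert[OF insert.hyps(1,2)] mult.assoc)
    moreover have "degree h' + card (insert a A) \<le> degree h"
      using h'(3) insert.hyps deg by (simp add: degree_synthetic_div)
    ultimately show ?case using h'(2) by blast
  qed
qed

lemma card_roots_le:
  assumes "incong A" "\<And>a. a \<in> A \<Longrightarrow> poly h a \<in> I" "h \<notin> Ip"
  shows "card A \<le> degree h"
  using roots_factor[OF assms] by auto

lemma prod_notin_I: "finite A \<Longrightarrow> (\<And>x. x \<in> A \<Longrightarrow> f x \<notin> I) \<Longrightarrow> prod f A \<notin> I"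
  by (induction A rule: finite_induct) (auto simp: one_notin_I I_mult_iff)

end

section \<open>A derivation and multiplicities of zeros\<close>

locale stepanov_op = residue_field I V p q
  for I :: "'a::idom set" and V :: "'a set" and p q :: nat +
  fixes r :: "'a poly"
begin

lemma pderiv_in_Ip: "f \<in> Ip \<Longrightarrow> pderiv f \<in> Ip"
  by (auto simp: Ip_def coeff_pderiv intro!: I_mult)


text \<open>The factor \<open>r\<close> clears the denominators of the logarithmic derivatives of
  the powers used below, so that \<open>theta\<close> maps polynomial multiples of such a power to
  polynomial multiples of it.\<close>

definition theta :: "'a poly \<Rightarrow> 'a poly" where "theta f = r * pderiv f"

text \<open>At a root of \<open>Z\<close> only the term in which every application of
  \<open>theta\<close> differentiates one factor \<open>Z\<close> survives. Hence the iterates read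
  off the value of the cofactor \<open>h\<close>.\<close>

lemma theta_iter:
  assumes "poly Z a = 0"
  shows "poly ((theta ^^ m) (Z ^ m * h)) a = of_nat (fact m) * (poly r a * poly (pderiv Z) a) ^ m * poly h a"
proof (induction m arbitrary: h)
  case (Suc m)
  have "theta (Z ^ Suc m * h) = Z ^ m * (of_nat (Suc m) * r * pderiv Z * h + Z * (r * pderiv h))"
    by (simp only: theta_def pderiv_mult pderiv_power_Suc) (simp add: algebra_simps of_nat_poly)
  then have "(theta ^^ Suc m) (Z ^ Suc m * h)
      = (theta ^^ m) (Z ^ m * (of_nat (Suc m) * r * pderiv Z * h + Z * (r * pderiv h)))"
    by (simp only: funpow_Suc_right o_apply)
  then have "poly ((theta ^^ Suc m) (Z ^ Suc m * h)) a
      = of_nat (fact m) * (poly r a * poly (pderiv Z) a) ^ m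
          * poly (of_nat (Suc m) * r * pderiv Z * h + Z * (r * pderiv h)) a"
    by (simp only: Suc.IH)
  then show ?case using assms by (simp add: algebra_simps)
qed simp

lemma theta_Ip: "f \<in> Ip \<Longrightarrow> (theta ^^ m) f \<in> Ip"
  by (induction m) (auto simp: theta_def intro: Ip_mult pderiv_in_Ip)

lemma theta_diff: "(theta ^^ m) (f - g) = (theta ^^ m) f - (theta ^^ m) g"
  by (induction m) (auto simp: theta_def pderiv_diff right_diff_distrib)

lemma theta_peqv: "f \<simeq>\<^sub>p g \<Longrightarrow> (theta ^^ m) f \<simeq>\<^sub>p (theta ^^ m) g"
  using theta_Ip[of "f - g" m] by (simp add: peqv_def theta_diff)

text \<open>Every further iterate of \<open>theta\<close> that vanishes on \<open>A\<close> lets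
  another factor \<open>?Z\<close> be extracted. The bound \<open>M \<le> p\<close> makes the
  factorials that occur invertible modulo \<open>I\<close>, so that ordinary derivatives detect the
  multiplicity.\<close>

lemma multiplicity_bound:
  assumes P: "P \<notin> Ip" and A: "incong A" and M: "M \<le> p"
    and van: "\<And>\<mu> a. \<mu> < M \<Longrightarrow> a \<in> A \<Longrightarrow> poly ((theta ^^ \<mu>) P) a \<in> I"
    and r: "\<And>a. a \<in> A \<Longrightarrow> poly r a \<notin> I"
  shows "M * card A \<le> degree P"
proof -
  let ?Z = "\<Prod>a\<in>A. [:-a, 1:]"
  have fin: "finite A" using A by (simp add: incong_def)
  have Z0: "poly ?Z a = 0" if "a \<in> A" for a
    using that fin by (auto simp: poly_prod intro!: prod_zero)
  have Z': "poly (pderiv ?Z) a \<notin> I" if a: "a \<in> A" for a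
  proof -
    have "?Z = [:-a, 1:] * (\<Prod>b\<in>A - {a}. [:-b, 1:])" using fin a by (rule prod.remove)
    then have "poly (pderiv ?Z) a = (\<Prod>b\<in>A - {a}. a - b)"
      by (simp only: pderiv_mult) (simp add: poly_prod pderiv_pCons)
    moreover have "(\<Prod>b\<in>A - {a}. a - b) \<notin> I"
      using A a fin by (intro prod_notin_I) (auto simp: incong_def)
    ultimately show ?thesis by simp
  qed
  have "\<exists>h. P \<simeq>\<^sub>p ?Z ^ \<mu> * h \<and> h \<notin> Ip \<and> degree h + \<mu> * card A \<le> degree P" if "\<mu> \<le> M" for \<mu>
    using that
  proof (induction \<mu>)
    case 0
    then show ?case using P by (intro exI[of _ P]) auto
  next
    case (Suc \<mu>)
    then obtain h where h: "P \<simeq>\<^sub>p ?Z ^ \<mu> * h" "h \<notin> Ip" "degree h + \<mu> * card A \<le> degree P" by auto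
    have "poly h a \<in> I" if a: "a \<in> A" for a
    proof -
      have "poly ((theta ^^ \<mu>) (?Z ^ \<mu> * h)) a \<in> I"
        using van[of \<mu> a] Suc.prems a eqv_I[OF peqv_poly[OF theta_peqv[OF h(1), of \<mu>], of a]] by auto
      then have "of_nat (fact \<mu>) * (poly r a * poly (pderiv ?Z) a) ^ \<mu> * poly h a \<in> I"
        using theta_iter[OF Z0[OF a]] by simp
      moreover have "(of_nat (fact \<mu>) :: 'a) \<notin> I"
        using of_nat_in_I_iff[of "fact \<mu>"] prime_dvd_fact_iff[OF prime_p] Suc.prems M by simp
      ultimately show ?thesis using r[OF a] Z'[OF a] by (auto simp: I_mult_iff I_power_iff)
    qed
    then obtain h' where "h \<simeq>\<^sub>p ?Z * h'" "h' \<notin> Ip" "degree h' + card A \<le> degree h"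
      using roots_factor[OF A] h(2) by blast
    moreover from this have "P \<simeq>\<^sub>p ?Z ^ \<mu> * (?Z * h')"
      using h(1) peqv_mult[OF peqv_refl] peqv_trans by blast
    ultimately show ?case using h(3) by (intro exI[of _ h']) (auto simp: algebra_simps)
  qed
  from this[of M] show ?thesis by auto
qed

end

section \<open>Frobenius, and descent at a linear factor\<close>

lemma degree_pderiv_le_idom: "degree (pderiv f) \<le> degree f - 1" for f :: "'a::idom poly"
  by (rule degree_le) (auto simp: coeff_pderiv coeff_eq_0)

context residue_field
begin

lemma freshman: "(1 + y) ^ p \<simeq>\<^sub>p 1 + y ^ p"
proof -
  have p0: "p > 0" using prime_p prime_gt_0_nat by blast
  have "(1 + y) ^ p = (\<Sum>k\<le>p. of_nat (p choose k) * y ^ k)"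
    using binomial_ring[of y 1 p] by (simp add: add.commute)
  also have "\<dots> = (\<Sum>k\<in>{0, p}. of_nat (p choose k) * y ^ k) + (\<Sum>k\<in>{..p} - {0, p}. of_nat (p choose k) * y ^ k)"
    by (subst sum.subset_diff[of "{0, p}"]) (auto simp: add.commute)
  also have "(\<Sum>k\<in>{0, p}. of_nat (p choose k) * y ^ k) = 1 + y ^ p" using p0 by simp
  finally have "(1 + y) ^ p - (1 + y ^ p) = (\<Sum>k\<in>{..p} - {0, p}. of_nat (p choose k) * y ^ k)"
    by simp
  also have "\<dots> \<in> Ip"
    using prime_p by (intro Ip_sum Ip_mult2 Ip_of_nat dvd_choose_prime) auto
  finally show ?thesis by (simp add: peqv_def)
qed

lemma freshman_q: "(1 + y) ^ q \<simeq>\<^sub>p 1 + y ^ q"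
proof -
  have "(1 + y) ^ (p ^ m) \<simeq>\<^sub>p 1 + y ^ (p ^ m)" for m
  proof (induction m)
    case (Suc m)
    have "(1 + y) ^ (p ^ Suc m) = ((1 + y) ^ (p ^ m)) ^ p" by (simp add: power_mult [symmetric] mult.commute)
    also have "\<dots> \<simeq>\<^sub>p (1 + y ^ (p ^ m)) ^ p" by (rule peqv_power[OF Suc.IH])
    also have "\<dots> \<simeq>\<^sub>p 1 + (y ^ (p ^ m)) ^ p" by (rule freshman)
    also have "\<dots> = 1 + y ^ (p ^ Suc m)" by (simp add: power_mult [symmetric] mult.commute)
    finally show ?case .
  qed simp
  then show ?thesis using q_power by metis
qed

lemma low_degree_in_Ip:
  assumes "Q \<simeq>\<^sub>p monom 1 d * Y" and "degree Q < d"
  shows "Q \<in> Ip"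
proof -
  have "coeff Q m \<in> I" for m
  proof (cases "m < d")
    case True
    have "coeff (Q - monom 1 d * Y) m \<in> I" using assms(1) by (simp add: peqv_def Ip_def)
    then show ?thesis using True by (simp add: coeff_monom_mult)
  next
    case False
    then show ?thesis using assms(2) by (simp add: coeff_eq_0 I_zero)
  qed
  then show ?thesis by (simp add: Ip_def)
qed

text \<open>The congruence \<open>f ^ q = 1\<close> modulo \<open>X ^ q\<close> and
  \<open>I\<close>. By Frobenius it holds for factors \<open>1 - c X\<close> and their products, and
  it allows such \<open>q\<close>-th powers to be dropped from congruences modulo
  \<open>X ^ q\<close>.\<close>

definition unital :: "'a poly \<Rightarrow> bool" where
  "unital f \<longleftrightarrow> (\<exists>Y. f ^ q \<simeq>\<^sub>p 1 + monom 1 q * Y)"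

lemma unital_one: "unital 1"
  by (auto simp: unital_def intro: exI[of _ 0])

lemma unital_mult: "unital f \<Longrightarrow> unital g \<Longrightarrow> unital (f * g)"
proof -
  assume "unital f" "unital g"
  then obtain Y Z where "f ^ q \<simeq>\<^sub>p 1 + monom 1 q * Y" "g ^ q \<simeq>\<^sub>p 1 + monom 1 q * Z"
    by (auto simp: unital_def)
  then have "f ^ q * g ^ q \<simeq>\<^sub>p (1 + monom 1 q * Y) * (1 + monom 1 q * Z)" by (rule peqv_mult)
  also have "\<dots> = 1 + monom 1 q * (Y + Z + monom 1 q * Y * Z)" by (simp add: algebra_simps)
  finally show ?thesis by (auto simp: unital_def power_mult_distrib)
qed

lemma unital_power: "unital f \<Longrightarrow> unital (f ^ k)"
  by (induction k) (auto simp: unital_one unital_mult)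

lemma unital_prod: "(\<And>i. i \<in> A \<Longrightarrow> unital (f i)) \<Longrightarrow> unital (prod f A)"
  by (induction A rule: infinite_finite_induct) (auto simp: unital_one unital_mult)

lemma unital_linear: "unital [:1, - c:]"
proof -
  have "[:1, - c:] = 1 + [:0, - c:]" by (simp add: one_pCons)
  then have "[:1, - c:] ^ q \<simeq>\<^sub>p 1 + [:0, - c:] ^ q" using freshman_q by metis
  also have "[:0, - c:] ^ q = monom 1 q * [:(- c) ^ q:]"
  proof -
    have "[:0, - c:] = monom (- c) 1" by (simp add: monom_altdef)
    then show ?thesis by (simp add: monom_power) (simp add: monom_altdef)
  qed
  finally show ?thesis unfolding unital_def by blast
qed

text \<open>Since \<open>c * b\<close> is 1 modulo \<open>I\<close>, the polynomial
  \<open>1 - c X\<close> is a unit times \<open>X - b\<close>, and root division by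
  \<open>X - b\<close> carries over to it.\<close>

lemma factor_peqv:
  assumes cb: "c * b \<simeq> 1" and h: "poly h b \<in> I"
  shows "\<exists>t. h \<simeq>\<^sub>p [:1, - c:] * t \<and> degree t \<le> degree h - 1"
proof -
  let ?t = "smult (- b) (synthetic_div h b)"
  have "[:-b, 1:] \<simeq>\<^sub>p [:1, - c:] * [:-b:]"
    using cb I_neg unfolding peqv_def Ip_def eqv_def
    by (auto simp: coeff_pCons I_zero algebra_simps split: nat.split) (metis I_neg minus_diff_eq)
  then have "[:-b, 1:] * synthetic_div h b \<simeq>\<^sub>p [:1, - c:] * [:-b:] * synthetic_div h b"
    by (rule peqv_mult) simp
  also have "\<dots> = [:1, - c:] * ?t" by (simp only: mult.assoc) simp
  finally have "h \<simeq>\<^sub>p [:1, - c:] * ?t" using synthetic_peqv[OF h] peqv_trans by blast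
  moreover have "degree ?t \<le> degree h - 1"
    by (metis degree_smult_le degree_synthetic_div)
  ultimately show ?thesis by blast
qed

text \<open>Infinite descent. With \<open>l\<close> for \<open>1 - c X\<close>, the cubes of
  \<open>s2\<close>, \<open>s1\<close>, \<open>s0\<close> carry \<open>l\<close> to the powers 0, 1,
  2 and have cofactors that do not vanish at \<open>b\<close>. So \<open>l\<close> divides
  \<open>s2\<close>, then \<open>s1\<close>, then \<open>s0\<close>, and cancelling reproduces the
  equation in lower degree. The expression is, up to a factor, the norm form for adjoining a cube
  root in which \<open>l\<close> ramifies, hence the absence of nontrivial zeros.\<close>

lemma cube_descent:
  assumes cb: "c * b \<simeq> 1"
    and r': "poly r' b \<notin> I" and f1': "poly f1' b \<notin> I" and f2': "poly f2' b \<notin> I"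
    and eq: "[:1, - c:]\<^sup>2 * r' ^ 3 * s0 ^ 3 + [:1, - c:] * f2' * s1 ^ 3 + f1' * s2 ^ 3
        - 3 * [:1, - c:] * r'\<^sup>2 * s0 * s1 * s2 \<in> Ip"
  shows "s0 \<in> Ip \<and> s1 \<in> Ip \<and> s2 \<in> Ip"
  using eq
proof (induction "degree s0 + degree s1 + degree s2" arbitrary: s0 s1 s2 rule: less_induct)
  case less
  let ?l = "[:1, - c:]"
  have lb: "poly ?l b \<in> I" using cb I_neg[of "c * b - 1"] by (simp add: eqv_def mult.commute)
  have l: "?l \<notin> Ip" using one_notin_I by (auto simp: Ip_def intro!: exI[of _ 0])
  define E where "E = ?l\<^sup>2 * r' ^ 3 * s0 ^ 3 + ?l * f2' * s1 ^ 3 + f1' * s2 ^ 3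
        - 3 * ?l * r'\<^sup>2 * s0 * s1 * s2"
  have E: "E \<in> Ip" using less.prems by (simp add: E_def)
  define X2 where "X2 = ?l * r' ^ 3 * s0 ^ 3 + f2' * s1 ^ 3 - 3 * r'\<^sup>2 * s0 * s1 * s2"
  have "E = ?l * X2 + f1' * s2 ^ 3" by (simp only: E_def X2_def) (simp only: algebra_simps power2_eq_square)
  then have "poly f1' b * poly s2 b ^ 3 = poly E b - poly ?l b * poly X2 b"
    by (simp only: poly_add poly_mult poly_power) simp
  also have "\<dots> \<in> I" by (intro I_diff poly_in_I E I_mult2 lb)
  finally have s2b: "poly s2 b \<in> I" using f1' by (simp add: I_mult_iff I_power_iff)
  then obtain t2 where t2: "s2 \<simeq>\<^sub>p ?l * t2" "degree t2 \<le> degree s2 - 1" using factor_peqv[OF cb] by blast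
  define E2 where "E2 = ?l * r' ^ 3 * s0 ^ 3 + f2' * s1 ^ 3 + ?l\<^sup>2 * f1' * t2 ^ 3 - 3 * ?l * r'\<^sup>2 * s0 * s1 * t2"
  have "E \<simeq>\<^sub>p ?l\<^sup>2 * r' ^ 3 * s0 ^ 3 + ?l * f2' * s1 ^ 3 + f1' * (?l * t2) ^ 3
        - 3 * ?l * r'\<^sup>2 * s0 * s1 * (?l * t2)"
    unfolding E_def by (intro peqv_diff peqv_add peqv_mult peqv_power peqv_refl t2(1))
  also have "\<dots> = ?l * E2"
    by (simp only: E2_def algebra_simps power2_eq_square power3_eq_cube)
  finally have E2: "E2 \<in> Ip" using E peqv_Ip Ip_mult_iff l by blast
  define X1 where "X1 = r' ^ 3 * s0 ^ 3 + ?l * f1' * t2 ^ 3 - 3 * r'\<^sup>2 * s0 * s1 * t2"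
  have "E2 = ?l * X1 + f2' * s1 ^ 3" by (simp only: E2_def X1_def) (simp only: algebra_simps power2_eq_square)
  then have "poly f2' b * poly s1 b ^ 3 = poly E2 b - poly ?l b * poly X1 b"
    by (simp only: poly_add poly_mult poly_power) simp
  also have "\<dots> \<in> I" by (intro I_diff poly_in_I E2 I_mult2 lb)
  finally have s1b: "poly s1 b \<in> I" using f2' by (simp add: I_mult_iff I_power_iff)
  then obtain t1 where t1: "s1 \<simeq>\<^sub>p ?l * t1" "degree t1 \<le> degree s1 - 1" using factor_peqv[OF cb] by blast
  define E1 where "E1 = r' ^ 3 * s0 ^ 3 + ?l\<^sup>2 * f2' * t1 ^ 3 + ?l * f1' * t2 ^ 3 - 3 * ?l * r'\<^sup>2 * s0 * t1 * t2"
  have "E2 \<simeq>\<^sub>p ?l * r' ^ 3 * s0 ^ 3 + f2' * (?l * t1) ^ 3 + ?l\<^sup>2 * f1' * t2 ^ 3 - 3 * ?l * r'\<^sup>2 * s0 * (?l * t1) * t2"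
    unfolding E2_def by (intro peqv_diff peqv_add peqv_mult peqv_power peqv_refl t1(1))
  also have "\<dots> = ?l * E1"
    by (simp only: E1_def algebra_simps power2_eq_square power3_eq_cube)
  finally have E1: "E1 \<in> Ip" using E2 peqv_Ip Ip_mult_iff l by blast
  define X0 where "X0 = ?l * f2' * t1 ^ 3 + f1' * t2 ^ 3 - 3 * r'\<^sup>2 * s0 * t1 * t2"
  have "E1 = ?l * X0 + r' ^ 3 * s0 ^ 3" by (simp only: E1_def X0_def) (simp only: algebra_simps power2_eq_square)
  then have "poly r' b ^ 3 * poly s0 b ^ 3 = poly E1 b - poly ?l b * poly X0 b"
    by (simp only: poly_add poly_mult poly_power) simp
  also have "\<dots> \<in> I" by (intro I_diff poly_in_I E1 I_mult2 lb)
  finally have s0b: "poly s0 b \<in> I" using r' by (simp add: I_mult_iff I_power_iff)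
  then obtain t0 where t0: "s0 \<simeq>\<^sub>p ?l * t0" "degree t0 \<le> degree s0 - 1" using factor_peqv[OF cb] by blast
  define E0 where "E0 = ?l\<^sup>2 * r' ^ 3 * t0 ^ 3 + ?l * f2' * t1 ^ 3 + f1' * t2 ^ 3 - 3 * ?l * r'\<^sup>2 * t0 * t1 * t2"
  have "E1 \<simeq>\<^sub>p r' ^ 3 * (?l * t0) ^ 3 + ?l\<^sup>2 * f2' * t1 ^ 3 + ?l * f1' * t2 ^ 3 - 3 * ?l * r'\<^sup>2 * (?l * t0) * t1 * t2"
    unfolding E1_def by (intro peqv_diff peqv_add peqv_mult peqv_power peqv_refl t0(1))
  also have "\<dots> = ?l * E0"
    by (simp only: E0_def algebra_simps power2_eq_square power3_eq_cube)
  finally have E0: "E0 \<in> Ip" using E1 peqv_Ip Ip_mult_iff l by blast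
  show ?case
  \<comment> \<open>The total degree fails to drop only for three constants, and a constant that
    vanishes at \<open>b\<close> lies in \<open>Ip\<close>.\<close>
  proof (cases "degree s0 + degree s1 + degree s2 = 0")
    case True
    then show ?thesis using const_in_Ip s0b s1b s2b by auto
  next
    case False
    then have "degree t0 + degree t1 + degree t2 < degree s0 + degree s1 + degree s2"
      using t0(2) t1(2) t2(2) by linarith
    then have "t0 \<in> Ip \<and> t1 \<in> Ip \<and> t2 \<in> Ip" using less.hyps[of t0 t1 t2] E0 unfolding E0_def by blast
    then show ?thesis using t0(1) t1(1) t2(1) peqv_Ip Ip_mult by blast
  qed
qed

end

section \<open>The auxiliary polynomial and its nonvanishing\<close>

lemma logarithmic_derivative:
  fixes l :: "nat \<Rightarrow> 'a::idom poly"
  assumes "\<And>i. i < k \<Longrightarrow> degree (l i) \<le> 1"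
  shows "\<exists>e. degree e \<le> k - 1 \<and> (\<Prod>i<k. l i) * pderiv (\<Prod>i<k. l i ^ \<beta> i) = e * (\<Prod>i<k. l i ^ \<beta> i)"
  using assms
proof (induction k)
  case 0
  then show ?case by (intro exI[of _ 0]) auto
next
  case (Suc k)
  then obtain e where e: "degree e \<le> k - 1"
    "(\<Prod>i<k. l i) * pderiv (\<Prod>i<k. l i ^ \<beta> i) = e * (\<Prod>i<k. l i ^ \<beta> i)" by auto
  let ?r = "\<Prod>i<k. l i" and ?f = "\<Prod>i<k. l i ^ \<beta> i"
  let ?e = "l k * e + of_nat (\<beta> k) * ?r * pderiv (l k)"
  have lk: "degree (l k) \<le> 1" using Suc.prems by simp
  have "?r * l k * pderiv (?f * l k ^ \<beta> k)
      = (?r * pderiv ?f) * l k * l k ^ \<beta> k + ?r * ?f * (pderiv (l k ^ \<beta> k) * l k)"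
    by (simp add: pderiv_mult algebra_simps)
  also have "\<dots> = ?e * (?f * l k ^ \<beta> k)"
    by (simp only: e(2) pderiv_power_mult) (simp add: algebra_simps)
  finally have eq: "?r * l k * pderiv (?f * l k ^ \<beta> k) = ?e * (?f * l k ^ \<beta> k)" .
  have r: "degree ?r \<le> k"
  proof -
    have "degree ?r \<le> (\<Sum>i<k. degree (l i))" using degree_prod_sum_le[of "{..<k}" l] by (simp add: o_def)
    also have "\<dots> \<le> (\<Sum>i<k. 1)" by (intro sum_mono) (use Suc.prems in auto)
    finally show ?thesis by simp
  qed
  have "degree (pderiv (l k)) = 0" using degree_pderiv_le_idom[of "l k"] lk by simp
  then have "degree (of_nat (\<beta> k) * ?r * pderiv (l k)) \<le> k"
    using degree_mult_le[of "of_nat (\<beta> k) * ?r" "pderiv (l k)"] degree_mult_le[of "of_nat (\<beta> k)" ?r] r by simp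
  moreover have "degree (l k * e) \<le> k"
  proof (cases "k = 0")
    case True
    then have "?f = 1" by simp
    then have "e = 0" using e(2) by simp
    then show ?thesis by simp
  next
    case False
    then show ?thesis using degree_mult_le[of "l k" e] e(1) lk by linarith
  qed
  ultimately have "degree ?e \<le> k" by (intro degree_add_le)
  then show ?case using eq by (intro exI[of _ ?e]) (simp add: mult.commute)
qed

lemma norm_form_factor:
  fixes l :: "'a::comm_ring_1"
  shows "(l * r) ^ 3 * a ^ 3 + l\<^sup>2 * F2 * b ^ 3 + l * F1 * d ^ 3 - 3 * (l * r)\<^sup>2 * a * b * d
    = l * (l\<^sup>2 * r ^ 3 * a ^ 3 + l * F2 * b ^ 3 + F1 * d ^ 3 - 3 * l * r\<^sup>2 * a * b * d)"
  by (simp add: power2_eq_square power3_eq_cube algebra_simps)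

locale stepanov = stepanov_op I V p q r
  for I :: "'a::idom set" and V :: "'a set" and p q :: nat and r +
  fixes k n :: nat and c :: "nat \<Rightarrow> 'a" and \<alpha> :: "nat \<Rightarrow> nat"
  assumes k_pos: "k > 0" and qn: "q = 3 * n + 1"
    and r_eq: "r = (\<Prod>i<k. [:1, - c i:])"
    and c_nonzero: "\<And>i. i < k \<Longrightarrow> c i \<notin> I"
    and c_incong: "\<And>i j. i < k \<Longrightarrow> j < k \<Longrightarrow> i \<noteq> j \<Longrightarrow> c i - c j \<notin> I"
    and alpha: "\<And>i. i < k \<Longrightarrow> \<alpha> i \<in> {1, 2}"
begin

definition f1 :: "'a poly" where "f1 = (\<Prod>i<k. [:1, - c i:] ^ \<alpha> i)"
definition f2 :: "'a poly" where "f2 = (\<Prod>i<k. [:1, - c i:] ^ (3 - \<alpha> i))"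
text \<open>The three powers of the cubic character of \<open>f1\<close>. The square is represented
  by \<open>f2 ^ n\<close>: as \<open>f1 * f2 = r ^ 3\<close> and \<open>r ^ (3 * n)\<close> is 1
  away from the roots of \<open>r\<close>, \<open>f2 ^ n\<close> inverts \<open>f1 ^ n\<close>
  there, and its degree does not grow like that of \<open>f1 ^ (2 * n)\<close>.\<close>

definition g :: "nat \<Rightarrow> 'a poly" where "g i = (if i = 0 then 1 else if i = 1 then f1 ^ n else f2 ^ n)"

lemma f1_f2: "f1 * f2 = r ^ 3"
proof -
  have "f1 * f2 = (\<Prod>i<k. [:1, - c i:] ^ (\<alpha> i + (3 - \<alpha> i)))"
    by (simp only: f1_def f2_def prod.distrib [symmetric] power_add)
  also have "\<dots> = (\<Prod>i<k. [:1, - c i:] ^ 3)"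
  proof (rule prod.cong[OF refl])
    fix i assume "i \<in> {..<k}"
    then have "\<alpha> i + (3 - \<alpha> i) = 3" using alpha[of i] by auto
    then show "[:1, - c i:] ^ (\<alpha> i + (3 - \<alpha> i)) = [:1, - c i:] ^ 3" by simp
  qed
  finally show ?thesis by (simp only: r_eq prod_power_distrib)
qed

lemma degree_linear: "degree [:1, - c i:] \<le> 1"
  by simp

lemma degree_r: "degree r \<le> k"
proof -
  have "degree r \<le> (\<Sum>i<k. degree [:1, - c i:])"
    unfolding r_eq using degree_prod_sum_le[of "{..<k}" "\<lambda>i. [:1, - c i:]"] by (simp add: o_def)
  also have "\<dots> \<le> (\<Sum>i<k. 1)" by (intro sum_mono) auto
  finally show ?thesis by simp
qed

lemma theta_g: "\<exists>e. degree e \<le> k - 1 \<and> r * pderiv (g i) = e * g i"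
proof -
  have "\<exists>e. degree e \<le> k - 1 \<and> r * pderiv (f ^ n) = e * f ^ n"
    if e: "degree e \<le> k - 1" "r * pderiv f = e * f" and f: "f \<noteq> 0" for e f
  proof -
    have "f * (r * pderiv (f ^ n)) = f * (of_nat n * e * f ^ n)"
    proof -
      have "f * (r * pderiv (f ^ n)) = r * (pderiv (f ^ n) * f)" by (simp add: ac_simps)
      also have "\<dots> = of_nat n * (r * pderiv f) * f ^ n" by (simp only: pderiv_power_mult) (simp add: ac_simps)
      also have "\<dots> = f * (of_nat n * e * f ^ n)" by (simp only: e(2)) (simp add: ac_simps)
      finally show ?thesis .
    qed
    then have "r * pderiv (f ^ n) = of_nat n * e * f ^ n" using f by simp
    moreover have "degree (of_nat n * e) \<le> k - 1"
      using degree_mult_le[of "of_nat n" e] e(1) by simp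
    ultimately show ?thesis by blast
  qed
  moreover have "\<exists>e. degree e \<le> k - 1 \<and> r * pderiv f1 = e * f1" "\<exists>e. degree e \<le> k - 1 \<and> r * pderiv f2 = e * f2"
    unfolding r_eq f1_def f2_def using degree_linear by (intro logarithmic_derivative; blast)+
  moreover have "f1 \<noteq> 0" "f2 \<noteq> 0" by (auto simp: f1_def f2_def)
  moreover have "\<exists>e. degree e \<le> k - 1 \<and> r * pderiv 1 = e * 1" by (intro exI[of _ 0]) auto
  ultimately show ?thesis unfolding g_def by (cases "i = 0"; cases "i = 1") (simp_all, blast+)
qed

definition ee :: "nat \<Rightarrow> 'a poly" where "ee i = (SOME e. degree e \<le> k - 1 \<and> r * pderiv (g i) = e * g i)"

lemma ee: "degree (ee i) \<le> k - 1" "r * pderiv (g i) = ee i * g i"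
  using someI_ex[OF theta_g[of i]] unfolding ee_def by auto

text \<open>The operator that \<open>theta\<close> induces on the cofactor of \<open>g i\<close>.
  One application raises the degree of the cofactor by at most \<open>k - 1\<close>, independently
  of the large degree of \<open>g i\<close>.\<close>

definition DD :: "nat \<Rightarrow> 'a poly \<Rightarrow> 'a poly" where "DD i s = r * pderiv s + ee i * s"

lemma theta_mult_g: "theta (s * g i) = DD i s * g i"
proof -
  have "theta (s * g i) = s * (r * pderiv (g i)) + r * pderiv s * g i"
    by (simp add: theta_def pderiv_mult algebra_simps)
  then show ?thesis by (simp only: ee(2) DD_def) (simp add: algebra_simps)
qed

lemma DD_diff: "(DD i ^^ m) (s - t) = (DD i ^^ m) s - (DD i ^^ m) t"
  by (induction m) (simp_all add: DD_def pderiv_diff right_diff_distrib)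

lemma degree_DD: "degree (DD i s) \<le> degree s + (k - 1)"
proof -
  have "degree (r * pderiv s) \<le> degree s + (k - 1)"
  proof (cases "degree s = 0")
    case True
    then have "pderiv s = 0" by (auto elim!: degree_eq_zeroE)
    then show ?thesis by simp
  next
    case False
    then show ?thesis using degree_mult_le[of r "pderiv s"] degree_r degree_pderiv_le_idom[of s] k_pos by linarith
  qed
  moreover have "degree (ee i * s) \<le> degree s + (k - 1)"
    using degree_mult_le[of "ee i" s] ee(1)[of i] by linarith
  ultimately show ?thesis unfolding DD_def by (rule degree_add_le)
qed

lemma degree_DD_iter: "degree ((DD i ^^ m) s) \<le> degree s + m * (k - 1)"
proof (induction m)
  case (Suc m)
  then show ?case using degree_DD[of i "(DD i ^^ m) s"] by simp
qed simp

text \<open>Stepanov's construction. Modulo \<open>p\<close> the powers \<open>X ^ (q * j)\<close>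
  are constants for \<open>theta\<close>, and at elements of the field they take the value of
  \<open>X ^ j\<close>. So the polynomial has high degree, but its values on the set to be counted
  come from a polynomial of low degree.\<close>

definition PP :: "nat \<Rightarrow> (nat \<Rightarrow> nat \<Rightarrow> 'a poly) \<Rightarrow> 'a poly" where
  "PP J s = (\<Sum>i<3. \<Sum>j<J. monom 1 (q * j) * (s i j * g i))"

lemma theta_monom: "theta (monom 1 (q * j) * h) \<simeq>\<^sub>p monom 1 (q * j) * theta h"
proof -
  have "theta (monom 1 (q * j) * h) - monom 1 (q * j) * theta h = r * pderiv (monom 1 (q * j)) * h"
    by (simp add: theta_def pderiv_mult algebra_simps)
  also have "\<dots> \<in> Ip"
  proof -
    have "of_nat (q * j) \<in> I" using p_dvd_q by (simp only: of_nat_in_I_iff) simp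
    then have "pderiv (monom 1 (q * j)) \<in> Ip" by (auto simp: pderiv_monom Ip_def I_zero)
    then show ?thesis by (intro Ip_mult2 Ip_mult)
  qed
  finally show ?thesis by (simp add: peqv_def)
qed

lemma theta_sum: "theta (sum f A) = (\<Sum>i\<in>A. theta (f i))"
  by (induction A rule: infinite_finite_induct) (auto simp: theta_def pderiv_add distrib_left)

lemma theta_PP: "(theta ^^ m) (PP J s) \<simeq>\<^sub>p PP J (\<lambda>i j. (DD i ^^ m) (s i j))"
proof (induction m)
  case (Suc m)
  have "(theta ^^ Suc m) (PP J s) \<simeq>\<^sub>p theta (PP J (\<lambda>i j. (DD i ^^ m) (s i j)))"
    using theta_peqv[OF Suc.IH, of 1] by simp
  also have "\<dots> \<simeq>\<^sub>p PP J (\<lambda>i j. (DD i ^^ Suc m) (s i j))"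
    unfolding PP_def theta_sum
  proof (intro peqv_sum)
    fix i j :: nat
    show "theta (monom 1 (q * j) * ((DD i ^^ m) (s i j) * g i)) \<simeq>\<^sub>p
        monom 1 (q * j) * ((DD i ^^ Suc m) (s i j) * g i)"
      using theta_monom[of j "(DD i ^^ m) (s i j) * g i"] by (simp add: theta_mult_g)
  qed
  finally show ?case .
qed simp

text \<open>If the sum vanished, its lowest nontrivial level would give
  \<open>a + b f1^n + d f2^n = 0\<close> modulo \<open>X^q\<close>. With \<open>u\<close>,
  \<open>v\<close>, \<open>w\<close> for the three summands,
  \<open>u^3 + v^3 + w^3 - 3 u v w\<close> is divisible by \<open>u + v + w\<close>. Multiplied by
  \<open>r^3\<close> it contains \<open>f1\<close>, \<open>f2\<close>, \<open>r\<close> to the power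
  \<open>q\<close> in place of powers depending on \<open>n\<close>, and these are 1 modulo
  \<open>X^q\<close>. What remains is \<open>Q\<close>, which has degree below \<open>q\<close> and
  hence vanishes; descent at one linear factor then kills \<open>a\<close>, \<open>b\<close>,
  \<open>d\<close>.\<close>

lemma PP_nonzero:
  assumes deg: "\<And>i j. degree (s i j) < \<kappa>" and kap: "\<kappa> + k \<le> n + 1"
    and nz: "i0 < 3" "j0 < J" "s i0 j0 \<notin> Ip"
  shows "PP J s \<notin> Ip"
proof
  assume PP: "PP J s \<in> Ip"
  define T where "T j = (\<Sum>i<3. s i j * g i)" for j
  define m where "m = (LEAST j. \<exists>i<3. s i j \<notin> Ip)"
  have m1: "\<exists>i<3. s i m \<notin> Ip" unfolding m_def by (rule LeastI[where k=j0]) (use nz in auto)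
  have m2: "s i j \<in> Ip" if "j < m" "i < 3" for i j
    using not_less_Least[of j "\<lambda>j. \<exists>i<3. s i j \<notin> Ip"] that by (auto simp: m_def)
  have mJ: "m < J"
  proof -
    have "m \<le> j0" unfolding m_def by (rule Least_le) (use nz in auto)
    then show ?thesis using nz(2) by simp
  qed
  have PP2: "PP J s = (\<Sum>j<J. monom 1 (q * j) * T j)"
    unfolding PP_def T_def by (subst sum.swap) (simp add: sum_distrib_left)
  define Y where "Y = (\<Sum>j\<in>{m<..<J}. monom 1 (q * (j - m - 1)) * T j)"
  have "(\<Sum>j<J. monom 1 (q * j) * T j) = (\<Sum>j<m. monom 1 (q * j) * T j) + (\<Sum>j\<in>{m..<J}. monom 1 (q * j) * T j)"
    using mJ by (simp add: ivl_disj_un sum.union_disjoint [symmetric] ivl_disj_int less_imp_le flip: atLeast0LessThan)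
  also have "(\<Sum>j\<in>{m..<J}. monom 1 (q * j) * T j) = monom 1 (q * m) * T m + (\<Sum>j\<in>{m<..<J}. monom 1 (q * j) * T j)"
  proof -
    have "{m..<J} = insert m {m<..<J}" using mJ by auto
    then show ?thesis by simp
  qed
  also have "(\<Sum>j\<in>{m<..<J}. monom 1 (q * j) * T j) = monom 1 (q * m) * (monom 1 q * Y)"
    unfolding Y_def sum_distrib_left
  proof (rule sum.cong[OF refl])
    fix j assume "j \<in> {m<..<J}"
    then have "q * m + (q + q * (j - m - 1)) = q * j"
      by (metis (no_types, lifting) Suc_diff_Suc Suc_eq_plus1 add.commute add_mult_distrib2 diff_Suc_1 greaterThanLessThan_iff le_add_diff_inverse less_imp_le mult.right_neutral diff_diff_left)
    then have "monom 1 (q * m) * (monom 1 q * monom 1 (q * (j - m - 1))) = (monom 1 (q * j) :: 'a poly)"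
      by (simp add: mult_monom)
    then show "monom 1 (q * j) * T j = monom 1 (q * m) * (monom 1 q * (monom 1 (q * (j - m - 1)) * T j))"
      by (simp only: mult.assoc [symmetric])
  qed
  finally have split: "PP J s = (\<Sum>j<m. monom 1 (q * j) * T j) + monom 1 (q * m) * (T m + monom 1 q * Y)"
    unfolding PP2 by (simp add: algebra_simps)
  have "(\<Sum>j<m. monom 1 (q * j) * T j) \<in> Ip"
    unfolding T_def by (intro Ip_sum Ip_mult Ip_mult2) (use m2 in auto)
  then have "monom 1 (q * m) * (T m + monom 1 q * Y) \<in> Ip"
    using PP split Ip_diff by (metis add_diff_cancel_left')
  then have "T m + monom 1 q * Y \<in> Ip" using Ip_prime monom_one_notin_Ip by blast
  then have Tm: "T m \<simeq>\<^sub>p monom 1 q * (- Y)" by (simp add: peqv_def)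
  define a b d where "a = s 0 m" and "b = s 1 m" and "d = s 2 m"
  have "T m = a + b * f1 ^ n + d * f2 ^ n"
  proof -
    have "{..<3::nat} = {0, 1, 2}" by auto
    then show ?thesis by (simp add: T_def a_def b_def d_def g_def algebra_simps)
  qed
  then have Tm2: "a + b * f1 ^ n + d * f2 ^ n \<simeq>\<^sub>p monom 1 q * (- Y)" using Tm by simp
  define u v w where "u = a" and "v = b * f1 ^ n" and "w = d * f2 ^ n"
  have "u ^ 3 + v ^ 3 + w ^ 3 - 3 * u * v * w = (u + v + w) * (u\<^sup>2 + v\<^sup>2 + w\<^sup>2 - u * v - v * w - u * w)"
    by (simp add: algebra_simps power2_eq_square power3_eq_cube)
  also have "\<dots> \<simeq>\<^sub>p monom 1 q * (- Y) * (u\<^sup>2 + v\<^sup>2 + w\<^sup>2 - u * v - v * w - u * w)"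
    using Tm2 unfolding u_def v_def w_def by (rule peqv_mult) simp
  finally obtain Y1 where Y1: "u ^ 3 + v ^ 3 + w ^ 3 - 3 * u * v * w \<simeq>\<^sub>p monom 1 q * Y1"
    by (metis mult.assoc)
  have unit: "unital f1" "unital f2" "unital r"
    unfolding f1_def f2_def r_eq by (intro unital_prod unital_power unital_linear)+
  then obtain Z1 Z2 Z3 where Z: "f1 ^ q \<simeq>\<^sub>p 1 + monom 1 q * Z1" "f2 ^ q \<simeq>\<^sub>p 1 + monom 1 q * Z2"
    "r ^ q \<simeq>\<^sub>p 1 + monom 1 q * Z3" unfolding unital_def by blast
  define Q where "Q = r ^ 3 * a ^ 3 + f2 * b ^ 3 + f1 * d ^ 3 - 3 * r\<^sup>2 * a * b * d"
  have e1: "r ^ 3 * v ^ 3 = f2 * b ^ 3 * f1 ^ q"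
  proof -
    have "r ^ 3 * v ^ 3 = f1 * f2 * (b ^ 3 * f1 ^ (n * 3))"
      by (simp only: f1_f2 [symmetric] v_def power_mult_distrib power_mult)
    then show ?thesis by (simp add: qn ac_simps)
  qed
  have e2: "r ^ 3 * w ^ 3 = f1 * d ^ 3 * f2 ^ q"
  proof -
    have "r ^ 3 * w ^ 3 = f1 * f2 * (d ^ 3 * f2 ^ (n * 3))"
      by (simp only: f1_f2 [symmetric] w_def power_mult_distrib power_mult)
    then show ?thesis by (simp add: qn ac_simps)
  qed
  have e3: "r ^ 3 * (3 * u * v * w) = 3 * r\<^sup>2 * a * b * d * r ^ q"
  proof -
    have "v * w = b * d * r ^ (3 * n)"
    proof -
      have "v * w = b * d * (f1 * f2) ^ n" by (simp add: v_def w_def power_mult_distrib ac_simps)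
      then show ?thesis by (simp only: f1_f2 power_mult)
    qed
    then have "r ^ 3 * (3 * u * v * w) = r ^ 3 * (3 * a * (b * d * r ^ (3 * n)))" by (simp add: u_def mult.assoc)
    then show ?thesis by (simp add: qn ac_simps power2_eq_square power3_eq_cube)
  qed
  have "r ^ 3 * (u ^ 3 + v ^ 3 + w ^ 3 - 3 * u * v * w)
      = r ^ 3 * a ^ 3 + f2 * b ^ 3 * f1 ^ q + f1 * d ^ 3 * f2 ^ q - 3 * r\<^sup>2 * a * b * d * r ^ q"
    by (simp only: e1 [symmetric] e2 [symmetric] e3 [symmetric]) (simp add: u_def algebra_simps)
  also have "\<dots> \<simeq>\<^sub>p r ^ 3 * a ^ 3 + f2 * b ^ 3 * (1 + monom 1 q * Z1) + f1 * d ^ 3 * (1 + monom 1 q * Z2)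
      - 3 * r\<^sup>2 * a * b * d * (1 + monom 1 q * Z3)"
    by (intro peqv_diff peqv_add peqv_mult Z peqv_refl)
  also have "\<dots> = Q + monom 1 q * (f2 * b ^ 3 * Z1 + f1 * d ^ 3 * Z2 - 3 * r\<^sup>2 * a * b * d * Z3)"
    by (simp add: Q_def algebra_simps)
  finally have "Q + monom 1 q * (f2 * b ^ 3 * Z1 + f1 * d ^ 3 * Z2 - 3 * r\<^sup>2 * a * b * d * Z3)
      \<simeq>\<^sub>p r ^ 3 * (monom 1 q * Y1)"
    using peqv_mult[OF peqv_refl Y1, of "r ^ 3"] peqv_sym peqv_trans by blast
  from peqv_diff[OF this peqv_refl, of "monom 1 q * (f2 * b ^ 3 * Z1 + f1 * d ^ 3 * Z2 - 3 * r\<^sup>2 * a * b * d * Z3)"]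
  have Q1: "Q \<simeq>\<^sub>p monom 1 q * (r ^ 3 * Y1 - (f2 * b ^ 3 * Z1 + f1 * d ^ 3 * Z2 - 3 * r\<^sup>2 * a * b * d * Z3))"
    by (simp add: algebra_simps)
  have da0: "degree a < \<kappa>" "degree b < \<kappa>" "degree d < \<kappa>" using deg by (auto simp: a_def b_def d_def)
  then have da: "degree a \<le> \<kappa> - 1" "degree b \<le> \<kappa> - 1" "degree d \<le> \<kappa> - 1" by linarith+
  have dpow: "degree (h ^ j) \<le> j * N" if "degree h \<le> N" for h :: "'a poly" and j N
    using degree_power_le[of h j] mult_le_mono2[OF that, of j] by (metis le_trans mult.commute)
  have dmul: "degree (h * h') \<le> N + N'" if "degree h \<le> N" "degree h' \<le> N'" for h h' :: "'a poly" and N N'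
    using degree_mult_le[of h h'] that by linarith
  have df: "degree (\<Prod>i<k. [:1, - c i:] ^ \<beta> i) \<le> 2 * k" if "\<And>i. i < k \<Longrightarrow> \<beta> i \<le> 2" for \<beta>
  proof -
    have "degree (\<Prod>i<k. [:1, - c i:] ^ \<beta> i) \<le> (\<Sum>i<k. degree ([:1, - c i:] ^ \<beta> i))"
      using degree_prod_sum_le[of "{..<k}" "\<lambda>i. [:1, - c i:] ^ \<beta> i"] by (simp add: o_def)
    also have "\<dots> \<le> (\<Sum>i<k. 2)"
    proof (intro sum_mono)
      fix i assume "i \<in> {..<k}"
      then have "\<beta> i \<le> 2" using that by simp
      then show "degree ([:1, - c i:] ^ \<beta> i) \<le> 2" using dpow[OF degree_linear[of i], of "\<beta> i"] by linarith
    qed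
    finally show ?thesis by simp
  qed
  have df1: "degree f1 \<le> 2 * k" unfolding f1_def by (rule df) (use alpha in fastforce)
  have df2: "degree f2 \<le> 2 * k" unfolding f2_def by (rule df) (use alpha in fastforce)
  have d3: "degree (3 :: 'a poly) \<le> 0" by simp
  \<comment> \<open>By \<open>kap\<close> this is at most \<open>3 * n\<close>, hence below
    \<open>q\<close>.\<close>
  let ?N = "3 * k + 3 * (\<kappa> - 1)"
  have "degree (r ^ 3 * a ^ 3) \<le> ?N"
    using dmul[OF dpow[OF degree_r, of 3] dpow[OF da(1), of 3]] by simp
  moreover have "degree (f2 * b ^ 3) \<le> ?N"
    using dmul[OF df2 dpow[OF da(2), of 3]] by linarith
  moreover have "degree (f1 * d ^ 3) \<le> ?N"
    using dmul[OF df1 dpow[OF da(3), of 3]] by linarith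
  moreover have "degree (3 * r\<^sup>2 * a * b * d) \<le> ?N"
    using dmul[OF dmul[OF dmul[OF dmul[OF d3 dpow[OF degree_r, of 2]] da(1)] da(2)] da(3)] by linarith
  ultimately have "degree Q \<le> ?N" unfolding Q_def by (intro degree_diff_le degree_add_le)
  then have "degree Q < q" using kap da0(1) qn by linarith
  then have Q: "Q \<in> Ip" using low_degree_in_Ip[OF Q1] by blast
  define l where "l = [:1, - c 0:]"
  have lnot: "l \<notin> Ip" using one_notin_I by (auto simp: l_def Ip_def intro!: exI[of _ 0])
  \<comment> \<open>The root of the factor \<open>l\<close>; as the \<open>c i\<close> are
    incongruent, no other linear factor vanishes there.\<close>
  obtain z where z: "c 0 * z \<simeq> 1" using inverse_ex c_nonzero k_pos by blast
  have other: "poly (\<Prod>i\<in>{..<k} - {0}. [:1, - c i:] ^ \<beta> i) z \<notin> I" for \<beta>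
  proof -
    have "1 - z * c i \<notin> I" if "i < k" "i \<noteq> 0" for i
    proof
      assume "1 - z * c i \<in> I"
      then have "c 0 * (1 - z * c i) \<in> I" by (rule I_mult)
      moreover have "(c 0 * z - 1) * c i \<in> I" using z I_mult2 by (simp add: eqv_def)
      ultimately have "c 0 * (1 - z * c i) + (c 0 * z - 1) * c i \<in> I" by (rule I_add)
      then have "c 0 - c i \<in> I" by (simp add: algebra_simps)
      then show False using c_incong that k_pos by blast
    qed
    then show ?thesis by (simp only: poly_prod) (intro prod_notin_I, auto simp: I_power_iff)
  qed
  have pull: "(\<Prod>i<k. [:1, - c i:] ^ \<beta> i) = l ^ \<beta> 0 * (\<Prod>i\<in>{..<k} - {0}. [:1, - c i:] ^ \<beta> i)" for \<beta>
    unfolding l_def using k_pos by (intro prod.remove) auto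
  define r' where "r' = (\<Prod>i\<in>{..<k} - {0}. [:1, - c i:] ^ 1)"
  have r': "r = l * r'" "poly r' z \<notin> I" using pull[of "\<lambda>_. 1"] other[of "\<lambda>_. 1"] by (simp_all add: r_eq r'_def)
  define F1 where "F1 = (\<Prod>i\<in>{..<k} - {0}. [:1, - c i:] ^ \<alpha> i)"
  define F2 where "F2 = (\<Prod>i\<in>{..<k} - {0}. [:1, - c i:] ^ (3 - \<alpha> i))"
  have F: "f1 = l ^ \<alpha> 0 * F1" "f2 = l ^ (3 - \<alpha> 0) * F2" "poly F1 z \<notin> I" "poly F2 z \<notin> I"
    unfolding f1_def f2_def F1_def F2_def by (rule pull other)+
  have abd: "a \<in> Ip \<and> b \<in> Ip \<and> d \<in> Ip"
  proof (cases "\<alpha> 0 = 1")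
    case True
    have "Q = l * (l\<^sup>2 * r' ^ 3 * a ^ 3 + l * F2 * b ^ 3 + F1 * d ^ 3 - 3 * l * r'\<^sup>2 * a * b * d)"
      unfolding Q_def F(1,2) r'(1) True norm_form_factor [symmetric] by simp
    then have "l\<^sup>2 * r' ^ 3 * a ^ 3 + l * F2 * b ^ 3 + F1 * d ^ 3 - 3 * l * r'\<^sup>2 * a * b * d \<in> Ip"
      using Q lnot Ip_prime by metis
    then show ?thesis using cube_descent[OF z r'(2) F(3,4)] unfolding l_def by blast
  next
    case False
    \<comment> \<open>With exponent 2 in \<open>f1\<close>, the factor \<open>l\<close> divides
      \<open>f2\<close> only once, so \<open>f1\<close> and \<open>f2\<close>, and with them
      \<open>b\<close> and \<open>d\<close>, change places.\<close>
    then have a0: "\<alpha> 0 = 2" using alpha k_pos by blast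
    have "Q = l * (l\<^sup>2 * r' ^ 3 * a ^ 3 + l * F1 * d ^ 3 + F2 * b ^ 3 - 3 * l * r'\<^sup>2 * a * d * b)"
      unfolding Q_def F(1,2) r'(1) a0 norm_form_factor [symmetric] by (simp add: ac_simps)
    then have "l\<^sup>2 * r' ^ 3 * a ^ 3 + l * F1 * d ^ 3 + F2 * b ^ 3 - 3 * l * r'\<^sup>2 * a * d * b \<in> Ip"
      using Q lnot Ip_prime by metis
    then show ?thesis using cube_descent[OF z r'(2) F(4,3)] unfolding l_def by blast
  qed
  obtain i where i: "i < 3" "s i m \<notin> Ip" using m1 by blast
  then consider "i = 0" | "i = 1" | "i = 2" by linarith
  then show False using i(2) abd unfolding a_def b_def d_def by cases simp_all
qed

end

section \<open>Stepanov's inequality\<close>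

lemma double_sum_arith: "2 * (\<Sum>\<mu><m. a + \<mu> * b) = 2 * m * a + b * (m * (m - 1))" for a b m :: nat
proof (induction m)
  case (Suc m)
  then show ?case by (cases m) (simp_all add: algebra_simps)
qed simp

context stepanov
begin

text \<open>What the iterate of \<open>theta\<close> on \<open>PP\<close> becomes at a point of
  \<open>A\<close>, where \<open>X ^ q\<close> acts as \<open>X\<close> and \<open>g i\<close> as
  the constant \<open>z i\<close>. Its degree is small, so demanding that it lie in
  \<open>Ip\<close> costs few linear conditions on the coefficients.\<close>

definition RR :: "(nat \<Rightarrow> 'a) \<Rightarrow> nat \<Rightarrow> nat \<Rightarrow> (nat \<Rightarrow> nat \<Rightarrow> 'a poly) \<Rightarrow> 'a poly" where
  "RR z J \<mu> s = (\<Sum>i<3. \<Sum>j<J. monom (z i) j * (DD i ^^ \<mu>) (s i j))"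

lemma RR_diff: "RR z J \<mu> (\<lambda>i j. s i j - t i j) = RR z J \<mu> s - RR z J \<mu> t"
  by (simp add: RR_def DD_diff right_diff_distrib sum_subtractf)

lemma degree_RR:
  assumes "\<And>i j. degree (s i j) < \<kappa>"
  shows "degree (RR z J \<mu> s) \<le> (J - 1) + (\<kappa> - 1) + \<mu> * (k - 1)"
  unfolding RR_def
proof (intro degree_sum_le)
  fix i j assume "j \<in> {..<J}"
  then have "degree (monom (z i) j) \<le> J - 1" using degree_monom_le[of "z i" j] by simp
  moreover have "degree ((DD i ^^ \<mu>) (s i j)) \<le> (\<kappa> - 1) + \<mu> * (k - 1)"
    using degree_DD_iter[of \<mu> i "s i j"] assms[of i j] by linarith
  ultimately show "degree (monom (z i) j * (DD i ^^ \<mu>) (s i j)) \<le> (J - 1) + (\<kappa> - 1) + \<mu> * (k - 1)"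
    using degree_mult_le[of "monom (z i) j" "(DD i ^^ \<mu>) (s i j)"] by linarith
qed auto

text \<open>A nonzero solution of the linear system exists because there are more unknown
  coefficients than equations.\<close>

lemma auxiliary_coefficients:
  assumes kap: "\<kappa> > 0"
    and count: "(\<Sum>\<mu><M. J + \<kappa> - 1 + \<mu> * (k - 1)) < 3 * J * \<kappa>"
  shows "\<exists>s. (\<forall>i j. degree (s i j) < \<kappa>) \<and> (\<exists>i<3. \<exists>j<J. s i j \<notin> Ip) \<and> (\<forall>\<mu><M. RR z J \<mu> s \<in> Ip)"
proof -
  define U where "U = {..<3::nat} \<times> {..<J} \<times> {..<\<kappa>}"
  define E where "E \<mu> = J + \<kappa> - 1 + \<mu> * (k - 1)" for \<mu>
  define W where "W = Sigma {..<M} (\<lambda>\<mu>. {..<E \<mu>})"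
  define sp where "sp u i j = (\<Sum>m<\<kappa>. monom (u (i, j, m)) m)" for u :: "nat \<times> nat \<times> nat \<Rightarrow> 'a" and i j
  define \<Theta> where "\<Theta> u = (\<lambda>x\<in>W. rep (coeff (RR z J (fst x) (sp u)) (snd x)))" for u
  have cU: "card U = 3 * J * \<kappa>" by (simp add: U_def card_cartesian_product)
  have cW: "card W = (\<Sum>\<mu><M. E \<mu>)" by (simp add: W_def)
  have J: "J > 0" using count by (cases J) auto
  \<comment> \<open>Linear algebra over the residue field is replaced by the pigeonhole principle:
    two coefficient vectors with entries in \<open>V\<close> have the same image, and their
    difference solves the system.\<close>
  have "card (W \<rightarrow>\<^sub>E V) < card (U \<rightarrow>\<^sub>E V)"
    using count cU cW finite_V q_gt_1 by (simp add: card_PiE card_V E_def U_def W_def)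
  moreover have "\<Theta> ` (U \<rightarrow>\<^sub>E V) \<subseteq> W \<rightarrow>\<^sub>E V" by (auto simp: \<Theta>_def)
  moreover have "finite (W \<rightarrow>\<^sub>E V)" using finite_V by (intro finite_PiE) (auto simp: W_def)
  ultimately have "\<not> inj_on \<Theta> (U \<rightarrow>\<^sub>E V)" using card_inj_on_le by (metis not_le)
  then obtain u u' where u: "u \<in> U \<rightarrow>\<^sub>E V" "u' \<in> U \<rightarrow>\<^sub>E V" "u \<noteq> u'" "\<Theta> u = \<Theta> u'"
    unfolding inj_on_def by blast
  define s where "s i j = sp u i j - sp u' i j" for i j
  have dsp: "degree (sp v i j) < \<kappa>" for v i j
  proof -
    have "degree (sp v i j) \<le> \<kappa> - 1" unfolding sp_def
    proof (intro degree_sum_le)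
      fix m assume "m \<in> {..<\<kappa>}"
      then show "degree (monom (v (i, j, m)) m) \<le> \<kappa> - 1" using degree_monom_le[of "v (i, j, m)" m] by simp
    qed auto
    then show ?thesis using kap by linarith
  qed
  have ds: "degree (s i j) < \<kappa>" for i j
    unfolding s_def using degree_diff_less[OF dsp dsp] .
  have csp: "coeff (sp v i j) m = v (i, j, m)" if "m < \<kappa>" for v i j m
    using that by (simp add: sp_def coeff_sum)
  have "\<exists>x\<in>U. u x \<noteq> u' x" using u(1-3) by (meson PiE_ext)
  then obtain i j m where ijm: "i < 3" "j < J" "m < \<kappa>" "u (i, j, m) \<noteq> u' (i, j, m)"
    by (auto simp: U_def)
  have "u (i, j, m) - u' (i, j, m) \<notin> I"
  proof
    assume "u (i, j, m) - u' (i, j, m) \<in> I"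
    moreover have "u (i, j, m) \<in> V" "u' (i, j, m) \<in> V"
      using u(1,2) ijm by (auto simp: U_def)
    ultimately show False using V_unique ijm(4) by blast
  qed
  then have "coeff (s i j) m \<notin> I" using ijm(3) by (simp add: s_def csp)
  then have "s i j \<notin> Ip" by (auto simp: Ip_def)
  moreover have "RR z J \<mu> s \<in> Ip" if \<mu>: "\<mu> < M" for \<mu>
  proof -
    have "coeff (RR z J \<mu> s) m \<in> I" for m
    proof (cases "m < E \<mu>")
      case True
      have "(\<mu>, m) \<in> W" using \<mu> True by (simp add: W_def)
      then have "rep (coeff (RR z J \<mu> (sp u)) m) = rep (coeff (RR z J \<mu> (sp u')) m)"
        using fun_cong[OF u(4), of "(\<mu>, m)"] by (simp add: \<Theta>_def)
      then have "coeff (RR z J \<mu> (sp u)) m - coeff (RR z J \<mu> (sp u')) m \<in> I"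
        by (simp only: rep_eq_iff eqv_def)
      moreover have "RR z J \<mu> s = RR z J \<mu> (sp u) - RR z J \<mu> (sp u')"
        using RR_diff[of z J \<mu> "sp u" "sp u'"] by (simp add: s_def [abs_def])
      ultimately show ?thesis by simp
    next
      case False
      have "degree (RR z J \<mu> s) < m" using degree_RR[of s \<kappa> z J \<mu>] ds False J kap by (simp add: E_def)
      then show ?thesis by (simp add: coeff_eq_0 I_zero)
    qed
    then show ?thesis by (simp add: Ip_def)
  qed
  ultimately show ?thesis using ds ijm(1,2) by blast
qed

text \<open>The auxiliary polynomial vanishes to order \<open>M\<close> at each point of
  \<open>A\<close>, so \<open>M * card A\<close> is at most its degree. The hypothesis
  \<open>count\<close> says that it has more free coefficients than conditions.\<close>

theorem stepanov_bound:
  assumes A: "incong A" and M: "M \<le> p" and kap: "\<kappa> > 0" "\<kappa> + k \<le> n + 1"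
    and count: "(\<Sum>\<mu><M. J + \<kappa> - 1 + \<mu> * (k - 1)) < 3 * J * \<kappa>"
    and r: "\<And>a. a \<in> A \<Longrightarrow> poly r a \<notin> I"
    and f1: "\<And>a. a \<in> A \<Longrightarrow> poly f1 a ^ n \<simeq> \<zeta>"
    and D: "degree f1 \<le> D" "degree f2 \<le> D"
  shows "M * card A \<le> q * (J - 1) + (\<kappa> - 1) + n * D"
proof -
  define z where "z i = (if i = 0 then 1 else if i = 1 then \<zeta> else \<zeta>\<^sup>2)" for i :: nat
  obtain s i0 j0 where s: "\<And>i j. degree (s i j) < \<kappa>" "i0 < 3" "j0 < J" "s i0 j0 \<notin> Ip"
    "\<And>\<mu>. \<mu> < M \<Longrightarrow> RR z J \<mu> s \<in> Ip"
    using auxiliary_coefficients[OF kap(1) count, of z] by blast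
  have g: "poly (g i) a \<simeq> z i" if a: "a \<in> A" for i a
  proof -
    have ra: "poly r a ^ (3 * n) \<simeq> 1" using fermat[OF r[OF a]] by (simp add: qn)
    have "\<zeta> ^ 3 \<simeq> (poly f1 a ^ n) ^ 3" by (rule eqv_power[OF eqv_sym[OF f1[OF a]]])
    also have "\<dots> = poly f1 a ^ (q - 1)" by (simp add: qn power_mult [symmetric] mult.commute)
    also have "\<dots> \<simeq> 1"
    proof (rule fermat)
      have "poly f1 a * poly f2 a = poly r a ^ 3" using arg_cong[OF f1_f2, of "\<lambda>f. poly f a"] by simp
      moreover have "poly r a ^ 3 \<notin> I" using r[OF a] by (simp add: I_power_iff)
      ultimately show "poly f1 a \<notin> I" using I_mult2 by metis
    qed
    finally have z3: "\<zeta> ^ 3 \<simeq> 1" .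
    have "poly f1 a ^ n * poly f2 a ^ n = poly r a ^ (3 * n)"
      using arg_cong[OF f1_f2, of "\<lambda>f. poly f a"]
      by (simp only: poly_mult poly_power power_mult power_mult_distrib [symmetric])
    then have "poly f1 a ^ n * poly f2 a ^ n \<simeq> 1" using ra by simp
    with eqv_mult[OF eqv_sym[OF f1[OF a]] eqv_refl, of "poly f2 a ^ n"]
    have "\<zeta> * poly f2 a ^ n \<simeq> 1" by (rule eqv_trans)
    then have "\<zeta>\<^sup>2 * (\<zeta> * poly f2 a ^ n) \<simeq> \<zeta>\<^sup>2 * 1" by (intro eqv_mult) auto
    moreover have "\<zeta>\<^sup>2 * (\<zeta> * poly f2 a ^ n) = \<zeta> ^ 3 * poly f2 a ^ n"
      by (simp add: power2_eq_square power3_eq_cube ac_simps)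
    ultimately have "\<zeta> ^ 3 * poly f2 a ^ n \<simeq> \<zeta>\<^sup>2" by simp
    moreover have "\<zeta> ^ 3 * poly f2 a ^ n \<simeq> 1 * poly f2 a ^ n" by (intro eqv_mult z3) auto
    then have "poly f2 a ^ n \<simeq> \<zeta> ^ 3 * poly f2 a ^ n" using eqv_sym by simp
    ultimately have "poly f2 a ^ n \<simeq> \<zeta>\<^sup>2" using eqv_trans by blast
    then show ?thesis using f1[OF a] by (auto simp: g_def z_def)
  qed
  have van: "poly ((theta ^^ \<mu>) (PP J s)) a \<in> I" if \<mu>: "\<mu> < M" and a: "a \<in> A" for \<mu> a
  proof -
    have "poly ((theta ^^ \<mu>) (PP J s)) a \<simeq> poly (PP J (\<lambda>i j. (DD i ^^ \<mu>) (s i j))) a"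
      by (intro peqv_poly theta_PP)
    also have "\<dots> = (\<Sum>i<3. \<Sum>j<J. a ^ (q * j) * (poly ((DD i ^^ \<mu>) (s i j)) a * poly (g i) a))"
      by (simp add: PP_def poly_sum poly_monom)
    also have "\<dots> \<simeq> (\<Sum>i<3. \<Sum>j<J. a ^ j * (poly ((DD i ^^ \<mu>) (s i j)) a * z i))"
    proof (intro eqv_sum eqv_mult g a eqv_refl)
      fix j show "a ^ (q * j) \<simeq> a ^ j" using eqv_power[OF fermat_q, of a j] by (simp add: power_mult)
    qed
    also have "\<dots> = poly (RR z J \<mu> s) a"
      by (simp add: RR_def poly_sum poly_monom algebra_simps)
    finally show ?thesis using poly_in_I[OF s(5)[OF \<mu>]] eqv_I by blast
  qed
  have "M * card A \<le> degree (PP J s)"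
  proof (rule multiplicity_bound[OF _ A M van r])
    show "PP J s \<notin> Ip" by (rule PP_nonzero[of s \<kappa> i0 j0 J]) (use s kap in auto)
  qed
  also have "\<dots> \<le> q * (J - 1) + (\<kappa> - 1) + n * D" unfolding PP_def
  proof (intro degree_sum_le)
    fix i j assume "j \<in> {..<J}"
    then have "j \<le> J - 1" by simp
    then have "degree (monom (1::'a) (q * j)) \<le> q * (J - 1)"
      using degree_monom_le[of "1::'a" "q * j"] mult_le_mono2[of j "J - 1" q] by linarith
    moreover have "degree (s i j) \<le> \<kappa> - 1" using s(1)[of i j] by linarith
    moreover have "degree (g i) \<le> n * D"
      using degree_power_le[of f1 n] degree_power_le[of f2 n] D mult_le_mono2[OF D(1), of n] mult_le_mono2[OF D(2), of n]
      by (auto simp: g_def mult.commute intro: le_trans)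
    ultimately show "degree (monom 1 (q * j) * (s i j * g i)) \<le> q * (J - 1) + (\<kappa> - 1) + n * D"
      using degree_mult_le[of "monom 1 (q * j)" "s i j * g i"] degree_mult_le[of "s i j" "g i"] by linarith
  qed auto
  finally show ?thesis .
qed

corollary stepanov_bound_sqrt:
  assumes A: "incong A" and M: "M \<le> p" "M\<^sup>2 \<le> q" "M \<ge> 30" and k6: "k \<le> 6"
    and r: "\<And>a. a \<in> A \<Longrightarrow> poly r a \<notin> I"
    and f1: "\<And>a. a \<in> A \<Longrightarrow> poly f1 a ^ n \<simeq> \<zeta>"
    and D: "degree f1 \<le> D" "degree f2 \<le> D"
  shows "6 * M * card A \<le> q * (2 * M + 3 * k + 1 + 2 * D)"
proof -
  \<comment> \<open>This is \<open>(2 * M + 3 * k) / 6\<close> rounded up. With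
    \<open>\<kappa>\<close> as large as \<open>PP_nonzero\<close> allows, about
    \<open>q / 3\<close>, and \<open>M^2\<close> at most \<open>q\<close>, the conditions number
    about \<open>M * \<kappa>\<close> plus \<open>(k - 1) * q / 2\<close>, and
    \<open>3 * J * \<kappa>\<close> exceeds this.\<close>
  define J where "J = (2 * M + 3 * k + 5) div 6"
  define \<kappa> where "\<kappa> = n + 1 - k"
  have J: "2 * M + 3 * k \<le> 6 * J" "6 * J \<le> 2 * M + 3 * k + 5" unfolding J_def by auto
  have q900: "q \<ge> 900"
  proof -
    have "30\<^sup>2 \<le> M\<^sup>2" using M(3) by (rule power_mono) simp
    then show ?thesis using M(2) by simp
  qed
  then have nk: "n + 1 > k" using qn k6 by linarith
  have kap: "3 * \<kappa> + 3 * k = q + 2" "\<kappa> > 0" "\<kappa> + k \<le> n + 1" using nk qn unfolding \<kappa>_def by auto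
  have J0: "J > 0" using J M(3) by linarith
  have sum_eq: "2 * (\<Sum>\<mu><m. J + \<kappa> - 1 + \<mu> * (k - 1)) = 2 * m * (J + \<kappa> - 1) + (k - 1) * (m * (m - 1))" for m
    by (rule double_sum_arith)
  have "2 * M * (J + \<kappa> - 1) + (k - 1) * (M * (M - 1)) < 6 * J * \<kappa>"
  proof -
    have MM: "int M * int M \<le> int q" using M(2) by (simp add: power2_eq_square flip: of_nat_mult)
    have a: "(2 * int M + 3 * int k) * int \<kappa> \<le> 6 * int J * int \<kappa>"
      using J(1) by (intro mult_right_mono) auto
    have b: "6 * int J * int M \<le> (2 * int M + 3 * int k + 5) * int M"
      using J(2) by (intro mult_right_mono) auto
    have c': "int k * (3 * int \<kappa> + 3 * int k) = int k * (int q + 2)" using kap(1)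
      by (metis of_nat_add of_nat_mult of_nat_numeral)
    have d: "int k * (int M * int M) \<le> int k * int q" using MM by (intro mult_left_mono) auto
    have e: "int M * int M \<ge> 30 * int M" using M(3) by (intro mult_right_mono) auto
    have f: "int k * int k \<le> 36" using k6 mult_mono[of "int k" 6 "int k" 6] by simp
    have "2 * int M * (int J + int \<kappa> - 1) + (int k - 1) * (int M * (int M - 1)) < 6 * int J * int \<kappa>"
      using a b c' d e f M(3) k_pos by (simp only: algebra_simps)
    moreover have "int (J + \<kappa> - 1) = int J + int \<kappa> - 1" "int (k - 1) = int k - 1" "int (M - 1) = int M - 1"
      using J0 k_pos M(3) by (auto simp: of_nat_diff)
    ultimately have "int (2 * M * (J + \<kappa> - 1) + (k - 1) * (M * (M - 1))) < int (6 * J * \<kappa>)"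
      by (simp only: of_nat_add of_nat_mult of_nat_numeral)
    then show ?thesis by (simp only: of_nat_less_iff)
  qed
  then have "(\<Sum>\<mu><M. J + \<kappa> - 1 + \<mu> * (k - 1)) < 3 * J * \<kappa>" using sum_eq[of M] by linarith
  then have "M * card A \<le> q * (J - 1) + (\<kappa> - 1) + n * D"
    by (intro stepanov_bound[OF A M(1) kap(2,3) _ r f1 D])
  then have "6 * (M * card A) \<le> q * (6 * (J - 1)) + 6 * (\<kappa> - 1) + 6 * n * D" by linarith
  also have "q * (6 * (J - 1)) \<le> q * (2 * M + 3 * k - 1)" using J by (intro mult_le_mono2) linarith
  also have "6 * (\<kappa> - 1) \<le> 2 * q" using kap by linarith
  also have "6 * n * D \<le> 2 * q * D" using qn by (intro mult_right_mono) auto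
  finally have "6 * (M * card A) \<le> q * (2 * M + 3 * k - 1) + 2 * q + 2 * q * D" by simp
  also have "\<dots> = q * (2 * M + 3 * k + 1 + 2 * D)"
  proof -
    have "q * (X - 1) + 2 * q + 2 * q * D = q * (X + 1 + 2 * D)" if "X > 0" for X
      using that by (cases X) (auto simp: algebra_simps)
    from this[of "2 * M + 3 * k"] show ?thesis using k_pos by simp
  qed
  finally show ?thesis by (simp add: mult.assoc)
qed

end

section \<open>Cubic residue classes\<close>

locale cubic_field = residue_field I V p q
  for I :: "'a::comm_ring_1 set" and V :: "'a set" and p q :: nat +
  fixes n :: nat and w :: 'a
  assumes q_eq: "q = 3 * n + 1" and even_n: "even n" and w_root: "w\<^sup>2 + w + 1 \<in> I"
begin

lemma w_cube: "w ^ 3 \<simeq> 1"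
proof -
  have "w ^ 3 - 1 = (w - 1) * (w\<^sup>2 + w + 1)" by (simp add: algebra_simps power2_eq_square power3_eq_cube)
  then show ?thesis unfolding eqv_def using I_mult[OF w_root] by metis
qed

lemma w_notin_I: "w \<notin> I"
proof
  assume w: "w \<in> I"
  have "1 = (w\<^sup>2 + w + 1) - (w + 1) * w" by (simp add: algebra_simps power2_eq_square)
  then show False using I_diff[OF w_root I_mult[OF w]] one_notin_I by metis
qed

lemma p_not_3: "p \<noteq> 3"
  using p_dvd_q q_eq by (metis dvd_add_right_iff dvd_triv_left nat_dvd_1_iff_1 numeral_eq_one_iff semiring_norm(86))

lemma p_not_2: "p \<noteq> 2"
  using p_dvd_q q_eq even_n by auto

lemma two_notin_I: "2 \<notin> I" and three_notin_I: "3 \<notin> I"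
proof -
  have "\<not> p dvd 2" using p_not_2 prime_p by (metis primes_dvd_imp_eq two_is_prime_nat)
  then show "2 \<notin> I" using of_nat_in_I_iff[of 2] by simp
  have "prime (3::nat)" by simp
  then have "\<not> p dvd 3" using p_not_3 prime_p primes_dvd_imp_eq by blast
  then show "3 \<notin> I" using of_nat_in_I_iff[of 3] by simp
qed

lemma w_minus_one: "w - 1 \<notin> I"
proof
  assume a: "w - 1 \<in> I"
  have "3 = (w\<^sup>2 + w + 1) - (w + 2) * (w - 1)" by (simp add: algebra_simps power2_eq_square)
  then show False using I_diff[OF w_root I_mult[OF a]] three_notin_I by metis
qed

lemma cube_root_cases: "x ^ 3 \<simeq> 1 \<Longrightarrow> x \<simeq> 1 \<or> x \<simeq> w \<or> x \<simeq> w\<^sup>2"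
proof -
  assume x: "x ^ 3 \<simeq> 1"
  have "(x - 1) * (x - w) * (x - w\<^sup>2)
      = (x ^ 3 - 1) + (1 - w ^ 3) + (x * w - x\<^sup>2) * (w\<^sup>2 + w + 1)"
    by (simp add: algebra_simps power2_eq_square power3_eq_cube)
  moreover have "1 - w ^ 3 \<in> I" using eqv_sym[OF w_cube] by (simp add: eqv_def)
  ultimately have "(x - 1) * (x - w) * (x - w\<^sup>2) \<in> I"
    using I_add[OF I_add[OF x[unfolded eqv_def]] I_mult[OF w_root]] by metis
  then show ?thesis using I_prime by (auto simp: eqv_def)
qed

lemma w_sq_minus_one: "w\<^sup>2 - 1 \<notin> I"
proof
  assume "w\<^sup>2 - 1 \<in> I"
  then have "(w - 1) * (w + 1) \<in> I" by (simp add: algebra_simps power2_eq_square)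
  then have "w + 1 \<in> I" using I_prime w_minus_one by blast
  then have "(w\<^sup>2 + w + 1) - (w + 1) \<in> I" using I_diff w_root by blast
  then show False using w_notin_I I_power_iff[of w 2] by simp
qed

lemma w_power_mod: "w ^ j \<simeq> w ^ (j mod 3)"
proof -
  have "w ^ j = (w ^ 3) ^ (j div 3) * w ^ (j mod 3)"
    by (simp only: power_mult [symmetric] power_add [symmetric]) simp
  also have "\<dots> \<simeq> 1 ^ (j div 3) * w ^ (j mod 3)" by (intro eqv_mult eqv_power w_cube) auto
  finally show ?thesis by simp
qed

lemma w_power_eqv_iff: "w ^ i \<simeq> w ^ j \<longleftrightarrow> i mod 3 = j mod 3"
proof
  assume "i mod 3 = j mod 3"
  then have "w ^ (i mod 3) \<simeq> w ^ j" using eqv_sym[OF w_power_mod[of j]] by simp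
  then show "w ^ i \<simeq> w ^ j" using w_power_mod[of i] eqv_trans by blast
next
  have *: "\<not> w ^ a \<simeq> w ^ b" if "a < b" "b < 3" for a b
  proof
    assume "w ^ a \<simeq> w ^ b"
    then have "w ^ a * w ^ (b - a) \<simeq> w ^ a * 1"
      using that eqv_sym by (simp add: power_add [symmetric])
    then have "w ^ (b - a) \<simeq> 1" using eqv_mult_cancel I_power_iff w_notin_I by blast
    moreover have "b - a = 1 \<or> b - a = 2" using that by linarith
    ultimately show False using w_minus_one w_sq_minus_one by (auto simp: eqv_def)
  qed
  assume "w ^ i \<simeq> w ^ j"
  then have "w ^ (i mod 3) \<simeq> w ^ (j mod 3)"
    using w_power_mod[of i] w_power_mod[of j] eqv_sym eqv_trans by blast
  then show "i mod 3 = j mod 3"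
    using *[of "i mod 3" "j mod 3"] *[of "j mod 3" "i mod 3"] eqv_sym
    by (metis linorder_neqE_nat mod_less_divisor zero_less_numeral)
qed

text \<open>The cubic residue character written additively, as an exponent of \<open>w\<close>. Its
  value at elements of \<open>I\<close> is arbitrary.\<close>

definition cls :: "'a \<Rightarrow> nat" where "cls x = (SOME j. j < 3 \<and> x ^ n \<simeq> w ^ j)"

lemma cls: assumes "x \<notin> I" shows "cls x < 3" "x ^ n \<simeq> w ^ cls x"
proof -
  have "(x ^ n) ^ 3 \<simeq> 1" using fermat[OF assms] q_eq by (simp add: power_mult [symmetric] mult.commute)
  then have "x ^ n \<simeq> 1 \<or> x ^ n \<simeq> w \<or> x ^ n \<simeq> w\<^sup>2" by (rule cube_root_cases)
  then have "\<exists>j. j < 3 \<and> x ^ n \<simeq> w ^ j"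
  proof (elim disjE)
    assume "x ^ n \<simeq> 1" then show ?thesis by (intro exI[of _ 0]) auto
  next
    assume "x ^ n \<simeq> w" then show ?thesis by (intro exI[of _ 1]) auto
  next
    assume "x ^ n \<simeq> w\<^sup>2" then show ?thesis by (intro exI[of _ 2]) auto
  qed
  then have "cls x < 3 \<and> x ^ n \<simeq> w ^ cls x" unfolding cls_def by (rule someI_ex)
  then show "cls x < 3" "x ^ n \<simeq> w ^ cls x" by auto
qed

lemma cls_eq_iff_power: "x \<notin> I \<Longrightarrow> cls x = j mod 3 \<longleftrightarrow> x ^ n \<simeq> w ^ j"
proof -
  assume x: "x \<notin> I"
  have "cls x = j mod 3 \<longleftrightarrow> w ^ cls x \<simeq> w ^ j" using w_power_eqv_iff[of "cls x" j] cls(1)[OF x] by simp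
  also have "\<dots> \<longleftrightarrow> x ^ n \<simeq> w ^ j" using cls(2)[OF x] eqv_trans eqv_sym by blast
  finally show ?thesis .
qed

lemma cls_eqv: "x \<simeq> y \<Longrightarrow> x \<notin> I \<Longrightarrow> cls x = cls y"
proof -
  assume a: "x \<simeq> y" "x \<notin> I"
  then have y: "y \<notin> I" using eqv_I by blast
  have "x ^ n \<simeq> w ^ cls y" using eqv_trans[OF eqv_power[OF a(1)] cls(2)[OF y]] .
  then show ?thesis using cls_eq_iff_power[OF a(2), of "cls y"] cls(1)[OF y] by simp
qed

lemma cls_mult: "x \<notin> I \<Longrightarrow> y \<notin> I \<Longrightarrow> cls (x * y) = (cls x + cls y) mod 3"
  using eqv_mult[OF cls(2) cls(2), of x y] cls_eq_iff_power[of "x * y" "cls x + cls y"]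
  by (simp add: I_mult_iff power_mult_distrib power_add)

lemma cls_one: "cls 1 = 0"
  using cls_eq_iff_power[of 1 0] one_notin_I by simp

text \<open>Evenness of \<open>n\<close> makes \<open>- 1\<close> a cube, so the class of a
  difference does not depend on the order of the two points.\<close>

lemma cls_minus: "x \<notin> I \<Longrightarrow> cls (- x) = cls x"
proof -
  assume x: "x \<notin> I"
  have "(- x) ^ n = x ^ n" using even_n by (simp add: power_minus_even)
  then show ?thesis using cls(1,2)[OF x] cls_eq_iff_power[of "- x" "cls x"] x by simp
qed

lemma cls_power: "x \<notin> I \<Longrightarrow> cls (x ^ k) = (k * cls x) mod 3"
proof (induction k)
  case (Suc k)
  then show ?case using cls_mult[of x "x ^ k"] by (simp add: I_power_iff mod_simps)
qed (simp add: cls_one)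

text \<open>Hence \<open>w\<close> is a cube exactly if 3 divides \<open>n\<close>, that is, if
  \<open>q\<close> is 1 modulo 9.\<close>

lemma cls_w: "cls w = n mod 3"
  using cls_eq_iff_power[OF w_notin_I, of n] by simp

definition rainbow :: "'a \<Rightarrow> 'a \<Rightarrow> 'a \<Rightarrow> bool" where
  "rainbow x y z \<longleftrightarrow> x \<notin> I \<and> y \<notin> I \<and> z \<notin> I \<and> cls x \<noteq> cls y \<and> cls y \<noteq> cls z \<and> cls x \<noteq> cls z"

lemma rainbow_eqv: "rainbow x y z \<Longrightarrow> x \<simeq> x' \<Longrightarrow> y \<simeq> y' \<Longrightarrow> z \<simeq> z' \<Longrightarrow> rainbow x' y' z'"
  unfolding rainbow_def using cls_eqv[of x x'] cls_eqv[of y y'] cls_eqv[of z z'] eqv_I[of x x'] eqv_I[of y y'] eqv_I[of z z'] by simp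

lemma rainbow_rotate: "rainbow x y z \<Longrightarrow> rainbow y z x"
  unfolding rainbow_def by auto

lemma rainbow_swap: "rainbow x y z \<Longrightarrow> rainbow y x z"
  unfolding rainbow_def by auto

lemma cls_mult_cancel: "a \<notin> I \<Longrightarrow> x \<notin> I \<Longrightarrow> y \<notin> I \<Longrightarrow> cls (a * x) = cls (a * y) \<longleftrightarrow> cls x = cls y"
proof -
  have "(c + d) mod 3 = (c + e) mod 3 \<longleftrightarrow> d = e" if "d < 3" "e < 3" for c d e :: nat
    using that cong_add_lcancel_nat[of c d e 3] by (simp add: cong_def)
  then show "a \<notin> I \<Longrightarrow> x \<notin> I \<Longrightarrow> y \<notin> I \<Longrightarrow> cls (a * x) = cls (a * y) \<longleftrightarrow> cls x = cls y"
    using cls(1) by (simp add: cls_mult)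
qed

lemma rainbow_mult_iff: "a \<notin> I \<Longrightarrow> rainbow (a * x) (a * y) (a * z) \<longleftrightarrow> rainbow x y z"
  unfolding rainbow_def I_mult_iff
  using cls_mult_cancel[of a x y] cls_mult_cancel[of a y z] cls_mult_cancel[of a x z] by blast

lemma rainbow_mult: "a \<notin> I \<Longrightarrow> rainbow x y z \<Longrightarrow> rainbow (a * x) (a * y) (a * z)"
  by (simp add: rainbow_mult_iff)

lemma rainbow_minus: "rainbow x y z \<longleftrightarrow> rainbow (- x) y z"
  unfolding rainbow_def using cls_minus by auto

text \<open>This form mentions neither \<open>w\<close> nor \<open>cls\<close>, so it can be decided
  by computing powers.\<close>

lemma rainbow_iff_powers:
  "rainbow x y z \<longleftrightarrow> x \<notin> I \<and> y \<notin> I \<and> z \<notin> I \<and>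
     \<not> x ^ n \<simeq> y ^ n \<and> \<not> y ^ n \<simeq> z ^ n \<and> \<not> x ^ n \<simeq> z ^ n"
proof -
  have "cls x = cls y \<longleftrightarrow> x ^ n \<simeq> y ^ n" if "x \<notin> I" "y \<notin> I" for x y
  proof -
    have "cls x = cls y \<longleftrightarrow> x ^ n \<simeq> w ^ cls y"
      using cls_eq_iff_power[OF that(1), of "cls y"] cls(1)[OF that(2)] by simp
    also have "\<dots> \<longleftrightarrow> x ^ n \<simeq> y ^ n"
      using cls(2)[OF that(2)] eqv_trans eqv_sym by blast
    finally show ?thesis .
  qed
  then show ?thesis unfolding rainbow_def by blast
qed

end

section \<open>Existence of a parameter by weighted counting\<close>

text \<open>Meant for the classes of \<open>1 - t w^j\<close> and \<open>1 + t w^j\<close>: the sums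
  are then classes of \<open>1 - t^2 w^(2 j)\<close>, and the disjunction allows \<open>t\<close> or
  \<open>- t\<close> as the parameter.\<close>

definition good_pattern :: "nat \<Rightarrow> nat \<Rightarrow> nat \<Rightarrow> nat \<Rightarrow> nat \<Rightarrow> nat \<Rightarrow> bool" where
  "good_pattern a0 a1 a2 b0 b1 b2 \<longleftrightarrow>
     (distinct [a0, a1, a2] \<or> distinct [b0, b1, b2]) \<and>
     distinct [(a0 + b0) mod 3, (a1 + b1) mod 3, (a2 + b2) mod 3]"

text \<open>A linear certificate. For independent uniform classes the mean is
  \<open>2 * 4 * (2/3) + 9 * (1/3) = 25/3\<close>, below the value 9 that every bad pattern attains.
  The first four terms exploit that three residues modulo 3 have sum 0 only if they are all equal or
  all distinct; the other nine compare a difference among the first three classes with one among the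
  last three, \<open>2\<close> standing for \<open>- 1\<close>.\<close>

definition pattern_weight :: "nat \<Rightarrow> nat \<Rightarrow> nat \<Rightarrow> nat \<Rightarrow> nat \<Rightarrow> nat \<Rightarrow> nat" where
  "pattern_weight a0 a1 a2 b0 b1 b2 =
     2 * ((if (a0 + a1 + a2) mod 3 = 0 then 0 else 1) + (if (b0 + b1 + b2) mod 3 = 0 then 0 else 1)
       + (if (a0 + a1 + a2 + b0 + b1 + b2) mod 3 = 0 then 0 else 1)
       + (if (a0 + a1 + a2 + 2 * b0 + 2 * b1 + 2 * b2) mod 3 = 0 then 0 else 1))
     + sum_list (map (\<lambda>(x, y). sum_list (map (\<lambda>(u, v). if (x + 2 * y + u + 2 * v) mod 3 = 0 then 1 else 0)
          [(b0, b1), (b1, b2), (b2, b0)])) [(a0, a1), (a1, a2), (a2, a0)])"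

lemma pattern_weight_ge:
  assumes "a0 < 3" "a1 < 3" "a2 < 3" "b0 < 3" "b1 < 3" "b2 < 3" "\<not> good_pattern a0 a1 a2 b0 b1 b2"
  shows "9 \<le> pattern_weight a0 a1 a2 b0 b1 b2"
proof -
  have "\<forall>a0\<in>set [0, 1, 2]. \<forall>a1\<in>set [0, 1, 2]. \<forall>a2\<in>set [0, 1, 2]. \<forall>b0\<in>set [0, 1, 2]. \<forall>b1\<in>set [0, 1, 2].
      \<forall>b2\<in>set [0, 1, 2]. good_pattern a0 a1 a2 b0 b1 b2 \<or> 9 \<le> pattern_weight a0 a1 a2 b0 b1 b2"
    by code_simp
  moreover have "x \<in> set [0, 1, 2]" if "x < 3" for x :: nat using that by auto
  ultimately show ?thesis using assms by blast
qed

locale cubic_field_idom = cubic_field I V p q n w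
  for I :: "'a::idom set" and V :: "'a set" and p q n :: nat and w :: 'a
begin

lemma cls_prod: fixes k :: nat shows "(\<And>i. i < k \<Longrightarrow> x i \<notin> I) \<Longrightarrow>
    (\<Prod>i<k. x i ^ e i) \<notin> I \<and> cls (\<Prod>i<k. x i ^ e i) = (\<Sum>i<k. e i * cls (x i)) mod 3"
proof (induction k)
  case (Suc k)
  then show ?case using cls_mult[of "\<Prod>i<k. x i ^ e i" "x k ^ e k"] cls_power[of "x k" "e k"]
    by (simp add: I_mult_iff I_power_iff mod_simps)
qed (simp add: cls_one one_notin_I)

definition pattern_set :: "'a list \<Rightarrow> nat list \<Rightarrow> nat \<Rightarrow> 'a set" where
  "pattern_set cs es j = {t \<in> V. (\<forall>c\<in>set cs. 1 - t * c \<notin> I) \<and>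
     (\<Sum>i<length cs. es ! i * cls (1 - t * cs ! i)) mod 3 = j}"

text \<open>Membership in the set says that the product of the linear factors with exponents
  \<open>es\<close> has \<open>n\<close>-th power \<open>w ^ j\<close>, which is the situation of
  \<open>stepanov_bound_sqrt\<close>; \<open>D\<close> bounds the degrees of that product and of its
  complement.\<close>

lemma pattern_bound:
  assumes len: "length es = length cs" "0 < length cs" "length cs \<le> 6" and es: "set es \<subseteq> {1, 2}"
    and cs: "\<And>c. c \<in> set cs \<Longrightarrow> c \<notin> I"
    and inc: "\<And>i j. i < length cs \<Longrightarrow> j < length cs \<Longrightarrow> i \<noteq> j \<Longrightarrow> cs ! i - cs ! j \<notin> I"
    and M: "M \<le> p" "M\<^sup>2 \<le> q" "M \<ge> 30"
    and D: "sum_list es \<le> D" "3 * length cs - sum_list es \<le> D"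
  shows "6 * M * card (pattern_set cs es j) \<le> q * (2 * M + 3 * length cs + 1 + 2 * D)"
proof -
  let ?k = "length cs" and ?A = "pattern_set cs es j"
  have e12: "es ! i \<in> {1, 2}" if "i < ?k" for i
    using es len(1) that by (metis nth_mem subsetD)
  interpret S: stepanov I V p q "\<Prod>i<?k. [:1, - (cs ! i):]" ?k n "\<lambda>i. cs ! i" "\<lambda>i. es ! i"
    by unfold_locales (use len cs inc e12 q_eq in auto)
  have inA: "1 - t * cs ! i \<notin> I" if "t \<in> ?A" "i < ?k" for t i
    using that by (auto simp: pattern_set_def)
  have sum_es: "(\<Sum>i<?k. es ! i) = sum_list es" using len(1) by (simp add: sum_list_sum_nth atLeast0LessThan)
  have degp: "degree (\<Prod>i<?k. [:1, - (cs ! i):] ^ \<beta> i) \<le> (\<Sum>i<?k. \<beta> i)" for \<beta>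
  proof -
    have "degree (\<Prod>i<?k. [:1, - (cs ! i):] ^ \<beta> i) \<le> (\<Sum>i<?k. degree ([:1, - (cs ! i):] ^ \<beta> i))"
      using degree_prod_sum_le[of "{..<?k}" "\<lambda>i. [:1, - (cs ! i):] ^ \<beta> i"] by (simp add: o_def)
    also have "\<dots> \<le> (\<Sum>i<?k. \<beta> i)"
    proof (intro sum_mono)
      fix i
      have "degree [:1, - (cs ! i):] \<le> 1" by simp
      then show "degree ([:1, - (cs ! i):] ^ \<beta> i) \<le> \<beta> i"
        using degree_power_le[of "[:1, - (cs ! i):]" "\<beta> i"] mult_le_mono1[of "degree [:1, - (cs ! i):]" 1 "\<beta> i"]
        by linarith
    qed
    finally show ?thesis .
  qed
  have "(\<Sum>i<?k. 3 - es ! i) + (\<Sum>i<?k. es ! i) = (\<Sum>i<?k. 3)"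
    unfolding sum.distrib [symmetric] by (intro sum.cong) (use e12 in fastforce)+
  then have sum_es2: "(\<Sum>i<?k. 3 - es ! i) = 3 * ?k - sum_list es" using sum_es by simp
  show ?thesis
  proof (rule S.stepanov_bound_sqrt[where \<zeta> = "w ^ j"])
    have "finite ?A" using finite_V by (simp add: pattern_set_def)
    then show "incong ?A" unfolding incong_def using V_unique by (auto simp: pattern_set_def)
    show "poly (\<Prod>i<?k. [:1, - (cs ! i):]) t \<notin> I" if "t \<in> ?A" for t
      by (simp only: poly_prod) (intro prod_notin_I, use inA[OF that] in \<open>auto simp: algebra_simps\<close>)
    show "poly S.f1 t ^ n \<simeq> w ^ j" if t: "t \<in> ?A" for t
    proof -
      have "poly S.f1 t = (\<Prod>i<?k. (1 - t * cs ! i) ^ (es ! i))"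
        by (simp add: S.f1_def poly_prod algebra_simps)
      moreover have "(\<Prod>i<?k. (1 - t * cs ! i) ^ (es ! i)) \<notin> I \<and>
          cls (\<Prod>i<?k. (1 - t * cs ! i) ^ (es ! i)) = (\<Sum>i<?k. es ! i * cls (1 - t * cs ! i)) mod 3"
        using cls_prod[of ?k "\<lambda>i. 1 - t * cs ! i" "\<lambda>i. es ! i"] inA[OF t] by blast
      moreover have "(\<Sum>i<?k. es ! i * cls (1 - t * cs ! i)) mod 3 = j" using t by (simp add: pattern_set_def)
      ultimately have f: "poly S.f1 t \<notin> I" "cls (poly S.f1 t) = j" by auto
      then show ?thesis using cls(2)[OF f(1)] by simp
    qed
    show "degree S.f1 \<le> D" unfolding S.f1_def using degp[of "\<lambda>i. es ! i"] sum_es D(1) by linarith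
    show "degree S.f2 \<le> D" unfolding S.f2_def using degp[of "\<lambda>i. 3 - es ! i"] sum_es2 D(2) by linarith
  qed (use M len in auto)
qed

lemma sum_indicator_le: "finite T \<Longrightarrow> finite S \<Longrightarrow> (\<And>t. t \<in> T \<Longrightarrow> P t \<Longrightarrow> t \<in> S) \<Longrightarrow>
    (\<Sum>t\<in>T. if P t then 1 else 0) \<le> card S" for T S :: "'b set"
  by (simp add: sum.If_cases) (metis (no_types, lifting) Int_iff card_mono mem_Collect_eq subsetI)

text \<open>If every admissible \<open>t\<close> had a bad pattern, the total weight would be at
  least \<open>9 * card T\<close>. But each indicator sums to at most \<open>q / 3\<close> plus an
  error of order \<open>q / M\<close>, and together these stay near
  \<open>25 * q / 3\<close>.\<close>

lemma exists_good_pattern: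
  assumes M: "M \<le> p" "M\<^sup>2 \<le> q" "M \<ge> 181"
  shows "\<exists>t\<in>V. (\<forall>j<3. 1 - t * w ^ j \<notin> I \<and> 1 + t * w ^ j \<notin> I) \<and>
    good_pattern (cls (1 - t)) (cls (1 - t * w)) (cls (1 - t * w\<^sup>2))
      (cls (1 + t)) (cls (1 + t * w)) (cls (1 + t * w\<^sup>2))"
proof (rule ccontr)
  assume neg: "\<not> ?thesis"
  define a where "a j t = cls (1 - t * w ^ j)" for j t
  define b where "b j t = cls (1 - t * (- (w ^ j)))" for j t
  define P where "P = [1, w, w\<^sup>2, - 1, - w, - (w\<^sup>2)]"
  define T where "T = {t \<in> V. \<forall>c\<in>set P. 1 - t * c \<notin> I}"
  have finT: "finite T" using finite_V by (simp add: T_def)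
  have P_notin: "c \<notin> I" if "c \<in> set P" for c
    using that w_notin_I one_notin_I by (auto simp: P_def I_power_iff)
  have one_minus: "1 - w \<notin> I" "1 - w\<^sup>2 \<notin> I" "w - w\<^sup>2 \<notin> I" "w\<^sup>2 - w \<notin> I"
    using w_minus_one w_sq_minus_one w_notin_I I_neg_iff[of "w - 1"] I_neg_iff[of "w\<^sup>2 - 1"]
      I_mult_iff[of w "1 - w"] I_mult_iff[of w "w - 1"] by (auto simp: algebra_simps power2_eq_square)
  have one_plus: "1 + w \<notin> I"
    using w_sq_minus_one I_mult2[of "1 + w" "w - 1"] by (auto simp: algebra_simps power2_eq_square)
  have one_plus2: "1 + w\<^sup>2 \<notin> I"
  proof
    assume "1 + w\<^sup>2 \<in> I"
    then have "(w\<^sup>2 + w + 1) - (1 + w\<^sup>2) \<in> I" using w_root I_diff by blast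
    then show False using w_notin_I by simp
  qed
  have one_plus3: "w + w\<^sup>2 \<notin> I" using one_plus w_notin_I I_mult_iff[of w "1 + w"] by (simp add: algebra_simps power2_eq_square)
  have two: "1 + 1 \<notin> I" "w + w \<notin> I" "w\<^sup>2 + w\<^sup>2 \<notin> I"
    using two_notin_I w_notin_I by (simp_all add: mult_2 [symmetric] I_mult_iff I_power_iff)
  have P_inc: "P ! i - P ! j \<notin> I" if "i < 6" "j < 6" "i \<noteq> j" for i j
  proof -
    have *: "x - y \<notin> I \<longleftrightarrow> y - x \<notin> I" for x y using I_neg_iff[of "x - y"] by simp
    have "\<forall>i\<in>set [0..<6]. \<forall>j\<in>set [0..<6]. i < j \<longrightarrow> P ! i - P ! j \<notin> I"
      using one_minus one_plus one_plus2 one_plus3 two w_minus_one w_sq_minus_one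
      by (simp add: P_def upt_rec[of _ 6] add.commute)
    then have "i < j \<longrightarrow> P ! i - P ! j \<notin> I" "j < i \<longrightarrow> P ! j - P ! i \<notin> I" using that by auto
    then show ?thesis using * that(3) by (metis linorder_neqE_nat)
  qed
  have inc: "map ((!) P) is ! i - map ((!) P) is ! j \<notin> I"
    if "distinct is" "set is \<subseteq> {..<6}" "i < length is" "j < length is" "i \<noteq> j" for "is" i j
  proof -
    have "is ! i < 6" "is ! j < 6" using that nth_mem by blast+
    moreover have "is ! i \<noteq> is ! j" using that by (simp add: nth_eq_iff_index_eq)
    ultimately show ?thesis using P_inc that by simp
  qed
  have bound: "6 * M * card (pattern_set (map ((!) P) is) es j) \<le> q * (2 * M + 3 * length is + 1 + 2 * D)"
    if "distinct is" "set is \<subseteq> {..<6}" "length es = length is" "0 < length is" "set es \<subseteq> {1, 2}"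
      "sum_list es \<le> D" "3 * length is - sum_list es \<le> D" for "is" es j D
  proof -
    have P6: "P ! i \<in> set P" if "i < 6" for i using that by (intro nth_mem) (simp add: P_def)
    have "length is \<le> 6" using that(1,2) by (metis card_lessThan card_mono distinct_card finite_lessThan)
    moreover have "c \<notin> I" if "c \<in> set (map ((!) P) is)" for c
      using that \<open>set is \<subseteq> {..<6}\<close> P6 P_notin by auto
    ultimately show ?thesis
      using pattern_bound[of es "map ((!) P) is" M D j] inc[OF that(1,2)] that M by simp
  qed
  have Tset: "t \<in> pattern_set (map ((!) P) is) es j"
    if "t \<in> T" "set is \<subseteq> {..<6}" "length es = length is"
      "sum_list (map2 (\<lambda>e i. e * cls (1 - t * P ! i)) es is) mod 3 = j" for t "is" es j
  proof -
    have "sum_list (map2 (\<lambda>e i. e * cls (1 - t * P ! i)) es is)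
        = (\<Sum>i<length is. es ! i * cls (1 - t * P ! (is ! i)))"
      using that(3) by (simp add: sum_list_sum_nth atLeast0LessThan)
    moreover have "P ! i \<in> set P" if "i < 6" for i using that by (intro nth_mem) (simp add: P_def)
    ultimately show ?thesis using that by (auto simp: T_def pattern_set_def)
  qed
  have finP: "finite (pattern_set cs es j)" for cs es j using finite_V by (simp add: pattern_set_def)
  let ?N = "\<lambda>is es j. card (pattern_set (map ((!) P) is) es j)"
  have ab: "cls (1 - t * P ! 0) = a 0 t" "cls (1 - t * P ! Suc 0) = a 1 t" "cls (1 - t * P ! 1) = a 1 t" "cls (1 - t * P ! 2) = a 2 t"
    "cls (1 - t * P ! 3) = b 0 t" "cls (1 - t * P ! 4) = b 1 t" "cls (1 - t * P ! 5) = b 2 t" for t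
    by (simp_all add: a_def b_def P_def)
  \<comment> \<open>Only upper bounds for fibres are available, so a nonzero value is counted as the
    two fibres 1 and 2.\<close>
  have nz: "(if x mod 3 = 0 then 0 else 1) = (if x mod 3 = 1 then 1 else 0) + (if x mod 3 = 2 then 1 else (0::nat))" for x :: nat
    by (simp; presburger)
  let ?W = "\<lambda>t. pattern_weight (a 0 t) (a 1 t) (a 2 t) (b 0 t) (b 1 t) (b 2 t)"
  have W9: "9 \<le> ?W t" if t: "t \<in> T" for t
  proof (rule pattern_weight_ge)
    have "1 - t * w ^ j \<notin> I \<and> 1 + t * w ^ j \<notin> I" if "j < 3" for j
    proof -
      have "j = 0 \<or> j = 1 \<or> j = 2" using that by linarith
      then show ?thesis using t by (auto simp: T_def P_def)
    qed
    moreover have "t \<in> V" using t by (simp add: T_def)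
    ultimately have "\<not> good_pattern (cls (1 - t)) (cls (1 - t * w)) (cls (1 - t * w\<^sup>2))
      (cls (1 + t)) (cls (1 + t * w)) (cls (1 + t * w\<^sup>2))" using neg by blast
    then show "\<not> good_pattern (a 0 t) (a 1 t) (a 2 t) (b 0 t) (b 1 t) (b 2 t)"
      by (simp add: a_def b_def)
    have "cls (1 - t * P ! i) < 3" if "i < 6" for i
    proof (rule cls(1))
      have "P ! i \<in> set P" using that by (intro nth_mem) (simp add: P_def)
      then show "1 - t * P ! i \<notin> I" using t by (auto simp: T_def)
    qed
    from this[of 0] this[of 1] this[of 2] this[of 3] this[of 4] this[of 5]
    show "a 0 t < 3" "a 1 t < 3" "a 2 t < 3" "b 0 t < 3" "b 1 t < 3" "b 2 t < 3"
      by (simp_all only: ab)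
  qed
  let ?S1 = "\<lambda>j. ?N [0, 1, 2] [1, 1, 1] j" and ?S2 = "\<lambda>j. ?N [3, 4, 5] [1, 1, 1] j"
    and ?S3 = "\<lambda>j. ?N [0, 1, 2, 3, 4, 5] [1, 1, 1, 1, 1, 1] j"
    and ?S4 = "\<lambda>j. ?N [0, 1, 2, 3, 4, 5] [1, 1, 1, 2, 2, 2] j"
    and ?Q = "\<lambda>x y u v. ?N [x, y, u, v] [1, 2, 1, 2] 0"
  have s1: "(\<Sum>t\<in>T. if (a 0 t + a 1 t + a 2 t) mod 3 = j then 1 else 0) \<le> ?S1 j" for j
    by (intro sum_indicator_le finT finP Tset) (simp_all add: ab add.assoc)
  have s2: "(\<Sum>t\<in>T. if (b 0 t + b 1 t + b 2 t) mod 3 = j then 1 else 0) \<le> ?S2 j" for j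
    by (intro sum_indicator_le finT finP Tset) (simp_all add: ab add.assoc)
  have s3: "(\<Sum>t\<in>T. if (a 0 t + a 1 t + a 2 t + b 0 t + b 1 t + b 2 t) mod 3 = j then 1 else 0) \<le> ?S3 j" for j
    by (intro sum_indicator_le finT finP Tset) (simp_all add: ab add.assoc)
  have s4: "(\<Sum>t\<in>T. if (a 0 t + a 1 t + a 2 t + 2 * b 0 t + 2 * b 1 t + 2 * b 2 t) mod 3 = j then 1 else 0) \<le> ?S4 j" for j
    by (intro sum_indicator_le finT finP Tset) (simp_all add: ab add.assoc)
  have q03: "(\<Sum>t\<in>T. if (a 0 t + 2 * a 1 t + b 0 t + 2 * b 1 t) mod 3 = 0 then 1 else 0) \<le> ?Q 0 1 3 4"
    by (intro sum_indicator_le finT finP Tset) (simp_all add: ab add.assoc)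
  have q04: "(\<Sum>t\<in>T. if (a 0 t + 2 * a 1 t + b 1 t + 2 * b 2 t) mod 3 = 0 then 1 else 0) \<le> ?Q 0 1 4 5"
    by (intro sum_indicator_le finT finP Tset) (simp_all add: ab add.assoc)
  have q05: "(\<Sum>t\<in>T. if (a 0 t + 2 * a 1 t + b 2 t + 2 * b 0 t) mod 3 = 0 then 1 else 0) \<le> ?Q 0 1 5 3"
    by (intro sum_indicator_le finT finP Tset) (simp_all add: ab add.assoc)
  have q13: "(\<Sum>t\<in>T. if (a 1 t + 2 * a 2 t + b 0 t + 2 * b 1 t) mod 3 = 0 then 1 else 0) \<le> ?Q 1 2 3 4"
    by (intro sum_indicator_le finT finP Tset) (simp_all add: ab add.assoc)
  have q14: "(\<Sum>t\<in>T. if (a 1 t + 2 * a 2 t + b 1 t + 2 * b 2 t) mod 3 = 0 then 1 else 0) \<le> ?Q 1 2 4 5"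
    by (intro sum_indicator_le finT finP Tset) (simp_all add: ab add.assoc)
  have q15: "(\<Sum>t\<in>T. if (a 1 t + 2 * a 2 t + b 2 t + 2 * b 0 t) mod 3 = 0 then 1 else 0) \<le> ?Q 1 2 5 3"
    by (intro sum_indicator_le finT finP Tset) (simp_all add: ab add.assoc)
  have q23: "(\<Sum>t\<in>T. if (a 2 t + 2 * a 0 t + b 0 t + 2 * b 1 t) mod 3 = 0 then 1 else 0) \<le> ?Q 2 0 3 4"
    by (intro sum_indicator_le finT finP Tset) (simp_all add: ab add.assoc)
  have q24: "(\<Sum>t\<in>T. if (a 2 t + 2 * a 0 t + b 1 t + 2 * b 2 t) mod 3 = 0 then 1 else 0) \<le> ?Q 2 0 4 5"
    by (intro sum_indicator_le finT finP Tset) (simp_all add: ab add.assoc)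
  have q25: "(\<Sum>t\<in>T. if (a 2 t + 2 * a 0 t + b 2 t + 2 * b 0 t) mod 3 = 0 then 1 else 0) \<le> ?Q 2 0 5 3"
    by (intro sum_indicator_le finT finP Tset) (simp_all add: ab add.assoc)
  have "9 * card T = (\<Sum>t\<in>T. 9)" by simp
  also have "\<dots> \<le> (\<Sum>t\<in>T. ?W t)" by (intro sum_mono W9)
  also have "\<dots> \<le> 2 * (?S1 1 + ?S1 2 + ?S2 1 + ?S2 2 + ?S3 1 + ?S3 2 + ?S4 1 + ?S4 2)
      + (?Q 0 1 3 4 + ?Q 0 1 4 5 + ?Q 0 1 5 3 + ?Q 1 2 3 4 + ?Q 1 2 4 5 + ?Q 1 2 5 3 + ?Q 2 0 3 4 + ?Q 2 0 4 5 + ?Q 2 0 5 3)"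
    unfolding pattern_weight_def nz
    using s1[of 1] s1[of 2] s2[of 1] s2[of 2] s3[of 1] s3[of 2] s4[of 1] s4[of 2] q03 q04 q05 q13 q14 q15 q23 q24 q25
    by (simp add: sum.distrib sum_distrib_left [symmetric])
  finally have le: "9 * card T \<le> \<dots>" .
  \<comment> \<open>The last number is \<open>3 * length is + 1 + 2 * D\<close>, with
    \<open>D\<close> the larger of \<open>sum_list es\<close> and its complement: 6 for three
    factors, 12 or 9 for six, and 6 for the four factors treated below.\<close>
  have B1: "6 * M * ?S1 j \<le> q * (2 * M + 22)" "6 * M * ?S2 j \<le> q * (2 * M + 22)" for j
    using bound[of "[0, 1, 2]" "[1, 1, 1]" 6 j] bound[of "[3, 4, 5]" "[1, 1, 1]" 6 j] by (simp_all add: add.commute)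
  have B3: "6 * M * ?S3 j \<le> q * (2 * M + 43)" "6 * M * ?S4 j \<le> q * (2 * M + 37)" for j
    using bound[of "[0, 1, 2, 3, 4, 5]" "[1, 1, 1, 1, 1, 1]" 12 j]
      bound[of "[0, 1, 2, 3, 4, 5]" "[1, 1, 1, 2, 2, 2]" 9 j] by (simp_all add: add.commute)
  have BQ: "6 * M * ?Q x y u v \<le> q * (2 * M + 25)" if "distinct [x, y, u, v]" "set [x, y, u, v] \<subseteq> {..<6}" for x y u v
    using bound[of "[x, y, u, v]" "[1, 2, 1, 2]" 6 0] that by (simp add: add.commute)
  have "6 * M * (9 * card T) \<le> 6 * M * (2 * (?S1 1 + ?S1 2 + ?S2 1 + ?S2 2 + ?S3 1 + ?S3 2 + ?S4 1 + ?S4 2)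
      + (?Q 0 1 3 4 + ?Q 0 1 4 5 + ?Q 0 1 5 3 + ?Q 1 2 3 4 + ?Q 1 2 4 5 + ?Q 1 2 5 3 + ?Q 2 0 3 4 + ?Q 2 0 4 5 + ?Q 2 0 5 3))"
    using le by (rule mult_le_mono2)
  also have "\<dots> = 2 * (6 * M * ?S1 1 + 6 * M * ?S1 2 + 6 * M * ?S2 1 + 6 * M * ?S2 2
        + 6 * M * ?S3 1 + 6 * M * ?S3 2 + 6 * M * ?S4 1 + 6 * M * ?S4 2)
      + (6 * M * ?Q 0 1 3 4 + 6 * M * ?Q 0 1 4 5 + 6 * M * ?Q 0 1 5 3 + 6 * M * ?Q 1 2 3 4 + 6 * M * ?Q 1 2 4 5 + 6 * M * ?Q 1 2 5 3 + 6 * M * ?Q 2 0 3 4 + 6 * M * ?Q 2 0 4 5 + 6 * M * ?Q 2 0 5 3)"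
    by (simp only: distrib_left mult.left_commute mult.assoc)
  also have "\<dots> \<le> 2 * (4 * (q * (2 * M + 22)) + 2 * (q * (2 * M + 43)) + 2 * (q * (2 * M + 37))) + 9 * (q * (2 * M + 25))"
    using B1[of 1] B1[of 2] B3[of 1] B3[of 2] BQ[of 0 1 3 4] BQ[of 0 1 4 5] BQ[of 0 1 5 3] BQ[of 1 2 3 4] BQ[of 1 2 4 5] BQ[of 1 2 5 3] BQ[of 2 0 3 4] BQ[of 2 0 4 5] BQ[of 2 0 5 3]
    by (simp only: distinct.simps list.set, simp)
  also have "\<dots> = q * (50 * M + 721)" by (simp add: algebra_simps)
  finally have main: "54 * M * card T \<le> q * (50 * M + 721)" by (simp add: algebra_simps)
  have cT: "q \<le> card T + 6"
  proof -
    have one: "card {t \<in> V. 1 - t * c \<in> I} \<le> 1" if c: "c \<in> set P" for c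
    proof -
      have "t = t'" if "t \<in> V" "t' \<in> V" "1 - t * c \<in> I" "1 - t' * c \<in> I" for t t'
      proof -
        have "(1 - t' * c) - (1 - t * c) \<in> I" using that I_diff by blast
        then have "(t - t') * c \<in> I" by (simp add: algebra_simps)
        then show ?thesis using P_notin[OF c] I_prime V_unique that by blast
      qed
      then show ?thesis using finite_V by (auto simp: card_le_Suc0_iff_eq)
    qed
    have "V - T = (\<Union>c\<in>set P. {t \<in> V. 1 - t * c \<in> I})" by (auto simp: T_def)
    then have "card (V - T) \<le> (\<Sum>c\<in>set P. card {t \<in> V. 1 - t * c \<in> I})" using card_UN_le[of "set P"] by simp
    also have "\<dots> \<le> (\<Sum>c\<in>set P. 1)" by (intro sum_mono one)
    also have "\<dots> \<le> 6" using card_length[of P] by (simp add: P_def)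
    finally have "card (V - T) \<le> 6" .
    moreover have "T \<subseteq> V" by (auto simp: T_def)
    ultimately show ?thesis using card_Diff_subset[OF finT] card_V by simp
  qed
  \<comment> \<open>The excess \<open>54 - 50 = 4\<close> has to beat 721, which happens from
    \<open>M = 181\<close> on; the term \<open>324 * M\<close> accounts for the at most six excluded
    \<open>t\<close>.\<close>
  have "54 * M * q \<le> 54 * M * (card T + 6)" using cT by (rule mult_le_mono2)
  then have "54 * (M * q) \<le> 50 * (q * M) + 721 * q + 324 * M" using main by (simp add: algebra_simps)
  then have e1: "4 * (M * q) \<le> 721 * q + 324 * M" by (simp add: mult.commute)
  have e2: "181 * q \<le> M * q" using M(3) by (rule mult_le_mono1)
  have "181 * M \<le> M * M" using M(3) by (rule mult_le_mono1)
  then have e3: "181 * M \<le> q" using M(2) unfolding power2_eq_square by (rule le_trans)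
  show False using e1 e2 e3 M(3) by linarith
qed

end

section \<open>The model plane, and the development of base planes\<close>

definition ag_lines :: "nat set set" where
  "ag_lines = {{0, 1, 2}, {3, 4, 5}, {6, 7, 8}, {0, 3, 6}, {1, 4, 7}, {2, 5, 8},
     {0, 4, 8}, {1, 5, 6}, {2, 3, 7}, {0, 5, 7}, {1, 3, 8}, {2, 4, 6}}"

lemma lessThan_9: "{..<9::nat} = {0, 1, 2, 3, 4, 5, 6, 7, 8}"
  by (simp add: numeral_eq_Suc lessThan_Suc insert_commute)

lemma ag_lines_props:
  shows "finite ag_lines" "card ag_lines = 12" "\<Union>ag_lines = {..<9}"
    "\<forall>l\<in>ag_lines. l \<subseteq> {..<9} \<and> card l = 3"
    "\<forall>i\<in>{..<9}. \<forall>j\<in>{..<9}. i \<noteq> j \<longrightarrow> (\<exists>!l. l \<in> ag_lines \<and> i \<in> l \<and> j \<in> l)"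
proof -
  show "finite ag_lines" by (simp add: ag_lines_def)
  show "card ag_lines = 12"
    by code_simp
  show "\<Union>ag_lines = {..<9}" unfolding lessThan_9 by (simp add: ag_lines_def insert_commute)
  show "\<forall>l\<in>ag_lines. l \<subseteq> {..<9} \<and> card l = 3" unfolding lessThan_9 by (simp add: ag_lines_def)
  show "\<forall>i\<in>{..<9}. \<forall>j\<in>{..<9}. i \<noteq> j \<longrightarrow> (\<exists>!l. l \<in> ag_lines \<and> i \<in> l \<and> j \<in> l)"
  proof (intro ballI impI)
    have *: "\<forall>i\<in>set [0..<9]. \<forall>j\<in>set [0..<9]. i \<noteq> j \<longrightarrow> card ({l \<in> ag_lines. i \<in> l \<and> j \<in> l}) = 1"
      by code_simp
    fix i j :: nat assume "i \<in> {..<9}" "j \<in> {..<9}" "i \<noteq> j"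
    then have "card ({l \<in> ag_lines. i \<in> l \<and> j \<in> l}) = 1" using * by simp
    then obtain l where "{l \<in> ag_lines. i \<in> l \<and> j \<in> l} = {l}" using card_1_singletonE by blast
    then show "\<exists>!l. l \<in> ag_lines \<and> i \<in> l \<and> j \<in> l"
      by (metis (mono_tags, lifting) mem_Collect_eq singleton_iff)
  qed
qed

lemma card_UNIV_12: "card (UNIV :: 12 set) = 12"
  by simp

text \<open>A base plane is a labelling of the nine points of the model plane by group elements,
  together with a bijection from the colours to the twelve lines of the model. Groups are
  quotients of an additive type by a subgroup \<open>I\<close>.\<close>

type_synonym 'b base_plane = "(nat \<Rightarrow> 'b) \<times> (12 \<Rightarrow> nat set)"

definition subgrp :: "'b::ab_group_add set \<Rightarrow> bool" where
  "subgrp I \<longleftrightarrow> 0 \<in> I \<and> (\<forall>x\<in>I. \<forall>y\<in>I. x - y \<in> I)"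

definition has_index :: "'b::ab_group_add set \<Rightarrow> nat \<Rightarrow> bool" where
  "has_index I q \<longleftrightarrow> (\<exists>V. finite V \<and> card V = q \<and> (\<forall>x. \<exists>!v. v \<in> V \<and> x - v \<in> I))"

text \<open>The set \<open>D\<close> is a parameter so that families for disjoint sets of
  differences can be joined; a complete family has \<open>D = - I\<close>. Uniqueness concerns the
  plane together with the ordered pair of labels.\<close>

definition covers :: "'b::ab_group_add set \<Rightarrow> 'b base_plane set \<Rightarrow> 'b set \<Rightarrow> bool" where
  "covers I B D \<longleftrightarrow>
     (\<forall>b\<in>B. bij_betw (snd b) UNIV ag_lines) \<and>
     (\<forall>b\<in>B. \<forall>i<9. \<forall>j<9. i \<noteq> j \<longrightarrow> fst b i - fst b j \<in> D) \<and>
     (\<forall>c. \<forall>d\<in>D. \<exists>!(b, i, j). b \<in> B \<and> i \<in> snd b c \<and> j \<in> snd b c \<and> i \<noteq> j \<and> fst b i - fst b j - d \<in> I)"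

definition hesse_family :: "'b::ab_group_add set \<Rightarrow> nat \<Rightarrow> bool" where
  "hesse_family I q \<longleftrightarrow> subgrp I \<and> has_index I q \<and> (\<exists>B. covers I B (- I))"

lemma subgrpD:
  assumes "subgrp I"
  shows "0 \<in> I" "x \<in> I \<Longrightarrow> y \<in> I \<Longrightarrow> x - y \<in> I" "x \<in> I \<Longrightarrow> - x \<in> I" "x \<in> I \<Longrightarrow> y \<in> I \<Longrightarrow> x + y \<in> I"
proof -
  show z: "0 \<in> I" and d: "x \<in> I \<Longrightarrow> y \<in> I \<Longrightarrow> x - y \<in> I" for x y using assms by (auto simp: subgrp_def)
  show n: "x \<in> I \<Longrightarrow> - x \<in> I" for x using d[OF z, of x] by simp
  show "x \<in> I \<Longrightarrow> y \<in> I \<Longrightarrow> x + y \<in> I" using d[of x "- y"] n[of y] by simp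
qed

lemma line_ex_points: "l \<in> ag_lines \<Longrightarrow> l \<subseteq> {..<9}"
  using ag_lines_props(4) by blast

text \<open>The planes are all translates of the base planes. For two points and a colour, the
  difference determines the base plane and the two labels, and the first point then determines the
  translation.\<close>

theorem hesse_family_imp_kaleidoscope:
  fixes I :: "'b::ab_group_add set"
  assumes fam: "hesse_family I q"
  shows "\<exists>(G :: nat monoid) \<phi> (V :: nat set) H. regular_hesse_kaleidoscope q G \<phi> V H"
proof -
  have sg: "subgrp I" and "has_index I q" using fam by (auto simp: hesse_family_def)
  then obtain W where W: "finite W" "card W = q" "\<And>x. \<exists>!v. v \<in> W \<and> x - v \<in> I"
    unfolding has_index_def by blast
  obtain B where B: "covers I B (- I)" using fam by (auto simp: hesse_family_def)
  note sgD = subgrpD[OF sg]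
  obtain e where e: "bij_betw e W {..<q}" using ex_bij_betw_finite_nat[OF W(1)] W(2) by (auto simp: atLeast0LessThan)
  \<comment> \<open>Names the cosets of \<open>I\<close> by the numbers below \<open>q\<close>, so
    that points and group elements become natural numbers.\<close>
  define \<Phi> where "\<Phi> x = e (THE v. v \<in> W \<and> x - v \<in> I)" for x
  have rep: "(THE v. v \<in> W \<and> x - v \<in> I) \<in> W \<and> x - (THE v. v \<in> W \<and> x - v \<in> I) \<in> I" for x
    by (rule theI'[OF W(3)])
  have \<Phi>_eq: "\<Phi> x = \<Phi> y \<longleftrightarrow> x - y \<in> I" for x y
  proof -
    let ?x = "THE v. v \<in> W \<and> x - v \<in> I" and ?y = "THE v. v \<in> W \<and> y - v \<in> I"
    have "\<Phi> x = \<Phi> y \<longleftrightarrow> ?x = ?y"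
      unfolding \<Phi>_def by (rule inj_on_eq_iff[OF bij_betw_imp_inj_on[OF e]]) (simp_all add: rep)
    also have "\<dots> \<longleftrightarrow> x - y \<in> I"
    proof
      assume eq: "?x = ?y"
      have "(x - ?x) - (y - ?y) \<in> I" using rep[of x] rep[of y] sgD(2) by blast
      then show "x - y \<in> I" by (simp add: eq)
    next
      assume "x - y \<in> I"
      then have "(x - y) + (y - ?y) \<in> I" using rep[of y] sgD(4) by blast
      then have "x - ?y \<in> I" by simp
      then show "?x = ?y" using W(3)[of x] rep[of x] rep[of y] by blast
    qed
    finally show ?thesis .
  qed
  have \<Phi>_range: "range \<Phi> = {..<q}"
  proof (intro equalityI subsetI)
    fix k assume "k \<in> range \<Phi>"
    then obtain x where "k = \<Phi> x" by auto
    then show "k \<in> {..<q}" using bij_betwE[OF e] rep[of x] by (simp add: \<Phi>_def)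
  next
    fix k assume "k \<in> {..<q}"
    then have "k \<in> e ` W" using bij_betw_imp_surj_on[OF e] by simp
    then obtain v where v: "v \<in> W" "e v = k" by auto
    have "v - v \<in> I" using sgD(1) by simp
    then have "v \<in> W \<and> v - v \<in> I" using v(1) by blast
    then have "(THE u. u \<in> W \<and> v - u \<in> I) = v" by (rule the1_equality[OF W(3)])
    then have "\<Phi> v = k" using v(2) by (simp add: \<Phi>_def)
    then show "k \<in> range \<Phi>" using rangeI[of \<Phi> v] by simp
  qed
  have \<Phi>_lt: "\<Phi> x < q" for x using rangeI[of \<Phi> x] unfolding \<Phi>_range by simp
  define s where "s k = (SOME x. \<Phi> x = k)" for k
  have s: "\<Phi> (s k) = k" if "k < q" for k
  proof -
    have "k \<in> range \<Phi>" using \<Phi>_range that by simp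
    then have "\<exists>x. \<Phi> x = k" by (metis rangeE)
    then show ?thesis unfolding s_def by (rule someI_ex)
  qed
  have add_cong: "\<Phi> (x + y) = \<Phi> (x' + y')" if "\<Phi> x = \<Phi> x'" "\<Phi> y = \<Phi> y'" for x y x' y'
  proof -
    have "(x - x') + (y - y') \<in> I" using that sgD(4) by (simp add: \<Phi>_eq)
    then show ?thesis by (simp add: \<Phi>_eq algebra_simps)
  qed
  define mul where "mul a b = \<Phi> (s a + s b)" for a b
  have mul: "mul (\<Phi> x) (\<Phi> y) = \<Phi> (x + y)" for x y
    unfolding mul_def by (rule add_cong) (simp_all add: s \<Phi>_lt)
  define G :: "nat monoid" where "G = \<lparr>carrier = {..<q}, monoid.mult = mul, one = \<Phi> 0\<rparr>"
  have G_simps: "carrier G = {..<q}" "monoid.mult G = mul" "one G = \<Phi> 0" by (simp_all add: G_def)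
  have elim: "\<exists>x. k = \<Phi> x" if "k < q" for k using s[OF that] by metis
  have grp: "group G"
  proof (rule groupI)
    fix a b assume "a \<in> carrier G" "b \<in> carrier G"
    then show "a \<otimes>\<^bsub>G\<^esub> b \<in> carrier G" by (simp add: G_simps mul_def \<Phi>_lt)
  next
    show "\<one>\<^bsub>G\<^esub> \<in> carrier G" by (simp add: G_simps \<Phi>_lt)
  next
    fix a b c assume "a \<in> carrier G" "b \<in> carrier G" "c \<in> carrier G"
    then obtain x y z where "a = \<Phi> x" "b = \<Phi> y" "c = \<Phi> z"
      using elim[of a] elim[of b] elim[of c] by (auto simp: G_simps)
    then show "a \<otimes>\<^bsub>G\<^esub> b \<otimes>\<^bsub>G\<^esub> c = a \<otimes>\<^bsub>G\<^esub> (b \<otimes>\<^bsub>G\<^esub> c)" by (simp add: G_simps mul add.assoc)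
  next
    fix a assume "a \<in> carrier G"
    then obtain x where x: "a = \<Phi> x" using elim[of a] by (auto simp: G_simps)
    then show "\<one>\<^bsub>G\<^esub> \<otimes>\<^bsub>G\<^esub> a = a" by (simp add: G_simps mul)
    show "\<exists>y\<in>carrier G. y \<otimes>\<^bsub>G\<^esub> a = \<one>\<^bsub>G\<^esub>"
      by (rule bexI[of _ "\<Phi> (- x)"]) (simp_all add: G_simps x mul \<Phi>_lt)
  qed
  \<comment> \<open>Restricted, because the elements of \<open>Bij\<close> are extensional
    functions.\<close>
  define \<phi> where "\<phi> g = (\<lambda>x\<in>{..<q}. mul g x)" for g
  have \<phi>: "\<phi> (\<Phi> g) (\<Phi> x) = \<Phi> (g + x)" for g x by (simp add: \<phi>_def mul \<Phi>_lt)
  have bij: "\<phi> g \<in> Bij {..<q}" if "g < q" for g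
  proof -
    obtain y where y: "g = \<Phi> y" using elim[OF \<open>g < q\<close>] by blast
    have "inj_on (\<phi> g) {..<q}"
    proof (rule inj_onI)
      fix a b assume ab: "a \<in> {..<q}" "b \<in> {..<q}" "\<phi> g a = \<phi> g b"
      then obtain u v where uv: "a = \<Phi> u" "b = \<Phi> v" using elim[of a] elim[of b] by auto
      have "\<Phi> (y + u) = \<Phi> (y + v)" using ab(3) by (simp add: y uv \<phi>)
      then show "a = b" by (simp add: uv \<Phi>_eq)
    qed
    moreover have "\<phi> g ` {..<q} \<subseteq> {..<q}" by (auto simp: \<phi>_def mul_def \<Phi>_lt)
    ultimately have "bij_betw (\<phi> g) {..<q} {..<q}"
      by (simp add: bij_betw_def endo_inj_surj)
    then show ?thesis by (simp add: Bij_def \<phi>_def)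
  qed
  have act: "group_action G {..<q} \<phi>"
    unfolding group_action_def group_hom_def group_hom_axioms_def
  proof (intro conjI grp group_BijGroup homI)
    fix g assume "g \<in> carrier G"
    then show "\<phi> g \<in> carrier (BijGroup {..<q})" using bij by (simp add: BijGroup_def G_simps)
  next
    fix g h assume gh: "g \<in> carrier G" "h \<in> carrier G"
    then obtain y z where yz: "g = \<Phi> y" "h = \<Phi> z" using elim[of g] elim[of h] by (auto simp: G_simps)
    have "\<phi> (mul g h) = compose {..<q} (\<phi> g) (\<phi> h)"
    proof
      fix a
      show "\<phi> (mul g h) a = compose {..<q} (\<phi> g) (\<phi> h) a"
      proof (cases "a < q")
        case True
        then obtain u where "a = \<Phi> u" using elim[of a] by blast
        then show ?thesis using True by (simp add: compose_def yz mul \<phi> add.assoc)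
      next
        case False
        then show ?thesis by (simp add: compose_def \<phi>_def)
      qed
    qed
    then show "\<phi> (g \<otimes>\<^bsub>G\<^esub> h) = \<phi> g \<otimes>\<^bsub>BijGroup {..<q}\<^esub> \<phi> h"
      using gh bij by (simp add: BijGroup_def G_simps)
  qed
  have sharp: "sharply_transitive_action G {..<q} \<phi>"
    unfolding sharply_transitive_action_def
  proof (intro conjI act ballI)
    fix a b assume "a \<in> {..<q}" "b \<in> {..<q}"
    then obtain u v where uv: "a = \<Phi> u" "b = \<Phi> v" using elim[of a] elim[of b] by auto
    show "\<exists>!g. g \<in> carrier G \<and> \<phi> g a = b"
    proof (rule ex1I[of _ "\<Phi> (v - u)"])
      show "\<Phi> (v - u) \<in> carrier G \<and> \<phi> (\<Phi> (v - u)) a = b" by (simp add: uv \<phi> G_simps \<Phi>_lt)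
    next
      fix g assume g: "g \<in> carrier G \<and> \<phi> g a = b"
      then obtain y where y: "g = \<Phi> y" using elim[of g] by (auto simp: G_simps)
      have "\<Phi> (y + u) = \<Phi> v" using g by (simp add: y uv \<phi>)
      then show "g = \<Phi> (v - u)" by (simp add: y \<Phi>_eq algebra_simps)
    qed
  qed
  define pl where "pl b g c = (\<lambda>i. \<Phi> (g + fst b i)) ` (snd b c)" for b :: "'b base_plane" and g c
  define H where "H = {pl b g | b g. b \<in> B}"
  have Bbij: "bij_betw (snd b) UNIV ag_lines" if "b \<in> B" for b using B that by (auto simp: covers_def)
  have Bdist: "fst b i - fst b j \<notin> I" if "b \<in> B" "i < 9" "j < 9" "i \<noteq> j" for b i j
    using B that by (auto simp: covers_def)
  have Bex: "\<exists>!(b, i, j). b \<in> B \<and> i \<in> snd b c \<and> j \<in> snd b c \<and> i \<noteq> j \<and> fst b i - fst b j - d \<in> I"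
    if "d \<notin> I" for c d using B that by (auto simp: covers_def)
  have line9: "snd b c \<subseteq> {..<9}" "snd b c \<in> ag_lines" if "b \<in> B" for b c
    using Bbij[OF that] line_ex_points unfolding bij_betw_def by blast+
  have inj9: "inj_on (\<lambda>i. \<Phi> (g + fst b i)) {..<9}" if "b \<in> B" for b g
  proof (rule inj_onI)
    fix i j assume ij: "i \<in> {..<9}" "j \<in> {..<9}" "\<Phi> (g + fst b i) = \<Phi> (g + fst b j)"
    then have "fst b i - fst b j \<in> I" by (simp add: \<Phi>_eq)
    then show "i = j" using Bdist[OF that] ij by blast
  qed
  have rangepl: "range (pl b g) = (\<lambda>l. (\<lambda>i. \<Phi> (g + fst b i)) ` l) ` ag_lines" if "b \<in> B" for b g
    using Bbij[OF that] unfolding pl_def bij_betw_def by (metis image_image)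
  have Unpl: "\<Union>(range (pl b g)) = (\<lambda>i. \<Phi> (g + fst b i)) ` {..<9}" if "b \<in> B" for b g
    unfolding rangepl[OF that] image_Union [symmetric] ag_lines_props(3) ..
  have plane: "colored_hesse_plane (pl b g) \<and> \<Union>(range (pl b g)) \<subseteq> {..<q}" if b: "b \<in> B" for b g
  proof (intro conjI)
    let ?f = "\<lambda>i. \<Phi> (g + fst b i)"
    note inj = inj9[OF b, of g]
    show "\<Union>(range (pl b g)) \<subseteq> {..<q}" unfolding Unpl[OF b] using \<Phi>_lt by auto
    show "colored_hesse_plane (pl b g)"
      unfolding colored_hesse_plane_def
    proof
      show "inj (pl b g)"
      proof (rule injI)
        fix c c' assume "pl b g c = pl b g c'"
        then have "snd b c = snd b c'"
          using inj_on_image_eq_iff[OF inj line9(1)[OF b] line9(1)[OF b]] by (simp add: pl_def)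
        then show "c = c'" using Bbij[OF b] by (auto simp: bij_betw_def dest: injD)
      qed
      show "hesse_plane (\<Union>(range (pl b g))) (range (pl b g))"
        unfolding hesse_plane_def two_design_def Unpl[OF b]
      proof (intro conjI ballI impI)
        show "finite (?f ` {..<9})" by simp
        show "card (?f ` {..<9}) = 9" using card_image[OF inj] by simp
      next
        fix L assume "L \<in> range (pl b g)"
        then obtain l where l: "l \<in> ag_lines" "L = ?f ` l" using rangepl[OF b] by auto
        then have l9: "l \<subseteq> {..<9}" "card l = 3" using ag_lines_props(4) by blast+
        show "L \<subseteq> ?f ` {..<9}" using l(2) l9(1) by blast
        show "card L = 3" unfolding l(2) using card_image[OF inj_on_subset[OF inj l9(1)]] l9(2) by simp
      next
        fix x y assume xy: "x \<in> ?f ` {..<9}" "y \<in> ?f ` {..<9}" "x \<noteq> y"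
        then obtain i j where ij: "i < 9" "j < 9" "x = ?f i" "y = ?f j" by auto
        then have "i \<noteq> j" using xy(3) by auto
        then obtain l where l: "l \<in> ag_lines" "i \<in> l" "j \<in> l"
          and lu: "\<And>l'. l' \<in> ag_lines \<Longrightarrow> i \<in> l' \<Longrightarrow> j \<in> l' \<Longrightarrow> l' = l"
          using ag_lines_props(5) ij(1,2) by blast
        show "\<exists>!L. L \<in> range (pl b g) \<and> x \<in> L \<and> y \<in> L"
        proof (rule ex1I[of _ "?f ` l"])
          show "?f ` l \<in> range (pl b g) \<and> x \<in> ?f ` l \<and> y \<in> ?f ` l"
            using l ij rangepl[OF b] by auto
        next
          fix L assume L: "L \<in> range (pl b g) \<and> x \<in> L \<and> y \<in> L"
          then obtain l' where l': "l' \<in> ag_lines" "L = ?f ` l'" using rangepl[OF b] by auto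
          have l'9: "l' \<subseteq> {..<9}" using line_ex_points[OF l'(1)] .
          have "?f i \<in> ?f ` l'" "?f j \<in> ?f ` l'" using L l'(2) ij(3,4) by auto
          then have "i \<in> l'" "j \<in> l'"
            using inj_on_image_mem_iff[OF inj _ l'9] ij(1,2) by (metis lessThan_iff)+
          then show "L = ?f ` l" using lu l' by blast
        qed
      qed
    qed
  qed
  have uniq: "\<exists>!\<pi>. \<pi> \<in> H \<and> x \<in> \<pi> c \<and> y \<in> \<pi> c" if xy: "x < q" "y < q" "x \<noteq> y" for x y c
  proof -
    obtain u v where uv: "x = \<Phi> u" "y = \<Phi> v" using elim[OF xy(1)] elim[OF xy(2)] by auto
    then have d: "u - v \<notin> I" using xy(3) by (simp add: \<Phi>_eq)
    let ?P = "\<lambda>b i j. b \<in> B \<and> i \<in> snd b c \<and> j \<in> snd b c \<and> i \<noteq> j \<and> fst b i - fst b j - (u - v) \<in> I"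
    obtain z where z: "case z of (b, i, j) \<Rightarrow> ?P b i j" "\<And>z'. (case z' of (b, i, j) \<Rightarrow> ?P b i j) \<Longrightarrow> z' = z"
      using Bex[OF d, of c] by (rule ex1E) blast
    obtain b i j where zb: "z = (b, i, j)" by (cases z)
    have bij: "b \<in> B" "i \<in> snd b c" "j \<in> snd b c" "i \<noteq> j" "fst b i - fst b j - (u - v) \<in> I"
      using z(1) by (simp_all add: zb)
    have un: "(b', i', j') = (b, i, j)" if "?P b' i' j'" for b' i' j'
      using z(2)[of "(b', i', j')"] that by (simp add: zb)
    let ?g = "u - fst b i"
    show ?thesis
    proof (rule ex1I[of _ "pl b ?g"])
      have "\<Phi> (?g + fst b j) = y" unfolding uv \<Phi>_eq
        using sgD(3)[OF bij(5)] by (simp add: algebra_simps)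
      then have "y \<in> pl b ?g c" unfolding pl_def using bij(3) by blast
      moreover have "x \<in> pl b ?g c" unfolding pl_def using bij(2) by (auto simp: uv intro!: image_eqI[of _ _ i])
      ultimately show "pl b ?g \<in> H \<and> x \<in> pl b ?g c \<and> y \<in> pl b ?g c" using bij(1) unfolding H_def by blast
    next
      fix \<pi> assume \<pi>: "\<pi> \<in> H \<and> x \<in> \<pi> c \<and> y \<in> \<pi> c"
      then obtain b' g' where b': "b' \<in> B" "\<pi> = pl b' g'" unfolding H_def by blast
      then obtain i' j' where ij: "i' \<in> snd b' c" "j' \<in> snd b' c" "\<Phi> (g' + fst b' i') = \<Phi> u" "\<Phi> (g' + fst b' j') = \<Phi> v"
        using \<pi> unfolding pl_def uv by (auto simp: image_iff)
      then have I: "g' + fst b' i' - u \<in> I" "g' + fst b' j' - v \<in> I" by (simp_all add: \<Phi>_eq)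
      from sgD(2)[OF this] have "fst b' i' - fst b' j' - (u - v) \<in> I" by (simp add: algebra_simps)
      moreover have "i' \<noteq> j'"
      proof
        assume "i' = j'"
        then have "x = y" using ij uv by simp
        then show False using xy by blast
      qed
      ultimately have eq: "b' = b" "i' = i" using un[of b' i' j'] b'(1) ij(1,2) by auto
      have "\<Phi> (g' + fst b m) = \<Phi> (?g + fst b m)" for m
        unfolding \<Phi>_eq using I(1) by (simp add: eq algebra_simps)
      then show "\<pi> = pl b ?g" unfolding b'(2) eq(1) pl_def by auto
    qed
  qed
  have inv: "(\<lambda>\<pi> c. \<phi> g ` \<pi> c) ` H = H" if g: "g \<in> carrier G" for g
  proof -
    obtain y where y: "g = \<Phi> y" using elim[of g] g by (auto simp: G_simps)
    have sh: "(\<lambda>c. \<phi> g ` pl b h c) = pl b (y + h)" for b h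
      by (auto simp: pl_def image_image y \<phi> add.assoc)
    show ?thesis
    proof (intro equalityI subsetI)
      fix \<pi> assume "\<pi> \<in> (\<lambda>\<pi> c. \<phi> g ` \<pi> c) ` H"
      then obtain b h where "b \<in> B" "\<pi> = (\<lambda>c. \<phi> g ` pl b h c)" unfolding H_def by blast
      then show "\<pi> \<in> H" unfolding sh H_def by blast
    next
      fix \<pi> assume "\<pi> \<in> H"
      then obtain b h where b: "b \<in> B" "\<pi> = pl b h" unfolding H_def by blast
      then have "\<pi> = (\<lambda>c. \<phi> g ` pl b (- y + h) c)" by (simp add: sh)
      moreover have "pl b (- y + h) \<in> H" using b(1) unfolding H_def by blast
      ultimately show "\<pi> \<in> (\<lambda>\<pi> c. \<phi> g ` \<pi> c) ` H" by blast
    qed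
  qed
  have "regular_hesse_kaleidoscope q G \<phi> {..<q} H"
    unfolding regular_hesse_kaleidoscope_def hesse_kaleidoscope_def
  proof (intro conjI ballI impI allI grp sharp inv)
    show "colored_hesse_plane \<pi>" "\<Union>(range \<pi>) \<subseteq> {..<q}" if "\<pi> \<in> H" for \<pi>
      using that plane unfolding H_def by blast+
    show "Coset.order G = q" by (simp add: Coset.order_def G_simps)
  qed (use uniq in auto)
  then show ?thesis by blast
qed

section \<open>Multipliers, and covering by rainbow lines\<close>

context residue_field
begin

lemma I_subgrp: "subgrp I"
  by (simp add: subgrp_def I_zero I_diff)

lemma I_has_index: "has_index I q"
  unfolding has_index_def
proof (intro exI[of _ V] conjI finite_V card_V allI)
  fix x
  show "\<exists>!v. v \<in> V \<and> x - v \<in> I"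
  proof (rule ex1I[of _ "rep x"])
    show "rep x \<in> V \<and> x - rep x \<in> I" using rep_eqv[of x] by (simp add: eqv_def)
    fix v assume v: "v \<in> V \<and> x - v \<in> I"
    then have "x \<simeq> v" "x \<simeq> rep x" using rep_eqv by (simp_all add: eqv_def)
    then have "v - rep x \<in> I" using eqv_trans eqv_sym eqv_def by blast
    then show "v = rep x" using V_unique v by auto
  qed
qed

text \<open>The set \<open>M\<close> represents a multiplicative group only up to congruence, so
  products are replaced by congruent members of \<open>M\<close>. The representative is chosen from
  the set \<open>orb x\<close>, not from \<open>x\<close>, so that points with equal orbits receive
  the same one.\<close>

lemma transversal:
  assumes one: "1 \<in> M"
    and closed: "\<And>u v. u \<in> M \<Longrightarrow> v \<in> M \<Longrightarrow> \<exists>x\<in>M. u * v \<simeq> x"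
    and inverse: "\<And>u. u \<in> M \<Longrightarrow> \<exists>v\<in>M. u * v \<simeq> 1"
    and distinct: "\<And>u v. u \<in> M \<Longrightarrow> v \<in> M \<Longrightarrow> u \<simeq> v \<Longrightarrow> u = v"
    and X: "\<And>x u. x \<in> X \<Longrightarrow> u \<in> M \<Longrightarrow> u * x \<in> X" "\<And>x. x \<in> X \<Longrightarrow> x \<notin> I"
  shows "\<exists>S\<subseteq>X. (\<forall>x\<in>X. \<exists>u\<in>M. \<exists>s\<in>S. x \<simeq> u * s) \<and>
    (\<forall>u\<in>M. \<forall>u'\<in>M. \<forall>s\<in>S. \<forall>s'\<in>S. u * s \<simeq> u' * s' \<longrightarrow> u = u' \<and> s = s')"
proof -
  define orb where "orb x = {y \<in> X. \<exists>u\<in>M. x \<simeq> u * y}" for x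
  have sub: "orb x \<subseteq> orb x'" if u: "u \<in> M" "x' \<simeq> u * x" for x x' u
  proof
    fix y assume "y \<in> orb x"
    then obtain v where v: "y \<in> X" "v \<in> M" "x \<simeq> v * y" by (auto simp: orb_def)
    obtain z where z: "z \<in> M" "u * v \<simeq> z" using closed u v by blast
    have "x' \<simeq> u * (v * y)" by (rule eqv_trans[OF u(2) eqv_mult[OF eqv_refl v(3)]])
    also have "\<dots> = u * v * y" by (simp add: mult.assoc)
    also have "\<dots> \<simeq> z * y" by (rule eqv_mult[OF z(2) eqv_refl])
    finally show "y \<in> orb x'" using v(1) z(1) by (auto simp: orb_def)
  qed
  have flip: "\<exists>v\<in>M. x \<simeq> v * x'" if u: "u \<in> M" "x' \<simeq> u * x" for x x' u
  proof -
    obtain v where v: "v \<in> M" "u * v \<simeq> 1" using inverse u by blast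
    have "v * x' \<simeq> v * (u * x)" by (rule eqv_mult[OF eqv_refl u(2)])
    also have "\<dots> = u * v * x" by (simp add: ac_simps)
    also have "\<dots> \<simeq> 1 * x" by (rule eqv_mult[OF v(2) eqv_refl])
    finally have "x \<simeq> v * x'" using eqv_sym by simp
    then show ?thesis using v by blast
  qed
  have orb_eq: "orb x = orb x'" if "u \<in> M" "x' \<simeq> u * x" for x x' u
    using sub[OF that] flip[OF that] sub by blast
  define \<sigma> where "\<sigma> x = (SOME y. y \<in> orb x)" for x
  have self: "x \<in> orb x" if "x \<in> X" for x using that one by (auto simp: orb_def intro!: bexI[of _ 1])
  have \<sigma>: "\<sigma> x \<in> orb x" if "x \<in> X" for x
    unfolding \<sigma>_def using self[OF that] by (metis someI)
  have \<sigma>D: "\<sigma> x \<in> X" "\<exists>u\<in>M. x \<simeq> u * \<sigma> x" "orb (\<sigma> x) = orb x" if "x \<in> X" for x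
  proof -
    show "\<sigma> x \<in> X" and e: "\<exists>u\<in>M. x \<simeq> u * \<sigma> x" using \<sigma>[OF that] by (simp_all add: orb_def)
    from e obtain u where "u \<in> M" "x \<simeq> u * \<sigma> x" ..
    then show "orb (\<sigma> x) = orb x" by (rule orb_eq)
  qed
  show ?thesis
  proof (intro exI[of _ "\<sigma> ` X"] conjI ballI impI)
    show "\<sigma> ` X \<subseteq> X" using \<sigma>D by blast
    show "\<exists>u\<in>M. \<exists>s\<in>\<sigma> ` X. x \<simeq> u * s" if "x \<in> X" for x using \<sigma>D[OF that] that by blast
    fix u u' s s' assume a: "u \<in> M" "u' \<in> M" "s \<in> \<sigma> ` X" "s' \<in> \<sigma> ` X" "u * s \<simeq> u' * s'"
    then obtain z z' where z: "z \<in> X" "s = \<sigma> z" "z' \<in> X" "s' = \<sigma> z'" by blast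
    have "orb s = orb (u * s)" "orb s' = orb (u * s)"
      using orb_eq[OF a(1) eqv_refl] orb_eq[OF a(2,5)] by auto
    then have "orb z = orb z'" using \<sigma>D(3)[OF z(1)] \<sigma>D(3)[OF z(3)] z by simp
    then have ss: "s = s'" by (simp add: z \<sigma>_def)
    moreover have "s \<notin> I" using X(2) \<sigma>D(1)[OF z(1)] z(2) by blast
    ultimately have "u \<simeq> u'" using a(5) eqv_mult_cancel2 by blast
    then show "u = u'" using distinct a by blast
    show "s = s'" by (rule ss)
  qed
qed

end

definition base_coloring :: "12 \<Rightarrow> nat set" where
  "base_coloring = (SOME l. bij_betw l UNIV ag_lines)"

lemma base_coloring: "bij_betw base_coloring UNIV ag_lines"
proof -
  have "\<exists>l. bij_betw l (UNIV :: 12 set) ag_lines"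
    using ag_lines_props(1,2) by (intro finite_same_card_bij) auto
  then show ?thesis unfolding base_coloring_def by (rule someI_ex)
qed

context cubic_field
begin

text \<open>Each pair in \<open>T\<close> gives the base plane with labels \<open>a * f\<close>, its
  lines coloured after the permutation \<open>\<rho>\<close>. Permutations other than the identity
  serve the case in which \<open>w\<close> is a cube.\<close>

lemma covers_of_lines:
  fixes T :: "('a \<times> (nat set \<Rightarrow> nat set)) set"
  assumes T: "\<And>a \<rho>. (a, \<rho>) \<in> T \<Longrightarrow> a \<notin> I \<and> bij_betw \<rho> ag_lines ag_lines"
    and inj: "\<And>i j. i < 9 \<Longrightarrow> j < 9 \<Longrightarrow> i \<noteq> j \<Longrightarrow> f i - f j \<notin> I"
    and ex: "\<And>l d. l \<in> ag_lines \<Longrightarrow> d \<notin> I \<Longrightarrow>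
      \<exists>a \<rho> i j. (a, \<rho>) \<in> T \<and> i \<in> \<rho> l \<and> j \<in> \<rho> l \<and> i \<noteq> j \<and> a * (f i - f j) \<simeq> d"
    and un: "\<And>l a \<rho> i j a' \<rho>' i' j'. l \<in> ag_lines \<Longrightarrow> (a, \<rho>) \<in> T \<Longrightarrow> i \<in> \<rho> l \<Longrightarrow> j \<in> \<rho> l \<Longrightarrow> i \<noteq> j \<Longrightarrow>
      (a', \<rho>') \<in> T \<Longrightarrow> i' \<in> \<rho>' l \<Longrightarrow> j' \<in> \<rho>' l \<Longrightarrow> i' \<noteq> j' \<Longrightarrow>
      a * (f i - f j) \<simeq> a' * (f i' - f j') \<Longrightarrow> a = a' \<and> \<rho> = \<rho>' \<and> i = i' \<and> j = j'"
  shows "\<exists>B. covers I B (- I)"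
proof -
  define mk where "mk a \<rho> = (\<lambda>m. a * f m, \<rho> \<circ> base_coloring)" for a :: 'a and \<rho> :: "nat set \<Rightarrow> nat set"
  define B where "B = {mk a \<rho> | a \<rho>. (a, \<rho>) \<in> T}"
  have "covers I B (- I)"
    unfolding covers_def
  proof (intro conjI ballI allI impI)
    fix b assume "b \<in> B"
    then obtain a \<rho> where b: "b = mk a \<rho>" "(a, \<rho>) \<in> T" unfolding B_def by blast
    show "bij_betw (snd b) UNIV ag_lines"
      using bij_betw_trans[OF base_coloring conjunct2[OF T[OF b(2)]]] by (simp add: b(1) mk_def)
    fix i j :: nat assume ij: "i < 9" "j < 9" "i \<noteq> j"
    have "a * (f i - f j) \<notin> I" using T[OF b(2)] inj[OF ij] by (simp add: I_mult_iff)
    then show "fst b i - fst b j \<in> - I" by (simp add: b(1) mk_def algebra_simps)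
  next
    fix c d assume "d \<in> - I"
    then have d: "d \<notin> I" by simp
    let ?l = "base_coloring c"
    have l: "?l \<in> ag_lines" using base_coloring by (auto simp: bij_betw_def)
    obtain a \<rho> i j where a: "(a, \<rho>) \<in> T" "i \<in> \<rho> ?l" "j \<in> \<rho> ?l" "i \<noteq> j" "a * (f i - f j) \<simeq> d"
      using ex[OF l d] by blast
    show "\<exists>!(b, i, j). b \<in> B \<and> i \<in> snd b c \<and> j \<in> snd b c \<and> i \<noteq> j \<and> fst b i - fst b j - d \<in> I"
    proof (rule ex1I[of _ "(mk a \<rho>, i, j)"])
      have "mk a \<rho> \<in> B" using a(1) unfolding B_def by blast
      then show "case (mk a \<rho>, i, j) of (b, i, j) \<Rightarrow>
          b \<in> B \<and> i \<in> snd b c \<and> j \<in> snd b c \<and> i \<noteq> j \<and> fst b i - fst b j - d \<in> I"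
        using a by (simp add: mk_def eqv_def algebra_simps)
    next
      fix z assume z: "case z of (b, i, j) \<Rightarrow>
          b \<in> B \<and> i \<in> snd b c \<and> j \<in> snd b c \<and> i \<noteq> j \<and> fst b i - fst b j - d \<in> I"
      obtain b i' j' where zb: "z = (b, i', j')" by (cases z)
      then have "b \<in> B" using z by simp
      then obtain a' \<rho>' where b: "b = mk a' \<rho>'" "(a', \<rho>') \<in> T" unfolding B_def by blast
      have z': "i' \<in> \<rho>' ?l" "j' \<in> \<rho>' ?l" "i' \<noteq> j'" "a' * (f i' - f j') \<simeq> d"
        using z by (simp_all add: zb b(1) mk_def eqv_def algebra_simps)
      have "a = a' \<and> \<rho> = \<rho>' \<and> i = i' \<and> j = j'"
        by (rule un[OF l a(1-4) b(2) z'(1-3) eqv_trans[OF a(5) eqv_sym[OF z'(4)]]])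
      then show "z = (mk a \<rho>, i, j)" by (simp add: zb b(1))
    qed
  qed
  then show ?thesis by blast
qed

definition rainbow_line :: "(nat \<Rightarrow> 'a) \<Rightarrow> nat set \<Rightarrow> bool" where
  "rainbow_line f l \<longleftrightarrow> (\<exists>i j k. l = {i, j, k} \<and> rainbow (f i - f j) (f j - f k) (f k - f i))"

lemma rainbow_lineD:
  assumes "rainbow_line f l"
  shows "\<lbrakk>i \<in> l; j \<in> l; i \<noteq> j\<rbrakk> \<Longrightarrow> f i - f j \<notin> I"
    and "\<lbrakk>i \<in> l; j \<in> l; i \<noteq> j; i' \<in> l; j' \<in> l; i' \<noteq> j'; cls (f i - f j) = cls (f i' - f j')\<rbrakk> \<Longrightarrow>
      (i = i' \<and> j = j') \<or> (i = j' \<and> j = i')"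
    and "x < 3 \<Longrightarrow> \<exists>i\<in>l. \<exists>j\<in>l. i \<noteq> j \<and> cls (f i - f j) = x"
proof -
  obtain a b c where l: "l = {a, b, c}" and r: "rainbow (f a - f b) (f b - f c) (f c - f a)"
    using assms by (auto simp: rainbow_line_def)
  have n: "f a - f b \<notin> I" "f b - f c \<notin> I" "f c - f a \<notin> I" using r by (auto simp: rainbow_def)
  have n': "f b - f a \<notin> I" "f c - f b \<notin> I" "f a - f c \<notin> I"
    using n I_neg_iff[of "f a - f b"] I_neg_iff[of "f b - f c"] I_neg_iff[of "f c - f a"] by auto
  have ne: "a \<noteq> b" "b \<noteq> c" "c \<noteq> a" using n I_zero by auto
  have sym: "cls (f b - f a) = cls (f a - f b)" "cls (f c - f b) = cls (f b - f c)" "cls (f a - f c) = cls (f c - f a)"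
    using cls_minus[OF n(1)] cls_minus[OF n(2)] cls_minus[OF n(3)] by auto
  have d: "cls (f a - f b) \<noteq> cls (f b - f c)" "cls (f b - f c) \<noteq> cls (f c - f a)" "cls (f a - f b) \<noteq> cls (f c - f a)"
    using r by (auto simp: rainbow_def)
  show "f i - f j \<notin> I" if "i \<in> l" "j \<in> l" "i \<noteq> j" for i j
    using that n n' unfolding l by auto
  show "(i = i' \<and> j = j') \<or> (i = j' \<and> j = i')"
    if "i \<in> l" "j \<in> l" "i \<noteq> j" "i' \<in> l" "j' \<in> l" "i' \<noteq> j'" "cls (f i - f j) = cls (f i' - f j')" for i j i' j'
  proof -
    have edge: "({i, j} = {a, b} \<and> cls (f i - f j) = cls (f a - f b)) \<or>
        ({i, j} = {b, c} \<and> cls (f i - f j) = cls (f b - f c)) \<or>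
        ({i, j} = {c, a} \<and> cls (f i - f j) = cls (f c - f a))" if "i \<in> l" "j \<in> l" "i \<noteq> j" for i j
      using that sym unfolding l by auto
    have "{i, j} = {i', j'}" using edge[OF that(1-3)] edge[OF that(4-6)] that(7) d by metis
    then show ?thesis by (simp add: doubleton_eq_iff)
  qed
  show "\<exists>i\<in>l. \<exists>j\<in>l. i \<noteq> j \<and> cls (f i - f j) = x" if "x < 3"
  proof -
    have "cls (f a - f b) < 3" "cls (f b - f c) < 3" "cls (f c - f a) < 3" using n cls(1) by auto
    then have "x = cls (f a - f b) \<or> x = cls (f b - f c) \<or> x = cls (f c - f a)" using that d by linarith
    then show ?thesis using ne unfolding l by auto
  qed
qed

lemma cls_divide: "e * x \<simeq> d \<Longrightarrow> d \<notin> I \<Longrightarrow> cls e = cls d \<Longrightarrow> x \<notin> I \<and> cls x = 0"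
proof -
  assume a: "e * x \<simeq> d" "d \<notin> I" "cls e = cls d"
  then have "e * x \<notin> I" using eqv_I by blast
  then have ex: "e \<notin> I" "x \<notin> I" using I_mult I_mult2 by blast+
  have "cls e = (cls e + cls x) mod 3"
    using cls_eqv[OF a(1)] \<open>e * x \<notin> I\<close> cls_mult[OF ex] a(3) by simp
  moreover have "cls e < 3" "cls x < 3" using cls(1) ex by auto
  ultimately have "cls x = 0" by presburger
  then show ?thesis using ex by simp
qed

definition units6 :: "'a set" where "units6 = {(- 1) ^ a * w ^ k | a k. a < (2::nat) \<and> k < (3::nat)}"

lemma unit_power_eqv: "(- 1) ^ a * w ^ k \<simeq> (- 1) ^ a' * w ^ k' \<longleftrightarrow> a mod 2 = a' mod 2 \<and> k mod 3 = k' mod 3"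
proof
  assume "a mod 2 = a' mod 2 \<and> k mod 3 = k' mod 3"
  moreover from this have "(- 1) ^ a = ((- 1) ^ a' :: 'a)" by (metis even_iff_mod_2_eq_zero neg_one_even_power neg_one_odd_power)
  ultimately show "(- 1) ^ a * w ^ k \<simeq> (- 1) ^ a' * w ^ k'" using w_power_eqv_iff by (auto intro: eqv_mult)
next
  assume e: "(- 1) ^ a * w ^ k \<simeq> (- 1) ^ a' * w ^ k'"
  \<comment> \<open>Cubing removes the power of \<open>w\<close> and keeps the sign, which separates
    the two exponents.\<close>
  have cube: "((- 1) ^ a * w ^ k) ^ 3 \<simeq> (- 1) ^ a" for a k
  proof -
    have "((- 1) ^ a * w ^ k) ^ 3 = ((- 1) ^ 3) ^ a * (w ^ 3) ^ k"
      by (simp only: power_mult_distrib power_mult [symmetric] mult.commute)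
    also have "\<dots> \<simeq> ((- 1) ^ 3) ^ a * 1 ^ k" by (intro eqv_mult eqv_power w_cube eqv_refl)
    finally show ?thesis by simp
  qed
  have "(- 1) ^ a \<simeq> (- 1) ^ a'"
    using eqv_trans[OF eqv_sym[OF cube] eqv_trans[OF eqv_power[OF e] cube]] .
  then have par: "even a \<longleftrightarrow> even a'"
    using two_notin_I I_neg_iff[of 2] by (cases "even a"; cases "even a'") (auto simp: eqv_def)
  then have s: "(- 1) ^ a = ((- 1) ^ a' :: 'a)" by (metis neg_one_even_power neg_one_odd_power)
  have "(- 1) ^ a' \<notin> I" using one_notin_I by (cases "even a'") auto
  then have "w ^ k \<simeq> w ^ k'" using e eqv_mult_cancel[of "(- 1) ^ a'" "w ^ k" "w ^ k'"] unfolding s by blast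
  then show "a mod 2 = a' mod 2 \<and> k mod 3 = k' mod 3" using par w_power_eqv_iff by (auto simp: even_iff_mod_2_eq_zero)
qed

lemma units6_eq: "(- 1) ^ a * w ^ k \<simeq> (- 1) ^ (a mod 2) * w ^ (k mod 3)"
  unfolding unit_power_eqv by simp

lemma units6_notin_I: "u \<in> units6 \<Longrightarrow> u \<notin> I"
  by (auto simp: units6_def I_mult_iff I_power_iff one_notin_I w_notin_I)

text \<open>If \<open>w\<close> is a cube, the six units are all cubes, so they act on the set of
  cubes and a transversal of the orbits exists.\<close>

lemma transversal_units6:
  assumes "cls w = 0"
  shows "\<exists>S. (\<forall>s\<in>S. s \<notin> I \<and> cls s = 0) \<and> (\<forall>x. x \<notin> I \<longrightarrow> cls x = 0 \<longrightarrow> (\<exists>u\<in>units6. \<exists>s\<in>S. x \<simeq> u * s)) \<and>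
    (\<forall>u\<in>units6. \<forall>u'\<in>units6. \<forall>s\<in>S. \<forall>s'\<in>S. u * s \<simeq> u' * s' \<longrightarrow> u = u' \<and> s = s')"
proof -
  have cu: "cls u = 0" if u6: "u \<in> units6" for u
  proof -
    obtain a k where u: "u = (- 1) ^ a * w ^ k" using u6 by (auto simp: units6_def)
    have "cls (w ^ k) = 0" using cls_power[OF w_notin_I, of k] assms by simp
    moreover have "w ^ k \<notin> I" by (simp add: I_power_iff w_notin_I)
    ultimately show ?thesis using cls_minus[of "w ^ k"] u by (cases "even a") auto
  qed
  have "\<exists>S\<subseteq>{x. x \<notin> I \<and> cls x = 0}. (\<forall>x\<in>{x. x \<notin> I \<and> cls x = 0}. \<exists>u\<in>units6. \<exists>s\<in>S. x \<simeq> u * s) \<and>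
    (\<forall>u\<in>units6. \<forall>u'\<in>units6. \<forall>s\<in>S. \<forall>s'\<in>S. u * s \<simeq> u' * s' \<longrightarrow> u = u' \<and> s = s')"
  proof (rule transversal)
    show "1 \<in> units6" unfolding units6_def by (rule CollectI, intro exI[of _ 0]) simp
  next
    fix u v assume "u \<in> units6" "v \<in> units6"
    then obtain a k b l where u: "u = (- 1) ^ a * w ^ k" "v = (- 1) ^ b * w ^ l" by (auto simp: units6_def)
    have "u * v = (- 1) ^ (a + b) * w ^ (k + l)" by (simp add: u power_add ac_simps)
    then have "u * v \<simeq> (- 1) ^ ((a + b) mod 2) * w ^ ((k + l) mod 3)" using units6_eq by metis
    moreover have "(- 1) ^ ((a + b) mod 2) * w ^ ((k + l) mod 3) \<in> units6"
      unfolding units6_def by (rule CollectI, intro exI conjI) (rule refl, auto)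
    ultimately show "\<exists>x\<in>units6. u * v \<simeq> x" by blast
  next
    fix u assume "u \<in> units6"
    then obtain a k where u: "u = (- 1) ^ a * w ^ k" "a < 2" "k < 3" by (auto simp: units6_def)
    have "u * ((- 1) ^ a * w ^ ((3 - k) mod 3)) = (- 1) ^ (a + a) * w ^ (k + (3 - k) mod 3)"
      by (simp add: u power_add ac_simps)
    also have "\<dots> \<simeq> (- 1) ^ 0 * w ^ 0"
      unfolding unit_power_eqv using u(3) by (auto simp: mod_simps)
    finally have "u * ((- 1) ^ a * w ^ ((3 - k) mod 3)) \<simeq> 1" by simp
    moreover have "(- 1) ^ a * w ^ ((3 - k) mod 3) \<in> units6"
      unfolding units6_def using u(2) by (intro CollectI exI conjI) (rule refl, auto)
    ultimately show "\<exists>v\<in>units6. u * v \<simeq> 1" by blast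
  next
    fix u v assume uv: "u \<in> units6" "v \<in> units6" "u \<simeq> v"
    then obtain a k b l where u: "u = (- 1) ^ a * w ^ k" "v = (- 1) ^ b * w ^ l" "a < 2" "b < 2" "k < 3" "l < 3"
      by (auto simp: units6_def)
    then have "a = b" "k = l" using uv(3) unit_power_eqv by auto
    then show "u = v" by (simp add: u)
  next
    fix x u assume "x \<in> {x. x \<notin> I \<and> cls x = 0}" "u \<in> units6"
    then show "u * x \<in> {x. x \<notin> I \<and> cls x = 0}"
      using cls_mult[of u x] cu[of u] units6_notin_I[of u] by (simp add: I_mult_iff)
  qed auto
  then obtain S where S: "S \<subseteq> {x. x \<notin> I \<and> cls x = 0}" "\<forall>x\<in>{x. x \<notin> I \<and> cls x = 0}. \<exists>u\<in>units6. \<exists>s\<in>S. x \<simeq> u * s"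
    "\<forall>u\<in>units6. \<forall>u'\<in>units6. \<forall>s\<in>S. \<forall>s'\<in>S. u * s \<simeq> u' * s' \<longrightarrow> u = u' \<and> s = s'"
    by (elim exE conjE) (rule that)
  show ?thesis
  proof (intro exI[of _ S] conjI allI impI)
    show "\<forall>s\<in>S. s \<notin> I \<and> cls s = 0" using S(1) by auto
    show "\<exists>u\<in>units6. \<exists>s\<in>S. x \<simeq> u * s" if "x \<notin> I" "cls x = 0" for x using S(2) that by simp
  qed (rule S(3))
qed

lemma transversal_pm:
  shows "\<exists>S. (\<forall>s\<in>S. s \<notin> I \<and> cls s = 0) \<and> (\<forall>x. x \<notin> I \<longrightarrow> cls x = 0 \<longrightarrow> (\<exists>u\<in>{1, - 1}. \<exists>s\<in>S. x \<simeq> u * s)) \<and>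
    (\<forall>u\<in>{1, - 1}. \<forall>u'\<in>{1, - 1}. \<forall>s\<in>S. \<forall>s'\<in>S. u * s \<simeq> u' * s' \<longrightarrow> u = u' \<and> s = s')"
proof -
  have two: "1 + 1 \<notin> I" "- 1 - 1 \<notin> I" using two_notin_I I_neg_iff[of 2] by auto
  have "\<exists>S\<subseteq>{x. x \<notin> I \<and> cls x = 0}. (\<forall>x\<in>{x. x \<notin> I \<and> cls x = 0}. \<exists>u\<in>{1, - 1}. \<exists>s\<in>S. x \<simeq> u * s) \<and>
    (\<forall>u\<in>{1, - 1}. \<forall>u'\<in>{1, - 1}. \<forall>s\<in>S. \<forall>s'\<in>S. u * s \<simeq> u' * s' \<longrightarrow> u = u' \<and> s = s')"
  proof (rule transversal)
    fix u v :: 'a assume "u \<in> {1, - 1}" "v \<in> {1, - 1}" "u \<simeq> v"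
    then show "u = v" using two by (auto simp: eqv_def)
  qed (auto simp: cls_minus)
  then obtain S where S: "S \<subseteq> {x. x \<notin> I \<and> cls x = 0}" "\<forall>x\<in>{x. x \<notin> I \<and> cls x = 0}. \<exists>u\<in>{1, - 1}. \<exists>s\<in>S. x \<simeq> u * s"
    "\<forall>u\<in>{1, - 1}. \<forall>u'\<in>{1, - 1}. \<forall>s\<in>S. \<forall>s'\<in>S. u * s \<simeq> u' * s' \<longrightarrow> u = u' \<and> s = s'"
    by (elim exE conjE) (rule that)
  show ?thesis
  proof (intro exI[of _ S] conjI allI impI)
    show "\<forall>s\<in>S. s \<notin> I \<and> cls s = 0" using S(1) by auto
    show "\<exists>u\<in>{1, - 1}. \<exists>s\<in>S. x \<simeq> u * s" if "x \<notin> I" "cls x = 0" for x using S(2) that by simp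
  qed (rule S(3))
qed

text \<open>The class of \<open>d\<close> selects an edge of the line. The quotient of
  \<open>d\<close> by that difference is a cube, hence congruent to \<open>s\<close> or
  \<open>- s\<close>, and a minus sign is absorbed by exchanging the endpoints.\<close>

lemma rainbow_line_cover:
  assumes r: "rainbow_line f l" and d: "d \<notin> I"
    and S: "\<And>x. x \<notin> I \<Longrightarrow> cls x = 0 \<Longrightarrow> \<exists>u\<in>{1, - 1}. \<exists>s\<in>S. x \<simeq> u * s"
  shows "\<exists>s\<in>S. \<exists>i\<in>l. \<exists>j\<in>l. i \<noteq> j \<and> s * (f i - f j) \<simeq> d"
proof -
  obtain i j where ij: "i \<in> l" "j \<in> l" "i \<noteq> j" "cls (f i - f j) = cls d"
    using rainbow_lineD(3)[OF r cls(1)[OF d]] by blast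
  obtain x where x: "(f i - f j) * x \<simeq> d" using divide_ex rainbow_lineD(1)[OF r ij(1-3)] by blast
  then have "x \<notin> I \<and> cls x = 0" using cls_divide d ij(4) by blast
  then obtain u s where us: "u \<in> {1, - 1}" "s \<in> S" "x \<simeq> u * s" using S by meson
  have "d \<simeq> (f i - f j) * (u * s)" using eqv_trans[OF eqv_sym[OF x] eqv_mult[OF eqv_refl us(3)]] .
  then have *: "(f i - f j) * (u * s) \<simeq> d" by (rule eqv_sym)
  show ?thesis
  proof (cases "u = 1")
    case True
    then have "s * (f i - f j) \<simeq> d" using * by (simp add: mult.commute)
    then show ?thesis using us(2) ij(1-3) by (intro bexI[of _ s] bexI[of _ i] bexI[of _ j] conjI)
  next
    case False
    then have "u = - 1" using us(1) by simp
    then have "s * (f j - f i) \<simeq> d" using * by (simp add: algebra_simps)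
    then show ?thesis using us(2) ij(1-3) by (intro bexI[of _ s] bexI[of _ j] bexI[of _ i] conjI) auto
  qed
qed

lemma rainbow_line_unique:
  assumes r: "rainbow_line f l"
    and s: "s \<notin> I" "cls s = 0" "s' \<notin> I" "cls s' = 0" and pm: "\<And>u u'. u \<in> {1, - 1} \<Longrightarrow> u' \<in> {1, - 1} \<Longrightarrow> u * s \<simeq> u' * s' \<Longrightarrow> u = u' \<and> s = s'"
    and ij: "i \<in> l" "j \<in> l" "i \<noteq> j" "i' \<in> l" "j' \<in> l" "i' \<noteq> j'"
    and eq: "s * (f i - f j) \<simeq> s' * (f i' - f j')"
  shows "s = s' \<and> i = i' \<and> j = j'"
proof -
  have n: "f i - f j \<notin> I" "f i' - f j' \<notin> I" using rainbow_lineD(1)[OF r] ij by blast+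
  have "cls (s * (f i - f j)) = cls (s' * (f i' - f j'))" using cls_eqv[OF eq] s n by (simp add: I_mult_iff)
  then have "cls (f i - f j) = cls (f i' - f j')"
    using cls_mult[OF s(1) n(1)] cls_mult[OF s(3) n(2)] s cls(1)[OF n(1)] cls(1)[OF n(2)] by simp
  then consider "i = i'" "j = j'" | "i = j'" "j = i'" using rainbow_lineD(2)[OF r ij] by blast
  then show ?thesis
  proof cases
    case 1
    then have "1 * s \<simeq> 1 * s'" using eq n eqv_mult_cancel2 by simp
    then show ?thesis using pm[of 1 1] 1 by simp
  next
    case 2
    have "s * (f i - f j) \<simeq> (- 1 * s') * (f i - f j)" using eq by (simp add: 2 algebra_simps)
    then have "s \<simeq> - 1 * s'" using eqv_mult_cancel2[OF n(1)] by blast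
    then have "1 = (- 1 :: 'a)" using pm[of 1 "- 1"] by simp
    then have "(2 :: 'a) = 0" by (metis add.right_inverse one_add_one)
    then show ?thesis using two_notin_I I_zero by simp
  qed
qed

text \<open>A rainbow line has two opposite ordered differences in each class, so the multiples by
  cubes modulo \<open>1, - 1\<close> reach each nonzero residue once. All base planes are multiples
  of one labelling, with the same colouring.\<close>

lemma hesse_family_rainbow:
  assumes r: "\<And>l. l \<in> ag_lines \<Longrightarrow> rainbow_line f l"
  shows "hesse_family I q"
proof -
  obtain S where S': "\<forall>s\<in>S. s \<notin> I \<and> cls s = 0"
    "\<forall>x. x \<notin> I \<longrightarrow> cls x = 0 \<longrightarrow> (\<exists>u\<in>{1, - 1}. \<exists>s\<in>S. x \<simeq> u * s)"
    "\<forall>u\<in>{1, - 1}. \<forall>u'\<in>{1, - 1}. \<forall>s\<in>S. \<forall>s'\<in>S. u * s \<simeq> u' * s' \<longrightarrow> u = u' \<and> s = s'"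
    using transversal_pm by (elim exE conjE) (rule that)
  note S = S'(1)[rule_format] S'(2)[rule_format] S'(3)[rule_format]
  have "\<exists>B. covers I B (- I)"
  proof (rule covers_of_lines[where T = "S \<times> {id}" and f = f])
    fix i j :: nat assume "i < 9" "j < 9" "i \<noteq> j"
    then obtain l where "l \<in> ag_lines" "i \<in> l" "j \<in> l" using ag_lines_props(5) by blast
    then show "f i - f j \<notin> I" using rainbow_lineD(1)[OF r] \<open>i \<noteq> j\<close> by blast
  next
    fix l d assume "l \<in> ag_lines" "d \<notin> I"
    then obtain s i j where "s \<in> S" "i \<in> l" "j \<in> l" "i \<noteq> j" "s * (f i - f j) \<simeq> d"
      using rainbow_line_cover[OF r _ S(2)] by meson
    then show "\<exists>a \<rho> i j. (a, \<rho>) \<in> S \<times> {id} \<and> i \<in> \<rho> l \<and> j \<in> \<rho> l \<and> i \<noteq> j \<and> a * (f i - f j) \<simeq> d"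
      by (intro exI[of _ s] exI[of _ id] exI[of _ i] exI[of _ j]) simp
  next
    fix l a \<rho> i j a' \<rho>' i' j'
    assume "l \<in> ag_lines" "(a, \<rho>) \<in> S \<times> {id}" "i \<in> \<rho> l" "j \<in> \<rho> l" "i \<noteq> j"
      "(a', \<rho>') \<in> S \<times> {id}" "i' \<in> \<rho>' l" "j' \<in> \<rho>' l" "i' \<noteq> j'" "a * (f i - f j) \<simeq> a' * (f i' - f j')"
    then have a: "l \<in> ag_lines" "a \<in> S" "a' \<in> S" "\<rho> = id" "\<rho>' = id" "i \<in> l" "j \<in> l" "i \<noteq> j"
      "i' \<in> l" "j' \<in> l" "i' \<noteq> j'" "a * (f i - f j) \<simeq> a' * (f i' - f j')" by simp_all
    have "a = a' \<and> i = i' \<and> j = j'"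
    proof (rule rainbow_line_unique[OF r[OF a(1)] _ _ _ _ _ a(6-12)])
      show "a \<notin> I" "cls a = 0" "a' \<notin> I" "cls a' = 0" using S(1)[OF a(2)] S(1)[OF a(3)] by simp_all
      show "u = u' \<and> a = a'" if "u \<in> {1, - 1}" "u' \<in> {1, - 1}" "u * a \<simeq> u' * a'" for u u'
        by (rule S(3)[OF that(1,2) a(2,3) that(3)])
    qed
    then show "a = a' \<and> \<rho> = \<rho>' \<and> i = i' \<and> j = j'" using a(4,5) by simp
  qed (use S(1) in auto)
  then show ?thesis unfolding hesse_family_def using I_subgrp I_has_index by blast
qed

end

section \<open>The labelling when the root of unity is not a cube\<close>

definition idx :: "nat \<Rightarrow> nat \<Rightarrow> nat" where "idx i j = 3 * (i mod 3) + j mod 3"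

definition ag_line :: "nat \<Rightarrow> nat \<Rightarrow> nat \<Rightarrow> nat \<Rightarrow> nat set" where
  "ag_line di dj i j = {idx i j, idx (i + di) (j + dj), idx (i + 2 * di) (j + 2 * dj)}"

lemma ag_lines_directions:
  "ag_lines = {ag_line 0 1 i 0 | i. i < 3} \<union> {ag_line 1 0 0 j | j. j < 3} \<union>
     {ag_line 1 1 0 j | j. j < 3} \<union> {ag_line 1 2 0 j | j. j < 3}"
proof -
  have *: "{f i | i. i < (3::nat)} = {f 0, f 1, f 2}" for f :: "nat \<Rightarrow> nat set"
  proof -
    have "{f i | i. i < (3::nat)} = f ` {..<3}" by auto
    also have "{..<3::nat} = {0, 1, 2}" by auto
    finally show ?thesis by simp
  qed
  show ?thesis unfolding * ag_lines_def ag_line_def idx_def by (simp add: insert_commute numeral_2_eq_2)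
qed

context cubic_field
begin

lemma one_minus_w: "1 - w \<notin> I"
  using w_minus_one I_neg_iff[of "w - 1"] by simp

lemma one_minus_w_sq: "1 - w\<^sup>2 \<notin> I"
  using w_sq_minus_one I_neg_iff[of "w\<^sup>2 - 1"] by simp

lemma one_minus_w_sq_eqv: "1 - w\<^sup>2 \<simeq> - ((1 - w) * w\<^sup>2)"
proof -
  have "(1 - w\<^sup>2) - - ((1 - w) * w\<^sup>2) = - (w ^ 3 - 1)" by (simp add: algebra_simps power2_eq_square power3_eq_cube)
  moreover have "- (w ^ 3 - 1) \<in> I" using w_cube I_neg by (simp only: eqv_def)
  ultimately show ?thesis unfolding eqv_def by metis
qed

text \<open>By the first assumption \<open>F\<close> has period 3 in both arguments up to
  congruence. The closing difference may therefore end at step 3 instead of step 0, which makes all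
  three differences instances of one formula.\<close>

lemma rainbow_line_direction:
  assumes f: "\<And>i j. f (idx i j) \<simeq> F i j"
    and r: "rainbow (F i j - F (i + di) (j + dj)) (F (i + di) (j + dj) - F (i + 2 * di) (j + 2 * dj))
        (F (i + 2 * di) (j + 2 * dj) - F (i + 3 * di) (j + 3 * dj))"
  shows "rainbow_line f (ag_line di dj i j)"
  unfolding rainbow_line_def
proof (intro exI conjI)
  show "ag_line di dj i j = {idx i j, idx (i + di) (j + dj), idx (i + 2 * di) (j + 2 * dj)}" by (simp add: ag_line_def)
  have f3: "f (idx i j) \<simeq> F (i + 3 * di) (j + 3 * dj)"
    using f[of "i + 3 * di" "j + 3 * dj"] by (simp add: idx_def)
  show "rainbow (f (idx i j) - f (idx (i + di) (j + dj)))
      (f (idx (i + di) (j + dj)) - f (idx (i + 2 * di) (j + 2 * dj)))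
      (f (idx (i + 2 * di) (j + 2 * dj)) - f (idx i j))"
    by (rule rainbow_eqv[OF r]) (intro eqv_diff eqv_sym[OF f] eqv_sym[OF f3])+
qed

lemma rainbow_powers:
  assumes "cls w \<noteq> 0" "d \<notin> I"
  shows "rainbow d (d * w) (d * w\<^sup>2)"
proof -
  have w: "w \<notin> I" "w\<^sup>2 \<notin> I" using w_notin_I by (auto simp: I_power_iff)
  have "cls w < 3" "cls d < 3" using cls(1) w(1) assms(2) by auto
  have "cls (d * w) = (cls d + cls w) mod 3" using cls_mult[OF assms(2) w(1)] .
  have "cls (d * w\<^sup>2) = (cls d + 2 * cls w) mod 3"
    using cls_mult[OF assms(2) w(2)] cls_power[OF w(1), of 2] by (simp add: mod_simps)
  have "cls d \<noteq> cls (d * w) \<and> cls (d * w) \<noteq> cls (d * w\<^sup>2) \<and> cls d \<noteq> cls (d * w\<^sup>2)"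
  proof -
    have *: "\<forall>c\<in>{0, 1, 2}. \<forall>v\<in>{1, 2}. c \<noteq> (c + v) mod 3 \<and> (c + v) mod 3 \<noteq> (c + 2 * v) mod 3 \<and> c \<noteq> (c + 2 * v) mod (3::nat)"
      by simp
    have "cls d \<in> {0, 1, 2}" "cls w \<in> {1, 2}" using \<open>cls w < 3\<close> \<open>cls d < 3\<close> assms(1) by auto
    then show ?thesis using * \<open>cls (d * w) = _\<close> \<open>cls (d * w\<^sup>2) = _\<close> by auto
  qed
  then show ?thesis using assms(2) w by (simp add: rainbow_def I_mult_iff)
qed

text \<open>In the directions (0,1), (1,0) and (1,1) each step multiplies the difference by
  \<open>w\<close> and so changes its class. Only the direction (1,2) imposes a condition, and there
  the differences are proportional to the triple in \<open>r\<close>.\<close>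

lemma hesse_family_noncube_root:
  assumes cw: "cls w \<noteq> 0" and e: "e \<notin> I"
    and r: "rainbow (1 - e) (w * (1 - e * w)) (w\<^sup>2 * (1 - e * w\<^sup>2))"
  shows "hesse_family I q"
proof -
  define F where "F i j = w ^ i + e * w ^ j" for i j
  define f where "f x = F (x div 3) (x mod 3)" for x
  have f: "f (idx i j) \<simeq> F i j" for i j
  proof -
    have "f (idx i j) = F (i mod 3) (j mod 3)" by (simp add: f_def idx_def)
    also have "\<dots> \<simeq> F i j" unfolding F_def
      by (intro eqv_add eqv_mult eqv_sym[OF w_power_mod] eqv_refl)
    finally show ?thesis .
  qed
  \<comment> \<open>If \<open>1 + e w^k\<close> vanished, the entries of the triple in
    \<open>r\<close> with exponents \<open>k + 1\<close> and \<open>k + 2\<close>, read modulo 3,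
    would be congruent.\<close>
  have size: "1 + e * w ^ j \<notin> I" for j
  proof
    assume a: "1 + e * w ^ j \<in> I"
    let ?X = "\<lambda>m. w ^ m * (1 - e * w ^ m)"
    have r': "cls (?X 0) \<noteq> cls (?X 1)" "cls (?X 1) \<noteq> cls (?X 2)" "cls (?X 0) \<noteq> cls (?X 2)"
      and nz: "?X 0 \<notin> I" "?X 1 \<notin> I" "?X 2 \<notin> I" using r by (auto simp: rainbow_def)
    have eq: "?X (k + 1) \<simeq> ?X (k + 2)" if k: "k mod 3 = j mod 3" for k
    proof -
      have "1 + e * w ^ k \<in> I"
        using a eqv_I[OF eqv_add[OF eqv_refl eqv_mult[OF eqv_refl]], of "w ^ k" "w ^ j" 1 e] k w_power_eqv_iff by blast
      then have "w ^ (k + 1) * (1 - w) * (1 + e * w ^ k) \<in> I" by (rule I_mult)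
      moreover have "?X (k + 1) - ?X (k + 2) = w ^ (k + 1) * (1 - w) * (1 + e * w ^ k)
          + e * w ^ (2 * k + 1) * (w ^ 3 - 1)"
        by (simp add: algebra_simps power_add power_mult power2_eq_square power3_eq_cube mult_2_right)
      moreover have "e * w ^ (2 * k + 1) * (w ^ 3 - 1) \<in> I" using w_cube I_mult by (simp add: eqv_def)
      ultimately show ?thesis unfolding eqv_def using I_add by metis
    qed
    have X3: "?X (m + 3) \<simeq> ?X m" for m
      by (intro eqv_mult eqv_diff eqv_refl) (simp_all add: w_power_eqv_iff)
    have eq2: "?X a \<simeq> ?X b" if "k mod 3 = j mod 3" "a = k + 1" "b = k + 2" for k a b
      using eq[OF that(1)] unfolding that(2,3) .
    have X30: "?X 3 \<simeq> ?X 0" and X41: "?X 4 \<simeq> ?X 1" using X3[of 0] X3[of 1] by simp_all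
    have "j mod 3 = 0 \<or> j mod 3 = 1 \<or> j mod 3 = 2" by linarith
    then show False
    proof (elim disjE)
      assume "j mod 3 = 0"
      then have "?X 1 \<simeq> ?X 2" by (intro eq2[of 0]) simp_all
      then show False using cls_eqv[of "?X 1" "?X 2"] nz(2) r'(2) by simp
    next
      assume "j mod 3 = 1"
      then have "?X 2 \<simeq> ?X 3" by (intro eq2[of 1]) simp_all
      then have "?X 2 \<simeq> ?X 0" using X30 by (rule eqv_trans)
      then have "cls (?X 2) = cls (?X 0)" using nz(3) by (rule cls_eqv)
      then show False using r'(3) by simp
    next
      assume "j mod 3 = 2"
      then have "?X 3 \<simeq> ?X 4" by (intro eq2[of 2]) simp_all
      then have "?X 0 \<simeq> ?X 4" using eqv_sym[OF X30] by (rule eqv_trans[rotated])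
      then have "?X 0 \<simeq> ?X 1" using X41 by (rule eqv_trans)
      then have "cls (?X 0) = cls (?X 1)" using nz(1) by (rule cls_eqv)
      then show False using r'(1) by simp
    qed
  qed
  have L01: "rainbow_line f (ag_line 0 1 i j)" for i j
  proof (rule rainbow_line_direction[of f F, OF f])
    let ?d = "e * (1 - w) * w ^ j"
    have "?d \<notin> I" using e one_minus_w w_notin_I by (simp add: I_mult_iff I_power_iff)
    moreover have "F i j - F (i + 0) (j + 1) = ?d" "F (i + 0) (j + 1) - F (i + 2 * 0) (j + 2 * 1) = ?d * w"
      "F (i + 2 * 0) (j + 2 * 1) - F (i + 3 * 0) (j + 3 * 1) = ?d * w\<^sup>2"
      by (simp_all add: F_def algebra_simps power_add power2_eq_square power3_eq_cube)
    ultimately show "rainbow (F i j - F (i + 0) (j + 1)) (F (i + 0) (j + 1) - F (i + 2 * 0) (j + 2 * 1))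
        (F (i + 2 * 0) (j + 2 * 1) - F (i + 3 * 0) (j + 3 * 1))" using rainbow_powers[OF cw] by metis
  qed
  have L10: "rainbow_line f (ag_line 1 0 i j)" for i j
  proof (rule rainbow_line_direction[of f F, OF f])
    let ?d = "(1 - w) * w ^ i"
    have "?d \<notin> I" using one_minus_w w_notin_I by (simp add: I_mult_iff I_power_iff)
    moreover have "F i j - F (i + 1) (j + 0) = ?d" "F (i + 1) (j + 0) - F (i + 2 * 1) (j + 2 * 0) = ?d * w"
      "F (i + 2 * 1) (j + 2 * 0) - F (i + 3 * 1) (j + 3 * 0) = ?d * w\<^sup>2"
      by (simp_all add: F_def algebra_simps power_add power2_eq_square power3_eq_cube)
    ultimately show "rainbow (F i j - F (i + 1) (j + 0)) (F (i + 1) (j + 0) - F (i + 2 * 1) (j + 2 * 0))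
        (F (i + 2 * 1) (j + 2 * 0) - F (i + 3 * 1) (j + 3 * 0))" using rainbow_powers[OF cw] by metis
  qed
  have L11: "rainbow_line f (ag_line 1 1 0 j)" for j
  proof (rule rainbow_line_direction[of f F, OF f])
    let ?d = "(1 - w) * (1 + e * w ^ j)"
    have "?d \<notin> I" using one_minus_w size by (simp add: I_mult_iff)
    moreover have "F 0 j - F (0 + 1) (j + 1) = ?d" "F (0 + 1) (j + 1) - F (0 + 2 * 1) (j + 2 * 1) = ?d * w"
      "F (0 + 2 * 1) (j + 2 * 1) - F (0 + 3 * 1) (j + 3 * 1) = ?d * w\<^sup>2"
      by (simp_all add: F_def algebra_simps power_add power2_eq_square power3_eq_cube)
    ultimately show "rainbow (F 0 j - F (0 + 1) (j + 1)) (F (0 + 1) (j + 1) - F (0 + 2 * 1) (j + 2 * 1))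
        (F (0 + 2 * 1) (j + 2 * 1) - F (0 + 3 * 1) (j + 3 * 1))" using rainbow_powers[OF cw] by metis
  qed
  let ?Y = "\<lambda>m. w ^ m * (1 - e * w ^ m)"
  have rY: "rainbow (?Y m) (?Y (m + 1)) (?Y (m + 2))" for m
  proof (induction m)
    case 0
    show ?case using r by (simp only: add_0 power_0 power_one_right mult_1_left mult_1_right)
  next
    case (Suc m)
    have Y3: "?Y (m + 3) \<simeq> ?Y m"
      by (intro eqv_mult eqv_diff eqv_refl) (simp_all add: w_power_eqv_iff)
    show ?case
      using rainbow_eqv[OF rainbow_rotate[OF Suc.IH] eqv_refl eqv_refl eqv_sym[OF Y3]] by (simp add: numeral_eq_Suc)
  qed
  have L12: "rainbow_line f (ag_line 1 2 0 j)" for j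
  proof (rule rainbow_line_direction[of f F, OF f])
    \<comment> \<open>The power of \<open>w\<close> cancels the \<open>w ^ (j + 2)\<close> in
      \<open>?Y (j + 2)\<close>, exponents counting modulo 3. The shift by 2 comes from rewriting
      \<open>1 - w^2\<close> as \<open>- (1 - w) w^2\<close>.\<close>
    let ?c = "(1 - w) * w ^ (2 * (j + 2))"
    have "?c \<notin> I" using one_minus_w w_notin_I by (simp add: I_mult_iff I_power_iff)
    then have rr: "rainbow (?c * ?Y (j + 2)) (?c * ?Y (j + 2 + 1)) (?c * ?Y (j + 2 + 2))" using rY rainbow_mult by blast
    have st: "?c * ?Y (j + 2 + i) \<simeq> F i (j + 2 * i) - F (i + 1) (j + 2 * (i + 1))" for i
    proof -
      have "F i (j + 2 * i) - F (i + 1) (j + 2 * (i + 1)) = w ^ i * (1 - w) + e * w ^ (j + 2 * i) * (1 - w\<^sup>2)"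
        by (simp add: F_def algebra_simps power_add power2_eq_square)
      also have "\<dots> \<simeq> w ^ i * (1 - w) + e * w ^ (j + 2 * i) * - ((1 - w) * w\<^sup>2)"
        by (intro eqv_add eqv_mult eqv_refl one_minus_w_sq_eqv)
      also have "\<dots> = (1 - w) * (w ^ i - e * w ^ (j + 2 * i + 2))" by (simp add: algebra_simps power_add power2_eq_square)
      also have "\<dots> \<simeq> (1 - w) * (w ^ (2 * (j + 2) + (j + 2 + i)) - e * w ^ (2 * (j + 2) + (j + 2 + i) + (j + 2 + i)))"
      proof (intro eqv_mult eqv_diff eqv_refl)
        have *: "(3 * a + b) mod 3 = b mod 3" for a b :: nat by simp
        show "w ^ i \<simeq> w ^ (2 * (j + 2) + (j + 2 + i))"
          unfolding w_power_eqv_iff using *[of "j + 2" i] by (simp add: algebra_simps)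
        show "w ^ (j + 2 * i + 2) \<simeq> w ^ (2 * (j + 2) + (j + 2 + i) + (j + 2 + i))"
          unfolding w_power_eqv_iff using *[of "j + 2" "j + 2 * i + 2"] by (simp add: algebra_simps)
      qed
      also have "\<dots> = ?c * ?Y (j + 2 + i)"
      proof -
        have "(1 - w) * (w ^ (A + B) - e * w ^ (A + B + B)) = (1 - w) * w ^ A * (w ^ B * (1 - e * w ^ B))" for A B
          by (simp add: power_add algebra_simps)
        then show ?thesis .
      qed
      finally show ?thesis by (rule eqv_sym)
    qed
    have st': "?c * ?Y b \<simeq> F i x - F i' x'" if "b = j + 2 + i" "x = j + 2 * i" "i' = i + 1" "x' = j + 2 * (i + 1)" for b i x i' x'
      unfolding that by (rule st)
    show "rainbow (F 0 j - F (0 + 1) (j + 2)) (F (0 + 1) (j + 2) - F (0 + 2 * 1) (j + 2 * 2))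
        (F (0 + 2 * 1) (j + 2 * 2) - F (0 + 3 * 1) (j + 3 * 2))"
    proof (rule rainbow_eqv[OF rr])
      show "?c * ?Y (j + 2) \<simeq> F 0 j - F (0 + 1) (j + 2)" by (rule st') simp_all
      show "?c * ?Y (j + 2 + 1) \<simeq> F (0 + 1) (j + 2) - F (0 + 2 * 1) (j + 2 * 2)" by (rule st') simp_all
      show "?c * ?Y (j + 2 + 2) \<simeq> F (0 + 2 * 1) (j + 2 * 2) - F (0 + 3 * 1) (j + 3 * 2)" by (rule st') simp_all
    qed
  qed
  show ?thesis
    by (rule hesse_family_rainbow[of f]) (use L01 L10 L11 L12 in \<open>auto simp: ag_lines_directions\<close>)
qed

end

section \<open>Recolouring three equilateral lines\<close>

context cubic_field
begin

text \<open>The six ordered differences of such a triangle are \<open>z\<close> times the six units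
  \<open>1\<close>, \<open>w\<close>, \<open>w^2\<close> and their negatives, and these units are
  pairwise incongruent.\<close>

lemma equilateral_edges:
  assumes l: "l = {i, j, k}" "i \<noteq> j" "j \<noteq> k" "i \<noteq> k" and z: "z \<notin> I"
    and e: "f i - f j \<simeq> z" "f j - f k \<simeq> w * z" "f k - f i \<simeq> w\<^sup>2 * z"
  shows "\<And>a m. a < 2 \<Longrightarrow> m < 3 \<Longrightarrow> \<exists>x\<in>l. \<exists>y\<in>l. x \<noteq> y \<and> f x - f y \<simeq> (- 1) ^ a * w ^ m * z"
    and "\<And>x y. x \<in> l \<Longrightarrow> y \<in> l \<Longrightarrow> x \<noteq> y \<Longrightarrow> \<exists>a<2. \<exists>m<3. f x - f y \<simeq> (- 1) ^ a * w ^ m * z"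
    and "\<And>x y x' y'. x \<in> l \<Longrightarrow> y \<in> l \<Longrightarrow> x \<noteq> y \<Longrightarrow> x' \<in> l \<Longrightarrow> y' \<in> l \<Longrightarrow> x' \<noteq> y' \<Longrightarrow>
      f x - f y \<simeq> f x' - f y' \<Longrightarrow> x = x' \<and> y = y'"
proof -
  define pp where "pp a m = (if a = 0 then [(i, j), (j, k), (k, i)] ! m else [(j, i), (k, j), (i, k)] ! m)" for a m :: nat
  have e': "f j - f i \<simeq> - z" "f k - f j \<simeq> - (w * z)" "f i - f k \<simeq> - (w\<^sup>2 * z)"
    using eqv_minus[OF e(1)] eqv_minus[OF e(2)] eqv_minus[OF e(3)] by simp_all
  have pp: "fst (pp a m) \<in> l \<and> snd (pp a m) \<in> l \<and> fst (pp a m) \<noteq> snd (pp a m) \<and>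
      f (fst (pp a m)) - f (snd (pp a m)) \<simeq> (- 1) ^ a * w ^ m * z" if "a < 2" "m < 3" for a m
  proof -
    have "a = 0 \<or> a = 1" "m = 0 \<or> m = 1 \<or> m = 2" using that by auto
    then show ?thesis using l e e' by (elim disjE) (simp_all add: pp_def)
  qed
  have cases: "\<exists>a<2. \<exists>m<3. (x, y) = pp a m" if xy: "x \<in> l" "y \<in> l" "x \<noteq> y" for x y
  proof -
    have "(x, y) \<in> {pp 0 0, pp 0 1, pp 0 2, pp 1 0, pp 1 1, pp 1 2}"
      using xy unfolding l(1) pp_def by auto
    moreover have "(0::nat) < 2" "(1::nat) < 2" "(0::nat) < 3" "(1::nat) < 3" "(2::nat) < 3" by simp_all
    ultimately show ?thesis by blast
  qed
  show "\<exists>x\<in>l. \<exists>y\<in>l. x \<noteq> y \<and> f x - f y \<simeq> (- 1) ^ a * w ^ m * z" if "a < 2" "m < 3" for a m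
    using pp[OF that] by blast
  show "\<exists>a<2. \<exists>m<3. f x - f y \<simeq> (- 1) ^ a * w ^ m * z" if xy: "x \<in> l" "y \<in> l" "x \<noteq> y" for x y
  proof -
    obtain a m where am: "a < 2" "m < 3" "(x, y) = pp a m" using cases[OF xy] by blast
    have "f x - f y \<simeq> (- 1) ^ a * w ^ m * z" using pp[OF am(1,2)] unfolding am(3) [symmetric] by simp
    then show ?thesis using am by blast
  qed
  show "x = x' \<and> y = y'"
    if xy: "x \<in> l" "y \<in> l" "x \<noteq> y" "x' \<in> l" "y' \<in> l" "x' \<noteq> y'" "f x - f y \<simeq> f x' - f y'" for x y x' y'
  proof -
    obtain a m where am: "a < 2" "m < 3" "(x, y) = pp a m" using cases[OF xy(1-3)] by blast
    obtain a' m' where am': "a' < 2" "m' < 3" "(x', y') = pp a' m'" using cases[OF xy(4-6)] by blast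
    have 1: "f x - f y \<simeq> (- 1) ^ a * w ^ m * z" using pp[OF am(1,2)] unfolding am(3) [symmetric] by simp
    have 2: "f x' - f y' \<simeq> (- 1) ^ a' * w ^ m' * z" using pp[OF am'(1,2)] unfolding am'(3) [symmetric] by simp
    have "(- 1) ^ a * w ^ m * z \<simeq> (- 1) ^ a' * w ^ m' * z"
      by (rule eqv_trans[OF eqv_sym[OF 1] eqv_trans[OF xy(7) 2]])
    then have "(- 1) ^ a * w ^ m \<simeq> (- 1) ^ a' * w ^ m'" using eqv_mult_cancel2[OF z] by blast
    then have "a = a'" "m = m'" using unit_power_eqv am am' by auto
    then show ?thesis using am(3) am'(3) by (metis prod.inject)
  qed
qed

text \<open>The multiplier \<open>w ^ k * s\<close> is paired with the rotation by \<open>k\<close>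
  of the lines \<open>E 0\<close>, \<open>E 1\<close>, \<open>E 2\<close>. In the colour of one of
  them the three rotations display all three, whose sides \<open>z m\<close> lie in different
  classes. Each equilateral line already contributes the six units, so \<open>s\<close> runs over
  cubes modulo \<open>units6\<close>. For the remaining lines the products \<open>w ^ k * s\<close>
  are the cubes modulo \<open>1, - 1\<close>, as in the plain rainbow case.\<close>

lemma hesse_family_recolored:
  fixes E :: "nat \<Rightarrow> nat set" and z :: "nat \<Rightarrow> 'a"
  assumes cw: "cls w = 0"
    and E: "\<And>m. m < 3 \<Longrightarrow> E m \<in> ag_lines" "\<And>m m'. m < 3 \<Longrightarrow> m' < 3 \<Longrightarrow> E m = E m' \<Longrightarrow> m = m'"
    and eq: "\<And>m. m < 3 \<Longrightarrow> \<exists>i j k. E m = {i, j, k} \<and> i \<noteq> j \<and> j \<noteq> k \<and> i \<noteq> k \<and>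
      f i - f j \<simeq> z m \<and> f j - f k \<simeq> w * z m \<and> f k - f i \<simeq> w\<^sup>2 * z m"
    and z: "rainbow (z 0) (z 1) (z 2)"
    and r: "\<And>l. l \<in> ag_lines \<Longrightarrow> (\<forall>m<3. l \<noteq> E m) \<Longrightarrow> rainbow_line f l"
  shows "hesse_family I q"
proof -
  obtain S where S': "\<forall>s\<in>S. s \<notin> I \<and> cls s = 0"
    "\<forall>x. x \<notin> I \<longrightarrow> cls x = 0 \<longrightarrow> (\<exists>u\<in>units6. \<exists>s\<in>S. x \<simeq> u * s)"
    "\<forall>u\<in>units6. \<forall>u'\<in>units6. \<forall>s\<in>S. \<forall>s'\<in>S. u * s \<simeq> u' * s' \<longrightarrow> u = u' \<and> s = s'"
    using transversal_units6[OF cw] by (elim exE conjE) (rule that)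
  note S = S'(1)[rule_format] S'(2)[rule_format] S'(3)[rule_format]
  have S_ex: "\<exists>a<2. \<exists>k<3. \<exists>s\<in>S. x \<simeq> (- 1) ^ a * w ^ k * s" if x: "x \<notin> I" "cls x = 0" for x
  proof -
    obtain u s where us: "u \<in> units6" "s \<in> S" "x \<simeq> u * s" using S(2)[OF x] by blast
    obtain a k where "u = (- 1) ^ a * w ^ k" "a < 2" "k < 3" using us(1) unfolding units6_def by blast
    then show ?thesis using us by blast
  qed
  have S_un: "a = a' \<and> k = k' \<and> s = s'"
    if "(- 1) ^ a * w ^ k * s \<simeq> (- 1) ^ a' * w ^ k' * s'" "a < 2" "a' < 2" "k < 3" "k' < 3" "s \<in> S" "s' \<in> S"
    for a a' k k' s s'
  proof -
    have "(- 1) ^ a * w ^ k \<in> units6" "(- 1) ^ a' * w ^ k' \<in> units6" unfolding units6_def using that by blast+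
    then have "(- 1) ^ a * w ^ k = (- 1) ^ a' * w ^ k'" "s = s'" using S(3) that by blast+
    then show ?thesis using unit_power_eqv[of a k a' k'] that by simp
  qed
  have zn: "z m \<notin> I" if "m < 3" for m
  proof -
    have "m = 0 \<or> m = 1 \<or> m = 2" using that by linarith
    then show ?thesis using z by (auto simp: rainbow_def)
  qed
  have zcls: "cls (z m) = cls (z m') \<Longrightarrow> m = m'" if "m < 3" "m' < 3" for m m'
  proof -
    have "m = 0 \<or> m = 1 \<or> m = 2" "m' = 0 \<or> m' = 1 \<or> m' = 2" using that by linarith+
    then show "cls (z m) = cls (z m') \<Longrightarrow> m = m'" using z by (auto simp: rainbow_def)
  qed
  have zex: "\<exists>m<3. cls (z m) = x" if x: "x < 3" for x
  proof -
    have "cls (z 0) < 3" "cls (z 1) < 3" "cls (z 2) < 3" using zn cls(1) by simp_all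
    then have "x = cls (z 0) \<or> x = cls (z 1) \<or> x = cls (z 2)" using z x unfolding rainbow_def by linarith
    then show ?thesis by (metis zero_less_numeral one_less_numeral_iff semiring_norm(77) numeral_less_iff semiring_norm(76) less_numeral_extra(1) lessI numeral_2_eq_2 numeral_3_eq_3 less_Suc_eq)
  qed
  have edges: "\<And>a m. a < 2 \<Longrightarrow> m < 3 \<Longrightarrow> \<exists>x\<in>E b. \<exists>y\<in>E b. x \<noteq> y \<and> f x - f y \<simeq> (- 1) ^ a * w ^ m * z b"
    "\<And>x y. x \<in> E b \<Longrightarrow> y \<in> E b \<Longrightarrow> x \<noteq> y \<Longrightarrow> \<exists>a<2. \<exists>m<3. f x - f y \<simeq> (- 1) ^ a * w ^ m * z b"
    "\<And>x y x' y'. x \<in> E b \<Longrightarrow> y \<in> E b \<Longrightarrow> x \<noteq> y \<Longrightarrow> x' \<in> E b \<Longrightarrow> y' \<in> E b \<Longrightarrow> x' \<noteq> y' \<Longrightarrow>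
      f x - f y \<simeq> f x' - f y' \<Longrightarrow> x = x' \<and> y = y'" if b: "b < 3" for b
  proof -
    obtain i j k where *: "E b = {i, j, k}" "i \<noteq> j" "j \<noteq> k" "i \<noteq> k"
      "f i - f j \<simeq> z b" "f j - f k \<simeq> w * z b" "f k - f i \<simeq> w\<^sup>2 * z b" using eq[OF b] by blast
    note ee = equilateral_edges[OF *(1-4) zn[OF b] *(5-7)]
    show "\<And>a m. a < 2 \<Longrightarrow> m < 3 \<Longrightarrow> \<exists>x\<in>E b. \<exists>y\<in>E b. x \<noteq> y \<and> f x - f y \<simeq> (- 1) ^ a * w ^ m * z b" by (rule ee(1))
    show "\<And>x y. x \<in> E b \<Longrightarrow> y \<in> E b \<Longrightarrow> x \<noteq> y \<Longrightarrow> \<exists>a<2. \<exists>m<3. f x - f y \<simeq> (- 1) ^ a * w ^ m * z b" by (rule ee(2))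
    show "\<And>x y x' y'. x \<in> E b \<Longrightarrow> y \<in> E b \<Longrightarrow> x \<noteq> y \<Longrightarrow> x' \<in> E b \<Longrightarrow> y' \<in> E b \<Longrightarrow> x' \<noteq> y' \<Longrightarrow>
      f x - f y \<simeq> f x' - f y' \<Longrightarrow> x = x' \<and> y = y'" by (rule ee(3))
  qed
  define \<rho> where "\<rho> k l = (if l = E 0 then E (k mod 3) else if l = E 1 then E ((1 + k) mod 3)
    else if l = E 2 then E ((2 + k) mod 3) else l)" for k :: nat and l
  have \<rho>E: "\<rho> k (E m) = E ((m + k) mod 3)" if "m < 3" for k m
  proof -
    have "m = 0 \<or> m = 1 \<or> m = 2" using that by linarith
    then show ?thesis using E(2)[of 0 1] E(2)[of 0 2] E(2)[of 1 2] by (auto simp: \<rho>_def)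
  qed
  have \<rho>o: "\<rho> k l = l" if "\<forall>m<3. l \<noteq> E m" for k l using that by (simp add: \<rho>_def)
  have \<rho>_bij: "bij_betw (\<rho> k) ag_lines ag_lines" for k
  proof -
    have into: "\<rho> k l \<in> ag_lines" if "l \<in> ag_lines" for k l
      using that E(1) \<rho>E \<rho>o by (metis mod_less_divisor zero_less_numeral)
    have inv: "\<rho> k (\<rho> k' l) = l" if "(k + k') mod 3 = 0" for k k' l
    proof (cases "\<forall>m<3. l \<noteq> E m")
      case True
      then show ?thesis by (simp add: \<rho>o)
    next
      case False
      then obtain m where m: "m < 3" "l = E m" by blast
      have "((m + k') mod 3 + k) mod 3 = (m + (k + k') mod 3) mod 3" by (simp add: mod_simps ac_simps)
      then show ?thesis using m that by (simp add: \<rho>E)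
    qed
    have "(k + 2 * k) mod 3 = 0" "(2 * k + k) mod 3 = 0" by simp_all
    then show ?thesis using inv into by (intro bij_betw_byWitness[of _ "\<rho> (2 * k)"]) auto
  qed
  define T where "T = {(w ^ k * s, \<rho> k) | k s. k < 3 \<and> s \<in> S}"
  have cS: "w ^ k * s \<notin> I" "cls (w ^ k * s) = 0" if "s \<in> S" for k s
    using S(1)[OF that] cls_mult[of "w ^ k" s] cls_power[OF w_notin_I, of k] cw w_notin_I
    by (simp_all add: I_mult_iff I_power_iff)
  have "\<exists>B. covers I B (- I)"
  proof (rule covers_of_lines[where T = T and f = f])
    fix a \<tau> assume "(a, \<tau>) \<in> T"
    then obtain k s where "a = w ^ k * s" "\<tau> = \<rho> k" "s \<in> S" unfolding T_def by blast
    then show "a \<notin> I \<and> bij_betw \<tau> ag_lines ag_lines" using cS(1) \<rho>_bij by simp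
  next
    fix i j :: nat assume ij: "i < 9" "j < 9" "i \<noteq> j"
    then obtain l where l: "l \<in> ag_lines" "i \<in> l" "j \<in> l" using ag_lines_props(5) by blast
    show "f i - f j \<notin> I"
    proof (cases "\<forall>m<3. l \<noteq> E m")
      case True
      then show ?thesis using rainbow_lineD(1)[OF r[OF l(1)]] l ij by blast
    next
      case False
      then obtain m where m: "m < 3" "l = E m" by blast
      then obtain a k where "f i - f j \<simeq> (- 1) ^ a * w ^ k * z m" using edges(2)[OF m(1)] l ij by blast
      moreover have "(- 1) ^ a * w ^ k * z m \<notin> I"
        using zn[OF m(1)] w_notin_I one_notin_I by (cases "even a") (auto simp: I_mult_iff I_power_iff)
      ultimately show ?thesis using eqv_I by blast
    qed
  next
    fix l d assume l: "l \<in> ag_lines" and d: "d \<notin> I"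
    show "\<exists>a \<tau> i j. (a, \<tau>) \<in> T \<and> i \<in> \<tau> l \<and> j \<in> \<tau> l \<and> i \<noteq> j \<and> a * (f i - f j) \<simeq> d"
    proof (cases "\<forall>m<3. l \<noteq> E m")
      case True
      have ex: "\<exists>u\<in>{1, - 1}. \<exists>s\<in>{w ^ k * s | k s. k < 3 \<and> s \<in> S}. x \<simeq> u * s" if x: "x \<notin> I" "cls x = 0" for x
      proof -
        obtain a k s where a: "a < 2" "k < 3" "s \<in> S" "x \<simeq> (- 1) ^ a * w ^ k * s" using S_ex[OF x] by blast
        have "(- 1) ^ a \<in> {1, - 1 :: 'a}" by (cases "even a") auto
        moreover have "x \<simeq> (- 1) ^ a * (w ^ k * s)" using a(4) by (simp add: mult.assoc)
        ultimately show ?thesis using a(2,3) by (intro bexI[of _ "(- 1) ^ a"] bexI[of _ "w ^ k * s"]) auto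
      qed
      obtain s' i j where s': "s' \<in> {w ^ k * s | k s. k < 3 \<and> s \<in> S}" "i \<in> l" "j \<in> l" "i \<noteq> j" "s' * (f i - f j) \<simeq> d"
        using rainbow_line_cover[OF r[OF l True] d ex] by blast
      then obtain k s where "k < 3" "s \<in> S" "s' = w ^ k * s" by blast
      then have "(s', \<rho> k) \<in> T" unfolding T_def by blast
      then show ?thesis using s'(2-5) \<rho>o[OF True, of k] by (intro exI[of _ s'] exI[of _ "\<rho> k"] exI[of _ i] exI[of _ j]) simp
    next
      case False
      then obtain m0 where m0: "m0 < 3" "l = E m0" by blast
      obtain m where m: "m < 3" "cls (z m) = cls d" using zex[OF cls(1)[OF d]] by blast
      \<comment> \<open>The rotation that carries \<open>E m0\<close> to \<open>E m\<close>, the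
        equilateral line whose class is that of \<open>d\<close>; \<open>3 - m0\<close> stands for
        \<open>- m0\<close> modulo 3.\<close>
      define k where "k = (m + (3 - m0)) mod 3"
      have k: "k < 3" "(m0 + k) mod 3 = m"
      proof -
        show "k < 3" by (simp add: k_def)
        have "(m0 + k) mod 3 = (m0 + (m + (3 - m0))) mod 3" unfolding k_def by (simp add: mod_simps)
        also have "m0 + (m + (3 - m0)) = m + 3" using m0(1) by simp
        finally show "(m0 + k) mod 3 = m" using m(1) by simp
      qed
      obtain x where x: "z m * x \<simeq> d" using divide_ex[OF zn[OF m(1)]] by blast
      have xc: "x \<notin> I \<and> cls x = 0" using cls_divide[OF x d m(2)] .
      have wk: "w ^ k \<notin> I" using w_notin_I by (simp add: I_power_iff)
      obtain y where y: "w ^ k * y \<simeq> x" using divide_ex[OF wk] by blast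
      have "cls (w ^ k) = cls x" using xc cls_power[OF w_notin_I, of k] cw by simp
      then have "y \<notin> I \<and> cls y = 0" using cls_divide[OF y] xc by blast
      then obtain a e s where a: "a < 2" "e < 3" "s \<in> S" "y \<simeq> (- 1) ^ a * w ^ e * s" using S_ex by blast
      obtain i j where ij: "i \<in> E m" "j \<in> E m" "i \<noteq> j" "f i - f j \<simeq> (- 1) ^ a * w ^ e * z m"
        using edges(1)[OF m(1) a(1,2)] by blast
      have "w ^ k * s * (f i - f j) \<simeq> w ^ k * s * ((- 1) ^ a * w ^ e * z m)" by (rule eqv_mult[OF eqv_refl ij(4)])
      also have "\<dots> = z m * (w ^ k * ((- 1) ^ a * w ^ e * s))" by (simp add: ac_simps)
      also have "\<dots> \<simeq> z m * (w ^ k * y)" by (intro eqv_mult eqv_refl eqv_sym[OF a(4)])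
      also have "\<dots> \<simeq> z m * x" by (intro eqv_mult eqv_refl y)
      also have "\<dots> \<simeq> d" by (rule x)
      finally have "w ^ k * s * (f i - f j) \<simeq> d" .
      moreover have "(w ^ k * s, \<rho> k) \<in> T" unfolding T_def using k(1) a(3) by blast
      moreover have "\<rho> k l = E m" using \<rho>E[OF m0(1), of k] k(2) m0(2) by simp
      ultimately show ?thesis using ij(1-3) by (intro exI[of _ "w ^ k * s"] exI[of _ "\<rho> k"] exI[of _ i] exI[of _ j]) simp
    qed
  next
    fix l a \<tau> i j a' \<tau>' i' j'
    assume l: "l \<in> ag_lines" and T: "(a, \<tau>) \<in> T" "(a', \<tau>') \<in> T"
      and ij: "i \<in> \<tau> l" "j \<in> \<tau> l" "i \<noteq> j" "i' \<in> \<tau>' l" "j' \<in> \<tau>' l" "i' \<noteq> j'"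
      and eqv: "a * (f i - f j) \<simeq> a' * (f i' - f j')"
    obtain k s where ks: "k < 3" "s \<in> S" "a = w ^ k * s" "\<tau> = \<rho> k" using T(1) unfolding T_def by blast
    obtain k' s' where ks': "k' < 3" "s' \<in> S" "a' = w ^ k' * s'" "\<tau>' = \<rho> k'" using T(2) unfolding T_def by blast
    show "a = a' \<and> \<tau> = \<tau>' \<and> i = i' \<and> j = j'"
    proof (cases "\<forall>m<3. l \<noteq> E m")
      case True
      have pm: "k = k' \<and> s = s' \<and> u = u'" if u: "u \<in> {1, - 1}" "u' \<in> {1, - 1}" "u * a \<simeq> u' * a'" for u u'
      proof -
        obtain b where b: "b < (2::nat)" "u = (- 1) ^ b" using u(1) by (metis insertE singletonD power_0 power_one_right one_less_numeral_iff semiring_norm(76) zero_less_numeral)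
        obtain b' where b': "b' < (2::nat)" "u' = (- 1) ^ b'" using u(2) by (metis insertE singletonD power_0 power_one_right one_less_numeral_iff semiring_norm(76) zero_less_numeral)
        have "(- 1) ^ b * w ^ k * s \<simeq> (- 1) ^ b' * w ^ k' * s'" using u(3) by (simp add: b b' ks ks' mult.assoc)
        then show ?thesis using S_un b b' ks ks' by blast
      qed
      have "a = a' \<and> i = i' \<and> j = j'"
      proof (rule rainbow_line_unique[OF r[OF l True] _ _ _ _ _ _ _ _ _ _ _ eqv])
        show "a \<notin> I" "cls a = 0" "a' \<notin> I" "cls a' = 0" using cS[OF ks(2)] cS[OF ks'(2)] ks ks' by simp_all
        show "u = u' \<and> a = a'" if "u \<in> {1, - 1}" "u' \<in> {1, - 1}" "u * a \<simeq> u' * a'" for u u'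
          using pm[OF that] ks ks' by simp
      qed (use ij \<rho>o[OF True] ks ks' in auto)
      moreover from this have "k = k'" using pm[of 1 1] by simp
      ultimately show ?thesis using ks ks' by simp
    next
      case False
      then obtain m0 where m0: "m0 < 3" "l = E m0" by blast
      define m m' where "m = (m0 + k) mod 3" and "m' = (m0 + k') mod 3"
      have mm: "m < 3" "m' < 3" by (simp_all add: m_def m'_def)
      have El: "\<tau> l = E m" "\<tau>' l = E m'" using \<rho>E[OF m0(1)] by (simp_all add: ks ks' m0 m_def m'_def)
      obtain b e where b: "b < 2" "e < 3" "f i - f j \<simeq> (- 1) ^ b * w ^ e * z m"
        using edges(2)[OF mm(1)] ij El by blast
      obtain b' e' where b': "b' < 2" "e' < 3" "f i' - f j' \<simeq> (- 1) ^ b' * w ^ e' * z m'"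
        using edges(2)[OF mm(2)] ij El by blast
      have cu: "cls ((- 1) ^ b * w ^ e) = 0 \<and> (- 1) ^ b * w ^ e \<notin> I" for b e :: nat
        using cls_minus[of "w ^ e"] cls_power[OF w_notin_I, of e] cw w_notin_I
        by (cases "even b") (auto simp: I_power_iff)
      have val: "a * (f i - f j) \<simeq> a * ((- 1) ^ b * w ^ e * z m)" "a' * (f i' - f j') \<simeq> a' * ((- 1) ^ b' * w ^ e' * z m')"
        using b(3) b'(3) by (auto intro: eqv_mult)
      have E1: "a * ((- 1) ^ b * w ^ e * z m) \<simeq> a' * ((- 1) ^ b' * w ^ e' * z m')"
        by (rule eqv_trans[OF eqv_sym[OF val(1)] eqv_trans[OF eqv val(2)]])
      have an: "a \<notin> I" "cls a = 0" "a' \<notin> I" "cls a' = 0" using cS[OF ks(2)] cS[OF ks'(2)] ks ks' by simp_all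
      have ca: "cls (a * ((- 1) ^ b * w ^ e * z m)) = cls (z m)" "a * ((- 1) ^ b * w ^ e * z m) \<notin> I"
        using an cu[of b e] zn[OF mm(1)] cls(1)[OF zn[OF mm(1)]]
          cls_mult[of a "(- 1) ^ b * w ^ e * z m"] cls_mult[of "(- 1) ^ b * w ^ e" "z m"] by (simp_all add: I_mult_iff)
      have ca': "cls (a' * ((- 1) ^ b' * w ^ e' * z m')) = cls (z m')"
        using an cu[of b' e'] zn[OF mm(2)] cls(1)[OF zn[OF mm(2)]]
          cls_mult[of a' "(- 1) ^ b' * w ^ e' * z m'"] cls_mult[of "(- 1) ^ b' * w ^ e'" "z m'"] by (simp add: I_mult_iff)
      have "cls (z m) = cls (z m')" using cls_eqv[OF E1 ca(2)] ca(1) ca' by simp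
      then have "m = m'" using zcls mm by blast
      then have "k mod 3 = k' mod 3" unfolding m_def m'_def using cong_add_lcancel_nat[of m0 k k' 3] by (simp add: cong_def)
      then have kk: "k = k'" using ks ks' by simp
      have wz: "w ^ k * z m \<notin> I" using w_notin_I zn[OF mm(1)] by (simp add: I_mult_iff I_power_iff)
      have "(w ^ k * z m) * ((- 1) ^ b * w ^ e * s) \<simeq> (w ^ k * z m) * ((- 1) ^ b' * w ^ e' * s')"
        using E1 by (simp add: ks ks' kk \<open>m = m'\<close> ac_simps)
      then have "(- 1) ^ b * w ^ e * s \<simeq> (- 1) ^ b' * w ^ e' * s'" using eqv_mult_cancel[OF wz] by blast
      then have be: "b = b' \<and> e = e' \<and> s = s'" using S_un b b' ks ks' by blast
      then have "f i' - f j' \<simeq> (- 1) ^ b * w ^ e * z m" using b'(3) \<open>m = m'\<close> by simp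
      then have "f i - f j \<simeq> f i' - f j'" using eqv_trans[OF b(3) eqv_sym] by blast
      then have "i = i' \<and> j = j'" using edges(3)[OF mm(1)] ij El \<open>m = m'\<close> by blast
      then show ?thesis using be kk ks ks' by simp
    qed
  qed
  then show ?thesis unfolding hesse_family_def using I_subgrp I_has_index by blast
qed

end

section \<open>The labelling when the root of unity is a cube\<close>

context cubic_field
begin

text \<open>Powers of \<open>w\<close> are cubes and do not affect classes. In the directions (0,1)
  and (1,2) the differences reduce to factors \<open>1 - t w^m\<close>, in the direction (1,0) to
  \<open>1 - t^2 w^m\<close>. A step in the direction (1,1) multiplies the label by
  \<open>w\<close>, so these lines are equilateral with sides \<open>(1 - w) * F 0 m\<close>. From
  \<open>F 0 m * (1 - t w^m) = 1 - t^3\<close> modulo \<open>I\<close>, the classes of the three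
  sides are distinct by \<open>r1\<close>, as recolouring demands.\<close>

lemma hesse_family_cube_root:
  assumes cw: "cls w = 0"
    and r1: "rainbow (1 - t) (1 - t * w) (1 - t * w\<^sup>2)"
    and r2: "rainbow (1 - t\<^sup>2) (1 - t\<^sup>2 * w) (1 - t\<^sup>2 * w\<^sup>2)"
  shows "hesse_family I q"
proof -
  define F where "F i j = w ^ i + t * w ^ j + t\<^sup>2 * w ^ (2 * (i + j))" for i j
  define f where "f x = F (x div 3) (x mod 3)" for x
  have f: "f (idx i j) \<simeq> F i j" for i j
  proof -
    have "f (idx i j) = F (i mod 3) (j mod 3)" by (simp add: f_def idx_def)
    also have "\<dots> \<simeq> F i j" unfolding F_def
    proof (intro eqv_add eqv_mult eqv_sym[OF w_power_mod] eqv_refl)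
      have "(2 * (i mod 3 + j mod 3)) mod 3 = (2 * (i + j)) mod 3"
        using mod_mult_right_eq[of 2 "i mod 3 + j mod 3" 3] mod_mult_right_eq[of 2 "i + j" 3] mod_add_eq[of i 3 j] by simp
      then show "w ^ (2 * (i mod 3 + j mod 3)) \<simeq> w ^ (2 * (i + j))" using w_power_eqv_iff by blast
    qed
    finally show ?thesis .
  qed
  have t: "t \<notin> I"
  proof
    assume a: "t \<in> I"
    have "1 - t * w - (1 - t) = t * (1 - w)" by (simp add: algebra_simps)
    then have "1 - t * w \<simeq> 1 - t" unfolding eqv_def using I_mult2[OF a] by metis
    then have "cls (1 - t * w) = cls (1 - t)" using cls_eqv r1 by (auto simp: rainbow_def)
    then show False using r1 by (simp add: rainbow_def)
  qed
  have R: "rainbow (1 - s * w ^ m) (1 - s * w ^ (m + 1)) (1 - s * w ^ (m + 2))"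
    if "rainbow (1 - s) (1 - s * w) (1 - s * w\<^sup>2)" for s m
  proof (induction m)
    case 0
    show ?case using that by (simp only: add_0 power_0 power_one_right mult_1_right)
  next
    case (Suc m)
    have "1 - s * w ^ m \<simeq> 1 - s * w ^ (m + 3)"
      by (intro eqv_mult eqv_diff eqv_refl) (simp_all add: w_power_eqv_iff)
    then show ?case
      using rainbow_eqv[OF rainbow_rotate[OF Suc.IH] eqv_refl eqv_refl] by (simp add: numeral_eq_Suc)
  qed
  \<comment> \<open>Differences acquire consecutive powers of \<open>w\<close>, which are harmless
    because \<open>w\<close> is a cube.\<close>
  have scaled: "rainbow (c * (w ^ a * x)) (c * (w ^ (a + 1) * y)) (c * (w ^ (a + 2) * z))"
    if c: "c \<notin> I" and r: "rainbow x y z" for c x y z a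
  proof -
    have n: "x \<notin> I" "y \<notin> I" "z \<notin> I" using r by (auto simp: rainbow_def)
    have "cls (w ^ k * v) = cls v \<and> w ^ k * v \<notin> I" if "v \<notin> I" for k v
      using cls_mult[of "w ^ k" v] cls_power[OF w_notin_I, of k] cw cls(1)[OF that] w_notin_I that
      by (simp add: I_power_iff I_mult_iff)
    note wk = this
    have "rainbow (w ^ a * x) (w ^ (a + 1) * y) (w ^ (a + 2) * z)"
      using r wk[OF n(1), of a] wk[OF n(2), of "a + 1"] wk[OF n(3), of "a + 2"] unfolding rainbow_def by metis
    then show ?thesis by (rule rainbow_mult[OF c])
  qed
  have L01: "rainbow_line f (ag_line 0 1 i j)" for i j
  proof (rule rainbow_line_direction[of f F, OF f])
    let ?c = "t * (1 - w)"
    have c: "?c \<notin> I" using t one_minus_w by (simp add: I_mult_iff)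
    have st: "?c * (w ^ x * (1 - t * w ^ m)) \<simeq> F i x - F i x'" if "m = 2 * i + x + 2" "x' = x + 1" for x x' m
    proof -
      have "F i x - F i x' = t * w ^ x * (1 - w) + t\<^sup>2 * w ^ (2 * (i + x)) * (1 - w\<^sup>2)"
        unfolding that by (simp add: F_def algebra_simps power_add power2_eq_square)
      also have "\<dots> \<simeq> t * w ^ x * (1 - w) + t\<^sup>2 * w ^ (2 * (i + x)) * - ((1 - w) * w\<^sup>2)"
        by (intro eqv_add eqv_mult eqv_refl one_minus_w_sq_eqv)
      also have "\<dots> = ?c * (w ^ x * (1 - t * w ^ m))"
        unfolding that by (simp add: algebra_simps power_add power_mult power_mult_distrib power2_eq_square)
      finally show ?thesis by (rule eqv_sym)
    qed
    show "rainbow (F i j - F (i + 0) (j + 1)) (F (i + 0) (j + 1) - F (i + 2 * 0) (j + 2 * 1))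
        (F (i + 2 * 0) (j + 2 * 1) - F (i + 3 * 0) (j + 3 * 1))"
      unfolding mult_0_right add_0_right
    proof (rule rainbow_eqv[OF scaled[OF c R[OF r1, of "2 * i + j + 2"]]])
      show "?c * (w ^ j * (1 - t * w ^ (2 * i + j + 2))) \<simeq> F i j - F i (j + 1)" by (rule st) simp_all
      show "?c * (w ^ (j + 1) * (1 - t * w ^ (2 * i + j + 2 + 1))) \<simeq> F i (j + 1) - F i (j + 2 * 1)" by (rule st) simp_all
      show "?c * (w ^ (j + 2) * (1 - t * w ^ (2 * i + j + 2 + 2))) \<simeq> F i (j + 2 * 1) - F i (j + 3 * 1)"
        using st[of "2 * i + j + 2 + 2" "j + 2" "j + 3"] by simp
    qed
  qed
  have L10: "rainbow_line f (ag_line 1 0 i j)" for i j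
  proof (rule rainbow_line_direction[of f F, OF f])
    let ?c = "1 - w"
    have st: "?c * (w ^ x * (1 - t\<^sup>2 * w ^ m)) \<simeq> F x j - F x' j" if "m = x + 2 * j + 2" "x' = x + 1" for x x' m
    proof -
      have "F x j - F x' j = w ^ x * (1 - w) + t\<^sup>2 * w ^ (2 * (x + j)) * (1 - w\<^sup>2)"
        unfolding that by (simp add: F_def algebra_simps power_add power2_eq_square)
      also have "\<dots> \<simeq> w ^ x * (1 - w) + t\<^sup>2 * w ^ (2 * (x + j)) * - ((1 - w) * w\<^sup>2)"
        by (intro eqv_add eqv_mult eqv_refl one_minus_w_sq_eqv)
      also have "\<dots> = ?c * (w ^ x * (1 - t\<^sup>2 * w ^ m))"
        unfolding that by (simp add: algebra_simps power_add power_mult power_mult_distrib power2_eq_square)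
      finally show ?thesis by (rule eqv_sym)
    qed
    show "rainbow (F i j - F (i + 1) (j + 0)) (F (i + 1) (j + 0) - F (i + 2 * 1) (j + 2 * 0))
        (F (i + 2 * 1) (j + 2 * 0) - F (i + 3 * 1) (j + 3 * 0))"
      unfolding mult_0_right add_0_right
    proof (rule rainbow_eqv[OF scaled[OF one_minus_w R[OF r2, of "i + 2 * j + 2"]]])
      show "?c * (w ^ i * (1 - t\<^sup>2 * w ^ (i + 2 * j + 2))) \<simeq> F i j - F (i + 1) j" by (rule st) simp_all
      show "?c * (w ^ (i + 1) * (1 - t\<^sup>2 * w ^ (i + 2 * j + 2 + 1))) \<simeq> F (i + 1) j - F (i + 2 * 1) j" by (rule st) simp_all
      show "?c * (w ^ (i + 2) * (1 - t\<^sup>2 * w ^ (i + 2 * j + 2 + 2))) \<simeq> F (i + 2 * 1) j - F (i + 3 * 1) j"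
        using st[of "i + 2 * j + 2 + 2" "i + 2" "i + 3"] by simp
    qed
  qed
  have L12: "rainbow_line f (ag_line 1 2 0 j)" for j
  proof (rule rainbow_line_direction[of f F, OF f])
    let ?c = "1 - w"
    have st: "?c * (w ^ i * (1 - t * w ^ m)) \<simeq> F i x - F i' x'"
      if "m = j + 2 + i" "x = j + 2 * i" "i' = i + 1" "x' = j + 2 * (i + 1)" for i i' x x' m
    proof -
      \<comment> \<open>Along the direction (1,2) the exponent of the quadratic term grows by 6, so
        this term is constant modulo \<open>I\<close>.\<close>
      have "F i x - F i' x' = w ^ i * (1 - w) + t * w ^ x * (1 - w\<^sup>2) + t\<^sup>2 * w ^ (2 * (i + x)) * (1 - w ^ 6)"
        unfolding that by (simp add: F_def algebra_simps power_add power2_eq_square power_numeral_reduce)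
      also have "\<dots> \<simeq> w ^ i * (1 - w) + t * w ^ x * - ((1 - w) * w\<^sup>2) + t\<^sup>2 * w ^ (2 * (i + x)) * (1 - w ^ 0)"
        by (intro eqv_add eqv_mult eqv_refl one_minus_w_sq_eqv eqv_diff) (rule w_power_eqv_iff[THEN iffD2], simp)
      also have "\<dots> = ?c * (w ^ i * (1 - t * w ^ m))"
        unfolding that by (simp add: algebra_simps power_add power_mult power_mult_distrib power2_eq_square)
      finally show ?thesis by (rule eqv_sym)
    qed
    show "rainbow (F 0 j - F (0 + 1) (j + 2)) (F (0 + 1) (j + 2) - F (0 + 2 * 1) (j + 2 * 2))
        (F (0 + 2 * 1) (j + 2 * 2) - F (0 + 3 * 1) (j + 3 * 2))"
    proof (rule rainbow_eqv[OF scaled[OF one_minus_w R[OF r1, of "j + 2"], of 0]])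
      show "?c * (w ^ 0 * (1 - t * w ^ (j + 2))) \<simeq> F 0 j - F (0 + 1) (j + 2)" by (rule st) simp_all
      show "?c * (w ^ (0 + 1) * (1 - t * w ^ (j + 2 + 1))) \<simeq> F (0 + 1) (j + 2) - F (0 + 2 * 1) (j + 2 * 2)"
        by (rule st) simp_all
      show "?c * (w ^ (0 + 2) * (1 - t * w ^ (j + 2 + 2))) \<simeq> F (0 + 2 * 1) (j + 2 * 2) - F (0 + 3 * 1) (j + 3 * 2)"
      proof -
        have e: "0 + 2 = (2::nat)" "0 + 2 * 1 = (2::nat)" "0 + 3 * 1 = (3::nat)" "j + 2 * 2 = j + 4" "j + 3 * 2 = j + 6"
          by simp_all
        show ?thesis unfolding e by (rule st) simp_all
      qed
    qed
  qed
  define z where "z m = (1 - w) * F 0 m" for m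
  have shift: "F (i + 1) (j + 1) \<simeq> w * F i j" for i j
  proof -
    have "F (i + 1) (j + 1) = w * w ^ i + t * (w * w ^ j) + t\<^sup>2 * w ^ (2 * (i + j) + 4)"
    proof -
      have e: "2 * (i + 1 + (j + 1)) = 2 * (i + j) + 4" by simp
      show ?thesis unfolding F_def e by simp
    qed
    also have "\<dots> \<simeq> w * w ^ i + t * (w * w ^ j) + t\<^sup>2 * w ^ (2 * (i + j) + 1)"
    proof (intro eqv_add eqv_mult eqv_refl)
      have "(2 * (i + j) + 4) mod 3 = (2 * (i + j) + 1) mod (3::nat)" by presburger
      then show "w ^ (2 * (i + j) + 4) \<simeq> w ^ (2 * (i + j) + 1)" using w_power_eqv_iff by blast
    qed
    also have "\<dots> = w * F i j" by (simp add: F_def algebra_simps)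
    finally show ?thesis .
  qed
  have zprod: "(1 - t * w ^ m) * F 0 m \<simeq> 1 - t ^ 3" for m
  proof -
    have "(1 - t * w ^ m) * F 0 m = 1 - t ^ 3 * (w ^ m) ^ 3"
      by (simp add: F_def algebra_simps power2_eq_square power3_eq_cube power_mult power_mult_distrib power_add)
    also have "\<dots> \<simeq> 1 - t ^ 3 * 1"
    proof (intro eqv_diff eqv_mult eqv_refl)
      have "(w ^ m) ^ 3 = (w ^ 3) ^ m" by (simp only: power_mult [symmetric] mult.commute)
      then show "(w ^ m) ^ 3 \<simeq> 1" using eqv_power[OF w_cube, of m] by simp
    qed
    finally show ?thesis by simp
  qed
  have one_t3: "1 - t ^ 3 \<notin> I"
  proof
    assume a: "1 - t ^ 3 \<in> I"
    have "(1 - t) * (1 - t * w) * (1 - t * w\<^sup>2) = (1 - t ^ 3) + (t\<^sup>2 * w - t) * (w\<^sup>2 + w + 1) - t ^ 3 * (w ^ 3 - 1)"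
      by (simp add: algebra_simps power2_eq_square power3_eq_cube)
    also have "\<dots> \<in> I" using I_diff[OF I_add[OF a I_mult[OF w_root]] I_mult[OF w_cube[unfolded eqv_def]]] by blast
    finally show False using r1 by (simp add: rainbow_def I_mult_iff)
  qed
  have F0: "F 0 m \<notin> I" for m using one_t3 eqv_I[OF zprod[of m]] I_mult by blast
  have zr: "rainbow (z 0) (z 1) (z 2)"
  proof -
    have n: "1 - t * w ^ m \<notin> I" for m using one_t3 eqv_I[OF zprod[of m]] I_mult2 by blast
    have key: "cls (1 - t * w ^ m) = cls (1 - t * w ^ m')" if "cls (F 0 m) = cls (F 0 m')" for m m'
    proof -
      have "cls ((1 - t * w ^ m) * F 0 m) = cls ((1 - t * w ^ m') * F 0 m')"
        using cls_eqv[OF zprod[of m]] cls_eqv[OF zprod[of m']] n F0 by (simp add: I_mult_iff)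
      then have "cls (F 0 m * (1 - t * w ^ m)) = cls (F 0 m * (1 - t * w ^ m'))"
        using that cls_mult n F0 by (simp add: mult.commute)
      then show ?thesis using cls_mult_cancel[OF F0 n n] by blast
    qed
    have "rainbow (F 0 0) (F 0 1) (F 0 2)"
      using r1 F0 key[of 0 1] key[of 1 2] key[of 0 2] unfolding rainbow_def by auto
    then show ?thesis unfolding z_def by (rule rainbow_mult[OF one_minus_w])
  qed
  define E where "E m = ag_line 1 1 0 m" for m
  show ?thesis
  proof (rule hesse_family_recolored[OF cw, of E f z])
    show "E m \<in> ag_lines" if "m < 3" for m unfolding ag_lines_directions E_def using that by blast
    show "m = m'" if "m < 3" "m' < 3" "E m = E m'" for m m'
    proof -
      have "m = 0 \<or> m = 1 \<or> m = 2" "m' = 0 \<or> m' = 1 \<or> m' = 2" using that by linarith+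
      moreover have "E 0 = {0, 4, 8}" "E 1 = {1, 5, 6}" "E 2 = {2, 3, 7}" by (auto simp: E_def ag_line_def idx_def)
      moreover have "{0, 4, 8} \<noteq> {1, 5, 6::nat}" "{0, 4, 8} \<noteq> {2, 3, 7::nat}" "{1, 5, 6} \<noteq> {2, 3, 7::nat}" by auto
      ultimately show ?thesis using that(3) by metis
    qed
    show "\<exists>i j k. E m = {i, j, k} \<and> i \<noteq> j \<and> j \<noteq> k \<and> i \<noteq> k \<and>
      f i - f j \<simeq> z m \<and> f j - f k \<simeq> w * z m \<and> f k - f i \<simeq> w\<^sup>2 * z m" if "m < 3" for m
    proof (intro exI conjI)
      show "E m = {idx 0 m, idx 1 (m + 1), idx 2 (m + 2)}" by (simp add: E_def ag_line_def numeral_2_eq_2)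
      show "idx 0 m \<noteq> idx 1 (m + 1)" "idx 1 (m + 1) \<noteq> idx 2 (m + 2)" "idx 0 m \<noteq> idx 2 (m + 2)"
        unfolding idx_def by simp_all
      have e: "0 + 1 = (1::nat)" "1 + 1 = (2::nat)" "m + 1 + 1 = m + 2" by simp_all
      have F1: "f (idx 1 (m + 1)) \<simeq> w * F 0 m" by (rule eqv_trans[OF f shift[of 0 m, unfolded e]])
      have "w * F 1 (m + 1) \<simeq> w * (w * F 0 m)" by (rule eqv_mult[OF eqv_refl shift[of 0 m, unfolded e]])
      then have F2: "f (idx 2 (m + 2)) \<simeq> w * (w * F 0 m)"
        by (rule eqv_trans[OF f eqv_trans[OF shift[of 1 "m + 1", unfolded e]]])
      have F3: "w ^ 3 * F 0 m \<simeq> f (idx 0 m)"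
        using eqv_trans[OF eqv_mult[OF w_cube eqv_refl, of "F 0 m"]] eqv_sym[OF f[of 0 m]] by simp
      show "f (idx 0 m) - f (idx 1 (m + 1)) \<simeq> z m"
        using eqv_diff[OF f[of 0 m] F1] by (simp add: z_def algebra_simps)
      show "f (idx 1 (m + 1)) - f (idx 2 (m + 2)) \<simeq> w * z m"
        using eqv_diff[OF F1 F2] by (simp add: z_def algebra_simps)
      show "f (idx 2 (m + 2)) - f (idx 0 m) \<simeq> w\<^sup>2 * z m"
        using eqv_diff[OF F2 eqv_sym[OF F3]] by (simp add: z_def algebra_simps power2_eq_square power3_eq_cube)
    qed
    show "rainbow_line f l" if "l \<in> ag_lines" "\<forall>m<3. l \<noteq> E m" for l
      using that L01 L10 L12 unfolding ag_lines_directions E_def by blast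
  qed (rule zr)
qed

text \<open>The Moebius substitution \<open>e = (w^2 - w x) / (1 - w x)\<close>. The triple
  \<open>1 - e\<close>, \<open>w (1 - e w)\<close>, \<open>w^2 (1 - e w^2)\<close> has sum 0 modulo
  \<open>I\<close>, and \<open>e\<close> is chosen to make it proportional to \<open>1\<close>,
  \<open>x\<close>, \<open>- (1 + x)\<close>, in which \<open>w\<close> no longer occurs. Excluding
  \<open>x = w\<close> and \<open>x = w^2\<close> keeps numerator and denominator nonzero.\<close>

lemma triple_to_ratio:
  assumes x: "x - w \<notin> I" "x - w\<^sup>2 \<notin> I"
  shows "\<exists>e. e \<notin> I \<and> (1 - w * x) * e \<simeq> w\<^sup>2 - w * x \<and> 1 - w * x \<notin> I"
proof -
  have l: "1 - w * x \<notin> I"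
  proof
    assume "1 - w * x \<in> I"
    then have "w\<^sup>2 * (1 - w * x) \<in> I" by (rule I_mult)
    moreover have "x * (w ^ 3 - 1) \<in> I" using w_cube I_mult by (simp add: eqv_def)
    ultimately have "w\<^sup>2 * (1 - w * x) + x * (w ^ 3 - 1) \<in> I" by (rule I_add)
    then have "- (x - w\<^sup>2) \<in> I" by (simp add: algebra_simps power2_eq_square power3_eq_cube)
    then have "x - w\<^sup>2 \<in> I" by (simp only: I_neg_iff)
    then show False using x(2) by blast
  qed
  obtain e where e: "(1 - w * x) * e \<simeq> w\<^sup>2 - w * x" using divide_ex[OF l] by blast
  have "w\<^sup>2 - w * x \<notin> I"
  proof
    assume "w\<^sup>2 - w * x \<in> I"
    then have "w * (x - w) \<in> I" using I_neg_iff[of "w\<^sup>2 - w * x"] by (simp add: algebra_simps power2_eq_square)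
    then show False using x(1) w_notin_I I_prime by blast
  qed
  then have "e \<notin> I" using eqv_I[OF e] I_mult by blast
  then show ?thesis using e l by blast
qed

lemma triple_ratio_values:
  assumes e: "(1 - w * x) * e \<simeq> w\<^sup>2 - w * x"
  shows "(1 - w * x) * (1 - e) \<simeq> 1 - w\<^sup>2"
    "(1 - w * x) * (w * (1 - e * w)) \<simeq> (1 - w\<^sup>2) * x"
    "(1 - w * x) * (w\<^sup>2 * (1 - e * w\<^sup>2)) \<simeq> (1 - w\<^sup>2) * - (1 + x)"
    "(1 - w * x) * (1 + e) \<simeq> - w * (1 + 2 * x)"
    "(1 - w * x) * (w * (1 + e * w)) \<simeq> w * (2 + x)"
    "(1 - w * x) * (w\<^sup>2 * (1 + e * w\<^sup>2)) \<simeq> - w * (1 - x)"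
proof -
  let ?l = "1 - w * x"
  have e': "?l * (a - b * e) \<simeq> ?l * a - b * (w\<^sup>2 - w * x)" for a b
  proof -
    have "?l * (a - b * e) = ?l * a - b * (?l * e)" by (simp add: algebra_simps)
    also have "\<dots> \<simeq> ?l * a - b * (w\<^sup>2 - w * x)" by (intro eqv_diff eqv_mult eqv_refl e)
    finally show ?thesis .
  qed
  \<comment> \<open>The six identities below hold modulo \<open>w^2 + w + 1\<close>; each is proved
    by exhibiting the cofactor.\<close>
  have cert: "u \<simeq> v" if "u - v = (w\<^sup>2 + w + 1) * c" for u v c
    unfolding eqv_def that using I_mult2[OF w_root] by simp
  have 1: "?l * 1 - 1 * (w\<^sup>2 - w * x) \<simeq> 1 - w\<^sup>2" by (rule cert[of _ _ 0]) (simp add: algebra_simps)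
  have 2: "?l * w - w\<^sup>2 * (w\<^sup>2 - w * x) \<simeq> (1 - w\<^sup>2) * x"
    by (rule cert[of _ _ "x * (w - 1) + w - w\<^sup>2"]) (simp add: algebra_simps power2_eq_square)
  have 3: "?l * w\<^sup>2 - w ^ 4 * (w\<^sup>2 - w * x) \<simeq> (1 - w\<^sup>2) * - (1 + x)"
    by (rule cert[of _ _ "1 - w + w ^ 3 * (1 - w) + x * (w ^ 3 - w\<^sup>2 - w + 1)"]) (simp add: algebra_simps power2_eq_square power_numeral_reduce)
  have 4: "?l * 1 - (- 1) * (w\<^sup>2 - w * x) \<simeq> - w * (1 + 2 * x)"
    by (rule cert[of _ _ 1]) (simp add: algebra_simps power2_eq_square)
  have 5: "?l * w - (- (w\<^sup>2)) * (w\<^sup>2 - w * x) \<simeq> w * (2 + x)"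
    by (rule cert[of _ _ "w\<^sup>2 - w - w * x"]) (simp add: algebra_simps power2_eq_square power_numeral_reduce)
  have 6: "?l * w\<^sup>2 - (- (w ^ 4)) * (w\<^sup>2 - w * x) \<simeq> - w * (1 - x)"
    by (rule cert[of _ _ "w ^ 4 - w ^ 3 + w - x * (w ^ 3 - w\<^sup>2 + w)"]) (simp add: algebra_simps power2_eq_square power_numeral_reduce)
  show "?l * (1 - e) \<simeq> 1 - w\<^sup>2" using eqv_trans[OF e'[of 1 1] 1] by simp
  show "?l * (w * (1 - e * w)) \<simeq> (1 - w\<^sup>2) * x"
    using eqv_trans[OF e'[of w "w\<^sup>2"] 2] by (simp add: algebra_simps power2_eq_square)
  show "?l * (w\<^sup>2 * (1 - e * w\<^sup>2)) \<simeq> (1 - w\<^sup>2) * - (1 + x)"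
    using eqv_trans[OF e'[of "w\<^sup>2" "w ^ 4"] 3] by (simp add: algebra_simps power2_eq_square power_numeral_reduce)
  show "?l * (1 + e) \<simeq> - w * (1 + 2 * x)" using eqv_trans[OF e'[of 1 "- 1"] 4] by simp
  show "?l * (w * (1 + e * w)) \<simeq> w * (2 + x)"
    using eqv_trans[OF e'[of w "- (w\<^sup>2)"] 5] by (simp add: algebra_simps power2_eq_square)
  show "?l * (w\<^sup>2 * (1 + e * w\<^sup>2)) \<simeq> - w * (1 - x)"
    using eqv_trans[OF e'[of "w\<^sup>2" "- (w ^ 4)"] 6] by (simp add: algebra_simps power2_eq_square power_numeral_reduce)
qed

end

context cubic_field
begin

lemma rainbow_w_mult_iff:
  assumes "cls w = 0"
  shows "rainbow (w ^ i * x) (w ^ j * y) (w ^ k * z) \<longleftrightarrow> rainbow x y z"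
proof -
  have *: "w ^ l * v \<in> I \<longleftrightarrow> v \<in> I" for l v using w_notin_I by (auto simp: I_mult_iff I_power_iff)
  have "cls (w ^ l * v) = cls v" if "v \<notin> I" for l v
    using cls_mult[of "w ^ l" v] cls_power[OF w_notin_I, of l] assms cls(1)[OF that] w_notin_I that
    by (simp add: I_power_iff)
  then show ?thesis unfolding rainbow_def * by metis
qed

text \<open>The condition on \<open>1 - t^2 w^j\<close> is unchanged under \<open>t\<close> to
  \<open>- t\<close>, so whichever triple is rainbow, one of the two signs satisfies both hypotheses
  of \<open>hesse_family_cube_root\<close>.\<close>

lemma hesse_family_good_pattern:
  assumes cw: "cls w = 0"
    and n: "\<forall>j<3. 1 - t * w ^ j \<notin> I \<and> 1 + t * w ^ j \<notin> I"
    and g: "good_pattern (cls (1 - t)) (cls (1 - t * w)) (cls (1 - t * w\<^sup>2))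
      (cls (1 + t)) (cls (1 + t * w)) (cls (1 + t * w\<^sup>2))"
  shows "hesse_family I q"
proof -
  have nn: "1 - t \<notin> I" "1 - t * w \<notin> I" "1 - t * w\<^sup>2 \<notin> I" "1 + t \<notin> I" "1 + t * w \<notin> I" "1 + t * w\<^sup>2 \<notin> I"
    using n[rule_format, of 0] n[rule_format, of 1] n[rule_format, of 2] by simp_all
  have "rainbow ((1 - t) * (1 + t)) ((1 - t * w) * (1 + t * w)) ((1 - t * w\<^sup>2) * (1 + t * w\<^sup>2))"
    using g nn unfolding rainbow_def good_pattern_def by (simp add: cls_mult I_mult_iff)
  moreover have "(1 - t) * (1 + t) = 1 - t\<^sup>2" "(1 - t * w) * (1 + t * w) = 1 - t\<^sup>2 * w\<^sup>2"
    by (simp_all add: algebra_simps power2_eq_square)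
  moreover have "(1 - t * w\<^sup>2) * (1 + t * w\<^sup>2) \<simeq> 1 - t\<^sup>2 * w"
  proof -
    have "(1 - t * w\<^sup>2) * (1 + t * w\<^sup>2) = 1 - t\<^sup>2 * w ^ 4"
      by (simp add: algebra_simps power2_eq_square power_numeral_reduce)
    also have "\<dots> \<simeq> 1 - t\<^sup>2 * w ^ 1" by (intro eqv_diff eqv_mult eqv_refl w_power_eqv_iff[THEN iffD2]) simp
    finally show ?thesis by simp
  qed
  ultimately have "rainbow (1 - t\<^sup>2) (1 - t\<^sup>2 * w\<^sup>2) (1 - t\<^sup>2 * w)" using rainbow_eqv eqv_refl by metis
  then have r2: "rainbow (1 - t\<^sup>2) (1 - t\<^sup>2 * w) (1 - t\<^sup>2 * w\<^sup>2)" by (auto simp: rainbow_def)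
  have "rainbow (1 - t) (1 - t * w) (1 - t * w\<^sup>2) \<or> rainbow (1 + t) (1 + t * w) (1 + t * w\<^sup>2)"
    using g nn unfolding rainbow_def good_pattern_def by auto
  then show ?thesis
  proof
    assume "rainbow (1 - t) (1 - t * w) (1 - t * w\<^sup>2)"
    then show ?thesis using hesse_family_cube_root[OF cw] r2 by blast
  next
    assume "rainbow (1 + t) (1 + t * w) (1 + t * w\<^sup>2)"
    then show ?thesis using hesse_family_cube_root[OF cw, of "- t"] r2 by simp
  qed
qed

text \<open>The hypotheses of \<open>hesse_family_cube_root\<close> in the parameter
  \<open>x\<close> of \<open>triple_to_ratio\<close>, the second triple coming from the products
  \<open>(1 - e w^j) (1 + e w^j)\<close>. As \<open>w\<close> is a cube, its powers drop out; the
  conditions can be checked numerically without knowing \<open>w\<close>.\<close>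

lemma hesse_family_triples:
  assumes cw: "cls w = 0" and r1: "rainbow 1 x (1 + x)"
    and r2: "rainbow (1 + 2 * x) (x * (2 + x)) ((1 + x) * (1 - x))"
  shows "hesse_family I q"
proof -
  have "cls x \<noteq> cls (w ^ k)" for k
    using r1 cls_power[OF w_notin_I, of k] cw by (simp add: rainbow_def cls_one)
  moreover have "x \<notin> I" using r1 by (simp add: rainbow_def)
  ultimately have "x - w ^ k \<notin> I" for k using cls_eqv[of x "w ^ k"] by (auto simp: eqv_def)
  from this[of 1] this[of 2] obtain e where
    e: "(1 - w * x) * e \<simeq> w\<^sup>2 - w * x" and l: "1 - w * x \<notin> I"
    using triple_to_ratio by auto
  let ?l = "1 - w * x" and ?c = "1 - w\<^sup>2"
  note v = triple_ratio_values[OF e]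
  have c: "?c \<notin> I" using w_sq_minus_one I_neg_iff[of ?c] by simp
  have "rainbow (?c * 1) (?c * x) (?c * - (1 + x))"
  proof (rule rainbow_mult[OF c])
    show "rainbow 1 x (- (1 + x))"
      using r1 rainbow_minus[of "1 + x" 1 x] rainbow_rotate by blast
  qed
  then have "rainbow (?l * (1 - e)) (?l * (w * (1 - e * w))) (?l * (w\<^sup>2 * (1 - e * w\<^sup>2)))"
    using rainbow_eqv[OF _ eqv_sym[OF v(1)] eqv_sym[OF v(2)] eqv_sym[OF v(3)]] by simp
  then have "rainbow (w ^ 0 * (1 - e)) (w ^ 1 * (1 - e * w)) (w\<^sup>2 * (1 - e * w\<^sup>2))"
    using rainbow_mult_iff[OF l] by simp
  then have R1: "rainbow (1 - e) (1 - e * w) (1 - e * w\<^sup>2)" by (simp only: rainbow_w_mult_iff[OF cw])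
  have cw': "?c * - w \<notin> I" using c w_notin_I by (simp add: I_mult_iff)
  have "rainbow (?c * - w * (1 + 2 * x)) (?c * - w * (x * (2 + x))) (?c * - w * ((1 + x) * (1 - x)))"
    by (rule rainbow_mult[OF cw' r2])
  then have "rainbow (?c * (- w * (1 + 2 * x))) (?c * x * (w * (2 + x))) (?c * - (1 + x) * (- w * (1 - x)))"
  proof -
    assume r: "rainbow (?c * - w * (1 + 2 * x)) (?c * - w * (x * (2 + x))) (?c * - w * ((1 + x) * (1 - x)))"
    have "rainbow a (- b) (- d)" if "rainbow a b d" for a b d
      using that unfolding rainbow_def by (simp add: cls_minus)
    from this[OF r] show ?thesis by (simp add: algebra_simps)
  qed
  then have "rainbow (?l * (1 - e) * (?l * (1 + e))) (?l * (w * (1 - e * w)) * (?l * (w * (1 + e * w))))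
      (?l * (w\<^sup>2 * (1 - e * w\<^sup>2)) * (?l * (w\<^sup>2 * (1 + e * w\<^sup>2))))"
    using rainbow_eqv[OF _ eqv_sym[OF eqv_mult[OF v(1) v(4)]] eqv_sym[OF eqv_mult[OF v(2) v(5)]]
        eqv_sym[OF eqv_mult[OF v(3) v(6)]]] by blast
  moreover have "?l * (1 - e) * (?l * (1 + e)) = ?l\<^sup>2 * (w ^ 0 * (1 - e\<^sup>2))"
    "?l * (w * (1 - e * w)) * (?l * (w * (1 + e * w))) = ?l\<^sup>2 * (w ^ 2 * (1 - e\<^sup>2 * w\<^sup>2))"
    "?l * (w\<^sup>2 * (1 - e * w\<^sup>2)) * (?l * (w\<^sup>2 * (1 + e * w\<^sup>2))) = ?l\<^sup>2 * (w ^ 4 * (1 - e\<^sup>2 * w ^ 4))"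
    by (simp_all add: algebra_simps power2_eq_square power_numeral_reduce)
  ultimately have "rainbow (1 - e\<^sup>2) (1 - e\<^sup>2 * w\<^sup>2) (1 - e\<^sup>2 * w ^ 4)"
    using rainbow_mult_iff[of "?l\<^sup>2"] l by (simp only: rainbow_w_mult_iff[OF cw] I_power_iff simp_thms)
  moreover have "1 - e\<^sup>2 * w ^ 4 \<simeq> 1 - e\<^sup>2 * w ^ 1" by (intro eqv_diff eqv_mult eqv_refl w_power_eqv_iff[THEN iffD2]) simp
  ultimately have "rainbow (1 - e\<^sup>2) (1 - e\<^sup>2 * w\<^sup>2) (1 - e\<^sup>2 * w)"
    using rainbow_eqv[OF _ eqv_refl eqv_refl] by simp
  then have "rainbow (1 - e\<^sup>2) (1 - e\<^sup>2 * w) (1 - e\<^sup>2 * w\<^sup>2)" by (auto simp: rainbow_def)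
  then show ?thesis using hesse_family_cube_root[OF cw R1] by blast
qed

section \<open>The noncube case by cyclotomic counts\<close>

lemma same_class_triple:
  assumes "x \<notin> I" "y \<notin> I" "x + y \<notin> I" "cls x = cls y" "cls (x + y) = cls x"
  shows "\<exists>u. u \<notin> I \<and> 1 + u \<notin> I \<and> cls u = 0 \<and> cls (1 + u) = 0"
proof -
  obtain u where u: "x * u \<simeq> y" using divide_ex[OF assms(1)] by blast
  have nu: "u \<notin> I" using eqv_I[OF u] assms(2) I_mult by blast
  have v: "x * (1 + u) \<simeq> x + y" using eqv_add[OF eqv_refl u, of x] by (simp add: distrib_left)
  have nv: "1 + u \<notin> I" using eqv_I[OF v] assms(3) I_mult by blast
  have z: "cls a = 0" if "a \<notin> I" "cls (x * a) = cls x" for a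
    using cls_mult_cancel[OF assms(1) that(1) one_notin_I] that(2) by (simp add: cls_one)
  have "cls (x * u) = cls x" using cls_eqv[OF u] assms nu by (simp add: I_mult_iff)
  moreover have "cls (x * (1 + u)) = cls x" using cls_eqv[OF v] assms nv by (simp add: I_mult_iff)
  ultimately show ?thesis using z nu nv by blast
qed

text \<open>A Schur type argument. A difference of class 0 between two elements of \<open>S\<close>
  would give the claim at once. Otherwise the pairs of at least six points carry two colours, and
  Ramsey's theorem gives a monochromatic triangle, where \<open>a - c\<close> is the sum of
  \<open>a - b\<close> and \<open>b - c\<close>.\<close>

lemma exists_consecutive_cubes:
  assumes fin: "finite S" and S: "\<And>x. x \<in> S \<Longrightarrow> x \<notin> I \<and> cls x = 0" "card S \<ge> 6"
    and inc: "\<And>x y. x \<in> S \<Longrightarrow> y \<in> S \<Longrightarrow> x \<noteq> y \<Longrightarrow> x - y \<notin> I"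
  shows "\<exists>u. u \<notin> I \<and> 1 + u \<notin> I \<and> cls u = 0 \<and> cls (1 + u) = 0"
proof (rule ccontr)
  assume neg: "\<not> ?thesis"
  have tri: "cls (a - b) \<noteq> k \<or> cls (b - c) \<noteq> k \<or> cls (a - c) \<noteq> k"
    if "a - b \<notin> I" "b - c \<notin> I" "a - c \<notin> I" for a b c k
    using same_class_triple[of "a - b" "b - c"] neg that by auto
  have cd: "cls (a - b) \<in> {1, 2}" if "a \<in> S" "b \<in> S" "a \<noteq> b" for a b
  proof -
    have "a - b \<notin> I" using inc that by blast
    moreover have "cls (a - b) \<noteq> 0" using tri[of a b 0 0] S(1) inc that by auto
    ultimately show ?thesis using cls(1)[of "a - b"] by auto
  qed
  have "S \<noteq> {}" using S(2) by auto
  then obtain a where a: "a \<in> S" by blast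
  define T where "T k = {b \<in> S - {a}. cls (a - b) = k}" for k
  have "S - {a} = T 1 \<union> T 2" using cd a by (auto simp: T_def)
  then have "card (S - {a}) \<le> card (T 1) + card (T 2)" by (metis card_Un_le)
  moreover have "card (S - {a}) \<ge> 5" using S(2) a fin by simp
  ultimately have "card (T 1) \<ge> 3 \<or> card (T 2) \<ge> 3" by linarith
  then obtain k where k: "k = 1 \<or> k = 2" "card (T k) \<ge> 3" by blast
  have "finite (T k)" using fin by (simp add: T_def)
  obtain U where U: "U \<subseteq> T k" "card U = 3" using obtain_subset_with_card_n[OF k(2)] by blast
  then obtain b c d where bcd: "U = {b, c, d}" "b \<noteq> c" "c \<noteq> d" "b \<noteq> d" by (auto simp: card_3_iff)
  have inT: "b \<in> T k" "c \<in> T k" "d \<in> T k" using U bcd by auto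
  have ne: "cls (x - y) \<in> {1, 2} - {k}" if "x \<in> T k" "y \<in> T k" "x \<noteq> y" for x y
  proof -
    have *: "x \<in> S" "y \<in> S" "x \<noteq> a" "y \<noteq> a" "cls (a - x) = k" "cls (a - y) = k" using that by (auto simp: T_def)
    then have "cls (x - y) \<noteq> k" using tri[of a x y k] inc a that(3) by auto
    then show ?thesis using cd * that(3) by blast
  qed
  have "cls (b - c) = 3 - k" "cls (c - d) = 3 - k" "cls (b - d) = 3 - k"
    using ne[of b c] ne[of c d] ne[of b d] inT bcd k(1) by auto
  moreover have "b \<in> S" "c \<in> S" "d \<in> S" using inT by (auto simp: T_def)
  ultimately show False using tri[of b c d "3 - k"] inc bcd by blast
qed

lemma rep_V: "x \<in> V \<Longrightarrow> rep x = x"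
  using V_unique[OF rep_in_V, of x x] rep_eqv[of x] eqv_sym[of x "rep x"] by (simp add: eqv_def)

lemma cls_rep: "x \<notin> I \<Longrightarrow> cls (rep x) = cls x"
  using cls_eqv[OF rep_eqv[of x]] by simp

text \<open>Multiplication by \<open>w\<close> moves the three classes around a cycle, so they have
  equal size.\<close>

lemma card_class_noncube_root:
  assumes cw: "cls w \<noteq> 0" and j: "j < 3"
  shows "card {x \<in> V - I. cls x = j} = n"
proof -
  define C where "C j = {x \<in> V - I. cls x = j}" for j
  have fin: "finite (C j)" for j using finite_V by (simp add: C_def)
  have step: "card (C i) \<le> card (C ((cls w + i) mod 3))" for i
  proof (rule card_inj_on_le[where f = "\<lambda>x. rep (w * x)"])
    show "inj_on (\<lambda>x. rep (w * x)) (C i)"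
      using inj_on_rep[OF w_notin_I] by (auto simp: inj_on_def C_def rep_eq_iff)
    show "(\<lambda>x. rep (w * x)) ` C i \<subseteq> C ((cls w + i) mod 3)"
    proof
      fix y assume "y \<in> (\<lambda>x. rep (w * x)) ` C i"
      then obtain x where x: "x \<in> V" "x \<notin> I" "cls x = i" "y = rep (w * x)" by (auto simp: C_def)
      have "w * x \<notin> I" using x w_notin_I by (simp add: I_mult_iff)
      then have "cls y = cls (w * x)" using cls_rep[of "w * x"] x by simp
      then show "y \<in> C ((cls w + i) mod 3)"
        using cls_mult[OF w_notin_I x(2)] x \<open>w * x \<notin> I\<close> by (simp add: C_def)
    qed
    show "finite (C ((cls w + i) mod 3))" by (rule fin)
  qed
  have "cls w = 1 \<or> cls w = 2" using cw cls(1)[OF w_notin_I] by auto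
  then have eq: "card (C 0) = card (C 1) \<and> card (C 1) = card (C 2)"
    using step[of 0] step[of 1] step[of 2] by (auto simp: numeral_2_eq_2)
  have "V - I = C 0 \<union> (C 1 \<union> C 2)"
  proof -
    have "cls x = 0 \<or> cls x = 1 \<or> cls x = 2" if "x \<notin> I" for x using cls(1)[OF that] by auto
    then show ?thesis unfolding C_def by blast
  qed
  moreover have "C 0 \<inter> (C 1 \<union> C 2) = {}" "C 1 \<inter> C 2 = {}" by (auto simp: C_def)
  ultimately have "card (V - I) = card (C 0) + (card (C 1) + card (C 2))"
    using fin by (simp add: card_Un_disjoint)
  then have "card (C 0) = n \<and> card (C 1) = n \<and> card (C 2) = n" using card_nonzero q_eq eq by simp
  moreover have "j = 0 \<or> j = 1 \<or> j = 2" using j by auto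
  ultimately show ?thesis unfolding C_def by auto
qed

text \<open>The sizes of the \<open>N i j\<close> are the cyclotomic numbers of order 3. The row
  sums \<open>n - 1\<close> and \<open>n\<close>, with \<open>N 1 0\<close> injecting into
  \<open>N 0 1\<close> and \<open>N 1 1\<close> into \<open>N 0 2\<close>, leave at least one more
  element in \<open>N 1 2\<close> than in \<open>N 0 0\<close>. The latter is nonempty because
  \<open>q \<ge> 19\<close> provides six cubes. An \<open>x\<close> in \<open>N 1 2\<close> makes
  \<open>1\<close>, \<open>x\<close>, \<open>- (1 + x)\<close> rainbow; two such \<open>x\<close>
  are wanted because \<open>w\<close> and \<open>w^2\<close>, at most one of which lies there, must
  be avoided.\<close>

lemma hesse_family_noncube:
  assumes cw: "cls w \<noteq> 0" and q: "q \<ge> 19"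
  shows "hesse_family I q"
proof -
  define C where "C j = {x \<in> V - I. cls x = j}" for j
  define N where "N i j = {x \<in> V - I. 1 + x \<notin> I \<and> cls x = i \<and> cls (1 + x) = j}" for i j
  have cardC: "card (C j) = n" if "j < 3" for j unfolding C_def by (rule card_class_noncube_root[OF cw that])
  have fC: "finite (C j)" and fN: "finite (N i j)" for i j using finite_V by (simp_all add: C_def N_def)
  have inN: "rep x \<in> N i j" if "x \<notin> I" "1 + x \<notin> I" "cls x = i" "cls (1 + x) = j" for x i j
  proof -
    have e: "1 + x \<simeq> 1 + rep x" by (intro eqv_add eqv_refl rep_eqv)
    show ?thesis using that cls_rep[of x] cls_eqv[OF e] eqv_I[OF e] by (simp add: N_def)
  qed
  have "N 0 0 \<noteq> {}"
  proof -
    have "\<exists>u. u \<notin> I \<and> 1 + u \<notin> I \<and> cls u = 0 \<and> cls (1 + u) = 0"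
    proof (rule exists_consecutive_cubes[of "C 0"])
      show "finite (C 0)" by (rule fC)
      show "card (C 0) \<ge> 6" using cardC[of 0] q q_eq by simp
      show "x \<notin> I \<and> cls x = 0" if "x \<in> C 0" for x using that by (simp add: C_def)
      show "x - y \<notin> I" if "x \<in> C 0" "y \<in> C 0" "x \<noteq> y" for x y using V_unique that by (auto simp: C_def)
    qed
    then show ?thesis using inN by blast
  qed
  then have N00: "card (N 0 0) \<ge> 1" using fN by (simp add: Suc_le_eq card_gt_0_iff)
  have cm1: "cls (- 1) = 0" "- 1 \<notin> I" using cls_minus[OF one_notin_I] cls_one one_notin_I by simp_all
  have split: "C i - {rep (- 1)} = N i 0 \<union> (N i 1 \<union> N i 2)" for i
  proof -
    have a: "1 + x \<notin> I" if "x \<in> V" "x \<noteq> rep (- 1)" for x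
    proof
      assume "1 + x \<in> I"
      then have "x \<simeq> - 1" by (simp add: eqv_def add.commute)
      then show False using rep_eq_iff rep_V[OF that(1)] that(2) by metis
    qed
    have b: "1 + rep (- 1) \<in> I" using eqv_sym[OF rep_eqv[of "- 1"]] by (simp add: eqv_def add.commute)
    have c: "cls x = 0 \<or> cls x = 1 \<or> cls x = 2" if "x \<notin> I" for x using cls(1)[OF that] by auto
    show ?thesis
    proof (intro equalityI subsetI)
      fix x assume "x \<in> C i - {rep (- 1)}"
      then have "x \<in> V" "x \<notin> I" "cls x = i" "x \<noteq> rep (- 1)" by (auto simp: C_def)
      then show "x \<in> N i 0 \<union> (N i 1 \<union> N i 2)" using a[of x] c[of "1 + x"] by (auto simp: N_def)
    next
      fix x assume "x \<in> N i 0 \<union> (N i 1 \<union> N i 2)"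
      then have "x \<in> V" "x \<notin> I" "cls x = i" "1 + x \<notin> I" by (auto simp: N_def)
      then show "x \<in> C i - {rep (- 1)}" using b by (auto simp: C_def)
    qed
  qed
  have dis: "card (N i 0 \<union> (N i 1 \<union> N i 2)) = card (N i 0) + (card (N i 1) + card (N i 2))" for i
  proof -
    have "N i 0 \<inter> (N i 1 \<union> N i 2) = {}" "N i 1 \<inter> N i 2 = {}" by (auto simp: N_def)
    then show ?thesis using fN by (simp add: card_Un_disjoint)
  qed
  \<comment> \<open>The residue of \<open>- 1\<close>, where \<open>1 + x\<close> has no class, is
    itself a cube; hence only this row loses one element.\<close>
  have row0: "card (N 0 0) + (card (N 0 1) + card (N 0 2)) = n - 1"
  proof -
    have "rep (- 1) \<in> C 0" using cm1 cls_rep[of "- 1"] by (simp add: C_def)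
    then have "card (C 0 - {rep (- 1)}) = n - 1" using cardC[of 0] fC by simp
    then show ?thesis unfolding split dis .
  qed
  have row1: "card (N 1 0) + (card (N 1 1) + card (N 1 2)) = n"
  proof -
    have "rep (- 1) \<notin> C 1" using cm1 cls_rep[of "- 1"] by (simp add: C_def)
    then have "card (C 1 - {rep (- 1)}) = n" using cardC[of 1] by simp
    then show ?thesis unfolding split dis .
  qed
  have le1: "card (N 1 0) \<le> card (N 0 1)"
  proof (rule card_inj_on_le[where f = "\<lambda>x. rep (- (1 + x))"])
    show "inj_on (\<lambda>x. rep (- (1 + x))) (N 1 0)"
    proof (rule inj_onI)
      fix x y assume a: "x \<in> N 1 0" "y \<in> N 1 0" "rep (- (1 + x)) = rep (- (1 + y))"
      then have "- (1 + x) - - (1 + y) \<in> I" unfolding rep_eq_iff eqv_def by simp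
      then have "y - x \<in> I" by simp
      then show "x = y" using V_unique a by (auto simp: N_def)
    qed
    show "(\<lambda>x. rep (- (1 + x))) ` N 1 0 \<subseteq> N 0 1"
    proof (intro image_subsetI inN)
      fix x assume x: "x \<in> N 1 0"
      have m: "1 + - (1 + x) = - x" by simp
      show "- (1 + x) \<notin> I" "cls (- (1 + x)) = 0" using x unfolding N_def I_neg_iff by (simp_all add: cls_minus del: minus_add_distrib)
      show "1 + - (1 + x) \<notin> I" "cls (1 + - (1 + x)) = 1" unfolding m I_neg_iff using x unfolding N_def by (simp_all add: cls_minus)
    qed
  qed (rule fN)
  have "\<exists>y. x * y \<simeq> - (1 + x)" if "x \<notin> I" for x using divide_ex[OF that] by blast
  \<comment> \<open>The map \<open>h x = - (1 + x) / x\<close>, for which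
    \<open>1 + h x = - 1 / x\<close>.\<close>
  then obtain h where h: "x * h x \<simeq> - (1 + x)" if "x \<notin> I" for x by metis
  have h': "x * (1 + h x) \<simeq> - 1" if "x \<notin> I" for x
    using eqv_add[OF eqv_refl h[OF that], of x] by (simp add: distrib_left)
  have le2: "card (N 1 1) \<le> card (N 0 2)"
  proof (rule card_inj_on_le[where f = "\<lambda>x. rep (h x)"])
    show "inj_on (\<lambda>x. rep (h x)) (N 1 1)"
    proof (rule inj_onI)
      fix x y assume a: "x \<in> N 1 1" "y \<in> N 1 1" "rep (h x) = rep (h y)"
      then have xy: "x \<in> V" "y \<in> V" "x \<notin> I" "y \<notin> I" by (simp_all add: N_def)
      have e: "h x \<simeq> h y" using a(3) by (simp only: rep_eq_iff)
      have nh: "1 + h y \<notin> I" using eqv_I[OF h'[OF xy(4)]] cm1(2) I_mult by blast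
      have "x * (1 + h y) \<simeq> x * (1 + h x)" by (intro eqv_mult eqv_add eqv_refl eqv_sym[OF e])
      then have "x * (1 + h y) \<simeq> y * (1 + h y)"
        using eqv_trans[OF _ eqv_trans[OF h'[OF xy(3)] eqv_sym[OF h'[OF xy(4)]]]] by blast
      then have "x \<simeq> y" using eqv_mult_cancel2[OF nh] by blast
      then show "x = y" using V_unique xy by (simp add: eqv_def)
    qed
    show "(\<lambda>x. rep (h x)) ` N 1 1 \<subseteq> N 0 2"
    proof (intro image_subsetI)
      fix x assume "x \<in> N 1 1"
      then have x: "x \<notin> I" "1 + x \<notin> I" "cls x = 1" "cls (1 + x) = 1" by (auto simp: N_def)
      have n1: "- (1 + x) \<notin> I" using x(2) by (simp only: I_neg_iff simp_thms)
      have nh: "h x \<notin> I" using eqv_I[OF h[OF x(1)]] n1 I_mult by blast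
      have nh': "1 + h x \<notin> I" using eqv_I[OF h'[OF x(1)]] cm1(2) I_mult by blast
      have "(1 + cls (h x)) mod 3 = 1"
        using cls_mult[OF x(1) nh] cls_eqv[OF h[OF x(1)]] cls_minus[OF x(2)] x nh by (simp add: I_mult_iff)
      moreover have "(1 + cls (1 + h x)) mod 3 = 0"
        using cls_mult[OF x(1) nh'] cls_eqv[OF h'[OF x(1)]] cm1 x nh' by (simp add: I_mult_iff)
      moreover have "cls (h x) = 0 \<or> cls (h x) = 1 \<or> cls (h x) = 2" using cls(1)[OF nh] by linarith
      moreover have "cls (1 + h x) = 0 \<or> cls (1 + h x) = 1 \<or> cls (1 + h x) = 2" using cls(1)[OF nh'] by linarith
      ultimately have "cls (h x) = 0" "cls (1 + h x) = 2" by (elim disjE; simp)+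
      then show "rep (h x) \<in> N 0 2" using inN nh nh' by blast
    qed
  qed (rule fN)
  have "n \<ge> 1" using q q_eq by simp
  then have N12: "card (N 1 2) \<ge> 2" using row0 row1 le1 le2 N00 by linarith
  have "\<exists>k. N 1 2 \<inter> {rep w, rep (w\<^sup>2)} \<subseteq> {k}"
  proof -
    have c2: "cls (w\<^sup>2) = (2 * cls w) mod 3" by (rule cls_power[OF w_notin_I])
    have "\<not> (cls w = 1 \<and> cls (w\<^sup>2) = 1)" using c2 by auto
    moreover have "cls (rep w) = cls w" "cls (rep (w\<^sup>2)) = cls (w\<^sup>2)"
      using w_notin_I by (simp_all add: cls_rep I_power_iff)
    ultimately have "rep w \<notin> N 1 2 \<or> rep (w\<^sup>2) \<notin> N 1 2" by (auto simp: N_def)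
    then show ?thesis by blast
  qed
  then obtain k where "N 1 2 \<inter> {rep w, rep (w\<^sup>2)} \<subseteq> {k}" by blast
  moreover have "\<not> N 1 2 \<subseteq> {k}" using N12 card_mono[of "{k}" "N 1 2"] by auto
  ultimately obtain x where x: "x \<in> N 1 2" "x \<noteq> rep w" "x \<noteq> rep (w\<^sup>2)" by blast
  then have xV: "x \<in> V" by (simp add: N_def)
  have "x - w \<notin> I" "x - w\<^sup>2 \<notin> I" using x(2,3) rep_V[OF xV] rep_eq_iff[of x w] rep_eq_iff[of x "w\<^sup>2"] by (auto simp: eqv_def)
  then obtain e where e: "e \<notin> I" "(1 - w * x) * e \<simeq> w\<^sup>2 - w * x" "1 - w * x \<notin> I"
    using triple_to_ratio by blast
  note v = triple_ratio_values[OF e(2)]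
  have c: "1 - w\<^sup>2 \<notin> I" using w_sq_minus_one I_neg_iff[of "1 - w\<^sup>2"] by simp
  have n1: "- (1 + x) \<notin> I" "cls (- (1 + x)) = 2" using x(1) cls_minus[of "1 + x"] unfolding N_def I_neg_iff by auto
  have "rainbow 1 x (- (1 + x))" using x(1) n1 one_notin_I unfolding rainbow_def N_def by (simp add: cls_one)
  then have "rainbow ((1 - w\<^sup>2) * 1) ((1 - w\<^sup>2) * x) ((1 - w\<^sup>2) * - (1 + x))" by (rule rainbow_mult[OF c])
  then have "rainbow ((1 - w * x) * (1 - e)) ((1 - w * x) * (w * (1 - e * w))) ((1 - w * x) * (w\<^sup>2 * (1 - e * w\<^sup>2)))"
    using rainbow_eqv[OF _ eqv_sym[OF v(1)] eqv_sym[OF v(2)] eqv_sym[OF v(3)]] by simp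
  then show ?thesis using hesse_family_noncube_root[OF cw e(1)] rainbow_mult_iff[OF e(3)] by blast
qed

end

section \<open>Families on products\<close>

text \<open>Transport of a family along several homomorphisms at once: by \<open>onto\<close> and
  \<open>uniq\<close>, each element of \<open>D'\<close> is, modulo \<open>J\<close>, the image of
  exactly one residue of \<open>D\<close> under exactly one \<open>\<psi> k\<close>.\<close>

lemma covers_images:
  fixes I :: "'b::ab_group_add set" and J :: "'c::ab_group_add set"
  assumes cov: "covers I B D" and J: "subgrp J"
    and add: "\<And>k x y. k \<in> K \<Longrightarrow> \<psi> k (x - y) = \<psi> k x - \<psi> k y"
    and into: "\<And>k x. k \<in> K \<Longrightarrow> x \<in> D \<Longrightarrow> \<psi> k x \<in> D'"
    and zero: "\<And>k x. k \<in> K \<Longrightarrow> x \<in> I \<Longrightarrow> \<psi> k x \<in> J"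
    and onto: "\<And>d. d \<in> D' \<Longrightarrow> \<exists>k\<in>K. \<exists>x\<in>D. \<psi> k x - d \<in> J"
    and uniq: "\<And>k k' x x'. k \<in> K \<Longrightarrow> k' \<in> K \<Longrightarrow> x \<in> D \<Longrightarrow> x' \<in> D \<Longrightarrow> \<psi> k x - \<psi> k' x' \<in> J \<Longrightarrow> k = k' \<and> x - x' \<in> I"
  shows "covers J ((\<lambda>(k, b). (\<psi> k \<circ> fst b, snd b)) ` (K \<times> B)) D'"
proof -
  have bij: "bij_betw (snd b) UNIV ag_lines" if "b \<in> B" for b using cov that by (auto simp: covers_def)
  have dif: "fst b i - fst b j \<in> D" if "b \<in> B" "i < 9" "j < 9" "i \<noteq> j" for b i j
    using cov that unfolding covers_def by blast
  have lt: "i < 9" if "b \<in> B" "i \<in> snd b c" for b i c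
  proof -
    have "snd b c \<in> ag_lines" using bij_betwE[OF bij[OF that(1)]] by blast
    then show ?thesis using line_ex_points that(2) by blast
  qed
  have ex1: "\<exists>!(b, i, j). b \<in> B \<and> i \<in> snd b c \<and> j \<in> snd b c \<and> i \<noteq> j \<and> fst b i - fst b j - d \<in> I" if "d \<in> D" for c d
    using cov that unfolding covers_def by blast
  let ?B = "(\<lambda>(k, b). (\<psi> k \<circ> fst b, snd b)) ` (K \<times> B)"
  show ?thesis unfolding covers_def
  proof (intro conjI ballI allI impI)
    fix b' assume "b' \<in> ?B"
    then obtain k b where b: "k \<in> K" "b \<in> B" "b' = (\<psi> k \<circ> fst b, snd b)" by auto
    show "bij_betw (snd b') UNIV ag_lines" using bij b by simp
    fix i j :: nat assume "i < 9" "j < 9" "i \<noteq> j"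
    then have "\<psi> k (fst b i - fst b j) \<in> D'" using into dif b by blast
    then show "fst b' i - fst b' j \<in> D'" using b by (simp add: add)
  next
    fix c d assume "d \<in> D'"
    then obtain k x where kx: "k \<in> K" "x \<in> D" "\<psi> k x - d \<in> J" using onto by blast
    obtain b i j where bij: "b \<in> B" "i \<in> snd b c" "j \<in> snd b c" "i \<noteq> j" "fst b i - fst b j - x \<in> I"
      using ex1[OF kx(2), of c] by (auto elim!: ex1E)
    let ?P = "\<lambda>(b', i, j). b' \<in> ?B \<and> i \<in> snd b' c \<and> j \<in> snd b' c \<and> i \<noteq> j \<and> fst b' i - fst b' j - d \<in> J"
    show "\<exists>!(b', i, j). b' \<in> ?B \<and> i \<in> snd b' c \<and> j \<in> snd b' c \<and> i \<noteq> j \<and> fst b' i - fst b' j - d \<in> J"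
    proof (rule ex1I[of _ "((\<psi> k \<circ> fst b, snd b), i, j)"])
      have "\<psi> k (fst b i - fst b j - x) + (\<psi> k x - d) \<in> J"
        using subgrpD(4)[OF J] zero[OF kx(1) bij(5)] kx(3) by blast
      then have "\<psi> k (fst b i) - \<psi> k (fst b j) - d \<in> J" using kx(1) by (simp add: add)
      then show "?P ((\<psi> k \<circ> fst b, snd b), i, j)" using bij kx(1) by auto
      fix t assume t: "?P t"
      obtain b' i' j' where t_eq: "t = (b', i', j')" by (cases t)
      have "b' \<in> ?B" using t t_eq by simp
      then obtain k1 b1 where b1: "k1 \<in> K" "b1 \<in> B" "b' = (\<psi> k1 \<circ> fst b1, snd b1)" by auto
      have m: "i' \<in> snd b1 c" "j' \<in> snd b1 c" "i' \<noteq> j'" "\<psi> k1 (fst b1 i' - fst b1 j') - d \<in> J"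
        using t t_eq b1 by (auto simp: add)
      have "\<psi> k1 (fst b1 i' - fst b1 j') - \<psi> k x \<in> J"
        using subgrpD(2)[OF J m(4) kx(3)] by simp
      then have u: "k1 = k" "fst b1 i' - fst b1 j' - x \<in> I"
        using uniq[OF b1(1) kx(1) dif[OF b1(2) lt[OF b1(2) m(1)] lt[OF b1(2) m(2)] m(3)] kx(2)] by auto
      have "(b1, i', j') = (b, i, j)"
        using ex1[OF kx(2), of c] bij b1(2) m u(2) by (auto elim!: ex1E)
      then show "t = ((\<psi> k \<circ> fst b, snd b), i, j)" using t_eq b1 u by simp
    qed
  qed
qed

lemma covers_Un:
  assumes 1: "covers J B1 D1" and 2: "covers J B2 D2" and J: "subgrp J"
    and dis: "\<And>x y. x \<in> D1 \<Longrightarrow> y \<in> D2 \<Longrightarrow> x - y \<notin> J"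
  shows "covers J (B1 \<union> B2) (D1 \<union> D2)"
proof -
  have dis': "y - x \<notin> J" if "x \<in> D1" "y \<in> D2" for x y
    using dis[OF that] subgrpD(3)[OF J, of "y - x"] by auto
  have lt: "i < 9" if "b \<in> B1 \<union> B2" "i \<in> snd b c" for b i c
  proof -
    have "bij_betw (snd b) UNIV ag_lines" using 1 2 that(1) by (auto simp: covers_def)
    then have "snd b c \<in> ag_lines" using bij_betwE by blast
    then show ?thesis using line_ex_points that(2) by blast
  qed
  have d1: "fst b i - fst b j \<in> D1" if "b \<in> B1" "i < 9" "j < 9" "i \<noteq> j" for b i j
    using 1 that unfolding covers_def by blast
  have d2: "fst b i - fst b j \<in> D2" if "b \<in> B2" "i < 9" "j < 9" "i \<noteq> j" for b i j
    using 2 that unfolding covers_def by blast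
  show ?thesis unfolding covers_def
  proof (intro conjI ballI allI impI)
    fix b assume b: "b \<in> B1 \<union> B2"
    then show "bij_betw (snd b) UNIV ag_lines" using 1 2 by (auto simp: covers_def)
    fix i j :: nat assume "i < 9" "j < 9" "i \<noteq> j"
    then show "fst b i - fst b j \<in> D1 \<union> D2" using b d1 d2 by blast
  next
    fix c :: 12 and d assume d: "d \<in> D1 \<union> D2"
    let ?P = "\<lambda>B (b, i, j). b \<in> B \<and> i \<in> snd b c \<and> j \<in> snd b c \<and> i \<noteq> j \<and> fst b i - fst b j - d \<in> J"
    have e1: "?P (B1 \<union> B2) t = ?P B1 t" if "d \<in> D1" for t
    proof -
      obtain b i j where t: "t = (b, i, j)" by (cases t)
      have "\<not> (b \<in> B2 \<and> i \<in> snd b c \<and> j \<in> snd b c \<and> i \<noteq> j \<and> fst b i - fst b j - d \<in> J)"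
        using d2[of b i j] dis'[of "d" "fst b i - fst b j"] that lt[of b i c] lt[of b j c] by auto
      then show ?thesis unfolding t prod.case Un_iff by argo
    qed
    have e2: "?P (B1 \<union> B2) t = ?P B2 t" if "d \<in> D2" for t
    proof -
      obtain b i j where t: "t = (b, i, j)" by (cases t)
      have "\<not> (b \<in> B1 \<and> i \<in> snd b c \<and> j \<in> snd b c \<and> i \<noteq> j \<and> fst b i - fst b j - d \<in> J)"
        using d1[of b i j] dis[of "fst b i - fst b j" "d"] that lt[of b i c] lt[of b j c] by auto
      then show ?thesis unfolding t prod.case Un_iff by argo
    qed
    have x1: "\<exists>!t. ?P B1 t" if "d \<in> D1" using 1 that unfolding covers_def by blast
    have x2: "\<exists>!t. ?P B2 t" if "d \<in> D2" using 2 that unfolding covers_def by blast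
    have "\<exists>!t. ?P (B1 \<union> B2) t" using d
    proof
      assume "d \<in> D1"
      from x1[OF this] show ?thesis unfolding e1[OF \<open>d \<in> D1\<close>] .
    next
      assume "d \<in> D2"
      from x2[OF this] show ?thesis unfolding e2[OF \<open>d \<in> D2\<close>] .
    qed
    then show "\<exists>!(b, i, j). b \<in> B1 \<union> B2 \<and> i \<in> snd b c \<and> j \<in> snd b c \<and> i \<noteq> j \<and> fst b i - fst b j - d \<in> J" .
  qed
qed

text \<open>The quotient is the product of the quotient by \<open>J\<close> with \<open>k\<close>
  copies of the quotient by \<open>I\<close>. Coordinates from \<open>k\<close> on are
  unconstrained, so that a single type serves every \<open>k\<close>.\<close>

definition power_subgrp :: "'c::ab_group_add set \<Rightarrow> 'a::comm_ring_1 set \<Rightarrow> nat \<Rightarrow> ('c \<times> (nat \<Rightarrow> 'a)) set" where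
  "power_subgrp J I k = {z. fst z \<in> J \<and> (\<forall>i<k. snd z i \<in> I)}"

text \<open>Induction on \<open>k\<close>. Differences whose last coordinate lies in
  \<open>I\<close> are covered by the earlier family. For the others, each \<open>v\<close> in a
  transversal of the earlier quotient sends the base planes of the field through \<open>c\<close> to
  \<open>(v c, c)\<close>: once the last coordinate is fixed outside \<open>I\<close>, its action is
  a bijection of the earlier quotient, so every first part occurs for exactly one \<open>v\<close>.
  All that is asked of \<open>act\<close> is biadditivity and this bijectivity.\<close>

lemma (in residue_field) hesse_family_product_power:
  fixes J :: "'c::ab_group_add set" and act :: "'c \<Rightarrow> 'a \<Rightarrow> 'c"
  assumes famI: "hesse_family I q" and famJ: "hesse_family J h"
    and addl: "\<And>x y b. act (x - y) b = act x b - act y b"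
    and addr: "\<And>x b c. act x (b - c) = act x b - act x c"
    and zero: "\<And>x b. b \<in> I \<Longrightarrow> act x b \<in> J"
    and left: "\<And>x b. x \<in> J \<Longrightarrow> act x b \<in> J"
    and inj: "\<And>x b. b \<notin> I \<Longrightarrow> act x b \<in> J \<Longrightarrow> x \<in> J"
    and surj: "\<And>y b. b \<notin> I \<Longrightarrow> \<exists>x. act x b - y \<in> J"
  shows "hesse_family (power_subgrp J I k) (h * q ^ k)"
proof (induction k)
  case 0
  have sJ: "subgrp J" using famJ by (simp add: hesse_family_def)
  have s: "subgrp (power_subgrp J I 0)" using sJ by (auto simp: subgrp_def power_subgrp_def)
  obtain W where W: "finite W" "card W = h" "\<And>x. \<exists>!v. v \<in> W \<and> x - v \<in> J"
    using famJ unfolding hesse_family_def has_index_def by blast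
  have "has_index (power_subgrp J I 0) h" unfolding has_index_def
  proof (intro exI conjI allI)
    show "finite (W \<times> {0::nat \<Rightarrow> 'a})" "card (W \<times> {0::nat \<Rightarrow> 'a}) = h" using W by (simp_all add: card_cartesian_product)
    fix z :: "'c \<times> (nat \<Rightarrow> 'a)"
    obtain v where v: "v \<in> W" "fst z - v \<in> J" using W(3) by blast
    show "\<exists>!u. u \<in> W \<times> {0} \<and> z - u \<in> power_subgrp J I 0"
      by (rule ex1I[of _ "(v, 0)"]) (use v W(3)[of "fst z"] in \<open>auto simp: power_subgrp_def\<close>)
  qed
  moreover obtain B where B: "covers J B (- J)" using famJ unfolding hesse_family_def by blast
  have "covers (power_subgrp J I 0) ((\<lambda>(k, b). ((\<lambda>x. (x, 0)) \<circ> fst b, snd b)) ` ({()} \<times> B)) (- power_subgrp J I 0)"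
    by (rule covers_images[OF B s]) (auto simp: power_subgrp_def subgrpD(1)[OF sJ] intro!: bexI[where P = "\<lambda>x. x - _ \<in> J"])
  ultimately show ?case using s unfolding hesse_family_def by auto
next
  case (Suc k)
  have sJ: "subgrp J" using famJ by (simp add: hesse_family_def)
  let ?J = "power_subgrp J I k" and ?J' = "power_subgrp J I (Suc k)"
  have mem: "z \<in> ?J' \<longleftrightarrow> z \<in> ?J \<and> snd z k \<in> I" for z :: "'c \<times> (nat \<Rightarrow> 'a)"
    by (auto simp: power_subgrp_def less_Suc_eq)
  have s: "subgrp ?J'" using sJ by (auto simp: subgrp_def power_subgrp_def I_zero I_diff)
  have sk: "subgrp ?J" using Suc.IH by (simp add: hesse_family_def)
  obtain W where W: "finite W" "card W = h * q ^ k" "\<And>x. \<exists>!v. v \<in> W \<and> x - v \<in> ?J"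
    using Suc.IH unfolding hesse_family_def has_index_def by blast
  have Wu: "u = v" if "u \<in> W" "v \<in> W" "u - v \<in> ?J" for u v
    using W(3)[of u] that subgrpD(1)[OF sk] by (metis diff_self)
  define ext where "ext z b = (fst z, (snd z)(k := b))" for z :: "'c \<times> (nat \<Rightarrow> 'a)" and b
  have ext_diff: "ext z b - ext z' b' = ext (z - z') (b - b')" for z b z' b'
    by (auto simp: ext_def fun_eq_iff)
  have ext_mem: "ext z b \<in> ?J \<longleftrightarrow> z \<in> ?J" "snd (ext z b) k = b" for z b
    by (auto simp: ext_def power_subgrp_def)
  have ext_mem': "ext z b \<in> ?J' \<longleftrightarrow> z \<in> ?J \<and> b \<in> I" for z b by (simp add: mem ext_mem)
  have ext_same: "ext z (snd z k) = z" for z by (simp add: ext_def)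
  have ix: "has_index ?J' (h * q ^ Suc k)" unfolding has_index_def
  proof (intro exI conjI allI)
    let ?W = "(\<lambda>(z, b). ext z b) ` (W \<times> V)"
    have "inj_on (\<lambda>(z, b). ext z b) (W \<times> V)"
    proof (rule inj_onI)
      fix x y assume a: "x \<in> W \<times> V" "y \<in> W \<times> V" "(case x of (z, b) \<Rightarrow> ext z b) = (case y of (z, b) \<Rightarrow> ext z b)"
      then have e: "ext (fst x) (snd x) = ext (fst y) (snd y)" by (auto split: prod.splits)
      then have "snd x = snd y" using ext_mem(2) by metis
      moreover have "ext (fst x - fst y) (snd x - snd y) \<in> ?J"
        using e subgrpD(1)[OF sk] unfolding ext_diff[symmetric] by simp
      then have "fst x = fst y" using Wu a unfolding ext_mem by auto
      ultimately show "x = y" by (simp add: prod_eq_iff)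
    qed
    then show "card ?W = h * q ^ Suc k" using W finite_V card_V by (simp add: card_image card_cartesian_product)
    show "finite ?W" using W finite_V by simp
    fix z :: "'c \<times> (nat \<Rightarrow> 'a)"
    obtain v where v: "v \<in> W" "z - v \<in> ?J" using W(3) by blast
    obtain b where b: "b \<in> V" "snd z k - b \<in> I" using V_ex by blast
    have d: "z - ext u c = ext (z - u) (snd z k - c)" for u c
      using ext_diff[of z "snd z k" u c] by (simp add: ext_same)
    show "\<exists>!u. u \<in> ?W \<and> z - u \<in> ?J'"
    proof (rule ex1I[of _ "ext v b"])
      show "ext v b \<in> ?W \<and> z - ext v b \<in> ?J'" using v b unfolding d ext_mem' by auto
      fix u assume u0: "u \<in> ?W \<and> z - u \<in> ?J'"
      then obtain v' b' where u1: "u = ext v' b'" "v' \<in> W" "b' \<in> V" by force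
      then have "z - v' \<in> ?J" "snd z k - b' \<in> I" using u0 unfolding u1(1) d ext_mem' by simp_all
      note u = u1 this
      have "v' = v" using W(3)[of z] u v by blast
      moreover have "(snd z k - b) - (snd z k - b') \<in> I" by (rule I_diff[OF b(2) u(5)])
      then have "b' = b" using V_unique[OF u(3) b(1)] by simp
      ultimately show "u = ext v b" using u by simp
    qed
  qed
  define D1 where "D1 = {z. snd z k \<in> I \<and> z \<notin> ?J}"
  define D2 where "D2 = {z :: 'c \<times> (nat \<Rightarrow> 'a). snd z k \<notin> I}"
  obtain B where B: "covers ?J B (- ?J)" using Suc.IH unfolding hesse_family_def by blast
  have c1: "covers ?J' ((\<lambda>(u, b). ((\<lambda>z. ext z 0) \<circ> fst b, snd b)) ` ({()} \<times> B)) D1"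
  proof (rule covers_images[OF B s])
    show "ext (x - y) 0 = ext x 0 - ext y 0" for x y using ext_diff by simp
    show "ext x 0 \<in> D1" if "x \<in> - ?J" for x using that by (simp add: D1_def ext_mem I_zero)
    show "ext x 0 \<in> ?J'" if "x \<in> ?J" for x using that by (simp add: ext_mem' I_zero)
    show "\<exists>u\<in>{()}. \<exists>x\<in>- ?J. ext x 0 - d \<in> ?J'" if "d \<in> D1" for d
    proof (intro bexI[of _ "()"] bexI[of _ d])
      have "ext d 0 - d = ext 0 (0 - snd d k)" using ext_diff[of d 0 d "snd d k"] by (simp add: ext_same)
      then show "ext d 0 - d \<in> ?J'" using that subgrpD(1)[OF sk] by (simp add: ext_mem' D1_def)
    qed (use that in \<open>simp_all add: D1_def\<close>)
    show "u = u' \<and> x - x' \<in> ?J" if "ext x 0 - ext x' 0 \<in> ?J'" for u u' :: unit and x x'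
      using that unfolding ext_diff ext_mem' by simp
  qed
  define act' where "act' z b = (act (fst z) b, \<lambda>i. snd z i * b)" for z :: "'c \<times> (nat \<Rightarrow> 'a)" and b
  have addl': "act' (x - y) b = act' x b - act' y b" for x y b
    by (auto simp: act'_def addl fun_eq_iff left_diff_distrib)
  have addr': "act' x (b - c) = act' x b - act' x c" for x b c
    by (auto simp: act'_def addr fun_eq_iff right_diff_distrib)
  have zero': "act' x b \<in> ?J" if "b \<in> I" for x b
    using that by (auto simp: act'_def power_subgrp_def zero I_mult)
  have inj': "x \<in> ?J" if "b \<notin> I" "act' x b \<in> ?J" for x b
    using that inj by (auto simp: I_mult_iff act'_def power_subgrp_def)
  have surj': "\<exists>x. act' x b - y \<in> ?J" if b: "b \<notin> I" for y b
  proof -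
    obtain a where a: "act a b - fst y \<in> J" using surj[OF b] by blast
    have "\<forall>i. \<exists>g. b * g \<simeq> snd y i" using divide_ex[OF b] by blast
    then obtain g where g: "\<And>i. b * g i \<simeq> snd y i" by metis
    have "act' (a, g) b - y \<in> ?J"
      using a g by (auto simp: act'_def power_subgrp_def eqv_def mult.commute)
    then show ?thesis by blast
  qed
  obtain C where C: "covers I C (- I)" using famI unfolding hesse_family_def by blast
  have c2: "covers ?J' ((\<lambda>(v, b). ((\<lambda>c. ext (act' v c) c) \<circ> fst b, snd b)) ` (W \<times> C)) D2"
  proof (rule covers_images[OF C s])
    fix v assume v: "v \<in> W"
    show "ext (act' v (x - y)) (x - y) = ext (act' v x) x - ext (act' v y) y" for x y
      unfolding ext_diff addr' ..
    show "ext (act' v x) x \<in> D2" if "x \<in> - I" for x using that by (simp add: D2_def ext_mem)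
    show "ext (act' v x) x \<in> ?J'" if "x \<in> I" for x using that by (simp add: ext_mem' zero')
  next
    fix d assume d: "d \<in> D2"
    let ?b = "snd d k"
    have b: "?b \<notin> I" using d by (simp add: D2_def)
    obtain x where x: "act' x ?b - d \<in> ?J" using surj'[OF b] by blast
    obtain v where v: "v \<in> W" "x - v \<in> ?J" using W(3) by blast
    have "act' (x - v) ?b \<in> ?J" using v(2) I_mult2 by (auto simp: act'_def power_subgrp_def left)
    then have "(act' x ?b - d) - act' (x - v) ?b \<in> ?J" using subgrpD(2)[OF sk x] by blast
    then have "act' v ?b - d \<in> ?J" by (simp add: addl')
    moreover have "ext (act' v ?b) ?b - d = ext (act' v ?b - d) (?b - ?b)"
      using ext_diff[of "act' v ?b" ?b d ?b] by (simp add: ext_same)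
    ultimately have "ext (act' v ?b) ?b - d \<in> ?J'" by (simp add: ext_mem' I_zero)
    then show "\<exists>v\<in>W. \<exists>x\<in>- I. ext (act' v x) x - d \<in> ?J'" using v b by blast
  next
    fix v v' x x' assume v: "v \<in> W" "v' \<in> W" and x: "x \<in> - I" "x' \<in> - I"
      and d: "ext (act' v x) x - ext (act' v' x') x' \<in> ?J'"
    have e: "act' v x - act' v' x' \<in> ?J" "x - x' \<in> I" using d unfolding ext_diff ext_mem' by auto
    have "(act' v x - act' v' x') - act' v' (x - x') \<in> ?J" by (rule subgrpD(2)[OF sk e(1) zero'[OF e(2)]])
    then have "act' (v - v') x \<in> ?J" by (simp add: addl' addr')
    then have "v - v' \<in> ?J" using inj' x by blast
    then show "v = v' \<and> x - x' \<in> I" using Wu v e by blast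
  qed
  have "covers ?J' (((\<lambda>(u, b). ((\<lambda>z. ext z 0) \<circ> fst b, snd b)) ` ({()} \<times> B)) \<union>
      ((\<lambda>(v, b). ((\<lambda>c. ext (act' v c) c) \<circ> fst b, snd b)) ` (W \<times> C))) (D1 \<union> D2)"
  proof (rule covers_Un[OF c1 c2 s])
    fix x y assume xy: "x \<in> D1" "y \<in> D2"
    show "x - y \<notin> ?J'"
    proof
      assume "x - y \<in> ?J'"
      then have "snd x k - snd y k \<in> I" unfolding mem by simp
      then have "snd x k - (snd x k - snd y k) \<in> I" by (rule I_diff[rotated]) (use xy in \<open>simp add: D1_def\<close>)
      then show False using xy by (simp add: D2_def)
    qed
  qed
  moreover have "D1 \<union> D2 = - ?J'" by (auto simp: D1_def D2_def mem)
  ultimately show ?case using s ix unfolding hesse_family_def by auto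
qed

lemma hesse_family_trivial: "hesse_family (UNIV :: int set) 1"
proof -
  have "covers (UNIV :: int set) {} (- UNIV)" by (simp add: covers_def)
  moreover have "has_index (UNIV :: int set) 1" unfolding has_index_def by (rule exI[of _ "{0}"]) simp
  ultimately show ?thesis unfolding hesse_family_def by (auto simp: subgrp_def)
qed

text \<open>The vector space case: with \<open>J\<close> everything, the first component carries no
  information and the zero action will do.\<close>

lemma (in residue_field) hesse_family_power:
  assumes "hesse_family I q"
  shows "hesse_family (power_subgrp (UNIV :: int set) I k) (q ^ k)"
  using hesse_family_product_power[OF assms hesse_family_trivial, of "\<lambda>x b. 0" k] by simp

section \<open>Choosing the root of unity; the split according to \<open>q\<close> modulo 9\<close>

lemma (in residue_field) cubic_field_ex:
  assumes "q mod 6 = 1"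
  shows "\<exists>w. cubic_field I V p q (q div 3) w"
proof -
  define n where "n = q div 3"
  have n: "q = 3 * n + 1" "even n" "n > 0" using assms q_gt_1 unfolding n_def by presburger+
  \<comment> \<open>The equation \<open>x ^ n = 1\<close> has at most \<open>n\<close> solutions
    among the \<open>3 * n\<close> nonzero residues.\<close>
  have "\<exists>x\<in>V - I. \<not> x ^ n \<simeq> 1"
  proof (rule ccontr)
    assume neg: "\<not> ?thesis"
    let ?h = "monom 1 n - 1 :: 'a poly"
    have c: "coeff ?h n = 1" using n(3) by (simp add: coeff_1)
    have "card (V - I) \<le> degree ?h"
    proof (rule card_roots_le)
      show "incong (V - I)" using finite_V V_unique by (auto simp: incong_def)
      show "poly ?h x \<in> I" if "x \<in> V - I" for x using neg that by (auto simp: poly_monom eqv_def)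
      show "?h \<notin> Ip" using c one_notin_I unfolding Ip_def by (metis mem_Collect_eq)
    qed
    moreover have "degree ?h \<le> n" by (intro degree_diff_le) (simp_all add: degree_monom_le)
    ultimately show False using card_nonzero n by linarith
  qed
  then obtain x where x: "x \<notin> I" "\<not> x ^ n \<simeq> 1" by blast
  have "(x ^ n) ^ 3 \<simeq> 1" using fermat[OF x(1)] n(1) by (simp add: power_mult[symmetric] mult.commute)
  moreover have "(x ^ n) ^ 3 - 1 = (x ^ n - 1) * ((x ^ n)\<^sup>2 + x ^ n + 1)"
    by (simp add: algebra_simps power2_eq_square power3_eq_cube)
  ultimately have "(x ^ n)\<^sup>2 + x ^ n + 1 \<in> I" using x(2) I_prime by (metis eqv_def)
  then have "cubic_field I V p q n (x ^ n)" by unfold_locales (use n in simp_all)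
  then show ?thesis unfolding n_def by blast
qed

lemma mod_9_eq: "q mod 6 = 1 \<Longrightarrow> q mod 9 = 3 * (q div 3 mod 3) + 1" for q :: nat
  using mod_mult2_eq[of q 3 3] mod_mod_cancel[of 3 6 q] by simp

lemma (in residue_field) hesse_family_mod_9:
  assumes "q mod 6 = 1" "q mod 9 \<noteq> 1" "q \<ge> 19"
  shows "hesse_family I q"
proof -
  obtain w where "cubic_field I V p q (q div 3) w" using cubic_field_ex[OF assms(1)] by blast
  then interpret cubic_field I V p q "q div 3" w .
  have "(q div 3) mod 3 \<noteq> 0" using mod_9_eq[OF assms(1)] assms(2) by simp
  then show ?thesis using hesse_family_noncube assms(3) by (simp add: cls_w)
qed

text \<open>Both requirements on \<open>M\<close> limit Stepanov's method: the order of vanishing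
  must not exceed the characteristic, nor the square root of \<open>q\<close>. The ring has to be a
  domain for the polynomial arguments.\<close>

lemma hesse_family_large:
  fixes I :: "'a::idom set"
  assumes "residue_field I V p q" "q mod 6 = 1" "q mod 9 = 1" "M \<le> p" "M\<^sup>2 \<le> q" "181 \<le> M"
  shows "hesse_family I q"
proof -
  interpret residue_field I V p q by fact
  obtain w where "cubic_field I V p q (q div 3) w" using cubic_field_ex[OF assms(2)] by blast
  then interpret cubic_field I V p q "q div 3" w .
  interpret cubic_field_idom I V p q "q div 3" w ..
  have "(q div 3) mod 3 = 0" using mod_9_eq[OF assms(2)] assms(3) by simp
  then have cw: "cls w = 0" by (simp add: cls_w)
  show ?thesis using exists_good_pattern[OF assms(4,5,6)] hesse_family_good_pattern[OF cw] by blast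
qed

text \<open>Square-and-multiply with a reduction map \<open>r\<close>; the first argument bounds the bit length of the exponent.\<close>

fun pow_red :: "('a::comm_ring_1 \<Rightarrow> 'a) \<Rightarrow> nat \<Rightarrow> int \<Rightarrow> 'a \<Rightarrow> 'a" where
  "pow_red r 0 e x = 1"
| "pow_red r (Suc b) e x = (if e = 0 then 1 else
     let y = pow_red r b (e div 2) x in if e mod 2 = 1 then r (y * y * x) else r (y * y))"

section \<open>Executable checks and their soundness\<close>

definition distinct_red :: "('a::comm_ring_1 \<Rightarrow> 'a) \<Rightarrow> 'a \<Rightarrow> 'a \<Rightarrow> 'a \<Rightarrow> bool" where
  "distinct_red r x y z \<longleftrightarrow> r x \<noteq> 0 \<and> r y \<noteq> 0 \<and> r z \<noteq> 0 \<and> r (x - y) \<noteq> 0 \<and> r (y - z) \<noteq> 0 \<and> r (x - z) \<noteq> 0"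

text \<open>The two conditions of \<open>hesse_family_triples\<close> in terms of
  \<open>n\<close>-th powers; \<open>y + x\<close> is \<open>1 + 2 * x\<close> and
  \<open>1 + y\<close> is \<open>2 + x\<close>. The powers are multiplied instead of taking powers
  of products, so those of \<open>x\<close> and \<open>1 + x\<close> are reused.\<close>

definition triples_check :: "('a::comm_ring_1 \<Rightarrow> 'a) \<Rightarrow> nat \<Rightarrow> int \<Rightarrow> 'a \<Rightarrow> bool" where
  "triples_check r b n x \<longleftrightarrow> (let y = 1 + x; a = pow_red r b n x; c = pow_red r b n y in
     distinct_red r 1 a c \<and>
     distinct_red r (pow_red r b n (y + x)) (a * pow_red r b n (1 + y)) (c * pow_red r b n (1 - x)))"

fun line_check :: "('a::comm_ring_1 \<Rightarrow> 'a) \<Rightarrow> nat \<Rightarrow> int \<Rightarrow> 'a list \<Rightarrow> nat \<times> nat \<times> nat \<Rightarrow> bool" where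
  "line_check r b n f (i, j, k) \<longleftrightarrow>
     distinct_red r (pow_red r b n (f ! i - f ! j)) (pow_red r b n (f ! j - f ! k)) (pow_red r b n (f ! k - f ! i))"

definition plane_check :: "('a::comm_ring_1 \<Rightarrow> 'a) \<Rightarrow> nat \<Rightarrow> int \<Rightarrow> 'a list \<Rightarrow> bool" where
  "plane_check r b n f \<longleftrightarrow> (\<forall>t \<in> set [(0, 1, 2), (3, 4, 5), (6, 7, 8), (0, 3, 6), (1, 4, 7), (2, 5, 8),
     (0, 4, 8), (1, 5, 6), (2, 3, 7), (0, 5, 7), (1, 3, 8), (2, 4, 6)]. line_check r b n f t)"

context residue_field
begin

lemma pow_red:
  assumes r: "\<And>x. r x \<simeq> x"
  shows "0 \<le> e \<Longrightarrow> e < 2 ^ b \<Longrightarrow> pow_red r b e x \<simeq> x ^ nat e"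
proof (induction b arbitrary: e x)
  case 0
  then show ?case by simp
next
  case (Suc b)
  show ?case
  proof (cases "e = 0")
    case False
    let ?y = "pow_red r b (e div 2) x" and ?m = "nat (e div 2)"
    have e: "nat e = 2 * ?m + nat (e mod 2)" using Suc.prems(1)
      by (simp add: nat_mult_distrib[symmetric] nat_add_distrib[symmetric] flip: nat_numeral)
    have y: "?y \<simeq> x ^ ?m" by (rule Suc.IH) (use Suc.prems in auto)
    show ?thesis
    proof (cases "e mod 2 = 1")
      case True
      have "r (?y * ?y * x) \<simeq> x ^ ?m * x ^ ?m * x"
        by (rule eqv_trans[OF r eqv_mult[OF eqv_mult[OF y y] eqv_refl]])
      also have "\<dots> = x ^ nat e" by (subst e) (simp add: True mult_2 power_add mult.commute)
      finally show ?thesis using True False by (simp add: Let_def)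
    next
      case False2: False
      then have "e mod 2 = 0" by presburger
      then have "x ^ nat e = x ^ ?m * x ^ ?m" by (subst e) (simp add: mult_2 power_add)
      moreover have "r (?y * ?y) \<simeq> x ^ ?m * x ^ ?m" by (rule eqv_trans[OF r eqv_mult[OF y y]])
      ultimately show ?thesis using False False2 by (simp add: Let_def)
    qed
  qed simp
qed

end

context cubic_field
begin

text \<open>The reduction is used in one direction: elements of \<open>I\<close> reduce to 0, so a
  nonzero reduction certifies that an element is outside \<open>I\<close>.\<close>

lemma rainbow_check:
  assumes r: "\<And>x. r x \<simeq> x" "\<And>x. x \<in> I \<Longrightarrow> r x = 0"
    and a: "a \<simeq> x ^ n" "b \<simeq> y ^ n" "c \<simeq> z ^ n" and d: "distinct_red r a b c"
  shows "rainbow x y z"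
proof -
  have n0: "n > 0" using q_eq q_gt_1 by simp
  have i: "u \<in> I \<Longrightarrow> r u = 0" for u using r by blast
  have no: "x ^ n \<notin> I" "y ^ n \<notin> I" "z ^ n \<notin> I"
    using d i eqv_I[OF a(1)] eqv_I[OF a(2)] eqv_I[OF a(3)] by (auto simp: distinct_red_def)
  moreover have "x ^ n - y ^ n \<notin> I" "y ^ n - z ^ n \<notin> I" "x ^ n - z ^ n \<notin> I"
    using d i eqv_I[OF eqv_diff[OF a(1,2)]] eqv_I[OF eqv_diff[OF a(2,3)]] eqv_I[OF eqv_diff[OF a(1,3)]]
    by (auto simp: distinct_red_def)
  ultimately show ?thesis using n0 by (simp add: rainbow_iff_powers I_power_iff eqv_def)
qed

end

context residue_field
begin

lemma hesse_family_triples_check: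
  assumes q6: "q mod 6 = 1" "q mod 9 = 1"
    and r: "\<And>x. r x \<simeq> x" "\<And>x. x \<in> I \<Longrightarrow> r x = 0"
    and n: "n = int (q div 3)" "n < 2 ^ b" and c: "triples_check r b n x"
  shows "hesse_family I q"
proof -
  obtain w where "cubic_field I V p q (q div 3) w" using cubic_field_ex[OF q6(1)] by blast
  then interpret cubic_field I V p q "q div 3" w .
  have "(q div 3) mod 3 = 0" using mod_9_eq[OF q6(1)] q6(2) by simp
  then have cw: "cls w = 0" by (simp add: cls_w)
  have P: "pow_red r b n y \<simeq> y ^ (q div 3)" for y using pow_red[of r n b, OF r(1)] n by simp
  have d: "distinct_red r 1 (pow_red r b n x) (pow_red r b n (1 + x))"
    "distinct_red r (pow_red r b n (1 + x + x)) (pow_red r b n x * pow_red r b n (1 + (1 + x)))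
      (pow_red r b n (1 + x) * pow_red r b n (1 - x))"
    using c by (auto simp: triples_check_def Let_def)
  have "1 \<simeq> 1 ^ (q div 3)" unfolding power_one by (rule eqv_refl)
  from rainbow_check[OF r this P P d(1)] have r1: "rainbow 1 x (1 + x)" .
  have PP: "pow_red r b n y * pow_red r b n z \<simeq> (y * z) ^ (q div 3)" for y z
    unfolding power_mult_distrib by (intro eqv_mult P)
  from rainbow_check[OF r P PP PP d(2)] have "rainbow (1 + x + x) (x * (1 + (1 + x))) ((1 + x) * (1 - x))" .
  moreover have "1 + x + x = 1 + 2 * x" by (simp only: mult_2 add.assoc)
  moreover have "1 + (1 + x) = 2 + x" by (simp only: one_add_one[symmetric] add.assoc)
  ultimately have "rainbow (1 + 2 * x) (x * (2 + x)) ((1 + x) * (1 - x))" by (simp only:)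
  then show ?thesis by (rule hesse_family_triples[OF cw r1])
qed

text \<open>For fields settled by listing nine labels outright: all twelve lines are rainbow, so
  there is no recolouring, whether or not \<open>w\<close> is a cube.\<close>

lemma hesse_family_plane_check:
  assumes q6: "q mod 6 = 1"
    and r: "\<And>x. r x \<simeq> x" "\<And>x. x \<in> I \<Longrightarrow> r x = 0"
    and n: "n = int (q div 3)" "n < 2 ^ b" and c: "plane_check r b n f"
  shows "hesse_family I q"
proof -
  obtain w where "cubic_field I V p q (q div 3) w" using cubic_field_ex[OF q6] by blast
  then interpret cubic_field I V p q "q div 3" w .
  have P: "pow_red r b n y \<simeq> y ^ (q div 3)" for y using pow_red[of r n b, OF r(1)] n by simp
  show ?thesis
  proof (rule hesse_family_rainbow[of "nth f"])
    fix l assume l: "l \<in> ag_lines"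
    let ?L = "[(0, 1, 2), (3, 4, 5), (6, 7, 8), (0, 3, 6), (1, 4, 7), (2, 5, 8),
     (0, 4, 8), (1, 5, 6), (2, 3, 7), (0, 5, 7), (1, 3, 8), (2, 4, 6)] :: (nat \<times> nat \<times> nat) list"
    have "l \<in> (\<lambda>(i, j, k). {i, j, k}) ` set ?L" using l unfolding ag_lines_def by simp
    then obtain u where u: "l = (\<lambda>(i, j, k). {i, j, k}) u" "u \<in> set ?L" by (rule imageE)
    obtain i j k where ijk: "u = (i, j, k)" by (cases u)
    have t: "(i, j, k) \<in> set ?L" "l = {i, j, k}" using u unfolding ijk prod.case by blast+
    have "distinct_red r (pow_red r b n (f ! i - f ! j)) (pow_red r b n (f ! j - f ! k)) (pow_red r b n (f ! k - f ! i))"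
      using bspec[OF c[unfolded plane_check_def] t(1)] unfolding line_check.simps .
    from rainbow_check[OF r P P P this] have "rainbow (f ! i - f ! j) (f ! j - f ! k) (f ! k - f ! i)" .
    then show "rainbow_line ((!) f) l" unfolding rainbow_line_def t(2) by blast
  qed
qed

end

section \<open>Prime fields and their certificates\<close>

lemma residue_field_int:
  assumes "prime p"
  shows "residue_field {x. int p dvd x} {0..<int p} p p"
proof unfold_locales
  have pp: "prime (int p)" using assms by simp
  show "\<exists>v\<in>{0..<int p}. x - v \<in> {x. int p dvd x}" for x
    using prime_gt_0_nat[OF assms] by (intro bexI[of _ "x mod int p"]) (simp_all add: dvd_minus_mod)
  show "u = v" if "u \<in> {0..<int p}" "v \<in> {0..<int p}" "u - v \<in> {x. int p dvd x}" for u v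
  proof -
    have "u mod int p = v mod int p" unfolding mod_eq_dvd_iff using that(3) by simp
    then show ?thesis using that by simp
  qed
  show "x * y \<in> {x. int p dvd x} \<Longrightarrow> x \<in> {x. int p dvd x} \<or> y \<in> {x. int p dvd x}" for x y
    using prime_dvd_mult_iff[OF pp] by simp
  show "1 \<notin> {x. int p dvd x}" using prime_gt_1_nat[OF assms] by simp
  show "\<exists>m>0. p = p ^ m" by (rule exI[of _ 1]) simp
qed (use assms in auto)

definition int_red :: "int \<Rightarrow> int \<Rightarrow> int" where "int_red p x = x mod p"

definition cube_red :: "int \<Rightarrow> int \<Rightarrow> int" where "cube_red p y = (y * y) mod p * y"

text \<open>The witness \<open>g\<close> is a noncube with \<open>1 + g = g\<^sup>2 a\<^sup>3\<close>, and \<open>1 + 2 g\<close>, \<open>2 + g\<close>, \<open>g - 1\<close> are the cubes of \<open>b, c, d\<close>.\<close>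

fun prime_cert :: "int \<times> int \<times> int \<times> int \<times> int \<times> int \<Rightarrow> bool" where
  "prime_cert (p, g, a, b, c, d) \<longleftrightarrow> 1 < g \<and> 2 * g + 1 < p \<and>
     int_red p (pow_red (int_red p) 15 (p div 3) g - 1) \<noteq> 0 \<and>
     (cube_red p a * (g * g) - (1 + g)) mod p = 0 \<and> (cube_red p b - (1 + 2 * g)) mod p = 0 \<and>
     (cube_red p c - (2 + g)) mod p = 0 \<and> (cube_red p d - (g - 1)) mod p = 0"

text \<open>The classes of \<open>g\<close> and \<open>1 + g\<close> are 1 and 2 in some order, so
  \<open>1\<close>, \<open>g\<close>, \<open>1 + g\<close> is rainbow. As \<open>1 + 2 g\<close>,
  \<open>2 + g\<close> and \<open>1 - g\<close> are cubes, the second triple of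
  \<open>hesse_family_triples\<close> has the same three classes. Thus one exponentiation, showing
  that \<open>g\<close> is no cube, and four tests with given cube roots suffice.\<close>

lemma hesse_family_prime_cert:
  assumes p: "prime p" "p mod 6 = 1" "p mod 9 = 1" "p < 32768"
    and c: "prime_cert (int p, g, a, b, c, d)"
  shows "hesse_family {x. int p dvd x} p"
proof -
  interpret F: residue_field "{x. int p dvd x}" "{0..<int p}" p p by (rule residue_field_int[OF p(1)])
  obtain w where "cubic_field {x. int p dvd x} {0..<int p} p p (p div 3) w" using F.cubic_field_ex[OF p(2)] by blast
  then interpret C: cubic_field "{x. int p dvd x}" "{0..<int p}" p p "p div 3" w .
  have "(p div 3) mod 3 = 0" using mod_9_eq[OF p(2)] p(3) by simp
  then have cw: "C.cls w = 0" by (simp add: C.cls_w)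
  let ?I = "{x. int p dvd x}"
  have bnd: "1 < g" "2 * g + 1 < int p" using c by auto
  \<comment> \<open>The bounds on \<open>g\<close> place the five linear expressions below strictly
    between 0 and \<open>p\<close>.\<close>
  have small: "x \<notin> ?I" if "0 < x" "x < int p" for x using zdvd_not_zless[OF that] by simp
  have n: "g \<notin> ?I" "1 + g \<notin> ?I" "1 + 2 * g \<notin> ?I" "2 + g \<notin> ?I" "g - 1 \<notin> ?I"
    by (rule small; use bnd in linarith)+
  have cube: "F.eqv (cube_red (int p) y) (y ^ 3)" for y
  proof -
    have "F.eqv ((y * y) mod int p) (y * y)" by (rule F.eqv_sym) (simp add: F.eqv_def dvd_minus_mod)
    from F.eqv_mult[OF this F.eqv_refl] have "F.eqv ((y * y) mod int p * y) (y * y * y)" .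
    then show ?thesis by (simp add: cube_red_def power3_eq_cube)
  qed
  have c0: "C.cls x = 0" if "(cube_red (int p) y - x) mod int p = 0" "x \<notin> ?I" for x y
  proof -
    have "F.eqv (cube_red (int p) y) x" unfolding F.eqv_def using mod_0_imp_dvd[OF that(1)] by simp
    from F.eqv_trans[OF F.eqv_sym[OF this] cube] have e: "F.eqv x (y ^ 3)" .
    have "y ^ 3 \<notin> ?I" using F.eqv_I[OF e] that(2) by blast
    then have "y \<notin> ?I" unfolding F.I_power_iff by simp
    then show ?thesis using C.cls_eqv[OF e that(2)] C.cls_power[of y 3] by simp
  qed
  have cg: "C.cls g \<noteq> 0"
  proof
    assume z: "C.cls g = 0"
    have "F.eqv (pow_red (int_red (int p)) 15 (int p div 3) g) (g ^ nat (int p div 3))"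
    proof (rule F.pow_red)
      show "F.eqv (int_red (int p) x) x" for x
        by (rule F.eqv_sym) (simp add: F.eqv_def int_red_def dvd_minus_mod)
      show "0 \<le> int p div 3" "int p div 3 < 2 ^ 15" using p(4) by simp_all
    qed
    moreover have "nat (int p div 3) = p div 3" by (simp add: nat_div_distrib)
    moreover have "F.eqv (g ^ (p div 3)) (w ^ 0)" using C.cls(2)[OF n(1)] unfolding z .
    ultimately have "F.eqv (pow_red (int_red (int p)) 15 (int p div 3) g) 1"
      using F.eqv_trans by (metis power_0)
    then have "int_red (int p) (pow_red (int_red (int p)) 15 (int p div 3) g - 1) = 0"
      by (simp add: F.eqv_def int_red_def)
    then show False using c by simp
  qed
  have s: "C.cls g = 1 \<or> C.cls g = 2" using cg C.cls(1)[OF n(1)] by linarith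
  have c1: "C.cls (1 + g) = (2 * C.cls g) mod 3"
  proof -
    have "F.eqv (cube_red (int p) a * (g * g)) (1 + g)" using c by (simp add: F.eqv_def mod_0_imp_dvd)
    from F.eqv_trans[OF F.eqv_sym[OF this] F.eqv_mult[OF cube F.eqv_refl]]
    have e: "F.eqv (1 + g) (a ^ 3 * g\<^sup>2)" unfolding power2_eq_square .
    then have "a ^ 3 * g\<^sup>2 \<notin> ?I" using F.eqv_I[OF e] n(2) by blast
    then have a: "a \<notin> ?I" "a ^ 3 \<notin> ?I" "g\<^sup>2 \<notin> ?I" unfolding F.I_mult_iff F.I_power_iff by auto
    have "C.cls (a ^ 3) = 0" using C.cls_power[OF a(1), of 3] by simp
    then show ?thesis using C.cls_eqv[OF e n(2)] C.cls_mult[OF a(2,3)] C.cls_power[OF n(1), of 2] by simp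
  qed
  have c2: "C.cls (1 + 2 * g) = 0" "C.cls (2 + g) = 0" "C.cls (g - 1) = 0"
    using c0[OF _ n(3), of b] c0[OF _ n(4), of c] c0[OF _ n(5), of d] c by simp_all
  have m: "1 - g \<notin> ?I" "C.cls (1 - g) = 0"
    using n(5) F.I_neg_iff[of "g - 1"] C.cls_minus[OF n(5)] c2(3) by simp_all
  show ?thesis
  proof (rule C.hesse_family_triples[OF cw, of g])
    show "C.rainbow 1 g (1 + g)"
      unfolding C.rainbow_def C.cls_one c1 using s n F.one_notin_I by auto
    have "C.cls (g * (2 + g)) = C.cls g" "C.cls ((1 + g) * (1 - g)) = C.cls (1 + g)"
      using C.cls_mult[OF n(1,4)] C.cls_mult[OF n(2) m(1)] c2 m C.cls(1)[OF n(1)] C.cls(1)[OF n(2)] by simp_all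
    moreover have "g * (2 + g) \<notin> ?I" "(1 + g) * (1 - g) \<notin> ?I" using n m F.I_mult_iff by blast+
    ultimately show "C.rainbow (1 + 2 * g) (g * (2 + g)) ((1 + g) * (1 - g))"
      unfolding C.rainbow_def c1 c2 using s n by auto
  qed
qed

text \<open>Together the eight lists contain every prime congruent to 1 modulo 18 below 32761 except
  19, 37, 109 and 127; the sieve below confirms this.\<close>

definition prime_certs1 :: "(int \<times> int \<times> int \<times> int \<times> int \<times> int) list" where
  "prime_certs1 = [
    (73, 25, 17, 7, 3, 35), (163, 62, 78, 5, 4, 81), (181, 72, 101, 75, 71, 97), (199, 53, 55, 21, 54, 86),
    (271, 11, 38, 115, 54, 81), (307, 25, 103, 21, 3, 77), (379, 31, 57, 192, 114, 88), (397, 138, 88, 87, 11, 49),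
    (433, 33, 132, 244, 95, 11), (487, 136, 97, 155, 64, 111), (523, 36, 69, 81, 67, 199),
    (541, 217, 259, 138, 107, 6), (577, 69, 338, 227, 243, 34), (613, 70, 326, 87, 34, 224),
    (631, 41, 83, 139, 376, 78), (739, 48, 387, 325, 436, 346), (757, 75, 130, 147, 119, 364),
    (811, 257, 268, 248, 63, 151), (829, 32, 411, 178, 88, 277), (883, 28, 36, 137, 319, 3),
    (919, 14, 454, 506, 50, 191), (937, 59, 65, 407, 292, 52), (991, 18, 297, 331, 531, 188),
    (1009, 40, 96, 67, 287, 131), (1063, 6, 224, 650, 2, 24), (1117, 82, 210, 481, 97, 70),
    (1153, 161, 25, 647, 137, 509), (1171, 51, 76, 195, 451, 512), (1279, 333, 166, 274, 275, 218),
    (1297, 151, 91, 575, 362, 14), (1423, 62, 311, 5, 4, 193), (1459, 214, 165, 924, 6, 134),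
    (1531, 103, 677, 84, 263, 419), (1549, 204, 11, 110, 83, 233), (1567, 90, 755, 694, 436, 922),
    (1621, 70, 417, 269, 817, 182), (1657, 30, 1011, 15, 400, 304), (1693, 171, 56, 7, 332, 539),
    (1747, 104, 193, 1063, 26, 121), (1783, 178, 374, 497, 216, 364), (1801, 341, 208, 55, 7, 28),
    (1873, 152, 952, 900, 448, 101), (1999, 294, 503, 68, 729, 519), (2017, 106, 291, 511, 161, 111),
    (2053, 13, 245, 3, 1072, 291), (2089, 68, 74, 441, 1322, 1079), (2143, 188, 156, 729, 845, 601),
    (2161, 141, 126, 1162, 52, 639), (2179, 49, 513, 1149, 866, 117), (2251, 97, 341, 515, 893, 289),
    (2269, 99, 240, 297, 991, 311), (2287, 13, 143, 3, 368, 1032), (2341, 391, 1138, 85, 100, 1390),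
    (2377, 60, 560, 112, 91, 72), (2467, 122, 90, 1310, 292, 237), (2503, 118, 1104, 1239, 1390, 1553),
    (2521, 165, 63, 899, 1280, 1083), (2539, 128, 90, 895, 493, 1203), (2557, 28, 202, 1044, 1300, 3),
    (2593, 75, 816, 14, 71, 1534), (2647, 62, 594, 5, 4, 620), (2683, 62, 148, 5, 4, 14),
    (2719, 284, 397, 492, 1489, 373), (2791, 347, 919, 731, 1396, 245), (2917, 43, 1602, 873, 1531, 173),
    (2953, 126, 159, 1155, 583, 5), (2971, 10, 99, 1031, 471, 767), (3061, 397, 1020, 180, 651, 48),
    (3079, 123, 1448, 1465, 5, 670), (3169, 179, 568, 1263, 1851, 146), (3187, 111, 149, 1366, 352, 595),
    (3259, 5, 1506, 591, 330, 1510)]"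

lemma prime_certs1: "\<forall>x\<in>set prime_certs1. prime_cert x"
  by code_simp

definition prime_certs2 :: "(int \<times> int \<times> int \<times> int \<times> int \<times> int) list" where
  "prime_certs2 = [
    (3313, 65, 311, 51, 1746, 4), (3331, 45, 69, 1764, 1516, 15), (3457, 224, 592, 1125, 53, 1685),
    (3511, 18, 574, 123, 898, 411), (3529, 170, 890, 414, 307, 1298), (3547, 18, 1092, 176, 1684, 592),
    (3583, 13, 844, 3, 596, 117), (3637, 28, 74, 774, 259, 3), (3673, 134, 1365, 140, 384, 589),
    (3691, 16, 494, 2023, 2115, 2388), (3709, 86, 1317, 1884, 531, 599), (3727, 456, 1881, 225, 1928, 828),
    (3853, 155, 249, 86, 217, 1633), (3889, 149, 2061, 2082, 1364, 431), (3907, 42, 811, 853, 683, 301),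
    (3943, 28, 390, 552, 742, 3), (4051, 374, 735, 1976, 2077, 1054), (4159, 13, 687, 3, 55, 478),
    (4177, 30, 406, 1150, 164, 2357), (4231, 374, 631, 122, 453, 1650), (4339, 56, 2396, 1070, 1334, 197),
    (4357, 131, 1437, 1457, 264, 67), (4447, 62, 377, 5, 4, 494), (4483, 28, 1285, 1943, 277, 3),
    (4519, 133, 2236, 24, 267, 1283), (4591, 67, 1376, 1030, 103, 2736), (4663, 6, 2077, 2251, 2, 203),
    (4789, 16, 2150, 1993, 734, 591), (4861, 339, 2361, 593, 628, 2370), (4933, 326, 1385, 1002, 225, 2587),
    (4951, 36, 3089, 2765, 1171, 397), (4969, 88, 727, 782, 2552, 2130), (4987, 65, 2224, 338, 783, 4),
    (5023, 160, 265, 1970, 1103, 2101), (5059, 57, 562, 2844, 2891, 2542), (5077, 182, 2168, 394, 1782, 867),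
    (5113, 22, 2572, 1930, 1652, 735), (5167, 454, 2409, 898, 528, 90), (5347, 47, 370, 3323, 496, 156),
    (5419, 35, 666, 425, 76, 1168), (5437, 164, 1094, 721, 587, 554), (5527, 353, 137, 866, 1051, 2265),
    (5563, 130, 239, 826, 1344, 858), (5581, 113, 1042, 199, 753, 3514), (5653, 157, 224, 1763, 150, 605),
    (5689, 172, 28, 659, 695, 1239), (5743, 62, 15, 5, 4, 1072), (5779, 23, 1303, 1533, 1460, 546),
    (5851, 205, 442, 319, 327, 604), (5869, 201, 654, 2354, 702, 344), (5923, 364, 100, 9, 3705, 1728),
    (6067, 12, 782, 994, 963, 375), (6121, 68, 2352, 2374, 2634, 3361), (6211, 12, 2784, 2188, 577, 3011),
    (6229, 45, 1105, 720, 2818, 430), (6247, 90, 3009, 3331, 1219, 145), (6301, 217, 1913, 840, 2597, 6),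
    (6337, 50, 1355, 1251, 1218, 82), (6373, 101, 3037, 585, 2983, 1594), (6427, 109, 974, 2578, 1950, 2708),
    (6481, 155, 199, 2814, 73, 300), (6553, 62, 349, 5, 4, 2153), (6571, 23, 734, 1282, 3110, 1343),
    (6607, 335, 2523, 3616, 3603, 2758), (6661, 624, 2464, 723, 3018, 947), (6679, 69, 746, 3656, 2410, 1512),
    (6733, 49, 880, 1571, 2976, 538), (6823, 53, 230, 1114, 85, 425), (6841, 176, 3057, 1076, 1162, 1204),
    (6949, 535, 3645, 1176, 2526, 2533), (6967, 147, 1658, 752, 1492, 397), (7039, 281, 1732, 879, 1404, 3931),
    (7057, 68, 397, 302, 552, 400)]"

lemma prime_certs2: "\<forall>x\<in>set prime_certs2. prime_cert x"
  by code_simp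

definition prime_certs3 :: "(int \<times> int \<times> int \<times> int \<times> int \<times> int) list" where
  "prime_certs3 = [
    (7129, 260, 1889, 3081, 1350, 1181), (7219, 413, 527, 1712, 3761, 3306), (7237, 37, 1712, 1128, 413, 1268),
    (7309, 228, 4435, 3220, 1410, 234), (7417, 19, 291, 1147, 1737, 1910), (7489, 62, 1367, 5, 4, 4349),
    (7507, 12, 2985, 1981, 3614, 835), (7561, 132, 107, 1545, 2486, 3570), (7669, 152, 154, 380, 153, 1609),
    (7687, 42, 592, 317, 4627, 1198), (7723, 109, 2066, 2821, 759, 998), (7741, 166, 3068, 3661, 683, 864),
    (7759, 468, 3682, 893, 2924, 376), (7867, 231, 1498, 1614, 3023, 428), (7993, 81, 177, 109, 1107, 565),
    (8011, 13, 1211, 3, 166, 842), (8101, 24, 2853, 4563, 151, 694), (8191, 13, 1759, 3, 140, 487),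
    (8209, 355, 6, 106, 1243, 1361), (8263, 62, 3200, 5, 4, 680), (8317, 62, 226, 5, 4, 299),
    (8353, 171, 4107, 7, 4133, 1172), (8389, 24, 382, 201, 4317, 1219), (8443, 9, 1480, 706, 301, 2),
    (8461, 488, 2295, 2795, 2086, 4496), (8623, 43, 2653, 5462, 394, 1577), (8641, 62, 3539, 5, 4, 4540),
    (8677, 156, 2789, 979, 3885, 757), (8713, 234, 4323, 152, 631, 517), (8731, 120, 3885, 1649, 1326, 582),
    (8803, 36, 1456, 318, 1330, 744), (8821, 171, 2817, 7, 600, 1810), (8839, 166, 2433, 3493, 2251, 1396),
    (8893, 33, 3962, 961, 4914, 4555), (8929, 126, 1281, 1367, 841, 5), (9001, 65, 2037, 2206, 680, 4),
    (9091, 110, 104, 2094, 1209, 3359), (9109, 39, 1502, 5088, 1832, 1382), (9127, 85, 329, 1510, 1252, 2233),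
    (9181, 87, 3518, 417, 371, 276), (9199, 243, 4837, 748, 4764, 646), (9343, 138, 2636, 5304, 5342, 3436),
    (9397, 42, 4415, 1812, 4795, 846), (9433, 46, 2315, 3931, 4439, 502), (9613, 277, 1365, 371, 4161, 5011),
    (9631, 109, 1102, 1647, 2513, 5755), (9649, 203, 1888, 1503, 5588, 5396), (9721, 117, 805, 3485, 3779, 1988),
    (9739, 9, 857, 976, 1931, 2), (9811, 74, 4024, 1037, 1341, 4449), (9829, 58, 3508, 542, 1479, 4651),
    (9883, 180, 2632, 6355, 3468, 453), (9901, 184, 1149, 1095, 5577, 4588), (9973, 22, 5025, 249, 2986, 5655),
    (10009, 344, 1634, 5242, 98, 7), (10099, 45, 6232, 3254, 4247, 4178), (10243, 13, 2247, 3, 6107, 495),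
    (10333, 115, 1925, 3439, 2096, 1322), (10369, 280, 629, 1092, 5263, 22), (10459, 161, 3683, 4837, 1618, 4798),
    (10477, 40, 785, 3802, 6038, 144), (10513, 60, 640, 3809, 5686, 3020), (10531, 62, 82, 5, 4, 2171),
    (10567, 133, 6463, 1212, 1041, 3573), (10639, 38, 4814, 908, 1031, 1888), (10657, 12, 5532, 1442, 2088, 1474),
    (10711, 435, 1363, 5200, 4962, 3125), (10729, 82, 3541, 5111, 2398, 4592), (10837, 97, 1138, 154, 3590, 2524),
    (10891, 31, 5736, 2718, 2026, 4110), (10909, 13, 921, 3, 6000, 6221), (11071, 20, 380, 2917, 5826, 1466)]"

lemma prime_certs3: "\<forall>x\<in>set prime_certs3. prime_cert x"
  by code_simp

definition prime_certs4 :: "(int \<times> int \<times> int \<times> int \<times> int \<times> int) list" where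
  "prime_certs4 = [
    (11161, 41, 1646, 171, 1819, 1483), (11197, 77, 3886, 187, 1621, 3599), (11251, 9, 250, 1106, 4442, 2),
    (11287, 95, 1254, 2380, 1937, 5053), (11467, 89, 5748, 6570, 5441, 2503), (11503, 19, 4109, 6665, 3719, 4235),
    (11593, 307, 485, 410, 1611, 5092), (11701, 19, 7074, 3893, 2571, 4461), (11719, 25, 858, 7187, 3, 3750),
    (11827, 25, 1750, 4073, 3, 226), (11863, 77, 1175, 3505, 193, 2356), (11953, 306, 1587, 5863, 4903, 1231),
    (11971, 10, 7260, 2977, 1098, 950), (12007, 61, 5313, 1388, 5326, 477), (12043, 40, 338, 2986, 7431, 5988),
    (12097, 101, 2387, 54, 1033, 3075), (12241, 28, 1725, 1907, 456, 3), (12277, 191, 7866, 2134, 2538, 488),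
    (12421, 56, 1676, 5045, 912, 6765), (12457, 19, 6119, 3892, 1904, 1291), (12511, 117, 4416, 2124, 6557, 8219),
    (12547, 6, 4173, 5356, 2, 3709), (12583, 75, 5685, 6100, 5960, 3596), (12601, 15, 6885, 869, 494, 667),
    (12619, 225, 2473, 6229, 3718, 716), (12637, 19, 4232, 5485, 291, 449), (12763, 37, 1083, 2279, 7165, 6428),
    (12781, 39, 6280, 2341, 585, 4813), (12799, 218, 7186, 3797, 4260, 3911), (12853, 87, 2374, 3251, 5992, 1739),
    (12889, 128, 1172, 2159, 2989, 2886), (12907, 565, 874, 2533, 47, 1056), (12979, 230, 7693, 6257, 1752, 1526),
    (13033, 19, 2678, 220, 6932, 3721), (13159, 46, 5810, 4379, 1345, 2318), (13177, 212, 2611, 5454, 660, 75),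
    (13249, 60, 5194, 7957, 967, 4323), (13267, 74, 7043, 1823, 1891, 764), (13339, 15, 296, 6394, 678, 2385),
    (13411, 214, 4460, 2515, 6, 1027), (13537, 31, 534, 568, 319, 4867), (13591, 287, 6555, 336, 3386, 3507),
    (13627, 120, 1159, 1868, 88, 7683), (13681, 36, 2930, 667, 4846, 6522), (13789, 25, 769, 178, 3, 2984),
    (13807, 25, 22, 1686, 3, 7044), (13879, 12, 4011, 271, 2438, 449), (13933, 199, 1935, 7546, 6761, 1196),
    (14149, 6, 596, 3781, 2, 2160), (14221, 38, 1671, 1836, 2983, 8620), (14293, 33, 8760, 83, 1167, 233),
    (14347, 55, 6191, 4605, 3652, 2408), (14401, 314, 2792, 7023, 6630, 1687), (14419, 108, 6289, 8146, 6404, 497),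
    (14437, 513, 1179, 3873, 6684, 8), (14563, 66, 4570, 4699, 1152, 2992), (14653, 42, 4891, 4769, 4320, 5023),
    (14779, 9, 4185, 4994, 3341, 2), (14797, 335, 9159, 7840, 2165, 2143), (14851, 57, 1265, 6486, 1009, 5218),
    (14869, 211, 1198, 7010, 976, 4910), (14887, 51, 789, 6909, 6584, 5489), (14923, 147, 4790, 3151, 904, 2825),
    (15013, 58, 364, 6612, 5357, 2665), (15031, 71, 421, 67, 569, 9558), (15121, 108, 379, 6793, 7145, 7898),
    (15139, 9, 5431, 3559, 2402, 2), (15193, 126, 1545, 3884, 535, 5), (15319, 123, 7869, 3806, 5, 3040),
    (15373, 86, 655, 1329, 1026, 296), (15391, 168, 2194, 4294, 2717, 774), (15427, 20, 455, 7059, 60, 476),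
    (15607, 28, 2677, 7130, 5499, 3)]"

lemma prime_certs4: "\<forall>x\<in>set prime_certs4. prime_cert x"
  by code_simp

definition prime_certs5 :: "(int \<times> int \<times> int \<times> int \<times> int \<times> int) list" where
  "prime_certs5 = [
    (15643, 450, 9807, 1142, 7538, 2732), (15661, 135, 416, 1956, 6424, 2937), (15679, 478, 556, 9210, 7585, 1813),
    (15733, 35, 1467, 2913, 384, 781), (15787, 15, 1599, 4837, 2358, 9095), (15823, 38, 3669, 2993, 364, 1970),
    (15859, 153, 8750, 9243, 1113, 2820), (15877, 66, 1013, 1593, 4133, 772), (15913, 230, 3532, 4923, 510, 2719),
    (16057, 62, 4057, 5, 4, 4673), (16111, 34, 4191, 5308, 2449, 2520), (16183, 6, 1419, 168, 2, 4849),
    (16273, 138, 189, 7697, 4545, 371), (16363, 374, 10659, 1760, 1699, 7553), (16381, 289, 7477, 574, 5103, 2048),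
    (16417, 21, 586, 2351, 7228, 2131), (16453, 164, 1207, 282, 2818, 3933), (16561, 169, 599, 7372, 2169, 8689),
    (16633, 184, 2088, 1217, 5641, 3697), (16651, 338, 1971, 1171, 1022, 9836), (16741, 52, 6995, 419, 8152, 3947),
    (16759, 32, 1290, 2574, 4028, 8982), (16831, 446, 2051, 8120, 8879, 2141), (16903, 13, 10519, 3, 9402, 915),
    (16921, 126, 6616, 2910, 5122, 5), (16993, 115, 864, 2025, 389, 3595), (17011, 123, 10120, 3089, 5, 3860),
    (17029, 29, 359, 2138, 2519, 3075), (17047, 231, 2571, 233, 1711, 479), (17137, 46, 1508, 256, 7554, 5862),
    (17191, 9, 1106, 402, 1973, 2), (17209, 54, 4374, 3847, 8098, 3337), (17299, 138, 9577, 26, 158, 7364),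
    (17317, 25, 2729, 6683, 3, 3698), (17389, 95, 3580, 676, 978, 2155), (17443, 62, 9305, 5, 4, 5144),
    (17497, 83, 6870, 286, 566, 4935), (17551, 6, 5498, 1464, 2, 9878), (17569, 88, 1295, 4035, 1164, 1083),
    (17623, 13, 1333, 3, 128, 7643), (17659, 62, 9184, 5, 4, 4914), (17713, 6, 7666, 442, 2, 6648),
    (17749, 62, 5160, 5, 4, 1390), (17839, 146, 1675, 4879, 8325, 513), (17911, 35, 3227, 430, 4080, 8295),
    (17929, 93, 6013, 3294, 9593, 3602), (18127, 148, 1094, 6655, 8900, 8980), (18181, 163, 8949, 2940, 244, 8517),
    (18199, 33, 1523, 8633, 3635, 1189), (18217, 188, 5123, 4474, 1967, 2881), (18253, 185, 2614, 5085, 5067, 194),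
    (18289, 38, 719, 1367, 76, 5466), (18307, 73, 10075, 4035, 809, 313), (18379, 30, 3173, 10516, 91, 470),
    (18397, 154, 188, 9479, 5824, 8604), (18433, 225, 9878, 104, 1580, 2608), (18451, 20, 6436, 10842, 808, 579),
    (18523, 281, 6117, 6799, 5253, 4926), (18541, 9, 5769, 12060, 8032, 2), (18757, 39, 192, 5916, 10923, 376),
    (18793, 88, 3293, 2975, 832, 3132), (18919, 123, 11237, 990, 5, 4354), (18973, 54, 8262, 4566, 9810, 7177),
    (19009, 25, 4010, 8245, 3, 10737), (19081, 402, 2954, 2321, 3467, 10055), (19207, 91, 6949, 3366, 6763, 8143),
    (19333, 9, 12514, 1235, 340, 2), (19387, 244, 9332, 10749, 7361, 1677), (19423, 34, 3731, 2827, 4077, 11762),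
    (19441, 74, 10148, 9256, 2903, 6512), (19477, 201, 190, 1526, 334, 3741), (19531, 13, 10901, 3, 3498, 1717),
    (19603, 13, 394, 3, 4367, 1373)]"

lemma prime_certs5: "\<forall>x\<in>set prime_certs5. prime_cert x"
  by code_simp

definition prime_certs6 :: "(int \<times> int \<times> int \<times> int \<times> int \<times> int) list" where
  "prime_certs6 = [
    (19801, 320, 3344, 10217, 9844, 885), (19819, 242, 769, 4208, 8520, 8797), (19891, 19, 5613, 9710, 5779, 1874),
    (19927, 264, 10582, 2011, 8573, 3672), (19963, 205, 6003, 10470, 3294, 3703),
    (20071, 54, 1155, 1895, 6946, 2891), (20089, 368, 8343, 4790, 10326, 9775), (20107, 238, 8931, 979, 10251, 388),
    (20143, 126, 1148, 3520, 652, 5), (20161, 155, 5438, 9812, 1070, 3248), (20233, 21, 11236, 8774, 438, 3251),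
    (20269, 399, 11232, 938, 1053, 11462), (20287, 233, 1863, 2768, 1823, 2075),
    (20323, 163, 10071, 9954, 1482, 7235), (20341, 24, 10290, 9847, 8960, 5124),
    (20359, 30, 6468, 10909, 2712, 12572), (20431, 119, 5898, 11529, 4805, 9201),
    (20521, 11, 8060, 8934, 9739, 1901), (20593, 62, 6620, 5, 4, 7044), (20611, 175, 1932, 8197, 4753, 8938),
    (20719, 161, 115, 564, 2008, 8441), (20773, 6, 4199, 6320, 2, 2506), (20809, 6, 2896, 3811, 2, 6599),
    (20899, 24, 2236, 8344, 8052, 2866), (21061, 28, 3154, 12292, 1589, 3), (21169, 30, 10258, 8562, 2695, 12932),
    (21187, 207, 4652, 2786, 4649, 7054), (21277, 153, 2838, 3052, 1754, 4394), (21313, 62, 4388, 5, 4, 40),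
    (21493, 50, 8984, 4487, 12413, 4745), (21529, 356, 4655, 1509, 3226, 11131),
    (21601, 196, 10492, 12732, 11761, 3365), (21673, 31, 10950, 3319, 7950, 5125), (21727, 28, 11816, 2012, 1672, 3),
    (21799, 25, 2685, 11503, 3, 271), (21817, 62, 10377, 5, 4, 5716), (21871, 219, 4574, 10114, 8399, 4418),
    (21943, 28, 2259, 1612, 6812, 3), (21961, 268, 486, 2271, 774, 3145), (21997, 13, 9037, 3, 2293, 8916),
    (22051, 188, 4642, 4064, 11880, 4122), (22123, 225, 1658, 7948, 4476, 5098), (22159, 25, 1862, 7952, 3, 3253),
    (22303, 6, 2218, 331, 2, 2984), (22447, 62, 270, 5, 4, 3230), (22483, 60, 1918, 4243, 2813, 1592),
    (22501, 171, 1602, 7, 13171, 673), (22573, 61, 2867, 2007, 5052, 882), (22699, 15, 3497, 527, 9776, 5228),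
    (22717, 47, 779, 3784, 2358, 3226), (22807, 6, 2660, 1038, 2, 3562), (22861, 53, 2037, 2510, 1642, 8922),
    (23041, 278, 13837, 3993, 3310, 1343), (23059, 231, 2040, 7744, 10726, 5283),
    (23131, 199, 2812, 1923, 3602, 4960), (23167, 46, 1661, 3235, 3387, 1217), (23203, 56, 13584, 3713, 6267, 5034),
    (23293, 28, 713, 3990, 9895, 3), (23311, 364, 899, 9, 1786, 11336), (23473, 79, 3020, 12598, 5240, 1762),
    (23509, 94, 4432, 8962, 3487, 15406), (23563, 133, 2, 3642, 6518, 1570), (23581, 55, 10207, 122, 3127, 962),
    (23599, 292, 12378, 10369, 948, 10256), (23671, 126, 86, 695, 3361, 5), (23689, 16, 11752, 13789, 1504, 3968),
    (23743, 214, 2511, 3964, 6, 3088), (23761, 350, 13982, 4899, 10977, 10906), (23833, 40, 1729, 3539, 7354, 13440),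
    (23869, 6, 783, 8520, 2, 7242), (23887, 115, 443, 11704, 1218, 13244), (23977, 168, 3077, 1526, 10481, 5221)]"

lemma prime_certs6: "\<forall>x\<in>set prime_certs6. prime_cert x"
  by code_simp

definition prime_certs7 :: "(int \<times> int \<times> int \<times> int \<times> int \<times> int) list" where
  "prime_certs7 = [
    (24049, 65, 7017, 9967, 1570, 4), (24103, 101, 9789, 13042, 1558, 12632), (24121, 28, 287, 6920, 11376, 3),
    (24229, 62, 5089, 5, 4, 736), (24247, 173, 8161, 4545, 3195, 4313), (24337, 199, 170, 5342, 11717, 669),
    (24373, 109, 431, 778, 13095, 2615), (24391, 12, 8259, 13710, 5431, 195), (24481, 184, 9374, 7935, 5303, 2598),
    (24499, 105, 5573, 3456, 7743, 3838), (24517, 52, 5114, 963, 6819, 12491), (24571, 13, 5668, 3, 4432, 13211),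
    (24697, 25, 2282, 5824, 3, 10742), (24733, 57, 1851, 6984, 10789, 2848), (24841, 9, 561, 4458, 250, 2),
    (24859, 176, 12274, 884, 3199, 635), (24877, 25, 3651, 11093, 3, 1172), (24967, 162, 3100, 4940, 2970, 6034),
    (25057, 66, 9877, 273, 7253, 263), (25111, 69, 4176, 4188, 6029, 1880), (25147, 62, 12305, 5, 4, 14918),
    (25183, 143, 6970, 37, 8414, 2901), (25219, 101, 5599, 3414, 14310, 3721), (25237, 20, 8531, 9028, 9787, 12588),
    (25309, 272, 14011, 12956, 9225, 11070), (25453, 50, 2230, 12636, 3838, 1510),
    (25471, 166, 10599, 13796, 13959, 15915), (25561, 28, 232, 71, 2275, 3), (25579, 16, 390, 962, 15189, 582),
    (25633, 62, 209, 5, 4, 12183), (25741, 24, 3760, 1064, 2227, 503), (25759, 9, 80, 12609, 2083, 2),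
    (25849, 11, 1948, 11476, 11949, 8975), (25867, 89, 8018, 6929, 4542, 3720),
    (25903, 187, 4654, 1384, 13715, 5806), (25939, 69, 4745, 2707, 3805, 2830),
    (26029, 115, 4107, 14346, 4377, 8229), (26083, 13, 2466, 3, 5504, 13436), (26119, 15, 1670, 12888, 13798, 4103),
    (26209, 131, 7113, 7494, 623, 2694), (26227, 11, 6359, 15152, 688, 12158), (26263, 243, 809, 4594, 10212, 7135),
    (26317, 30, 14112, 4717, 11971, 7122), (26371, 9, 1567, 11816, 4585, 2), (26407, 300, 12476, 4763, 4232, 5376),
    (26479, 12, 3906, 10450, 6719, 7556), (26497, 52, 12534, 4659, 2125, 3978),
    (26641, 67, 11780, 12863, 3824, 1068), (26713, 107, 2283, 9949, 5117, 675), (26731, 159, 119, 3699, 4306, 2068),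
    (26821, 115, 11373, 5436, 2793, 758), (26839, 37, 6738, 2404, 550, 13104), (26893, 10, 3122, 13816, 12236, 1920),
    (26947, 41, 1682, 689, 1892, 1015), (27073, 9, 4934, 1366, 10918, 2), (27091, 25, 9433, 11167, 3, 3192),
    (27109, 13, 1157, 3, 1966, 1508), (27127, 331, 2024, 2203, 13579, 14402), (27253, 340, 4065, 12518, 3883, 1943),
    (27271, 123, 4593, 2688, 5, 13016), (27361, 9, 5068, 3467, 14998, 2), (27397, 45, 3132, 14472, 6842, 2787),
    (27487, 144, 5778, 1073, 521, 6532), (27541, 62, 613, 5, 4, 2878), (27631, 40, 5836, 7063, 3212, 2978),
    (27739, 358, 410, 12844, 5133, 2283), (27793, 183, 6440, 5380, 4636, 13779), (27847, 36, 4025, 2394, 5632, 3893),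
    (27883, 287, 10778, 1816, 15094, 1241), (27901, 28, 7811, 547, 1286, 3), (27919, 62, 6740, 5, 4, 2482),
    (28027, 20, 5532, 13801, 12314, 13554), (28081, 189, 1677, 7252, 6093, 9495)]"

lemma prime_certs7: "\<forall>x\<in>set prime_certs7. prime_cert x"
  by code_simp

definition prime_certs8 :: "(int \<times> int \<times> int \<times> int \<times> int \<times> int) list" where
  "prime_certs8 = [
    (28099, 359, 10132, 654, 5740, 14379), (28279, 5, 2015, 685, 16262, 4934), (28297, 88, 2601, 16224, 6103, 3958),
    (28351, 291, 1105, 1083, 6290, 17044), (28387, 426, 1445, 15305, 779, 9337), (28477, 25, 11054, 7474, 3, 2641),
    (28513, 61, 15360, 14101, 10764, 10109), (28549, 91, 980, 12190, 3359, 15549),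
    (28603, 165, 1349, 6982, 2571, 4501), (28621, 126, 11723, 8525, 10189, 5), (28657, 18, 14915, 16690, 861, 347),
    (28711, 31, 4468, 1189, 1946, 668), (28729, 99, 3802, 12713, 1666, 15151), (28837, 145, 6480, 6656, 13189, 983),
    (28909, 29, 5318, 1743, 5334, 251), (28927, 131, 8160, 7808, 13021, 7471), (29017, 9, 2375, 11079, 149, 2),
    (29179, 13, 15064, 3, 9587, 4784), (29251, 153, 4757, 18485, 616, 17190), (29269, 158, 15860, 3455, 13883, 3257),
    (29287, 57, 10852, 9854, 17391, 4027), (29611, 33, 7632, 14105, 14309, 10090),
    (29629, 91, 10789, 3863, 434, 9040), (29683, 139, 11689, 7141, 12844, 4948),
    (29863, 10, 12480, 14791, 14638, 6983), (29881, 9, 13277, 6091, 14161, 2), (29917, 85, 15112, 1074, 6681, 5859),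
    (29989, 18, 18939, 14026, 17085, 4767), (30097, 73, 88, 3383, 8094, 17132),
    (30133, 264, 11219, 10005, 1956, 5572), (30169, 19, 13956, 5936, 14773, 10121),
    (30187, 260, 2605, 12493, 5693, 16565), (30223, 12, 12721, 4378, 15689, 17374), (30241, 6, 4642, 3202, 2, 591),
    (30259, 55, 11382, 6874, 4090, 11026), (30313, 295, 5832, 8103, 2962, 1588),
    (30367, 107, 15264, 16408, 515, 14358), (30403, 25, 1663, 11642, 3, 16383), (30493, 65, 12434, 5080, 13735, 4),
    (30529, 98, 7521, 5915, 9752, 7708), (30637, 84, 4016, 11820, 8229, 9949), (30727, 239, 756, 11841, 6194, 3211),
    (30763, 160, 89, 1007, 1467, 15628), (30781, 28, 4202, 2121, 18501, 3), (30817, 16, 7845, 14386, 3659, 15199),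
    (30853, 423, 10037, 7210, 16251, 11645), (30871, 44, 400, 2325, 1966, 3718),
    (31033, 42, 18232, 8371, 5014, 14620), (31051, 28, 454, 13950, 5135, 3), (31069, 41, 17183, 7793, 5231, 2430),
    (31123, 34, 16883, 2923, 1212, 612), (31159, 142, 17967, 3785, 16926, 14639), (31177, 13, 6755, 3, 15411, 5428),
    (31231, 45, 7508, 8877, 20089, 15204), (31249, 6, 13123, 16637, 2, 6339), (31267, 258, 2883, 15948, 2194, 3564),
    (31321, 289, 13590, 11630, 12795, 14973), (31357, 133, 2082, 1637, 5224, 1099),
    (31393, 96, 20111, 1418, 9580, 14066), (31573, 313, 17181, 11905, 12714, 2173),
    (31627, 341, 6653, 14834, 7, 12322), (31663, 255, 20186, 12821, 1914, 3026),
    (31699, 141, 17047, 19984, 6335, 3654), (31771, 217, 16452, 10937, 16898, 6),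
    (32059, 164, 12378, 4675, 20315, 9978), (32077, 25, 14903, 13564, 3, 17104),
    (32203, 81, 3150, 12615, 18397, 20295), (32257, 65, 5857, 12719, 2721, 4), (32401, 81, 2920, 1791, 4389, 9059),
    (32491, 28, 18085, 16215, 3463, 3), (32563, 42, 6161, 1323, 1666, 13745), (32653, 151, 12313, 4460, 19677, 5796),
    (32707, 254, 6151, 18564, 8202, 806)]"

lemma prime_certs8: "\<forall>x\<in>set prime_certs8. prime_cert x"
  by code_simp

definition prime_certs :: "(int \<times> int \<times> int \<times> int \<times> int \<times> int) list" where
  "prime_certs = prime_certs1 @ prime_certs2 @ prime_certs3 @ prime_certs4 @ prime_certs5 @ prime_certs6 @ prime_certs7 @ prime_certs8"

lemma prime_certs: "x \<in> set prime_certs \<Longrightarrow> prime_cert x"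
  using prime_certs1 prime_certs2 prime_certs3 prime_certs4 prime_certs5 prime_certs6 prime_certs7 prime_certs8 unfolding prime_certs_def set_append by blast

text \<open>Walks through the progression \<open>k, k + 18, \<dots>\<close>: a nonzero entry is a proper divisor,
  a zero consumes the next member of the list of primes.\<close>

fun sieve :: "int \<Rightarrow> int \<Rightarrow> int list \<Rightarrow> int list \<Rightarrow> bool" where
  "sieve e k [] ps = (e \<le> k)"
| "sieve e k (d # ds) ps = (if d = 0 then (case ps of [] \<Rightarrow> False | p # ps' \<Rightarrow> if p = k then sieve e (k + 18) ds ps' else False)
     else if 1 < d \<and> d < k \<and> k mod d = 0 then sieve e (k + 18) ds ps else False)"

section \<open>Completeness of the table of primes\<close>

text \<open>Only completeness is at stake, so nonprimality is justified by a divisor while an entry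
  0 asserts nothing: a composite number marked 0 would merely have to appear in the list.\<close>

lemma sieve_prime:
  assumes "sieve e k ds ps" "prime n" "int n = k + 18 * int j" "int n < e"
  shows "int n \<in> set ps"
  using assms
proof (induction ds arbitrary: k ps j)
  case Nil
  then show ?case by simp
next
  case (Cons d ds)
  show ?case
  proof (cases "d = 0")
    case True
    then obtain ps' where ps: "ps = k # ps'" "sieve e (k + 18) ds ps'"
      using Cons.prems(1) by (auto split: list.splits if_splits)
    show ?thesis
    proof (cases j)
      case 0
      then show ?thesis using ps Cons.prems(3) by simp
    next
      case (Suc i)
      then show ?thesis using Cons.IH[OF ps(2) Cons.prems(2), of i] Cons.prems(3,4) ps by simp
    qed
  next
    case False
    then have d: "1 < d" "d < k" "k mod d = 0" "sieve e (k + 18) ds ps"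
      using Cons.prems(1) by (auto split: if_splits)
    show ?thesis
    proof (cases j)
      case 0
      have "prime (int n)" using Cons.prems(2) by simp
      then have "\<forall>m. 0 \<le> m \<and> m dvd int n \<longrightarrow> m = 1 \<or> m = int n" unfolding prime_int_iff by (rule conjunct2)
      then have "0 \<le> d \<and> d dvd int n \<longrightarrow> d = 1 \<or> d = int n" by (rule spec)
      moreover have "d dvd int n" using d(3) Cons.prems(3) 0 by (simp add: mod_0_imp_dvd)
      moreover have "0 \<le> d" using d(1) by simp
      ultimately have "d = 1 \<or> d = int n" by blast
      then show ?thesis using d(1,2) Cons.prems(3) 0 by simp
    next
      case (Suc i)
      then show ?thesis using Cons.IH[OF d(4) Cons.prems(2), of i] Cons.prems(3,4) by simp
    qed
  qed
qed

definition sieve_entries1 :: "int list" where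
  "sieve_entries1 = [
    0, 0, 5, 0, 7, 0, 0, 5, 0, 0, 0, 7, 5, 11, 0, 17, 0, 5, 7, 19, 0, 0, 5, 0, 11, 7, 0, 5, 0, 0, 13, 0, 5, 0, 0, 11,
    23, 5, 19, 7, 0, 0, 5, 13, 0, 0, 7, 5, 0, 17, 0, 0, 5, 7, 0, 0, 13, 5, 0, 23, 7, 0, 5, 0, 0, 29, 17, 5, 11, 13,
    0, 0, 5, 31, 7, 37, 19, 5, 0, 11, 0, 7, 5, 17, 0, 0, 0, 5, 7, 0, 11, 0, 5, 0, 29, 7, 0, 5, 0, 0, 17, 11, 5, 0,
    31, 23, 41, 5, 13, 7, 0, 0, 5, 0, 19, 0, 7, 5, 0, 0, 0, 13, 5, 7, 0, 0, 0, 5, 23, 0, 7, 0, 5, 19, 11, 31, 0, 5,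
    0, 0, 0, 0, 5, 0, 7, 11, 0, 5, 0, 37, 0, 7, 5, 47, 0, 53, 11, 5, 7, 43, 13, 0, 5, 0, 0, 7, 31, 5, 17, 0, 0, 19,
    5, 13, 23, 0, 0, 5, 11, 7, 0, 29, 5]"

text \<open>73 heads the certificates but lies between 37 and 109 in the progression, hence the
  splicing with the four primes that have no certificate.\<close>

lemma sieve_entries1: "sieve 3313 19 sieve_entries1 (19 # 37 # 73 # 109 # 127 # map fst (tl prime_certs1))"
  by code_simp

definition sieve_entries2 :: "int list" where
  "sieve_entries2 = [
    0, 0, 17, 7, 5, 41, 11, 19, 0, 5, 7, 0, 0, 0, 5, 0, 13, 7, 0, 5, 0, 0, 0, 0, 5, 53, 19, 29, 11, 5, 0, 7, 0, 0, 5,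
    0, 17, 23, 7, 5, 37, 0, 13, 61, 5, 7, 41, 0, 0, 5, 11, 0, 7, 17, 5, 13, 29, 0, 0, 5, 23, 11, 43, 0, 5, 0, 7, 0,
    13, 5, 17, 0, 11, 7, 5, 0, 31, 37, 53, 5, 7, 13, 0, 11, 5, 29, 0, 7, 59, 5, 0, 0, 0, 0, 5, 0, 71, 0, 0, 5, 0, 7,
    19, 0, 5, 11, 23, 13, 7, 5, 67, 47, 73, 0, 5, 7, 11, 0, 0, 5, 13, 17, 7, 0, 5, 0, 0, 11, 41, 5, 0, 53, 0, 13, 5,
    0, 7, 0, 11, 5, 19, 0, 0, 7, 5, 0, 13, 59, 43, 5, 7, 37, 23, 0, 5, 17, 0, 7, 47, 5, 11, 0, 0, 0, 5, 61, 0, 71, 0,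
    5, 0, 7, 13, 0, 5, 23, 0, 67, 7, 5, 0, 0, 11, 0, 5, 7, 0, 0, 37, 5, 0, 43, 7, 11, 5, 0, 0, 19, 13, 5, 31, 29, 0,
    0, 5, 47, 7, 0, 0, 5, 41, 13]"

lemma sieve_entries2: "sieve 7129 3313 sieve_entries2 (map fst prime_certs2)"
  by code_simp

definition sieve_entries3 :: "int list" where
  "sieve_entries3 = [
    0, 7, 5, 11, 19, 0, 0, 5, 7, 23, 0, 17, 5, 37, 11, 7, 0, 5, 29, 31, 0, 0, 5, 19, 0, 11, 71, 5, 17, 7, 0, 0, 5, 0,
    0, 0, 7, 5, 13, 41, 47, 0, 5, 7, 89, 17, 73, 5, 0, 0, 7, 13, 5, 59, 0, 23, 79, 5, 11, 0, 0, 19, 5, 0, 7, 43, 0,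
    5, 0, 11, 0, 7, 5, 0, 0, 61, 29, 5, 7, 17, 11, 31, 5, 0, 0, 7, 0, 5, 0, 0, 13, 11, 5, 0, 0, 0, 17, 5, 0, 7, 0,
    23, 5, 13, 0, 29, 7, 5, 43, 0, 0, 0, 5, 7, 0, 0, 13, 5, 19, 73, 7, 41, 5, 0, 11, 83, 0, 5, 0, 13, 17, 53, 5, 89,
    7, 11, 61, 5, 0, 0, 0, 7, 5, 31, 0, 0, 11, 5, 7, 0, 0, 43, 5, 0, 0, 7, 19, 5, 0, 97, 0, 37, 5, 29, 17, 0, 67, 5,
    11, 7, 23, 59, 5, 0, 31, 19, 7, 5, 0, 11, 0, 13, 5, 7, 53, 0, 0, 5, 0, 0, 7, 0, 5, 23, 13, 0, 0, 5, 17, 0, 0, 11,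
    5, 41, 7, 31, 0, 5, 83, 0, 0, 7, 5, 19, 79, 17, 23, 5, 7, 0, 13, 29, 5, 11]"

lemma sieve_entries3: "sieve 11161 7129 sieve_entries3 (map fst prime_certs3)"
  by code_simp

definition sieve_entries4 :: "int list" where
  "sieve_entries4 = [
    0, 7, 0, 5, 47, 0, 59, 0, 5, 13, 11, 37, 31, 5, 101, 7, 107, 0, 5, 0, 41, 11, 7, 5, 0, 17, 29, 19, 5, 7, 0, 0,
    11, 5, 61, 13, 7, 0, 5, 0, 109, 73, 17, 5, 0, 0, 19, 0, 5, 0, 7, 47, 0, 5, 11, 29, 43, 7, 5, 17, 0, 13, 0, 5, 7,
    11, 53, 83, 5, 79, 0, 7, 0, 5, 13, 0, 11, 0, 5, 0, 0, 0, 0, 5, 19, 7, 71, 11, 5, 0, 0, 0, 7, 5, 0, 61, 0, 0, 5,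
    7, 13, 0, 41, 5, 0, 31, 7, 23, 5, 11, 17, 0, 0, 5, 73, 101, 0, 0, 5, 53, 7, 0, 19, 5, 59, 0, 13, 7, 5, 97, 23,
    11, 0, 5, 7, 0, 31, 0, 5, 13, 0, 7, 11, 5, 17, 47, 0, 0, 5, 109, 83, 0, 13, 5, 0, 7, 61, 71, 5, 37, 19, 17, 7, 5,
    11, 13, 0, 31, 5, 7, 0, 29, 53, 5, 0, 11, 7, 0, 5, 19, 0, 0, 0, 5, 41, 43, 11, 73, 5, 0, 7, 13, 47, 5, 0, 17, 37,
    7, 5, 23, 29, 0, 0, 5, 7, 0, 0, 0, 5, 0, 67, 7, 17, 5, 0, 0, 101, 13, 5, 11, 0, 0, 23, 5, 0, 7, 97, 79, 5, 17,
    11, 0, 7, 5, 0, 0, 19, 0, 5, 7, 113, 11, 59, 5, 103, 23, 7, 0, 5]"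

lemma sieve_entries4: "sieve 15643 11161 sieve_entries4 (map fst prime_certs4)"
  by code_simp

definition sieve_entries5 :: "int list" where
  "sieve_entries5 = [
    0, 0, 0, 11, 5, 0, 19, 13, 0, 5, 0, 7, 0, 0, 5, 0, 89, 41, 7, 5, 13, 37, 43, 0, 5, 7, 0, 127, 67, 5, 0, 17, 7,
    13, 5, 0, 11, 47, 29, 5, 0, 0, 23, 0, 5, 0, 7, 11, 17, 5, 71, 0, 59, 7, 5, 0, 0, 79, 11, 5, 7, 0, 0, 19, 5, 17,
    0, 7, 101, 5, 0, 0, 13, 31, 5, 0, 0, 0, 0, 5, 11, 7, 17, 0, 5, 13, 0, 0, 7, 5, 61, 11, 0, 0, 5, 7, 29, 0, 13, 5,
    0, 19, 7, 0, 5, 89, 0, 0, 43, 5, 0, 13, 0, 11, 5, 0, 7, 0, 109, 5, 19, 71, 0, 7, 5, 29, 0, 0, 131, 5, 7, 47, 37,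
    17, 5, 11, 79, 7, 0, 5, 41, 0, 0, 0, 5, 0, 11, 0, 0, 5, 13, 7, 0, 0, 5, 0, 0, 11, 7, 5, 0, 0, 67, 13, 5, 7, 31,
    17, 11, 5, 59, 97, 7, 0, 5, 0, 13, 19, 47, 5, 23, 41, 0, 29, 5, 0, 7, 0, 53, 5, 11, 0, 71, 7, 5, 107, 19, 31, 0,
    5, 7, 11, 13, 23, 5, 0, 37, 7, 0, 5, 0, 0, 11, 0, 5, 13, 0, 113, 17, 5, 0, 7, 41, 11, 5, 47, 23, 109, 7, 5, 73]"

lemma sieve_entries5: "sieve 19801 15643 sieve_entries5 (map fst prime_certs5)"
  by code_simp

definition sieve_entries6 :: "int list" where
  "sieve_entries6 = [
    0, 0, 83, 5, 7, 0, 43, 0, 5, 0, 13, 7, 37, 5, 11, 0, 0, 0, 5, 0, 0, 17, 19, 5, 0, 7, 0, 0, 5, 0, 0, 0, 7, 5, 137,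
    0, 11, 97, 5, 7, 0, 19, 61, 5, 0, 0, 7, 11, 5, 13, 127, 0, 89, 5, 0, 17, 0, 59, 5, 31, 7, 0, 13, 5, 23, 67, 139,
    7, 5, 11, 0, 107, 17, 5, 7, 13, 0, 0, 5, 19, 11, 7, 0, 5, 0, 83, 37, 23, 5, 17, 31, 11, 43, 5, 0, 7, 0, 29, 5,
    113, 0, 13, 7, 5, 0, 109, 17, 0, 5, 7, 23, 0, 0, 5, 13, 0, 7, 19, 5, 0, 0, 31, 0, 5, 11, 0, 29, 13, 5, 0, 7, 0,
    67, 5, 97, 11, 19, 7, 5, 0, 13, 89, 79, 5, 7, 73, 11, 0, 5, 0, 0, 7, 31, 5, 0, 19, 23, 11, 5, 131, 37, 0, 0, 5,
    61, 7, 13, 0, 5, 53, 0, 137, 7, 5, 17, 59, 103, 127, 5, 7, 0, 0, 47, 5, 29, 0, 7, 0, 5, 0, 11, 17, 13, 5, 0, 0,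
    41, 37, 5, 67, 7, 11, 23, 5, 0, 13, 0, 7, 5, 0, 0, 0, 11, 5, 7, 0, 0, 151, 5, 0, 0, 7, 53, 5, 0, 17, 0, 0, 5, 47,
    89, 13, 0, 5, 11, 7]"

lemma sieve_entries6: "sieve 24049 19801 sieve_entries6 (map fst prime_certs6)"
  by code_simp

definition sieve_entries7 :: "int list" where
  "sieve_entries7 = [
    0, 41, 5, 0, 0, 101, 7, 5, 13, 11, 0, 0, 5, 7, 19, 83, 0, 5, 0, 0, 7, 13, 5, 17, 0, 0, 0, 5, 43, 0, 67, 11, 5,
    19, 7, 23, 0, 5, 0, 53, 17, 7, 5, 103, 0, 0, 0, 5, 7, 107, 61, 0, 5, 11, 131, 7, 0, 5, 23, 0, 13, 0, 5, 0, 11, 0,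
    0, 5, 127, 7, 0, 19, 5, 13, 17, 11, 7, 5, 0, 0, 71, 23, 5, 7, 0, 0, 11, 5, 0, 113, 7, 17, 5, 29, 0, 0, 149, 5,
    83, 13, 0, 0, 5, 0, 7, 0, 101, 5, 11, 19, 0, 7, 5, 0, 43, 0, 59, 5, 7, 11, 0, 0, 5, 0, 41, 7, 0, 5, 19, 0, 11, 0,
    5, 31, 47, 0, 0, 5, 13, 7, 163, 11, 5, 79, 0, 53, 7, 5, 0, 0, 23, 13, 5, 7, 0, 0, 107, 5, 0, 17, 7, 0, 5, 11, 13,
    41, 19, 5, 0, 0, 0, 0, 5, 23, 7, 59, 17, 5, 0, 0, 29, 7, 5, 37, 0, 11, 0, 5, 7, 97, 13, 0, 5, 17, 0, 7, 11, 5,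
    53, 0, 43, 73, 5, 13, 19, 0, 41, 5, 0, 7, 17, 0, 5, 0, 0, 0, 7, 5, 11, 23, 37, 0, 5, 7, 0]"

lemma sieve_entries7: "sieve 28099 24049 sieve_entries7 (map fst prime_certs7)"
  by code_simp

definition sieve_entries8 :: "int list" where
  "sieve_entries8 = [
    0, 31, 5, 47, 11, 7, 67, 5, 61, 59, 0, 0, 5, 29, 0, 11, 0, 5, 43, 7, 149, 0, 5, 0, 103, 0, 7, 5, 0, 0, 13, 0, 5,
    7, 0, 0, 17, 5, 107, 83, 7, 0, 5, 13, 167, 0, 0, 5, 11, 73, 47, 0, 5, 17, 7, 19, 13, 5, 151, 11, 0, 7, 5, 23, 0,
    0, 0, 5, 7, 13, 11, 29, 5, 67, 19, 7, 79, 5, 163, 53, 109, 11, 5, 101, 0, 0, 23, 5, 0, 7, 113, 131, 5, 19, 31,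
    13, 7, 5, 0, 0, 29, 0, 5, 7, 17, 0, 37, 5, 13, 23, 7, 0, 5, 0, 11, 0, 0, 5, 0, 0, 0, 13, 5, 0, 7, 11, 0, 5, 0,
    29, 61, 7, 5, 0, 13, 0, 11, 5, 7, 71, 67, 0, 5, 37, 47, 7, 0, 5, 0, 0, 19, 0, 5, 0, 0, 17, 31, 5, 11, 7, 13, 139,
    5, 0, 0, 0, 7, 5, 0, 11, 0, 0, 5, 7, 0, 0, 0, 5, 23, 0, 7, 0, 5, 0, 101, 53, 13, 5, 19, 17, 43, 11, 5, 0, 7, 73,
    0, 5, 0, 13, 0, 7, 5, 113, 0, 83, 17, 5, 7, 151, 71, 167, 5, 11, 89, 7, 29, 5, 31, 179, 0, 0, 5, 17, 11, 13, 19,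
    5, 0, 7, 103, 0, 5, 43, 79, 11, 7, 5, 13, 0, 17, 163, 5, 7, 0, 19, 11, 5, 0, 31, 7, 13, 5, 0, 37, 97, 0, 5, 137]"

lemma sieve_entries8: "sieve 32761 28099 sieve_entries8 (map fst prime_certs8)"
  by code_simp

lemma hd_prime_certs: "prime_certs1 \<noteq> [] \<and> fst (hd prime_certs1) = 73"
  by (simp add: prime_certs1_def)

text \<open>Chains consecutive stretches of the progression: \<open>Q\<close> collects the lists in
  which the prime may already have been found.\<close>

lemma sieve_chunk:
  assumes "Q \<or> s \<le> int n" "sieve e s ds ps" "s = 19 + 18 * int a" "prime n" "int n = 19 + 18 * int j"
  shows "(Q \<or> int n \<in> set ps) \<or> e \<le> int n"
proof (cases "s \<le> int n \<and> int n < e")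
  case True
  then have "a \<le> j" using assms(3,5) by simp
  then have "int n = s + 18 * int (j - a)" using assms(3,5) by (simp add: of_nat_diff)
  then show ?thesis using sieve_prime[OF assms(2,4)] True by blast
next
  case False
  then show ?thesis using assms(1) by auto
qed

text \<open>Explicit rainbow labellings for the four primes congruent to 1 modulo 18 that carry no
  certificate.\<close>

lemma prime_planes:
  "plane_check (int_red 19) 6 6 [0, 1, 4, 2, 3, 17, 8, 11, 15]"
  "plane_check (int_red 37) 6 12 [0, 1, 3, 7, 24, 25, 17, 29, 35]"
  "plane_check (int_red 109) 6 36 [0, 1, 10, 2, 3, 12, 69, 82, 90]"
  "plane_check (int_red 127) 6 42 [0, 1, 12, 2, 3, 48, 31, 117, 47]"
  by code_simp+

lemma hesse_family_prime:
  assumes p: "prime p" "p mod 6 = 1" "p \<noteq> 7" "p \<noteq> 13"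
  shows "hesse_family {x. int p dvd x} p"
proof -
  interpret F: residue_field "{x. int p dvd x}" "{0..<int p}" p p by (rule residue_field_int[OF p(1)])
  have ge: "p \<ge> 19"
  proof -
    have "p = 6 * (p div 6) + 1" using p(2) mult_div_mod_eq[of 6 p] by simp
    moreover have "p div 6 \<noteq> 0" "p div 6 \<noteq> 1" "p div 6 \<noteq> 2"
      using calculation p(3,4) prime_gt_1_nat[OF p(1)] by auto
    ultimately show ?thesis by linarith
  qed
  have r1: "F.eqv (int_red (int p) x) x" for x
    by (rule F.eqv_sym) (simp add: F.eqv_def int_red_def dvd_minus_mod)
  have r2: "int_red (int p) x = 0" if "x \<in> {x. int p dvd x}" for x using that by (simp add: int_red_def)
  have plane: ?thesis if "plane_check (int_red (int p)) 6 (int (p div 3)) f" "p div 3 < 64" for f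
  proof (rule F.hesse_family_plane_check[OF p(2) r1 r2 refl _ that(1)])
    have "int (p div 3) < int 64" using that(2) by (simp only: of_nat_less_iff)
    then show "int (p div 3) < 2 ^ 6" by simp
  qed
  show ?thesis
  proof (cases "p mod 9 = 1")
    case False
    then show ?thesis using F.hesse_family_mod_9 p(2) ge by blast
  next
    case q9: True
    show ?thesis
    \<comment> \<open>The bound is the square of 181, from which on the weighted count
      applies.\<close>
    proof (cases "p < 32761")
      case False
      then show ?thesis
        using hesse_family_large[OF residue_field_int[OF p(1)] p(2) q9, of 181] by simp
    next
      case True
      have "9 dvd p - 1" "6 dvd p - 1" using p(2) q9 ge by (simp_all add: mod_eq_dvd_iff_nat[symmetric])
      have "(2::nat) dvd 6" by simp
      then have "2 dvd p - 1" using \<open>6 dvd p - 1\<close> dvd_trans by blast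
      have "coprime (2::nat) 9" by simp
      then have "2 * 9 dvd p - 1" using \<open>2 dvd p - 1\<close> \<open>9 dvd p - 1\<close> divides_mult by blast
      then obtain i where i: "p - 1 = 18 * i" by (auto elim: dvdE)
      then have "i \<ge> 1" using ge by (cases i) auto
      then have "int p = 19 + 18 * int (i - 1)" using i ge by (simp add: of_nat_diff)
      note n = p(1) this
      have c0: "False \<or> 19 \<le> int p" using ge by simp
      have a1: "19 = 19 + 18 * int 0" by simp
      note c1 = sieve_chunk[OF c0 sieve_entries1 a1 n]
      have a2: "3313 = 19 + 18 * int 183" by simp
      note c2 = sieve_chunk[OF c1 sieve_entries2 a2 n]
      have a3: "7129 = 19 + 18 * int 395" by simp
      note c3 = sieve_chunk[OF c2 sieve_entries3 a3 n]
      have a4: "11161 = 19 + 18 * int 619" by simp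
      note c4 = sieve_chunk[OF c3 sieve_entries4 a4 n]
      have a5: "15643 = 19 + 18 * int 868" by simp
      note c5 = sieve_chunk[OF c4 sieve_entries5 a5 n]
      have a6: "19801 = 19 + 18 * int 1099" by simp
      note c6 = sieve_chunk[OF c5 sieve_entries6 a6 n]
      have a7: "24049 = 19 + 18 * int 1335" by simp
      note c7 = sieve_chunk[OF c6 sieve_entries7 a7 n]
      have a8: "28099 = 19 + 18 * int 1560" by simp
      note c8 = sieve_chunk[OF c7 sieve_entries8 a8 n]
      have hd: "73 \<in> fst ` set prime_certs1" using hd_prime_certs by (metis image_eqI list.set_sel(1))
      have "set (tl prime_certs1) \<subseteq> set prime_certs1" using hd_prime_certs by (meson list.set_sel(2) subsetI)
      then have tl: "fst ` set (tl prime_certs1) \<subseteq> fst ` set prime_certs1" by (rule image_mono)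
      have "set (19 # 37 # 73 # 109 # 127 # map fst (tl prime_certs1)) \<subseteq> {19, 37, 109, 127} \<union> fst ` set prime_certs1"
        using hd tl by auto
      moreover have "\<not> 32761 \<le> int p" using True by simp
      ultimately have "int p \<in> {19, 37, 109, 127} \<union> fst ` set prime_certs"
        using c8 unfolding prime_certs_def set_append image_Un set_map by blast
      then have "int p = 19 \<or> int p = 37 \<or> int p = 109 \<or> int p = 127 \<or> int p \<in> fst ` set prime_certs" by blast
      moreover have "int p = 19 \<longrightarrow> p = 19" "int p = 37 \<longrightarrow> p = 37" "int p = 109 \<longrightarrow> p = 109" "int p = 127 \<longrightarrow> p = 127"
        by linarith+
      ultimately have mem: "p = 19 \<or> p = 37 \<or> p = 109 \<or> p = 127 \<or> int p \<in> fst ` set prime_certs" by blast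
      then consider "p = 19" | "p = 37" | "p = 109" | "p = 127" | "int p \<in> fst ` set prime_certs" using mem by blast
      then show ?thesis
      proof cases
        case 1
        show ?thesis by (rule plane[of "[0, 1, 4, 2, 3, 17, 8, 11, 15]"]) (use prime_planes(1) in \<open>simp_all add: 1\<close>)
      next
        case 2
        show ?thesis by (rule plane[of "[0, 1, 3, 7, 24, 25, 17, 29, 35]"]) (use prime_planes(2) in \<open>simp_all add: 2\<close>)
      next
        case 3
        show ?thesis by (rule plane[of "[0, 1, 10, 2, 3, 12, 69, 82, 90]"]) (use prime_planes(3) in \<open>simp_all add: 3\<close>)
      next
        case 4
        show ?thesis by (rule plane[of "[0, 1, 12, 2, 3, 48, 31, 117, 47]"]) (use prime_planes(4) in \<open>simp_all add: 4\<close>)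
      next
        case 5
        then obtain x where x: "x \<in> set prime_certs" "int p = fst x" by blast
        obtain g a b c d where "x = (int p, g, a, b, c, d)" using x(2) by (cases x) auto
        then show ?thesis using prime_certs[OF x(1)] hesse_family_prime_cert[OF p(1,2) q9] True by simp
      qed
    qed
  qed
qed

section \<open>Fields of order \<open>p^2\<close> from Eisenstein integers\<close>

lemma all_less_2: "(\<forall>i<2. P i) \<longleftrightarrow> P 0 \<and> P (1::nat)" and all_less_3: "(\<forall>i<3. P i) \<longleftrightarrow> P 0 \<and> P 1 \<and> P (2::nat)"
  by (auto simp: numeral_eq_Suc less_Suc_eq)

lemma mod_diff_dvd: "p dvd x mod p - (x::int)"
  by (subst dvd_diff_commute) (rule dvd_minus_mod)

text \<open>A ring that is free over the integers becomes a field modulo \<open>p\<close> as soon as \<open>p\<close> divides the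
  norm of an element only if it divides all its coordinates.\<close>

lemma residue_field_coordinates:
  fixes co :: "nat \<Rightarrow> 'a::comm_ring_1 \<Rightarrow> int" and mk :: "(nat \<Rightarrow> int) \<Rightarrow> 'a"
  assumes p: "prime p" and d: "0 < d"
    and add: "\<And>i x y. co i (x + y) = co i x + co i y"
    and mk: "\<And>i f. i < d \<Longrightarrow> co i (mk f) = f i"
    and mult: "\<And>a x. \<forall>i<d. int p dvd co i x \<Longrightarrow> \<forall>i<d. int p dvd co i (a * x)"
    and one: "\<not> (\<forall>i<d. int p dvd co i 1)"
    and nat: "\<And>i. int p dvd co i (of_nat p)"
    and adj: "\<And>x y. \<forall>i<d. co i (adj x * (x * y)) = N x * co i y"
    and norm: "\<And>x. int p dvd N x \<Longrightarrow> \<forall>i<d. int p dvd co i x"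
  shows "residue_field {x. \<forall>i<d. int p dvd co i x} (mk ` PiE {..<d} (\<lambda>_. {0..<int p})) p (p ^ d)"
proof unfold_locales
  let ?I = "{x. \<forall>i<d. int p dvd co i x}" and ?P = "PiE {..<d} (\<lambda>_. {0..<int p})"
  have pp: "prime (int p)" using p by simp
  have zero: "co i 0 = 0" for i using add[of i 0 0] by simp
  have diff: "co i (x - y) = co i x - co i y" for i x y using add[of i "x - y" y] by simp
  have inj: "f = g" if "f \<in> ?P" "g \<in> ?P" "\<And>i. i < d \<Longrightarrow> f i = g i" for f g
    by (rule PiE_ext[OF that(1,2)]) (use that(3) in simp)
  show "0 \<in> ?I" by (simp add: zero)
  show "x + y \<in> ?I" if "x \<in> ?I" "y \<in> ?I" for x y using that by (simp add: add)
  show "a * x \<in> ?I" if "x \<in> ?I" for a x using mult[of x a] that by simp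
  show "1 \<notin> ?I" using one by simp
  show "x \<in> ?I \<or> y \<in> ?I" if xy: "x * y \<in> ?I" for x y
  proof (cases "x \<in> ?I")
    case False
    then have n: "\<not> int p dvd N x" using norm by blast
    have "int p dvd co i y" if "i < d" for i
    proof -
      have "int p dvd co i (adj x * (x * y))" using mult[of "x * y" "adj x"] xy that by blast
      then have "int p dvd N x * co i y" using adj[of x y] that by simp
      then show ?thesis using n prime_dvd_mult_iff[OF pp] by blast
    qed
    then show ?thesis by simp
  qed simp
  show "finite (mk ` ?P)" by (intro finite_imageI finite_PiE) auto
  have "inj_on mk ?P"
  proof (rule inj_onI)
    fix f g assume fg: "f \<in> ?P" "g \<in> ?P" "mk f = mk g"
    show "f = g" by (rule inj[OF fg(1,2)]) (use mk[of _ f] mk[of _ g] fg(3) in simp)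
  qed
  then have "card (mk ` ?P) = card ?P" by (rule card_image)
  then show "card (mk ` ?P) = p ^ d" by (simp add: card_PiE)
  show "\<exists>v\<in>mk ` ?P. x - v \<in> ?I" for x
  proof -
    let ?f = "restrict (\<lambda>i. co i x mod int p) {..<d}"
    have "x - mk ?f \<in> ?I" by (simp add: diff mk dvd_minus_mod)
    moreover have "?f \<in> ?P" using prime_gt_0_nat[OF p] by auto
    ultimately show ?thesis by blast
  qed
  show "u = v" if uv: "u \<in> mk ` ?P" "v \<in> mk ` ?P" "u - v \<in> ?I" for u v
  proof -
    obtain f g where f: "f \<in> ?P" "u = mk f" and g: "g \<in> ?P" "v = mk g" using uv(1,2) by blast
    have "f i = g i" if i: "i < d" for i
    proof -
      have "f i \<in> {0..<int p}" "g i \<in> {0..<int p}" using PiE_mem[OF f(1)] PiE_mem[OF g(1)] i by blast+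
      moreover have "int p dvd co i (u - v)" using uv(3) i by blast
      then have "int p dvd f i - g i" unfolding diff f(2) g(2) mk[OF i] .
      then have "f i mod int p = g i mod int p" by (simp add: mod_eq_dvd_iff)
      ultimately show ?thesis by simp
    qed
    then show ?thesis using inj[OF f(1) g(1)] f(2) g(2) by simp
  qed
  show "prime p" by (rule p)
  show "of_nat p \<in> ?I" using nat by simp
  show "\<exists>m>0. p ^ d = p ^ m" using d by blast
qed

text \<open>The Eisenstein integers \<open>a + b z\<close> with
  \<open>z^2 = - 1 - z\<close>.\<close>

datatype eis = Eis (eis_re: int) (eis_im: int)

instantiation eis :: comm_ring_1
begin

definition zero_eis where "0 = Eis 0 0"
definition one_eis where "1 = Eis 1 0"
definition plus_eis where "x + y = Eis (eis_re x + eis_re y) (eis_im x + eis_im y)"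
definition uminus_eis where "- x = Eis (- eis_re x) (- eis_im x)"
definition minus_eis where "x - y = Eis (eis_re x - eis_re y) (eis_im x - eis_im y)"
definition times_eis where "x * y = Eis (eis_re x * eis_re y - eis_im x * eis_im y) (eis_re x * eis_im y + eis_im x * eis_re y - eis_im x * eis_im y)"

instance
  by standard (simp_all add: zero_eis_def one_eis_def plus_eis_def uminus_eis_def minus_eis_def times_eis_def
      algebra_simps)

end

lemma eis_ops:
  "eis_re (0 :: eis) = 0" "eis_im (0 :: eis) = 0"
  "eis_re (1 :: eis) = 1" "eis_im (1 :: eis) = 0"
  "eis_re (x + y) = eis_re x + eis_re y" "eis_im (x + y) = eis_im x + eis_im y"
  "eis_re (x - y) = eis_re x - eis_re y" "eis_im (x - y) = eis_im x - eis_im y"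
  "eis_re (x * y) = eis_re x * eis_re y - eis_im x * eis_im y" "eis_im (x * y) = eis_re x * eis_im y + eis_im x * eis_re y - eis_im x * eis_im y"
  by (simp_all add: zero_eis_def one_eis_def plus_eis_def minus_eis_def times_eis_def)

lemma eis_of_nat: "eis_re (of_nat k) = int k" "eis_im (of_nat k) = 0"
  by (induction k) (simp_all add: eis_ops)

definition eis_coord :: "nat \<Rightarrow> eis \<Rightarrow> int" where
  "eis_coord i x = (if i = 0 then eis_re x else eis_im x)"

definition eis_red :: "int \<Rightarrow> eis \<Rightarrow> eis" where
  "eis_red p x = Eis (eis_re x mod p) (eis_im x mod p)"

text \<open>Needed for Stepanov's method over this ring. Multiplying by the conjugate brings in the
  norm, and four times the norm is \<open>(2 x - y)^2 + 3 y^2\<close>, which vanishes only at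
  0.\<close>

instance eis :: idom
proof
  fix a b :: eis assume ab: "a \<noteq> 0" "b \<noteq> 0"
  show "a * b \<noteq> 0"
  proof
    assume z: "a * b = 0"
    let ?x = "eis_re a" and ?y = "eis_im a"
    let ?N = "?x * ?x - ?x * ?y + ?y * ?y"
    have "Eis (?x - ?y) (- ?y) * (a * b) = 0" unfolding z by simp
    then have "eis_re (Eis (?x - ?y) (- ?y) * (a * b)) = 0" "eis_im (Eis (?x - ?y) (- ?y) * (a * b)) = 0"
      by (simp_all add: eis_ops)
    moreover have "eis_re (Eis (?x - ?y) (- ?y) * (a * b)) = ?N * eis_re b"
      "eis_im (Eis (?x - ?y) (- ?y) * (a * b)) = ?N * eis_im b" by (simp_all add: eis_ops algebra_simps)
    ultimately have "?N * eis_re b = 0" "?N * eis_im b = 0" by simp_all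
    moreover have "\<not> (eis_re b = 0 \<and> eis_im b = 0)" using ab(2) by (cases b) (simp add: zero_eis_def)
    ultimately have N: "?N = 0" by (metis mult_eq_0_iff)
    have s: "(2 * ?x - ?y)\<^sup>2 + 3 * ?y\<^sup>2 = 4 * ?N" by (simp add: power2_eq_square algebra_simps)
    have "3 * ?y\<^sup>2 \<le> 0" using s[unfolded N] zero_le_power2[of "2 * ?x - ?y"] by linarith
    then have y: "?y = 0" by simp
    then have "?x = 0" using N by simp
    then show False using y ab(1) by (cases a) (simp add: zero_eis_def)
  qed
qed

text \<open>Cubing is injective on nonzero residues because \<open>p - 1\<close> is 1 modulo 3. If
  \<open>p\<close> divides the norm and not \<open>b\<close>, then \<open>a^3 = - b^3\<close>, hence
  \<open>a = - b\<close>, and the norm becomes \<open>3 a^2\<close>, which is not divisible by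
  \<open>p\<close>.\<close>

lemma eis_norm_dvd:
  assumes p: "prime p" "p mod 6 = 5" and N: "int p dvd a * a - a * b + b * b"
  shows "int p dvd a \<and> int p dvd b"
proof -
  interpret F: residue_field "{x. int p dvd x}" "{0..<int p}" p p by (rule residue_field_int[OF p(1)])
  have pp: "prime (int p)" using p(1) by simp
  have b: "int p dvd b"
  proof (rule ccontr)
    assume nb: "\<not> int p dvd b"
    have na: "\<not> int p dvd a"
    proof
      assume "int p dvd a"
      then have "int p dvd a * a - a * b" by simp
      then have "int p dvd (a * a - a * b + b * b) - (a * a - a * b)" using N by (rule dvd_diff[rotated])
      then have "int p dvd b * b" by simp
      then show False using nb prime_dvd_mult_iff[OF pp] by blast
    qed
    define k where "k = p div 3"
    have "p mod 3 = 2" using mod_mod_cancel[of 3 6 p] p(2) by simp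
    then have k: "p - 1 = 3 * k + 1" using mult_div_mod_eq[of 3 p] by (simp add: k_def)
    have "odd p" using mod_mod_cancel[of 2 6 p] p(2) by (simp add: odd_iff_mod_2_eq_one)
    moreover have "p = 3 * k + 2" using k by simp
    ultimately have "odd k" by simp
    have fa: "F.eqv (x * (x ^ 3) ^ k) 1" if "\<not> int p dvd x" for x
    proof -
      have "x ^ (p - 1) = x * (x ^ 3) ^ k" unfolding k by (simp add: power_mult)
      then show ?thesis using F.fermat[of x] that by simp
    qed
    have "a ^ 3 - - (b ^ 3) = (a + b) * (a * a - a * b + b * b)" by (simp add: algebra_simps power3_eq_cube)
    then have "F.eqv (a ^ 3) (- (b ^ 3))" using N unfolding F.eqv_def by simp
    then have "F.eqv ((a ^ 3) ^ k) ((- (b ^ 3)) ^ k)" by (rule F.eqv_power)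
    then have e: "F.eqv ((a ^ 3) ^ k) (- ((b ^ 3) ^ k))" using \<open>odd k\<close> by simp
    have "F.eqv (b * (a * (a ^ 3) ^ k)) (b * 1)" by (rule F.eqv_mult[OF F.eqv_refl fa[OF na]])
    moreover have "F.eqv (b * (a * (a ^ 3) ^ k)) (b * (a * - ((b ^ 3) ^ k)))"
      by (intro F.eqv_mult F.eqv_refl e)
    moreover have "b * (a * - ((b ^ 3) ^ k)) = - a * (b * (b ^ 3) ^ k)" by (simp add: algebra_simps)
    moreover have "F.eqv (- a * (b * (b ^ 3) ^ k)) (- a * 1)" by (rule F.eqv_mult[OF F.eqv_refl fa[OF nb]])
    ultimately have "F.eqv b (- a)"
      using F.eqv_trans F.eqv_sym by (metis mult.right_neutral)
    then have "int p dvd b + a" by (simp add: F.eqv_def)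
    then have "int p dvd (b + a) * (b - 2 * a)" by simp
    then have "int p dvd (a * a - a * b + b * b) - (b + a) * (b - 2 * a)" using N by (rule dvd_diff[rotated])
    moreover have "(a * a - a * b + b * b) - (b + a) * (b - 2 * a) = 3 * (a * a)" by (simp add: algebra_simps)
    ultimately have "int p dvd 3 * (a * a)" by simp
    then have "int p dvd 3" using na prime_dvd_mult_iff[OF pp] by blast
    then have "int p \<le> 3" by (rule zdvd_imp_le) simp
    then have "p \<le> 3" by simp
    then have "p = 0 \<or> p = 1 \<or> p = 2 \<or> p = 3" by linarith
    then show False using p(2) by auto
  qed
  then have "int p dvd - (a * b) + b * b" by simp
  then have "int p dvd (a * a - a * b + b * b) - (- (a * b) + b * b)" using N by (rule dvd_diff[rotated])
  then have "int p dvd a * a" by simp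
  then show ?thesis using b prime_dvd_mult_iff[OF pp] by blast
qed

lemma residue_field_eis:
  assumes "prime p" "p mod 6 = 5"
  shows "residue_field {x. \<forall>i<2. int p dvd eis_coord i x}
    ((\<lambda>f. Eis (f 0) (f 1)) ` PiE {..<2::nat} (\<lambda>_. {0..<int p})) p (p ^ 2)"
proof (rule residue_field_coordinates[where adj = "\<lambda>x. Eis (eis_re x - eis_im x) (- eis_im x)" and N = "\<lambda>x. eis_re x * eis_re x - eis_re x * eis_im x + eis_im x * eis_im x"])
  show "prime p" using assms by auto
  then have "p > 1" by (rule prime_gt_1_nat)
  then show "\<not> (\<forall>i<2. int p dvd eis_coord i 1)" by (auto simp: all_less_2 eis_coord_def eis_ops)
  show "(0::nat) < 2" by simp
  show "eis_coord i (x + y) = eis_coord i x + eis_coord i y" for i x y by (simp add: eis_coord_def eis_ops)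
  show "eis_coord i (Eis (f 0) (f 1)) = f i" if "i < 2" for i f
    using that by (auto simp: eis_coord_def numeral_eq_Suc less_Suc_eq)
  show "\<forall>i<2. int p dvd eis_coord i (a * x)" if "\<forall>i<2. int p dvd eis_coord i x" for a x
    using that unfolding all_less_2 eis_coord_def by (simp add: eis_ops)
  show "int p dvd eis_coord i (of_nat p)" for i by (simp add: eis_coord_def eis_of_nat)
  show "\<forall>i<2. eis_coord i ((Eis (eis_re x - eis_im x) (- eis_im x)) * (x * y)) = (eis_re x * eis_re x - eis_re x * eis_im x + eis_im x * eis_im x) * eis_coord i y" for x y
    unfolding all_less_2 eis_coord_def by (simp add: eis_ops algebra_simps)
  show "\<forall>i<2. int p dvd eis_coord i x" if "int p dvd eis_re x * eis_re x - eis_re x * eis_im x + eis_im x * eis_im x" for x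
    using eis_norm_dvd[OF assms that] unfolding all_less_2 eis_coord_def by simp
qed

lemma eis_red_props:
  "\<forall>i<2. int p dvd eis_coord i (eis_red (int p) x - x)"
  "\<forall>i<2. int p dvd eis_coord i x \<Longrightarrow> eis_red (int p) x = 0"
  unfolding all_less_2 eis_coord_def
  by (simp_all add: eis_red_def eis_ops zero_eis_def mod_diff_dvd)

text \<open>For \<open>p\<close> congruent to 5 modulo 6, \<open>p^2\<close> is 1 modulo 9 exactly
  if \<open>p\<close> is 17 modulo 18; these are the primes of that kind below 181.\<close>

lemma eis_checks:
  "triples_check (eis_red 17) 14 96 (Eis 3 1)"
  "triples_check (eis_red 53) 14 936 (Eis 6 1)"
  "triples_check (eis_red 71) 14 1680 (Eis 13 1)"
  "triples_check (eis_red 89) 14 2640 (Eis 3 1)"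
  "triples_check (eis_red 107) 14 3816 (Eis 3 1)"
  "triples_check (eis_red 179) 14 10680 (Eis 30 1)"
  by code_simp+

lemma hesse_family_eis:
  assumes p: "prime p" "p mod 6 = 5"
  shows "hesse_family {x. \<forall>i<2. int p dvd eis_coord i x} (p\<^sup>2)"
proof -
  let ?I = "{x. \<forall>i<2. int p dvd eis_coord i x}"
  interpret F: residue_field ?I "(\<lambda>f. Eis (f 0) (f 1)) ` PiE {..<2::nat} (\<lambda>_. {0..<int p})" p "p\<^sup>2"
    by (rule residue_field_eis[OF p])
  have q6: "p\<^sup>2 mod 6 = 1" using power_mod[of p 6 2] p(2) by simp
  have ge: "p \<ge> 5" using p(2) mod_less_eq_dividend[of p 6] by simp
  show ?thesis
  proof (cases "p\<^sup>2 mod 9 = 1")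
    case False
    have "5 * 5 \<le> p * p" by (rule mult_le_mono[OF ge ge])
    then show ?thesis using F.hesse_family_mod_9[OF q6 False] by (simp add: power2_eq_square)
  next
    case q9: True
    show ?thesis
    proof (cases "181 \<le> p")
      case True
      have "(181::nat)\<^sup>2 \<le> p\<^sup>2" by (rule power_mono[OF True]) simp
      then show ?thesis using hesse_family_large[OF residue_field_eis[OF p] q6 q9 True] by simp
    next
      case False
      have check: ?thesis if "triples_check (eis_red (int p)) 14 (int (p\<^sup>2 div 3)) x" "p\<^sup>2 div 3 < 16384" for x
      proof (rule F.hesse_family_triples_check[OF q6 q9 _ _ refl _ that(1)])
        show "F.eqv (eis_red (int p) x) x" for x using eis_red_props(1)[of p x] by (simp add: F.eqv_def)
        show "eis_red (int p) x = 0" if "x \<in> ?I" for x using eis_red_props(2)[of p x] that by simp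
        have "int (p\<^sup>2 div 3) < int 16384" using that(2) by (simp only: of_nat_less_iff)
        then show "int (p\<^sup>2 div 3) < 2 ^ 14" by simp
      qed
      \<comment> \<open>The numbers below 181 congruent to 17 modulo 18; the four composite ones are
        discarded afterwards.\<close>
      have table: "\<forall>i\<in>set [0..29::int]. (6 * i + 5) * (6 * i + 5) mod 9 = 1 \<longrightarrow>
          6 * i + 5 \<in> set [17, 35, 53, 71, 89, 107, 125, 143, 161, 179]" by code_simp
      define i where "i = int (p div 6)"
      have "p = 6 * (p div 6) + 5" using p(2) mult_div_mod_eq[of 6 p] by simp
      then have "int p = int (6 * (p div 6) + 5)" by (rule arg_cong)
      then have pi: "int p = 6 * i + 5" by (simp add: i_def)
      have "i \<in> set [0..29]" using False pi by (simp add: i_def)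
      moreover have "(6 * i + 5) * (6 * i + 5) mod 9 = 1"
      proof -
        have "int (p\<^sup>2 mod 9) = int 1" using q9 by simp
        then show ?thesis by (simp add: zmod_int power2_eq_square pi)
      qed
      ultimately have "6 * i + 5 \<in> set [17, 35, 53, 71, 89, 107, 125, 143, 161, 179]" using table by blast
      then have "int p \<in> set [17, 35, 53, 71, 89, 107, 125, 143, 161, 179]" by (simp only: pi)
      then have "p \<in> {17, 35, 53, 71, 89, 107, 125, 143, 161, 179}" by auto
      moreover have D: "m = 1 \<or> m = p" if "m dvd p" for m using p(1) that unfolding prime_nat_iff by blast
      have "p \<noteq> 35" using D[of 5] by auto
      moreover have "p \<noteq> 125" using D[of 5] by auto
      moreover have "p \<noteq> 143" using D[of 11] by auto
      moreover have "p \<noteq> 161" using D[of 7] by auto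
      ultimately consider "p = 17" | "p = 53" | "p = 71" | "p = 89" | "p = 107" | "p = 179" by blast
      then show ?thesis
      proof cases
        case 1 show ?thesis by (rule check[of "Eis 3 1"]) (use eis_checks(1) in \<open>simp_all add: 1\<close>)
      next
        case 2 show ?thesis by (rule check[of "Eis 6 1"]) (use eis_checks(2) in \<open>simp_all add: 2\<close>)
      next
        case 3 show ?thesis by (rule check[of "Eis 13 1"]) (use eis_checks(3) in \<open>simp_all add: 3\<close>)
      next
        case 4 show ?thesis by (rule check[of "Eis 3 1"]) (use eis_checks(4) in \<open>simp_all add: 4\<close>)
      next
        case 5 show ?thesis by (rule check[of "Eis 3 1"]) (use eis_checks(5) in \<open>simp_all add: 5\<close>)
      next
        case 6 show ?thesis by (rule check[of "Eis 30 1"]) (use eis_checks(6) in \<open>simp_all add: 6\<close>)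
      qed
    qed
  qed
qed

section \<open>Powers of 7 and 13\<close>

datatype golden = Golden (gold_re: int) (gold_im: int)

instantiation golden :: comm_ring_1
begin

definition zero_golden where "0 = Golden 0 0"
definition one_golden where "1 = Golden 1 0"
definition plus_golden where "x + y = Golden (gold_re x + gold_re y) (gold_im x + gold_im y)"
definition uminus_golden where "- x = Golden (- gold_re x) (- gold_im x)"
definition minus_golden where "x - y = Golden (gold_re x - gold_re y) (gold_im x - gold_im y)"
definition times_golden where "x * y = Golden (gold_re x * gold_re y + gold_im x * gold_im y) (gold_re x * gold_im y + gold_im x * gold_re y + gold_im x * gold_im y)"

instance
  by standard (simp_all add: zero_golden_def one_golden_def plus_golden_def uminus_golden_def minus_golden_def times_golden_def
      algebra_simps)

end

lemma golden_ops:
  "gold_re (0 :: golden) = 0" "gold_im (0 :: golden) = 0"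
  "gold_re (1 :: golden) = 1" "gold_im (1 :: golden) = 0"
  "gold_re (x + y) = gold_re x + gold_re y" "gold_im (x + y) = gold_im x + gold_im y"
  "gold_re (x - y) = gold_re x - gold_re y" "gold_im (x - y) = gold_im x - gold_im y"
  "gold_re (x * y) = gold_re x * gold_re y + gold_im x * gold_im y" "gold_im (x * y) = gold_re x * gold_im y + gold_im x * gold_re y + gold_im x * gold_im y"
  by (simp_all add: zero_golden_def one_golden_def plus_golden_def minus_golden_def times_golden_def)

lemma golden_of_nat: "gold_re (of_nat k) = int k" "gold_im (of_nat k) = 0"
  by (induction k) (simp_all add: golden_ops)

definition golden_coord :: "nat \<Rightarrow> golden \<Rightarrow> int" where
  "golden_coord i x = (if i = 0 then gold_re x else gold_im x)"

text \<open>Irreducibility of \<open>X^2 - X - 1\<close> modulo 7 and 13, stated for the norm form.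
  Eisenstein integers would not give fields here, as both primes are 1 modulo 3 and -3 is a
  square.\<close>

lemma golden_check:
  "\<forall>a\<in>set [0..6]. \<forall>b\<in>set [0..6]. (a * a + a * b - b * b) mod 7 = (0::int) \<longrightarrow> a = 0 \<and> b = 0"
  "\<forall>a\<in>set [0..12]. \<forall>b\<in>set [0..12]. (a * a + a * b - b * b) mod 13 = (0::int) \<longrightarrow> a = 0 \<and> b = 0"
  by code_simp+

lemma golden_norm_dvd:
  assumes p: "p = 7 \<or> p = (13::nat)" and N: "int p dvd a * a + a * b - b * b"
  shows "int p dvd a \<and> int p dvd b"
proof -
  let ?a = "a mod int p" and ?b = "b mod int p"
  have "(?a * ?a + ?a * ?b - ?b * ?b) mod int p = (a * a + a * b - b * b) mod int p"
    by (intro mod_diff_cong mod_add_cong mod_mult_cong mod_mod_trivial)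
  also have "\<dots> = 0" using N by simp
  finally have z: "(?a * ?a + ?a * ?b - ?b * ?b) mod int p = 0" .
  have r: "0 \<le> x mod int p" "x mod int p < int p" for x using p by auto
  have "?a = 0 \<and> ?b = 0" using p
  proof
    assume 7: "p = 7"
    have "?a \<in> set [0..6]" "?b \<in> set [0..6]" unfolding set_upto atLeastAtMost_iff using r[of a] r[of b] unfolding 7 by simp_all
    then show ?thesis using bspec[OF bspec[OF golden_check(1)], of ?a ?b] z by (simp add: 7)
  next
    assume 13: "p = 13"
    have "?a \<in> set [0..12]" "?b \<in> set [0..12]" unfolding set_upto atLeastAtMost_iff using r[of a] r[of b] unfolding 13 by simp_all
    then show ?thesis using bspec[OF bspec[OF golden_check(2)], of ?a ?b] z by (simp add: 13)
  qed
  then show ?thesis by (simp add: dvd_eq_mod_eq_0)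
qed

lemma residue_field_golden:
  assumes "p = 7 \<or> p = (13::nat)"
  shows "residue_field {x. \<forall>i<2. int p dvd golden_coord i x}
    ((\<lambda>f. Golden (f 0) (f 1)) ` PiE {..<2::nat} (\<lambda>_. {0..<int p})) p (p ^ 2)"
proof (rule residue_field_coordinates[where adj = "\<lambda>x. Golden (gold_re x + gold_im x) (- gold_im x)" and N = "\<lambda>x. gold_re x * gold_re x + gold_re x * gold_im x - gold_im x * gold_im x"])
  show "prime p" using assms by auto
  then have "p > 1" by (rule prime_gt_1_nat)
  then show "\<not> (\<forall>i<2. int p dvd golden_coord i 1)" by (auto simp: all_less_2 golden_coord_def golden_ops)
  show "(0::nat) < 2" by simp
  show "golden_coord i (x + y) = golden_coord i x + golden_coord i y" for i x y by (simp add: golden_coord_def golden_ops)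
  show "golden_coord i (Golden (f 0) (f 1)) = f i" if "i < 2" for i f
    using that by (auto simp: golden_coord_def numeral_eq_Suc less_Suc_eq)
  show "\<forall>i<2. int p dvd golden_coord i (a * x)" if "\<forall>i<2. int p dvd golden_coord i x" for a x
    using that unfolding all_less_2 golden_coord_def by (simp add: golden_ops)
  show "int p dvd golden_coord i (of_nat p)" for i by (simp add: golden_coord_def golden_of_nat)
  show "\<forall>i<2. golden_coord i ((Golden (gold_re x + gold_im x) (- gold_im x)) * (x * y)) = (gold_re x * gold_re x + gold_re x * gold_im x - gold_im x * gold_im x) * golden_coord i y" for x y
    unfolding all_less_2 golden_coord_def by (simp add: golden_ops algebra_simps)
  show "\<forall>i<2. int p dvd golden_coord i x" if "int p dvd gold_re x * gold_re x + gold_re x * gold_im x - gold_im x * gold_im x" for x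
    using golden_norm_dvd[OF assms that] unfolding all_less_2 golden_coord_def by simp
qed

text \<open>The integers with a cube root of 2 adjoined; as 2 is not a cube modulo 7 or 13,
  reduction gives the fields of order 343 and 2197.\<close>

datatype cubic = Cubic (cub_0: int) (cub_1: int) (cub_2: int)

instantiation cubic :: comm_ring_1
begin

definition zero_cubic where "0 = Cubic 0 0 0"
definition one_cubic where "1 = Cubic 1 0 0"
definition plus_cubic where "x + y = Cubic (cub_0 x + cub_0 y) (cub_1 x + cub_1 y) (cub_2 x + cub_2 y)"
definition uminus_cubic where "- x = Cubic (- cub_0 x) (- cub_1 x) (- cub_2 x)"
definition minus_cubic where "x - y = Cubic (cub_0 x - cub_0 y) (cub_1 x - cub_1 y) (cub_2 x - cub_2 y)"
definition times_cubic where "x * y = Cubic (cub_0 x * cub_0 y + 2 * (cub_1 x * cub_2 y + cub_2 x * cub_1 y)) (cub_0 x * cub_1 y + cub_1 x * cub_0 y + 2 * (cub_2 x * cub_2 y)) (cub_0 x * cub_2 y + cub_1 x * cub_1 y + cub_2 x * cub_0 y)"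

instance
  by standard (simp_all add: zero_cubic_def one_cubic_def plus_cubic_def uminus_cubic_def minus_cubic_def times_cubic_def
      algebra_simps)

end

lemma cubic_ops:
  "cub_0 (0 :: cubic) = 0" "cub_1 (0 :: cubic) = 0" "cub_2 (0 :: cubic) = 0"
  "cub_0 (1 :: cubic) = 1" "cub_1 (1 :: cubic) = 0" "cub_2 (1 :: cubic) = 0"
  "cub_0 (x + y) = cub_0 x + cub_0 y" "cub_1 (x + y) = cub_1 x + cub_1 y" "cub_2 (x + y) = cub_2 x + cub_2 y"
  "cub_0 (x - y) = cub_0 x - cub_0 y" "cub_1 (x - y) = cub_1 x - cub_1 y" "cub_2 (x - y) = cub_2 x - cub_2 y"
  "cub_0 (x * y) = cub_0 x * cub_0 y + 2 * (cub_1 x * cub_2 y + cub_2 x * cub_1 y)" "cub_1 (x * y) = cub_0 x * cub_1 y + cub_1 x * cub_0 y + 2 * (cub_2 x * cub_2 y)" "cub_2 (x * y) = cub_0 x * cub_2 y + cub_1 x * cub_1 y + cub_2 x * cub_0 y"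
  by (simp_all add: zero_cubic_def one_cubic_def plus_cubic_def minus_cubic_def times_cubic_def)

lemma cubic_of_nat: "cub_0 (of_nat k) = int k" "cub_1 (of_nat k) = 0" "cub_2 (of_nat k) = 0"
  by (induction k) (simp_all add: cubic_ops)

definition cubic_coord :: "nat \<Rightarrow> cubic \<Rightarrow> int" where
  "cubic_coord i x = (if i = 0 then cub_0 x else if i = 1 then cub_1 x else cub_2 x)"

definition cubic_red :: "int \<Rightarrow> cubic \<Rightarrow> cubic" where
  "cubic_red p x = Cubic (cub_0 x mod p) (cub_1 x mod p) (cub_2 x mod p)"

lemma cubic_check:
  "\<forall>a\<in>set [0..6]. \<forall>b\<in>set [0..6]. \<forall>c\<in>set [0..6].
     (a * a * a + 2 * (b * b * b) + 4 * (c * c * c) - 6 * (a * b * c)) mod 7 = (0::int) \<longrightarrow> a = 0 \<and> b = 0 \<and> c = 0"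
  "\<forall>a\<in>set [0..12]. \<forall>b\<in>set [0..12]. \<forall>c\<in>set [0..12].
     (a * a * a + 2 * (b * b * b) + 4 * (c * c * c) - 6 * (a * b * c)) mod 13 = (0::int) \<longrightarrow> a = 0 \<and> b = 0 \<and> c = 0"
  by code_simp+

lemma cubic_norm_dvd:
  assumes p: "p = 7 \<or> p = (13::nat)" and N: "int p dvd a * a * a + 2 * (b * b * b) + 4 * (c * c * c) - 6 * (a * b * c)"
  shows "int p dvd a \<and> int p dvd b \<and> int p dvd c"
proof -
  let ?a = "a mod int p" and ?b = "b mod int p" and ?c = "c mod int p"
  have "(?a * ?a * ?a + 2 * (?b * ?b * ?b) + 4 * (?c * ?c * ?c) - 6 * (?a * ?b * ?c)) mod int p =
      (a * a * a + 2 * (b * b * b) + 4 * (c * c * c) - 6 * (a * b * c)) mod int p"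
    by (intro mod_diff_cong mod_add_cong mod_mult_cong refl mod_mod_trivial)
  also have "\<dots> = 0" using N by simp
  finally have z: "(?a * ?a * ?a + 2 * (?b * ?b * ?b) + 4 * (?c * ?c * ?c) - 6 * (?a * ?b * ?c)) mod int p = 0" .
  have r: "0 \<le> x mod int p" "x mod int p < int p" for x using p by auto
  have "?a = 0 \<and> ?b = 0 \<and> ?c = 0" using p
  proof
    assume 7: "p = 7"
    have m: "?a \<in> set [0..6]" "?b \<in> set [0..6]" "?c \<in> set [0..6]"
      unfolding set_upto atLeastAtMost_iff using r[of a] r[of b] r[of c] unfolding 7 by simp_all
    have "int p = 7" by (simp add: 7)
    then show ?thesis using bspec[OF bspec[OF bspec[OF cubic_check(1) m(1)] m(2)] m(3)] z by simp
  next
    assume 13: "p = 13"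
    have m: "?a \<in> set [0..12]" "?b \<in> set [0..12]" "?c \<in> set [0..12]"
      unfolding set_upto atLeastAtMost_iff using r[of a] r[of b] r[of c] unfolding 13 by simp_all
    have "int p = 13" by (simp add: 13)
    then show ?thesis using bspec[OF bspec[OF bspec[OF cubic_check(2) m(1)] m(2)] m(3)] z by simp
  qed
  then show ?thesis by (simp add: dvd_eq_mod_eq_0)
qed

lemma residue_field_cubic:
  assumes "p = 7 \<or> p = (13::nat)"
  shows "residue_field {x. \<forall>i<3. int p dvd cubic_coord i x}
    ((\<lambda>f. Cubic (f 0) (f 1) (f 2)) ` PiE {..<3::nat} (\<lambda>_. {0..<int p})) p (p ^ 3)"
proof (rule residue_field_coordinates[where adj = "\<lambda>x. Cubic (cub_0 x * cub_0 x - 2 * (cub_1 x * cub_2 x)) (2 * (cub_2 x * cub_2 x) - cub_0 x * cub_1 x) (cub_1 x * cub_1 x - cub_0 x * cub_2 x)" and N = "\<lambda>x. cub_0 x * cub_0 x * cub_0 x + 2 * (cub_1 x * cub_1 x * cub_1 x) + 4 * (cub_2 x * cub_2 x * cub_2 x) - 6 * (cub_0 x * cub_1 x * cub_2 x)"])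
  show "prime p" using assms by auto
  then have "p > 1" by (rule prime_gt_1_nat)
  then show "\<not> (\<forall>i<3. int p dvd cubic_coord i 1)" by (auto simp: all_less_3 cubic_coord_def cubic_ops)
  show "(0::nat) < 3" by simp
  show "cubic_coord i (x + y) = cubic_coord i x + cubic_coord i y" for i x y by (simp add: cubic_coord_def cubic_ops)
  show "cubic_coord i (Cubic (f 0) (f 1) (f 2)) = f i" if "i < 3" for i f
    using that by (auto simp: cubic_coord_def numeral_eq_Suc less_Suc_eq)
  show "\<forall>i<3. int p dvd cubic_coord i (a * x)" if "\<forall>i<3. int p dvd cubic_coord i x" for a x
    using that unfolding all_less_3 cubic_coord_def by (simp add: cubic_ops)
  show "int p dvd cubic_coord i (of_nat p)" for i by (simp add: cubic_coord_def cubic_of_nat)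
  show "\<forall>i<3. cubic_coord i ((Cubic (cub_0 x * cub_0 x - 2 * (cub_1 x * cub_2 x)) (2 * (cub_2 x * cub_2 x) - cub_0 x * cub_1 x) (cub_1 x * cub_1 x - cub_0 x * cub_2 x)) * (x * y)) = (cub_0 x * cub_0 x * cub_0 x + 2 * (cub_1 x * cub_1 x * cub_1 x) + 4 * (cub_2 x * cub_2 x * cub_2 x) - 6 * (cub_0 x * cub_1 x * cub_2 x)) * cubic_coord i y" for x y
    unfolding all_less_3 cubic_coord_def by (simp add: cubic_ops algebra_simps)
  show "\<forall>i<3. int p dvd cubic_coord i x" if "int p dvd cub_0 x * cub_0 x * cub_0 x + 2 * (cub_1 x * cub_1 x * cub_1 x) + 4 * (cub_2 x * cub_2 x * cub_2 x) - 6 * (cub_0 x * cub_1 x * cub_2 x)" for x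
    using cubic_norm_dvd[OF assms that] unfolding all_less_3 cubic_coord_def by simp
qed

lemma cubic_red_props:
  "\<forall>i<3. int p dvd cubic_coord i (cubic_red (int p) x - x)"
  "\<forall>i<3. int p dvd cubic_coord i x \<Longrightarrow> cubic_red (int p) x = 0"
  unfolding all_less_3 cubic_coord_def
  by (simp_all add: cubic_red_def cubic_ops zero_cubic_def mod_diff_dvd)

text \<open>The orders 49 and 169 are 4 and 7 modulo 9, so the noncube case applies.\<close>

lemma hesse_family_golden:
  assumes "p = 7 \<or> p = (13::nat)"
  shows "hesse_family {x. \<forall>i<2. int p dvd golden_coord i x} (p\<^sup>2)"
  by (rule residue_field.hesse_family_mod_9[OF residue_field_golden[OF assms]]) (use assms in auto)

text \<open>The orders 343 and 2197 are 1 modulo 9 and the characteristic is far below 181, so both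
  are settled by computation.\<close>

lemma cubic_planes:
  "plane_check (cubic_red 7) 10 114 [Cubic 0 0 0, Cubic 1 0 0, Cubic 6 6 1, Cubic 0 6 6, Cubic 1 0 2, Cubic 3 0 0,
     Cubic 4 0 3, Cubic 4 2 6, Cubic 3 1 1]"
  "triples_check (cubic_red 13) 10 732 (Cubic 8 1 0)"
  by code_simp+

lemma hesse_family_cubic:
  assumes p: "p = 7 \<or> p = (13::nat)"
  shows "hesse_family {x. \<forall>i<3. int p dvd cubic_coord i x} (p ^ 3)"
proof -
  let ?I = "{x. \<forall>i<3. int p dvd cubic_coord i x}"
  interpret F: residue_field ?I "(\<lambda>f. Cubic (f 0) (f 1) (f 2)) ` PiE {..<3::nat} (\<lambda>_. {0..<int p})" p "p ^ 3"
    by (rule residue_field_cubic[OF p])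
  have r1: "F.eqv (cubic_red (int p) x) x" for x using cubic_red_props(1)[of p x] by (simp add: F.eqv_def)
  have r2: "cubic_red (int p) x = 0" if "x \<in> ?I" for x using cubic_red_props(2)[of p x] that by simp
  show ?thesis using p
  proof
    assume 7: "p = 7"
    have "plane_check (cubic_red (int p)) 10 114 [Cubic 0 0 0, Cubic 1 0 0, Cubic 6 6 1, Cubic 0 6 6, Cubic 1 0 2,
        Cubic 3 0 0, Cubic 4 0 3, Cubic 4 2 6, Cubic 3 1 1]" using cubic_planes(1) by (simp add: 7)
    note c = this
    show ?thesis
    proof (rule F.hesse_family_plane_check[OF _ _ _ _ _ c])
      show "p ^ 3 mod 6 = 1" by (simp add: 7)
      show "F.eqv (cubic_red (int p) x) x" for x by (rule r1)
      show "cubic_red (int p) x = 0" if "x \<in> ?I" for x by (rule r2[OF that])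
      show "114 = int (p ^ 3 div 3)" by (simp add: 7)
      show "(114::int) < 2 ^ 10" by simp
    qed
  next
    assume 13: "p = 13"
    have "triples_check (cubic_red (int p)) 10 732 (Cubic 8 1 0)" using cubic_planes(2) by (simp add: 13)
    note c = this
    show ?thesis
    proof (rule F.hesse_family_triples_check[OF _ _ _ _ _ _ c])
      show "p ^ 3 mod 6 = 1" "p ^ 3 mod 9 = 1" by (simp_all add: 13)
      show "F.eqv (cubic_red (int p) x) x" for x by (rule r1)
      show "cubic_red (int p) x = 0" if "x \<in> ?I" for x by (rule r2[OF that])
      show "732 = int (p ^ 3 div 3)" by (simp add: 13)
      show "(732::int) < 2 ^ 10" by simp
    qed
  qed
qed

text \<open>One factor of order \<open>p^3\<close> accounts for the odd exponent, the others
  contribute \<open>p^2\<close> each. Neither field contains the other, so the action needed for the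
  product is built from an additive embedding.\<close>

lemma hesse_family_cubic_golden:
  assumes p: "p = 7 \<or> p = (13::nat)"
  shows "hesse_family (power_subgrp {x. \<forall>i<3. int p dvd cubic_coord i x} {x. \<forall>i<2. int p dvd golden_coord i x} m)
    (p ^ 3 * (p\<^sup>2) ^ m)"
proof -
  let ?I = "{x. \<forall>i<2. int p dvd golden_coord i x}" and ?J = "{x. \<forall>i<3. int p dvd cubic_coord i x}"
  interpret F: residue_field ?I "(\<lambda>f. Golden (f 0) (f 1)) ` PiE {..<2::nat} (\<lambda>_. {0..<int p})" p "p\<^sup>2"
    by (rule residue_field_golden[OF p])
  interpret K: residue_field ?J "(\<lambda>f. Cubic (f 0) (f 1) (f 2)) ` PiE {..<3::nat} (\<lambda>_. {0..<int p})" p "p ^ 3"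
    by (rule residue_field_cubic[OF p])
  \<comment> \<open>Not a ring homomorphism: it matches coordinates. It is additive and takes an
    element into \<open>?J\<close> exactly if the element is in \<open>?I\<close>; multiplication in
    the cubic field then makes the action bijective.\<close>
  define emb where "emb b = Cubic (gold_re b) (gold_im b) 0" for b
  have emb_diff: "emb (b - c) = emb b - emb c" for b c by (simp add: emb_def minus_cubic_def golden_ops)
  have emb_I: "emb b \<in> ?J \<longleftrightarrow> b \<in> ?I" for b
    by (simp add: emb_def all_less_2 all_less_3 golden_coord_def cubic_coord_def)
  show ?thesis
  proof (rule F.hesse_family_product_power[where act = "\<lambda>x b. x * emb b", OF hesse_family_golden[OF p] hesse_family_cubic[OF p]])
    show "(x - y) * emb b = x * emb b - y * emb b" for x y b by (rule left_diff_distrib)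
    show "x * emb (b - c) = x * emb b - x * emb c" for x b c by (simp add: emb_diff right_diff_distrib)
    show "x * emb b \<in> ?J" if "b \<in> ?I" for x b using K.I_mult emb_I that by blast
    show "x * emb b \<in> ?J" if "x \<in> ?J" for x b using K.I_mult2 that by blast
    show "x \<in> ?J" if "b \<notin> ?I" "x * emb b \<in> ?J" for x b using K.I_prime emb_I that by blast
    show "\<exists>x. x * emb b - y \<in> ?J" if "b \<notin> ?I" for y b
    proof -
      have "emb b \<notin> ?J" using emb_I that by blast
      from K.divide_ex[OF this] obtain x where "K.eqv (emb b * x) y" by blast
      then have "x * emb b - y \<in> ?J" unfolding K.eqv_def by (simp only: mult.commute)
      then show ?thesis by blast
    qed
  qed
qed

section \<open>Assembly over all prime powers\<close>

theorem theorem22: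
  fixes q :: nat
  assumes "primepow q" and "[q = 1] (mod 6)" and "q \<noteq> 13" and "q \<noteq> 7"
  shows "\<exists>(G :: nat monoid) \<phi> (V :: nat set) H. regular_hesse_kaleidoscope q G \<phi> V H"
proof -
  obtain p k where pk: "prime p" "k > 0" "q = p ^ k" using assms(1) unfolding primepow_def by blast
  have q6: "q mod 6 = 1" using assms(2) by (simp add: cong_def)
  have nd: "\<not> d dvd p" if "d dvd 6" "d > 1" for d :: nat
  proof
    assume "d dvd p"
    then have "d dvd q" using pk(2,3) dvd_trans[OF _ dvd_power[of k p]] by blast
    then have "q mod d = 0" by simp
    moreover have "q mod d = 1" using mod_mod_cancel[OF that(1), of q] q6 that(2) by simp
    ultimately show False by simp
  qed
  have n2: "\<not> 2 dvd p" and n3: "\<not> 3 dvd p" by (rule nd; simp)+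
  have "p mod 6 < 6" by simp
  then have "p mod 6 = 0 \<or> p mod 6 = 1 \<or> p mod 6 = 2 \<or> p mod 6 = 3 \<or> p mod 6 = 4 \<or> p mod 6 = 5" by linarith
  moreover have "p mod 6 mod 2 = p mod 2" "p mod 6 mod 3 = p mod 3" by (simp_all add: mod_mod_cancel)
  moreover have "p mod 2 \<noteq> 0" "p mod 3 \<noteq> 0" using n2 n3 by (simp_all add: dvd_eq_mod_eq_0)
  ultimately have p6: "p mod 6 = 1 \<or> p mod 6 = 5" by (elim disjE) simp_all
  then show ?thesis
  proof
    assume p1: "p mod 6 = 1"
    show ?thesis
    proof (cases "p = 7 \<or> p = 13")
      case False
      then have "hesse_family {x. int p dvd x} p" using hesse_family_prime[OF pk(1) p1] by blast
      from residue_field.hesse_family_power[OF residue_field_int[OF pk(1)] this, of k]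
      show ?thesis unfolding pk(3) by (rule hesse_family_imp_kaleidoscope)
    next
      case True
      then have k1: "k \<noteq> 1" using assms(3,4) pk(3) by auto
      show ?thesis
      proof (cases "even k")
        case ev: True
        then obtain m where m: "k = 2 * m" by (elim evenE)
        from residue_field.hesse_family_power[OF residue_field_golden[OF True] hesse_family_golden[OF True], of m]
        show ?thesis unfolding pk(3) m power_mult by (rule hesse_family_imp_kaleidoscope)
      next
        case od: False
        then obtain l where l: "k = 2 * l + 1" by (elim oddE)
        then obtain m where m: "l = Suc m" using k1 by (cases l) auto
        have "2 * Suc m + 1 = 3 + 2 * m" by simp
        then have "q = p ^ 3 * (p\<^sup>2) ^ m" unfolding pk(3) l m by (simp only: power_add power_mult)
        then show ?thesis using hesse_family_imp_kaleidoscope[OF hesse_family_cubic_golden[OF True, of m]] by simp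
      qed
    qed
  next
    assume p5: "p mod 6 = 5"
    have sq: "p\<^sup>2 mod 6 = 1" using power_mod[of p 6 2] p5 by simp
    have "even k"
    proof (rule ccontr)
      assume "odd k"
      then obtain m where m: "k = 2 * m + 1" by (elim oddE)
      have "(p\<^sup>2) ^ m mod 6 = 1" using power_mod[of "p\<^sup>2" 6 m] sq by simp
      moreover have "q = p * (p\<^sup>2) ^ m" unfolding pk(3) m by (simp add: power_mult)
      ultimately have "q mod 6 = 5" using mod_mult_eq[of p 6 "(p\<^sup>2) ^ m"] p5 by simp
      then show False using q6 by simp
    qed
    then obtain m where m: "k = 2 * m" by (elim evenE)
    from residue_field.hesse_family_power[OF residue_field_eis[OF pk(1) p5] hesse_family_eis[OF pk(1) p5], of m]
    show ?thesis unfolding pk(3) m power_mult by (rule hesse_family_imp_kaleidoscope)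
  qed
qed

end
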